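(* Let $\mathcal{D}$ be a proper polyhedral divisor on $Y=\mathbb{P}^1$ with tail cone $\delta$, let $X=X(\mathcal{D})$, and let $\mathcal{D}_P=\mathcal{D}_P^0+\dots+\mathcal{D}_P^{r_P}$ ($P\in\mathcal{P}$) be a decomposition of $\mathcal{D}$, with associated base $B$, polyhedral divisor $\mathcal{D}^{\mathrm{tot}}$ on $\mathbb{P}^1\times B$, polyhedral divisors $\mathcal{D}^{(\lambda)}$ on $\mathbb{P}^1$ ($\lambda\in B$), and morphism $\pi\colon X(\mathcal{D}^{\mathrm{tot}})\to B$. If the decomposition of $\mathcal{D}_P$ is admissible for each $P\in\mathcal{P}$, then $\pi\colon X(\mathcal{D}^{\mathrm{tot}})\to B$ is a flat family with $\pi^{-1}(\lambda)\cong X(\mathcal{D}^{(\lambda)})$ for every $\lambda\in B$. In particular, $\pi^{-1}(0)=X(\mathcal{D})=X$.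
   Context: We work over $\mathbb{C}$. $N$ is a lattice of finite rank, $M$ its dual, $N_{\mathbb{Q}},M_{\mathbb{Q}}$ the associated $\mathbb{Q}$-vector spaces. Polyhedra in $N_{\mathbb{Q}}$ are assumed to contain no linear subspace of positive dimension; the empty set is also considered a polyhedron. $\mathrm{tail}(\Delta)$ is the cone of unbounded directions of $\Delta$. A polyhedron is nontrivial if it is empty or differs from its tailcone. Sums of polyhedra are Minkowski sums (a sum with an empty summand is empty). For a cone $\delta$, $\delta^\vee=\{u\in M_{\mathbb{Q}}: \langle v,u\rangle\ge 0\ \forall v\in\delta\}$. Polyhedral divisors. Let $Y$ be a smooth semiprojective variety (projective over an affine variety) and $\delta\subset N_{\mathbb{Q}}$ a pointed polyhedral cone. A polyhedral divisor on $Y$ with tail cone $\delta$ is a formal sum $\mathcal{D}=\sum_P\mathcal{D}_P\otimes P$ over prime divisors $P$ of $Y$, each $\mathcal{D}_P$ being a polyhedron with tailcone $\delta$ or the empty set, only finitely many being nontrivial. For $u\in\delta^\vee\cap M$ put $\mathcal{D}(u)=\sum_P\min_{v\in\mathcal{D}_P}\langle v,u\rangle P$ (minimum over $\emptyset$ is $\infty$), regarded as a $\mathbb{Q}$-divisor on $\mathrm{Loc}\,\mathcal{D}=Y\setminus\bigcup_{\mathcal{D}_P=\emptyset}P$; write $H^0(Y,\mathcal{D}(u)):=H^0(\mathrm{Loc}\,\mathcal{D},\mathcal{O}(\mathcal{D}(u)))$, where $\mathcal O(D)=\mathcal O(\lfloor D\rfloor)$. $\mathcal{D}$ is proper if: $Y\setminus\mathrm{Loc}\,\mathcal{D}$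 is the support of a semiample divisor on $Y$; $\mathcal{D}(u)$ is semiample on $\mathrm{Loc}\,\mathcal{D}$ for all $u\in\delta^\vee\cap M$; and $\mathcal{D}(u)$ is big on $\mathrm{Loc}\,\mathcal{D}$ for all $u\in\mathrm{relint}(\delta^\vee)\cap M$ (semiample: some positive multiple is base point free; big: some positive multiple has a section with affine non-vanishing locus). For $\mathcal{D}$ proper, $X(\mathcal{D})=\mathrm{Spec}\bigoplus_{u\in\delta^\vee\cap M}H^0(Y,\mathcal{D}(u))\cdot\chi^u$. Decompositions. An $r$-parameter Minkowski decomposition of a polyhedron $\Delta$ with tailcone $\delta$ is $\Delta=\Delta^0+\dots+\Delta^r$ with $\mathrm{tail}(\Delta^i)=\delta$ for all $i$; for $\Delta=\emptyset$ (with $\delta$ fixed) at least one $\Delta^i$ is empty and the nonempty ones have tailcone $\delta$. It is admissible if for each $u\in\delta^\vee\cap M$ there is at most one $i$ with $\Delta^i\ne\emptyset$ and $\min\langle\Delta^i,u\rangle\notin\mathbb{Z}$. A decomposition of $\mathcal{D}$ consists of a finite set $\mathcal{P}\subset Y$ of points containing all $P$ with $\mathcal{D}_P$ nontrivial, and for each $P\in\mathcal{P}$ a Minkowski decomposition $\mathcal{D}_P=\sum_{i=0}^{r_P}\mathcal{D}_P^i$. Associated family. For a rational function $f$, $V(f)$ is its divisor of zeros. For $P\in\mathcal{P}$ let $y_P\in\mathbb{C}(\mathbb{P}^1)$ be a rational function whose sole zero is a simple zero at $P$. Let $t_{P,1},\dots,t_{P,r_P}$ be coordinates on $\mathbb{A}^{r_P}$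 and $t_{P,0}=0$. $B$ is any open affine neighborhood of the origin in $\prod_{P\in\mathcal{P}}\mathbb{A}^{r_P}$ such that on $\mathbb{P}^1\times B$ no divisor $V(y_P-t_{P,i})$ meets a divisor $V(y_Q-t_{Q,j})$ for $P\ne Q$ in $\mathcal{P}$. Put $\mathcal{D}^{\mathrm{tot}}=\sum_{P\in\mathcal{P},\,0\le i\le r_P}\mathcal{D}_P^i\otimes V(y_P-t_{P,i})$, a polyhedral divisor on $Y^{\mathrm{tot}}=\mathbb{P}^1\times B$; it is proper. The morphism $\pi\colon X(\mathcal{D}^{\mathrm{tot}})\to B$ is the composition of the rational quotient map $X(\mathcal{D}^{\mathrm{tot}})\dashrightarrow Y^{\mathrm{tot}}$ with the projection $Y^{\mathrm{tot}}\to B$; equivalently it is induced by the inclusion of regular functions of $B$ into the degree $0$ part $H^0(Y^{\mathrm{tot}},\mathcal{D}^{\mathrm{tot}}(0))$. For $\lambda\in B$ with coordinates $\lambda_{P,i}$, and $\lambda_{P,0}=0$, put $\mathcal{D}^{(\lambda)}=\sum_{P\in\mathcal{P},\,0\le i\le r_P}\mathcal{D}_P^i\otimes V(y_P-\lambda_{P,i})$ on $\mathbb{P}^1$, where coefficients of a prime divisor appearing several times are added by Minkowski sum; it is a proper polyhedral divisor. *)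

theory Defs
  imports
    Complex_Main
    "HOL-Library.Poly_Mapping"
    "HOL-Library.Set_Algebras"
    "HOL-Library.Product_Lexorder"
    "HOL-Computational_Algebra.Fraction_Field"
    "HOL-Algebra.QuotRing"
    "HOL-Algebra.Module"
    "HOL-Algebra.Free_Abelian_Groups"
begin

abbreviation keys :: "('a \<Rightarrow>\<^sub>0 'b::zero) \<Rightarrow> 'a set" where
  "keys \<equiv> Poly_Mapping.keys"

abbreviation lookup :: "('a \<Rightarrow>\<^sub>0 'b::zero) \<Rightarrow> 'a \<Rightarrow> 'b" where
  "lookup \<equiv> Poly_Mapping.lookup"


section \<open>Polyhedra\<close>

text \<open>
  The lattice is \<open>N = \<int>\<^sup>n\<close> (\<open>n = 0\<close> allowed) with dual \<open>M = \<int>\<^sup>n\<close>. Vectors are finitely supported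
  functions on \<open>nat\<close> whose support lies in \<open>{..<n}\<close>. Minkowski sums are the sums of sets from
  \<^theory>\<open>HOL-Library.Set_Algebras\<close>, so a sum with an empty summand is empty.
\<close>

type_synonym qvec = "nat \<Rightarrow>\<^sub>0 rat"
type_synonym zvec = "nat \<Rightarrow>\<^sub>0 int"

definition qspace :: "nat \<Rightarrow> qvec set" where
  "qspace n = {v. keys v \<subseteq> {..<n}}"

definition dual_lattice :: "nat \<Rightarrow> zvec set" where
  "dual_lattice n = {u. keys u \<subseteq> {..<n}}"

definition rat_vec :: "zvec \<Rightarrow> qvec" where
  "rat_vec u = Poly_Mapping.map of_int u"

definition scaleq :: "rat \<Rightarrow> qvec \<Rightarrow> qvec" where
  "scaleq s v = Poly_Mapping.map (\<lambda>x. s * x) v"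

definition pairing :: "qvec \<Rightarrow> qvec \<Rightarrow> rat" where
  "pairing v u = (\<Sum>i\<in>keys v. lookup v i * lookup u i)"

text \<open>``Contains no linear subspace'' means: contains no (affine) line.\<close>

definition polyhedron :: "nat \<Rightarrow> qvec set \<Rightarrow> bool" where
  "polyhedron n \<Delta> \<longleftrightarrow>
     (\<exists>H \<subseteq> qspace n \<times> UNIV. finite H \<and> \<Delta> = {v \<in> qspace n. \<forall>(w, a)\<in>H. a \<le> pairing v w}) \<and>
     \<not> (\<exists>v\<in>\<Delta>. \<exists>w\<in>qspace n. w \<noteq> 0 \<and> (\<forall>s. v + scaleq s w \<in> \<Delta>))"

definition pointed_cone :: "nat \<Rightarrow> qvec set \<Rightarrow> bool" where
  "pointed_cone n \<delta> \<longleftrightarrow> polyhedron n \<delta> \<and> \<delta> \<noteq> {} \<and> (\<forall>v\<in>\<delta>. \<forall>s\<ge>0. scaleq s v \<in> \<delta>)"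

definition tail :: "nat \<Rightarrow> qvec set \<Rightarrow> qvec set" where
  "tail n \<Delta> = {w \<in> qspace n. \<forall>v\<in>\<Delta>. \<forall>s\<ge>0. v + scaleq s w \<in> \<Delta>}"

definition nontrivial :: "nat \<Rightarrow> qvec set \<Rightarrow> bool" where
  "nontrivial n \<Delta> \<longleftrightarrow> \<Delta> = {} \<or> \<Delta> \<noteq> tail n \<Delta>"

definition dual_cone :: "nat \<Rightarrow> qvec set \<Rightarrow> qvec set" where
  "dual_cone n \<delta> = {u \<in> qspace n. \<forall>v\<in>\<delta>. 0 \<le> pairing v u}"

definition weights :: "nat \<Rightarrow> qvec set \<Rightarrow> zvec set" where
  "weights n \<delta> = {u \<in> dual_lattice n. rat_vec u \<in> dual_cone n \<delta>}"

definition affine_hullq :: "qvec set \<Rightarrow> qvec set" where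
  "affine_hullq C = {x. \<exists>S c. finite S \<and> S \<subseteq> C \<and> sum c S = 1 \<and> x = (\<Sum>v\<in>S. scaleq (c v) v)}"

definition relint :: "qvec set \<Rightarrow> qvec set" where
  "relint C = {u \<in> C. \<exists>\<epsilon>>0. \<forall>w\<in>affine_hullq C.
     (\<forall>i. \<bar>lookup w i - lookup u i\<bar> < \<epsilon>) \<longrightarrow> w \<in> C}"

text \<open>The minimum is only meaningful for nonempty \<open>\<Delta>\<close> and \<open>u\<close> in the dual of its tail cone.\<close>

definition minval :: "qvec set \<Rightarrow> zvec \<Rightarrow> rat" where
  "minval \<Delta> u = (LEAST x. x \<in> (\<lambda>v. pairing v (rat_vec u)) ` \<Delta>)"

text \<open>
  For \<open>\<Delta> \<noteq> {}\<close> the equation forces all summands to be nonempty; for \<open>\<Delta> = {}\<close> it forces at least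
  one of them to be empty.
\<close>

definition minkowski_decomposition ::
    "nat \<Rightarrow> qvec set \<Rightarrow> qvec set \<Rightarrow> nat \<Rightarrow> (nat \<Rightarrow> qvec set) \<Rightarrow> bool" where
  "minkowski_decomposition n \<delta> \<Delta> r \<Delta>s \<longleftrightarrow>
     (\<forall>i\<le>r. polyhedron n (\<Delta>s i) \<and> (\<Delta>s i \<noteq> {} \<longrightarrow> tail n (\<Delta>s i) = \<delta>)) \<and>
     \<Delta> = (\<Sum>i\<le>r. \<Delta>s i)"

definition admissible :: "nat \<Rightarrow> qvec set \<Rightarrow> nat \<Rightarrow> (nat \<Rightarrow> qvec set) \<Rightarrow> bool" where
  "admissible n \<delta> r \<Delta>s \<longleftrightarrow>
     (\<forall>u\<in>weights n \<delta>. \<forall>i\<le>r. \<forall>j\<le>r.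
        \<Delta>s i \<noteq> {} \<and> minval (\<Delta>s i) u \<notin> \<int> \<and> \<Delta>s j \<noteq> {} \<and> minval (\<Delta>s j) u \<notin> \<int> \<longrightarrow> i = j)"


section \<open>Coordinates and rational functions\<close>

text \<open>
  \<open>Fin z\<close> is the point \<open>[z : 1]\<close> and \<open>Infty\<close> the point \<open>[1 : 0]\<close> of \<open>\<bbbP>\<^sup>1\<close>. The coordinates are the
  homogeneous coordinates \<open>X0\<close>, \<open>X1\<close> of \<open>\<bbbP>\<^sup>1\<close> and the parameters \<open>T P i\<close>. All varieties below
  have their function field inside the one field \<open>ratfun\<close>; in particular
  \<open>\<complex>(\<bbbP>\<^sup>1) \<subseteq> \<complex>(\<bbbP>\<^sup>1 \<times> B)\<close> is an inclusion of sets.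
\<close>

datatype p1 = Fin complex | Infty

datatype coord = X0 | X1 | T p1 nat

text \<open>
  An arbitrary linear order on the coordinates; it only serves to make polynomials an instance
  of class \<open>idom\<close>.
\<close>

fun coord_key :: "coord \<Rightarrow> nat \<times> real \<times> real \<times> nat" where
  "coord_key X0 = (0, 0, 0, 0)"
| "coord_key X1 = (1, 0, 0, 0)"
| "coord_key (T Infty i) = (2, 0, 0, i)"
| "coord_key (T (Fin z) i) = (3, Re z, Im z, i)"

lemma coord_key_inject: "coord_key a = coord_key b \<longleftrightarrow> a = b"
  by (cases a rule: coord_key.cases; cases b rule: coord_key.cases) (auto simp: complex_eq_iff)

instantiation coord :: linorder
begin

definition less_eq_coord :: "coord \<Rightarrow> coord \<Rightarrow> bool" where
  "a \<le> b \<longleftrightarrow> coord_key a \<le> coord_key b"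

definition less_coord :: "coord \<Rightarrow> coord \<Rightarrow> bool" where
  "a < b \<longleftrightarrow> coord_key a < coord_key b"

instance
  by standard
    (auto simp: less_eq_coord_def less_coord_def coord_key_inject less_le_not_le
      intro: order_trans dest: antisym)

end

type_synonym poly = "(coord \<Rightarrow>\<^sub>0 nat) \<Rightarrow>\<^sub>0 complex"
type_synonym ratfun = "poly fract"

definition poly_var :: "coord \<Rightarrow> poly" where
  "poly_var v = Poly_Mapping.single (Poly_Mapping.single v 1) 1"

definition const :: "complex \<Rightarrow> ratfun" where
  "const c = Fract (Poly_Mapping.single 0 c) 1"

definition poly_eval :: "(coord \<Rightarrow> complex) \<Rightarrow> poly \<Rightarrow> complex" where
  "poly_eval x F = (\<Sum>m\<in>keys F. lookup F m * (\<Prod>v\<in>keys m. x v ^ lookup m v))"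

text \<open>Polynomials in the coordinates \<open>V\<close>, homogeneous of degree \<open>d\<close> in \<open>X0\<close>, \<open>X1\<close>.\<close>

definition hpolys :: "coord set \<Rightarrow> nat \<Rightarrow> poly set" where
  "hpolys V d = {F. \<forall>m\<in>keys F. keys m \<subseteq> V \<and> lookup m X0 + lookup m X1 = d}"


section \<open>Varieties\<close>

text \<open>
  A variety is given by its closed points, its Zariski closed sets, its function field, and its
  local rings as subrings of the function field.
\<close>

record 'p variety =
  pts :: "'p set"
  closed_sets :: "'p set set"
  funs :: "ratfun set"
  lring :: "'p \<Rightarrow> ratfun set"

text \<open>\<open>x p\<close> is a vector of (homogeneous, resp. affine) coordinates of the point \<open>p\<close>.\<close>

definition zariski :: "coord set \<Rightarrow> 'p set \<Rightarrow> ('p \<Rightarrow> coord \<Rightarrow> complex) \<Rightarrow> 'p variety" where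
  "zariski V X x =
     \<lparr>pts = X,
      closed_sets = {{p \<in> X. \<forall>F\<in>S. poly_eval (x p) F = 0} | S. S \<subseteq> (\<Union>d. hpolys V d)},
      funs = {Fract F G | F G d. F \<in> hpolys V d \<and> G \<in> hpolys V d \<and> G \<noteq> 0},
      lring = (\<lambda>p. {Fract F G | F G d. F \<in> hpolys V d \<and> G \<in> hpolys V d \<and> poly_eval (x p) G \<noteq> 0})\<rparr>"

definition open_subvariety :: "'p variety \<Rightarrow> 'p set \<Rightarrow> 'p variety" where
  "open_subvariety Y U = Y\<lparr>pts := U, closed_sets := {C \<inter> U | C. C \<in> closed_sets Y}\<rparr>"

definition is_open :: "'p variety \<Rightarrow> 'p set \<Rightarrow> bool" where
  "is_open Y U \<longleftrightarrow> (\<exists>C\<in>closed_sets Y. U = pts Y - C)"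

fun p1_coords :: "p1 \<Rightarrow> coord \<Rightarrow> complex" where
  "p1_coords (Fin z) v = (case v of X0 \<Rightarrow> z | X1 \<Rightarrow> 1 | T P i \<Rightarrow> 0)"
| "p1_coords Infty v = (case v of X0 \<Rightarrow> 1 | X1 \<Rightarrow> 0 | T P i \<Rightarrow> 0)"

definition aff_coords :: "(p1 \<times> nat \<Rightarrow> complex) \<Rightarrow> coord \<Rightarrow> complex" where
  "aff_coords a v = (case v of X0 \<Rightarrow> 0 | X1 \<Rightarrow> 0 | T P i \<Rightarrow> a (P, i))"

definition aff_points :: "(p1 \<times> nat) set \<Rightarrow> (p1 \<times> nat \<Rightarrow> complex) set" where
  "aff_points I = {a. \<forall>k. k \<notin> I \<longrightarrow> a k = 0}"

definition P1 :: "p1 variety" where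
  "P1 = zariski {X0, X1} UNIV p1_coords"

definition Aff :: "(p1 \<times> nat) set \<Rightarrow> (p1 \<times> nat \<Rightarrow> complex) variety" where
  "Aff I = zariski {T P i | P i. (P, i) \<in> I} (aff_points I) aff_coords"

definition P1_Aff :: "(p1 \<times> nat) set \<Rightarrow> (p1 \<times> (p1 \<times> nat \<Rightarrow> complex)) variety" where
  "P1_Aff I = zariski ({X0, X1} \<union> {T P i | P i. (P, i) \<in> I}) (UNIV \<times> aff_points I)
     (\<lambda>(q, a) v. p1_coords q v + aff_coords a v)"

definition regular_functions :: "'p variety \<Rightarrow> ratfun set" where
  "regular_functions Y = {f \<in> funs Y. \<forall>y\<in>pts Y. f \<in> lring Y y}"

definition nonunits :: "ratfun set \<Rightarrow> ratfun set" where
  "nonunits L = {f \<in> L. f = 0 \<or> inverse f \<notin> L}"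

definition subring_of :: "'a::comm_ring_1 set \<Rightarrow> 'a ring" where
  "subring_of S = \<lparr>carrier = S, mult = (*), one = 1, ring.zero = 0, add = (+)\<rparr>"

definition point_ideal :: "'p variety \<Rightarrow> 'p \<Rightarrow> ratfun set" where
  "point_ideal Y y = {f \<in> regular_functions Y. f \<in> nonunits (lring Y y)}"

definition is_subalgebra :: "ratfun set \<Rightarrow> bool" where
  "is_subalgebra S \<longleftrightarrow> range const \<subseteq> S \<and> (\<forall>a\<in>S. \<forall>b\<in>S. a + b \<in> S \<and> a * b \<in> S)"

text \<open>
  \<open>Y\<close> is affine: its ring \<open>A\<close> of regular functions is a finitely generated algebra, and \<open>Y\<close>
  together with its local rings is the maximal spectrum of \<open>A\<close>.
\<close>

definition is_affine :: "'p variety \<Rightarrow> bool" where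
  "is_affine Y \<longleftrightarrow>
     (let A = regular_functions Y in
       (\<exists>S. finite S \<and> S \<subseteq> A \<and> (\<forall>S'. is_subalgebra S' \<and> S \<subseteq> S' \<longrightarrow> A \<subseteq> S')) \<and>
       bij_betw (point_ideal Y) (pts Y) {J. maximalideal J (subring_of A)} \<and>
       (\<forall>y\<in>pts Y. lring Y y = {a / s | a s. a \<in> A \<and> s \<in> A \<and> s \<notin> point_ideal Y y}))"


section \<open>Divisors\<close>

definition irreducible_closed :: "'p variety \<Rightarrow> 'p set \<Rightarrow> bool" where
  "irreducible_closed Y Z \<longleftrightarrow> Z \<in> closed_sets Y \<and> Z \<noteq> {} \<and>
     (\<forall>A\<in>closed_sets Y. \<forall>B\<in>closed_sets Y. Z \<subseteq> A \<union> B \<longrightarrow> Z \<subseteq> A \<or> Z \<subseteq> B)"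

definition prime_divisors :: "'p variety \<Rightarrow> 'p set set" where
  "prime_divisors Y = {Z. irreducible_closed Y Z \<and> Z \<noteq> pts Y \<and>
     (\<forall>W. irreducible_closed Y W \<and> Z \<subseteq> W \<longrightarrow> W = Z \<or> W = pts Y)}"

definition lring_along :: "'p variety \<Rightarrow> 'p set \<Rightarrow> ratfun set" where
  "lring_along Y Z = (\<Union>z\<in>Z. lring Y z)"

fun ideal_power :: "ratfun set \<Rightarrow> ratfun set \<Rightarrow> nat \<Rightarrow> ratfun set" where
  "ideal_power L I 0 = L"
| "ideal_power L I (Suc k) =
     {(\<Sum>i<m. a i * b i) | (m::nat) a b. (\<forall>i<m. a i \<in> I \<and> b i \<in> ideal_power L I k)}"

text \<open>
  The valuation of the discrete valuation ring of \<open>Z\<close>: the largest power of the maximal ideal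
  containing \<open>f\<close>. If \<open>f\<close> is not in that ring, then its inverse is. Only meaningful for \<open>f \<noteq> 0\<close>.
\<close>

definition ord_along :: "'p variety \<Rightarrow> 'p set \<Rightarrow> ratfun \<Rightarrow> int" where
  "ord_along Y Z f =
     (let L = lring_along Y Z; v = (\<lambda>g. GREATEST k. g \<in> ideal_power L (nonunits L) k)
      in if f \<in> L then int (v f) else - int (v (inverse f)))"

definition zero_divisor :: "'p variety \<Rightarrow> ratfun \<Rightarrow> 'p set \<Rightarrow> nat" where
  "zero_divisor Y f Z = nat (ord_along Y Z f)"

definition zero_support :: "'p variety \<Rightarrow> ratfun \<Rightarrow> 'p set" where
  "zero_support Y f = \<Union>{Z \<in> prime_divisors Y. zero_divisor Y f Z > 0}"

definition stalk_ideal :: "'p variety \<Rightarrow> 'p set \<Rightarrow> 'p \<Rightarrow> ratfun set" where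
  "stalk_ideal Y Z y = {f \<in> lring Y y. \<forall>z\<in>Z. f \<in> lring Y z \<longrightarrow> f \<in> nonunits (lring Y z)}"

text \<open>
  A local equation at \<open>y\<close> of the divisor \<open>E\<close> on a smooth variety: the product of the powers
  \<open>g Z powi E Z\<close>, where \<open>g Z\<close> generates the ideal of \<open>Z\<close> at \<open>y\<close>. The sheaf \<open>\<O>(E)\<close> is the
  invertible subsheaf of the constant sheaf of rational functions generated near \<open>y\<close> by the inverse
  of a local equation, so \<open>sections Y U E\<close> is \<open>H\<^sup>0(U, \<O>(E))\<close>. Coefficients of \<open>E\<close> at prime
  divisors not meeting \<open>U\<close> are irrelevant.
\<close>

definition local_equation :: "'p variety \<Rightarrow> ('p set \<Rightarrow> int) \<Rightarrow> 'p \<Rightarrow> ratfun \<Rightarrow> bool" where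
  "local_equation Y E y h \<longleftrightarrow>
     (\<exists>g. (\<forall>Z\<in>prime_divisors Y. y \<in> Z \<and> E Z \<noteq> 0 \<longrightarrow>
             stalk_ideal Y Z y = {g Z * a | a. a \<in> lring Y y}) \<and>
          h = (\<Prod>Z | Z \<in> prime_divisors Y \<and> y \<in> Z \<and> E Z \<noteq> 0. g Z powi E Z))"

definition sections :: "'p variety \<Rightarrow> 'p set \<Rightarrow> ('p set \<Rightarrow> int) \<Rightarrow> ratfun set" where
  "sections Y U E = {f \<in> funs Y. \<forall>y\<in>U. \<exists>h. local_equation Y E y h \<and> f * h \<in> lring Y y}"

text \<open>The complement in \<open>U\<close> of the support of \<open>div(s) + E\<close>, for a \<open>\<rat>\<close>-divisor \<open>E\<close>.\<close>

definition nonvanishing_locus ::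
    "'p variety \<Rightarrow> 'p set \<Rightarrow> ('p set \<Rightarrow> rat) \<Rightarrow> ratfun \<Rightarrow> 'p set" where
  "nonvanishing_locus Y U E s =
     {y \<in> U. \<forall>Z\<in>prime_divisors Y. y \<in> Z \<longrightarrow> of_int (ord_along Y Z s) + E Z = 0}"

definition semiample :: "'p variety \<Rightarrow> 'p set \<Rightarrow> ('p set \<Rightarrow> rat) \<Rightarrow> bool" where
  "semiample Y U E \<longleftrightarrow>
     (\<exists>m::nat. m > 0 \<and> (\<forall>y\<in>U. \<exists>s\<in>sections Y U (\<lambda>Z. \<lfloor>of_nat m * E Z\<rfloor>).
        s \<noteq> 0 \<and> y \<in> nonvanishing_locus Y U (\<lambda>Z. of_nat m * E Z) s))"

definition big :: "'p variety \<Rightarrow> 'p set \<Rightarrow> ('p set \<Rightarrow> rat) \<Rightarrow> bool" where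
  "big Y U E \<longleftrightarrow>
     (\<exists>m::nat. m > 0 \<and> (\<exists>s\<in>sections Y U (\<lambda>Z. \<lfloor>of_nat m * E Z\<rfloor>).
        s \<noteq> 0 \<and> is_affine (open_subvariety Y (nonvanishing_locus Y U (\<lambda>Z. of_nat m * E Z) s))))"


section \<open>Polyhedral divisors\<close>

text \<open>A formal sum over prime divisors is the function giving the coefficient of each of them.\<close>

definition polyhedral_divisor ::
    "nat \<Rightarrow> 'p variety \<Rightarrow> qvec set \<Rightarrow> ('p set \<Rightarrow> qvec set) \<Rightarrow> bool" where
  "polyhedral_divisor n Y \<delta> D \<longleftrightarrow>
     pointed_cone n \<delta> \<and>
     (\<forall>Z\<in>prime_divisors Y. polyhedron n (D Z) \<and> (D Z = {} \<or> tail n (D Z) = \<delta>)) \<and>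
     finite {Z \<in> prime_divisors Y. nontrivial n (D Z)}"

definition locus :: "'p variety \<Rightarrow> ('p set \<Rightarrow> qvec set) \<Rightarrow> 'p set" where
  "locus Y D = pts Y - \<Union>{Z \<in> prime_divisors Y. D Z = {}}"

text \<open>\<open>D(u)\<close>; its coefficients are only meaningful at prime divisors meeting the locus.\<close>

definition evaluate :: "('p set \<Rightarrow> qvec set) \<Rightarrow> zvec \<Rightarrow> 'p set \<Rightarrow> rat" where
  "evaluate D u Z = minval (D Z) u"

definition proper ::
    "nat \<Rightarrow> 'p variety \<Rightarrow> qvec set \<Rightarrow> ('p set \<Rightarrow> qvec set) \<Rightarrow> bool" where
  "proper n Y \<delta> D \<longleftrightarrow>
     (\<exists>E :: 'p set \<Rightarrow> int. finite {Z \<in> prime_divisors Y. E Z \<noteq> 0} \<and>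
        semiample Y (pts Y) (\<lambda>Z. of_int (E Z)) \<and>
        pts Y - locus Y D = \<Union>{Z \<in> prime_divisors Y. E Z \<noteq> 0}) \<and>
     (\<forall>u\<in>weights n \<delta>. semiample Y (locus Y D) (evaluate D u)) \<and>
     (\<forall>u\<in>dual_lattice n. rat_vec u \<in> relint (dual_cone n \<delta>) \<longrightarrow> big Y (locus Y D) (evaluate D u))"

text \<open>
  The algebra of global functions of \<open>X(D)\<close>: finite sums of \<open>f \<chi>\<^sup>u\<close> with \<open>f\<close> in
  \<open>H\<^sup>0(Y, D(u))\<close>, as a subring of the group ring of \<open>M\<close> over the field of rational functions.
\<close>

definition divisor_algebra ::
    "nat \<Rightarrow> 'p variety \<Rightarrow> qvec set \<Rightarrow> ('p set \<Rightarrow> qvec set) \<Rightarrow> (zvec \<Rightarrow>\<^sub>0 ratfun) ring" where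
  "divisor_algebra n Y \<delta> D = subring_of
     {a. \<forall>u\<in>keys a. u \<in> weights n \<delta> \<and>
        lookup a u \<in> sections Y (locus Y D) (\<lambda>Z. \<lfloor>evaluate D u Z\<rfloor>)}"

definition degree0 :: "ratfun \<Rightarrow> (zvec \<Rightarrow>\<^sub>0 ratfun)" where
  "degree0 f = Poly_Mapping.single 0 f"


section \<open>Affine schemes over the complex numbers\<close>

text \<open>
  \<open>pfrac R p a s\<close> is the element \<open>a/s\<close> of the localization of \<open>R\<close> at the prime ideal \<open>p\<close>,
  as an equivalence class of pairs.
\<close>

definition pfrac :: "('a, 'b) ring_scheme \<Rightarrow> 'a set \<Rightarrow> 'a \<Rightarrow> 'a \<Rightarrow> ('a \<times> 'a) set" where
  "pfrac R p a s = {(b, t). b \<in> carrier R \<and> t \<in> carrier R - p \<and>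
     (\<exists>w\<in>carrier R - p. w \<otimes>\<^bsub>R\<^esub> (a \<otimes>\<^bsub>R\<^esub> t \<ominus>\<^bsub>R\<^esub> b \<otimes>\<^bsub>R\<^esub> s) = \<zero>\<^bsub>R\<^esub>)}"

definition localization :: "('a, 'b) ring_scheme \<Rightarrow> 'a set \<Rightarrow> ('a \<times> 'a) set ring" where
  "localization R p =
     \<lparr>carrier = {pfrac R p a s | a s. a \<in> carrier R \<and> s \<in> carrier R - p},
      mult = (\<lambda>X Y. \<Union>(a, s)\<in>X. \<Union>(b, t)\<in>Y. pfrac R p (a \<otimes>\<^bsub>R\<^esub> b) (s \<otimes>\<^bsub>R\<^esub> t)),
      one = pfrac R p \<one>\<^bsub>R\<^esub> \<one>\<^bsub>R\<^esub>,
      ring.zero = pfrac R p \<zero>\<^bsub>R\<^esub> \<one>\<^bsub>R\<^esub>,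
      add = (\<lambda>X Y. \<Union>(a, s)\<in>X. \<Union>(b, t)\<in>Y.
        pfrac R p (a \<otimes>\<^bsub>R\<^esub> t \<oplus>\<^bsub>R\<^esub> b \<otimes>\<^bsub>R\<^esub> s) (s \<otimes>\<^bsub>R\<^esub> t))\<rparr>"

definition prime_spectrum :: "('a, 'b) ring_scheme \<Rightarrow> 'a set set" where
  "prime_spectrum R = {p. primeideal p R}"

definition spec_opens :: "('a, 'b) ring_scheme \<Rightarrow> 'a set set set" where
  "spec_opens R = {{p \<in> prime_spectrum R. \<not> S \<subseteq> p} | S. S \<subseteq> carrier R}"

definition structure_sheaf ::
    "('a, 'b) ring_scheme \<Rightarrow> 'a set set \<Rightarrow> ('a set \<Rightarrow> ('a \<times> 'a) set) ring" where
  "structure_sheaf R U =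
     \<lparr>carrier = {s \<in> (\<Pi>\<^sub>E p\<in>U. carrier (localization R p)).
        \<forall>p\<in>U. \<exists>V\<in>spec_opens R. p \<in> V \<and> V \<subseteq> U \<and>
          (\<exists>a\<in>carrier R. \<exists>f\<in>carrier R. \<forall>q\<in>V. f \<notin> q \<and> s q = pfrac R q a f)},
      mult = (\<lambda>s t. \<lambda>p\<in>U. s p \<otimes>\<^bsub>localization R p\<^esub> t p),
      one = (\<lambda>p\<in>U. \<one>\<^bsub>localization R p\<^esub>),
      ring.zero = (\<lambda>p\<in>U. \<zero>\<^bsub>localization R p\<^esub>),
      add = (\<lambda>s t. \<lambda>p\<in>U. s p \<oplus>\<^bsub>localization R p\<^esub> t p)\<rparr>"

text \<open>
  Ringed spaces over \<open>\<complex>\<close>: points, open sets, rings of sections, restriction maps (from the first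
  open set to the second), and the structure maps from \<open>\<complex>\<close>.
\<close>

record ('p, 's) cspace =
  points :: "'p set"
  opens :: "'p set set"
  sheaf :: "'p set \<Rightarrow> 's ring"
  res :: "'p set \<Rightarrow> 'p set \<Rightarrow> 's \<Rightarrow> 's"
  scalar :: "'p set \<Rightarrow> complex \<Rightarrow> 's"

definition Spec :: "'a ring \<Rightarrow> (complex \<Rightarrow> 'a) \<Rightarrow> ('a set, 'a set \<Rightarrow> ('a \<times> 'a) set) cspace" where
  "Spec R \<kappa> =
     \<lparr>points = prime_spectrum R,
      opens = spec_opens R,
      sheaf = structure_sheaf R,
      res = (\<lambda>U V s. restrict s V),
      scalar = (\<lambda>U c. \<lambda>p\<in>U. pfrac R p (\<kappa> c) \<one>\<^bsub>R\<^esub>)\<rparr>"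

text \<open>
  Isomorphism as ringed spaces over \<open>\<complex>\<close>. For schemes this is isomorphism of schemes over \<open>\<complex>\<close>,
  since an isomorphism of ringed spaces automatically induces local isomorphisms of stalks.
\<close>

definition isomorphic_over_C :: "('p, 's) cspace \<Rightarrow> ('q, 't) cspace \<Rightarrow> bool" where
  "isomorphic_over_C X Y \<longleftrightarrow>
     (\<exists>\<phi> \<psi>. bij_betw \<phi> (points X) (points Y) \<and>
        (\<forall>U\<subseteq>points X. U \<in> opens X \<longleftrightarrow> \<phi> ` U \<in> opens Y) \<and>
        (\<forall>U\<in>opens X. \<psi> U \<in> ring_iso (sheaf Y (\<phi> ` U)) (sheaf X U)) \<and>
        (\<forall>U\<in>opens X. \<forall>V\<in>opens X. V \<subseteq> U \<longrightarrow>
           (\<forall>s\<in>carrier (sheaf Y (\<phi> ` U)). \<psi> V (res Y (\<phi> ` U) (\<phi> ` V) s) = res X U V (\<psi> U s))) \<and>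
        (\<forall>U\<in>opens X. \<forall>c. \<psi> U (scalar Y (\<phi> ` U) c) = scalar X U c))"


section \<open>Flatness\<close>

text \<open>
  The tensor product of two modules is the free abelian group on pairs modulo the relations of
  bilinearity.
\<close>

definition tensor_relations ::
    "('r, 'x) ring_scheme \<Rightarrow> ('r, 'a) module \<Rightarrow> ('r, 'b) module \<Rightarrow> ('a \<times> 'b \<Rightarrow>\<^sub>0 int) set" where
  "tensor_relations R M N = generate (free_Abelian_group (carrier M \<times> carrier N))
     ({frag_of (x \<oplus>\<^bsub>M\<^esub> y, z) - frag_of (x, z) - frag_of (y, z) | x y z.
         x \<in> carrier M \<and> y \<in> carrier M \<and> z \<in> carrier N} \<union>
      {frag_of (x, y \<oplus>\<^bsub>N\<^esub> z) - frag_of (x, y) - frag_of (x, z) | x y z.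
         x \<in> carrier M \<and> y \<in> carrier N \<and> z \<in> carrier N} \<union>
      {frag_of (r \<odot>\<^bsub>M\<^esub> x, z) - frag_of (x, r \<odot>\<^bsub>N\<^esub> z) | r x z.
         r \<in> carrier R \<and> x \<in> carrier M \<and> z \<in> carrier N})"

definition tensor_product ::
    "('r, 'x) ring_scheme \<Rightarrow> ('r, 'a) module \<Rightarrow> ('r, 'b) module \<Rightarrow> ('a \<times> 'b \<Rightarrow>\<^sub>0 int) set monoid" where
  "tensor_product R M N =
     free_Abelian_group (carrier M \<times> carrier N) Mod tensor_relations R M N"

text \<open>The map \<open>M \<otimes> N \<rightarrow> M \<otimes> N'\<close> induced by \<open>f : N \<rightarrow> N'\<close>.\<close>

definition tensor_map ::
    "('r, 'x) ring_scheme \<Rightarrow> ('r, 'a) module \<Rightarrow> ('r, 'c) module \<Rightarrow> ('b \<Rightarrow> 'c) \<Rightarrow>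
     ('a \<times> 'b \<Rightarrow>\<^sub>0 int) set \<Rightarrow> ('a \<times> 'c \<Rightarrow>\<^sub>0 int) set" where
  "tensor_map R M N' f C =
     (\<Union>c\<in>C. tensor_relations R M N' #>\<^bsub>free_Abelian_group (carrier M \<times> carrier N')\<^esub>
        frag_extend (\<lambda>(x, z). frag_of (x, f z)) c)"

definition module_homs ::
    "('r, 'x) ring_scheme \<Rightarrow> ('r, 'a) module \<Rightarrow> ('r, 'b) module \<Rightarrow> ('a \<Rightarrow> 'b) set" where
  "module_homs R M N = {f \<in> carrier M \<rightarrow> carrier N.
     (\<forall>x\<in>carrier M. \<forall>y\<in>carrier M. f (x \<oplus>\<^bsub>M\<^esub> y) = f x \<oplus>\<^bsub>N\<^esub> f y) \<and>
     (\<forall>r\<in>carrier R. \<forall>x\<in>carrier M. f (r \<odot>\<^bsub>M\<^esub> x) = r \<odot>\<^bsub>N\<^esub> f x)}"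

text \<open>
  \<open>M\<close> is flat: tensoring with \<open>M\<close> preserves injectivity. A formula of HOL cannot quantify over types,
  so the carrier types of the test modules are parameters; in a theorem in which they are free type
  variables they range over all types.
\<close>

definition flat_module ::
    "'b itself \<Rightarrow> 'c itself \<Rightarrow> ('r, 'x) ring_scheme \<Rightarrow> ('r, 'a) module \<Rightarrow> bool" where
  "flat_module _ _ R M \<longleftrightarrow> module R M \<and>
     (\<forall>(N :: ('r, 'b) module) (N' :: ('r, 'c) module) f.
        module R N \<and> module R N' \<and> f \<in> module_homs R N N' \<and> inj_on f (carrier N) \<longrightarrow>
        inj_on (tensor_map R M N' f) (carrier (tensor_product R M N)))"

definition contraction :: "('r, 'x) ring_scheme \<Rightarrow> ('r \<Rightarrow> 'a) \<Rightarrow> 'a set \<Rightarrow> 'r set" where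
  "contraction R \<iota> p = {r \<in> carrier R. \<iota> r \<in> p}"

text \<open>
  The local ring of \<open>Spec A\<close> at \<open>p\<close> as a module over the local ring of \<open>Spec R\<close> at the image of
  \<open>p\<close>, via the local homomorphism induced by \<open>\<iota> : R \<rightarrow> A\<close>.
\<close>

definition local_module ::
    "('r, 'x) ring_scheme \<Rightarrow> ('a, 'y) ring_scheme \<Rightarrow> ('r \<Rightarrow> 'a) \<Rightarrow> 'a set \<Rightarrow>
     (('r \<times> 'r) set, ('a \<times> 'a) set) module" where
  "local_module R A \<iota> p = (let L = localization A p in
     \<lparr>carrier = carrier L, mult = mult L, one = one L, ring.zero = ring.zero L, add = add L,
      smult = (\<lambda>X x. (\<Union>(r, s)\<in>X. pfrac A p (\<iota> r) (\<iota> s)) \<otimes>\<^bsub>L\<^esub> x)\<rparr>)"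

text \<open>
  The morphism \<open>Spec A \<rightarrow> Spec R\<close> induced by the ring homomorphism \<open>\<iota>\<close> is flat, i.e. flat on local
  rings at every point of \<open>Spec A\<close>.
\<close>

definition flat_morphism ::
    "'b itself \<Rightarrow> 'c itself \<Rightarrow> ('r, 'x) ring_scheme \<Rightarrow> ('a, 'y) ring_scheme \<Rightarrow> ('r \<Rightarrow> 'a) \<Rightarrow> bool" where
  "flat_morphism tb tc R A \<iota> \<longleftrightarrow> \<iota> \<in> ring_hom R A \<and>
     (\<forall>p\<in>prime_spectrum A.
        flat_module tb tc (localization R (contraction R \<iota> p)) (local_module R A \<iota> p))"

text \<open>
  The scheme-theoretic fibre of \<open>Spec A \<rightarrow> Spec R\<close> over the closed point given by the maximal ideal
  \<open>J\<close> of \<open>R\<close>: the spectrum of \<open>A / J A\<close>, which is \<open>A \<otimes>\<^sub>R (R / J)\<close>.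
\<close>

definition fibre ::
    "'a ring \<Rightarrow> (complex \<Rightarrow> 'a) \<Rightarrow> ('r \<Rightarrow> 'a) \<Rightarrow> 'r set \<Rightarrow>
     ('a set set, 'a set set \<Rightarrow> ('a set \<times> 'a set) set) cspace" where
  "fibre A \<kappa> \<iota> J =
     (let I = genideal A (\<iota> ` J) in Spec (A Quot I) (\<lambda>c. I +>\<^bsub>A\<^esub> \<kappa> c))"

definition X_scheme ::
    "nat \<Rightarrow> 'p variety \<Rightarrow> qvec set \<Rightarrow> ('p set \<Rightarrow> qvec set) \<Rightarrow>
     ((zvec \<Rightarrow>\<^sub>0 ratfun) set, (zvec \<Rightarrow>\<^sub>0 ratfun) set \<Rightarrow>
        ((zvec \<Rightarrow>\<^sub>0 ratfun) \<times> (zvec \<Rightarrow>\<^sub>0 ratfun)) set) cspace" where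
  "X_scheme n Y \<delta> D = Spec (divisor_algebra n Y \<delta> D) (\<lambda>c. degree0 (const c))"


section \<open>The family associated with a decomposition\<close>

text \<open>
  The polyhedral divisor \<open>\<Sum>\<^sub>j \<Delta> j \<otimes> V(f j)\<close>: the coefficient at \<open>Z\<close> is the Minkowski sum of the
  \<open>\<Delta> j\<close>, each taken with the multiplicity of \<open>Z\<close> in \<open>V(f j)\<close>. Adding \<open>\<delta>\<close> makes the
  coefficient trivial where no \<open>V(f j)\<close> contributes, and changes nothing elsewhere.
\<close>

definition divisor_sum ::
    "'p variety \<Rightarrow> qvec set \<Rightarrow> 'j set \<Rightarrow> ('j \<Rightarrow> qvec set) \<Rightarrow> ('j \<Rightarrow> ratfun) \<Rightarrow> 'p set \<Rightarrow> qvec set" where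
  "divisor_sum Y \<delta> J \<Delta> f Z = \<delta> + (\<Sum>j\<in>J. \<Sum>k<zero_divisor Y (f j) Z. \<Delta> j)"

definition summand_index :: "p1 set \<Rightarrow> (p1 \<Rightarrow> nat) \<Rightarrow> (p1 \<times> nat) set" where
  "summand_index Ps r = {(P, i). P \<in> Ps \<and> i \<le> r P}"

definition param_index :: "p1 set \<Rightarrow> (p1 \<Rightarrow> nat) \<Rightarrow> (p1 \<times> nat) set" where
  "param_index Ps r = {(P, i). P \<in> Ps \<and> 1 \<le> i \<and> i \<le> r P}"

definition param :: "p1 \<Rightarrow> nat \<Rightarrow> ratfun" where
  "param P i = (if i = 0 then 0 else Fract (poly_var (T P i)) 1)"

definition sole_simple_zero :: "ratfun \<Rightarrow> p1 \<Rightarrow> bool" where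
  "sole_simple_zero f P \<longleftrightarrow> f \<in> funs P1 \<and> f \<noteq> 0 \<and> zero_divisor P1 f {P} = 1 \<and>
     (\<forall>Q. Q \<noteq> P \<longrightarrow> zero_divisor P1 f {Q} = 0)"

definition base_variety ::
    "p1 set \<Rightarrow> (p1 \<Rightarrow> nat) \<Rightarrow> (p1 \<times> nat \<Rightarrow> complex) set \<Rightarrow> (p1 \<times> nat \<Rightarrow> complex) variety" where
  "base_variety Ps r B = open_subvariety (Aff (param_index Ps r)) B"

definition Ytot ::
    "p1 set \<Rightarrow> (p1 \<Rightarrow> nat) \<Rightarrow> (p1 \<times> nat \<Rightarrow> complex) set \<Rightarrow>
     (p1 \<times> (p1 \<times> nat \<Rightarrow> complex)) variety" where
  "Ytot Ps r B = open_subvariety (P1_Aff (param_index Ps r)) (UNIV \<times> B)"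

definition admissible_base ::
    "p1 set \<Rightarrow> (p1 \<Rightarrow> nat) \<Rightarrow> (p1 \<Rightarrow> ratfun) \<Rightarrow> (p1 \<times> nat \<Rightarrow> complex) set \<Rightarrow> bool" where
  "admissible_base Ps r y B \<longleftrightarrow>
     is_open (Aff (param_index Ps r)) B \<and> is_affine (base_variety Ps r B) \<and> (\<lambda>_. 0) \<in> B \<and>
     (\<forall>P\<in>Ps. \<forall>Q\<in>Ps. P \<noteq> Q \<longrightarrow> (\<forall>i\<le>r P. \<forall>j\<le>r Q.
        zero_support (Ytot Ps r B) (y P - param P i) \<inter>
        zero_support (Ytot Ps r B) (y Q - param Q j) = {}))"

definition Dtot ::
    "p1 set \<Rightarrow> (p1 \<Rightarrow> nat) \<Rightarrow> (p1 \<Rightarrow> nat \<Rightarrow> qvec set) \<Rightarrow> (p1 \<Rightarrow> ratfun) \<Rightarrow>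
     (p1 \<times> nat \<Rightarrow> complex) set \<Rightarrow> qvec set \<Rightarrow>
     (p1 \<times> (p1 \<times> nat \<Rightarrow> complex)) set \<Rightarrow> qvec set" where
  "Dtot Ps r \<Delta> y B \<delta> = divisor_sum (Ytot Ps r B) \<delta> (summand_index Ps r)
     (\<lambda>(P, i). \<Delta> P i) (\<lambda>(P, i). y P - param P i)"

text \<open>Points \<open>\<lambda>\<close> of \<open>B\<close> satisfy \<open>\<lambda> (P, 0) = 0\<close>, since \<open>(P, 0)\<close> is not in \<open>param_index\<close>.\<close>

definition Dlam ::
    "p1 set \<Rightarrow> (p1 \<Rightarrow> nat) \<Rightarrow> (p1 \<Rightarrow> nat \<Rightarrow> qvec set) \<Rightarrow> (p1 \<Rightarrow> ratfun) \<Rightarrow>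
     (p1 \<times> nat \<Rightarrow> complex) \<Rightarrow> qvec set \<Rightarrow> p1 set \<Rightarrow> qvec set" where
  "Dlam Ps r \<Delta> y l \<delta> = divisor_sum P1 \<delta> (summand_index Ps r)
     (\<lambda>(P, i). \<Delta> P i) (\<lambda>(P, i). y P - const (l (P, i)))"

definition base_ring ::
    "p1 set \<Rightarrow> (p1 \<Rightarrow> nat) \<Rightarrow> (p1 \<times> nat \<Rightarrow> complex) set \<Rightarrow> ratfun ring" where
  "base_ring Ps r B = subring_of (regular_functions (base_variety Ps r B))"

end

theory Submission
  imports Defs "HOL-Computational_Algebra.Polynomial" "HOL-Computational_Algebra.Fundamental_Theorem_Algebra"
begin

text \<open>
  Each \<open>y\<^sub>P\<close> is a quotient of two linear forms on the projective line, so the summands of the divisor on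
  \<open>\<bbbP>\<^sup>1 \<times> B\<close> sit on the zero sets of linear forms \<open>l\<^sub>j\<close> whose coefficients are regular on \<open>B\<close>. By
  admissibility, rounding down commutes with the Minkowski sums, also where several of these zero sets
  come together. So a section in degree \<open>u\<close> is a rational function \<open>f\<close> such that \<open>f\<close> times
  \<open>\<Prod> l\<^sub>j\<^bsup>e\<^esup>\<close>, with \<open>e = \<lfloor>min \<langle>\<Delta>\<^sub>j, u\<rangle>\<rfloor>\<close>, is a section of a line bundle \<open>\<O>(d)\<close>
  away from the zero sets that carry an empty summand. Clearing the poles along those, the sections in
  degree \<open>u\<close> are an increasing union of free modules over the ring \<open>R\<close> of regular functions of
  \<open>B\<close>, with the monomials
  \<open>X0\<^bsup>i\<^esup> X1\<^bsup>d - i\<^esup>\<close> as a basis. This gives flatness. These bases specialise to those on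
  each fibre, so evaluating the coefficients at \<open>\<lambda>\<close> is a surjection onto the algebra of the
  divisor of the fibre, whose kernel is generated by the functions in \<open>R\<close> that vanish at \<open>\<lambda>\<close>.
\<close>

subsection \<open>Flatness from finite dual bases\<close>

text \<open>Cohomology and base change would supply two facts: the sections in one degree form a
  flat module, and every section on a fibre extends. Here both come from bookkeeping in one field of
  rational functions. The exponents and degrees depend only on the polyhedra and the weight, not on
  the point of the base, so the family and each of its fibres have bases indexed by the same
  exponents. The empty summands are the obstacle: without a bound on the poles there is no finite
  basis, and the bound has to be raised for each finite set of sections. The flatness criterion is
  therefore stated with coordinates on submodules that may be chosen anew for each finite set; its
  proof rests on the fact that a relation in a tensor product involves only finitely many elements.
  Admissibility enters twice, over the whole base and over each of its points, since zero sets that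
  differ over the base may meet in a fibre; the condition on the base ensures that only summands of
  the same coefficient can do so. Evaluation at a point of the base is a partial map of the field,
  defined on fractions for which some denominator survives.\<close>

lemma tensor_relations_carrier:
  assumes "module R M" "module R N" "c \<in> tensor_relations R M N"
  shows "c \<in> carrier (free_Abelian_group (carrier M \<times> carrier N))"
proof -
  interpret M: module R M by fact
  interpret N: module R N by fact
  have sub: "{frag_of (x \<oplus>\<^bsub>M\<^esub> y, z) - frag_of (x, z) - frag_of (y, z) | x y z.
         x \<in> carrier M \<and> y \<in> carrier M \<and> z \<in> carrier N} \<union>
      {frag_of (x, y \<oplus>\<^bsub>N\<^esub> z) - frag_of (x, y) - frag_of (x, z) | x y z.
         x \<in> carrier M \<and> y \<in> carrier N \<and> z \<in> carrier N} \<union>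
      {frag_of (r \<odot>\<^bsub>M\<^esub> x, z) - frag_of (x, r \<odot>\<^bsub>N\<^esub> z) | r x z.
         r \<in> carrier R \<and> x \<in> carrier M \<and> z \<in> carrier N}
     \<subseteq> carrier (free_Abelian_group (carrier M \<times> carrier N))"
    by (auto dest!: subsetD[OF keys_diff] simp: keys_frag_of)
  show ?thesis
    using group.generate_in_carrier[OF group_free_Abelian_group sub] assms(3)
    unfolding tensor_relations_def by blast
qed

lemma tensor_relations_subgroup:
  assumes "module R M" "module R N"
  shows "subgroup (tensor_relations R M N) (free_Abelian_group (carrier M \<times> carrier N))"
proof -
  interpret M: module R M by fact
  interpret N: module R N by fact
  show ?thesis unfolding tensor_relations_def
    by (rule group.generate_is_subgroup[OF group_free_Abelian_group])
      (auto dest!: subsetD[OF keys_diff] simp: keys_frag_of)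
qed

lemma tensor_relations_intros:
  shows "x \<in> carrier M \<Longrightarrow> y \<in> carrier M \<Longrightarrow> z \<in> carrier N \<Longrightarrow>
      frag_of (x \<oplus>\<^bsub>M\<^esub> y, z) - frag_of (x, z) - frag_of (y, z) \<in> tensor_relations R M N"
    and "x \<in> carrier M \<Longrightarrow> y' \<in> carrier N \<Longrightarrow> z \<in> carrier N \<Longrightarrow>
      frag_of (x, y' \<oplus>\<^bsub>N\<^esub> z) - frag_of (x, y') - frag_of (x, z) \<in> tensor_relations R M N"
    and "r \<in> carrier R \<Longrightarrow> x \<in> carrier M \<Longrightarrow> z \<in> carrier N \<Longrightarrow>
      frag_of (r \<odot>\<^bsub>M\<^esub> x, z) - frag_of (x, r \<odot>\<^bsub>N\<^esub> z) \<in> tensor_relations R M N"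
  unfolding tensor_relations_def by (rule generate.incl; blast)+

lemma tensor_relations_closed:
  assumes "module R M" "module R N"
  shows "0 \<in> tensor_relations R M N"
    and "a \<in> tensor_relations R M N \<Longrightarrow> b \<in> tensor_relations R M N \<Longrightarrow> a + b \<in> tensor_relations R M N"
    and "a \<in> tensor_relations R M N \<Longrightarrow> - a \<in> tensor_relations R M N"
    and "a \<in> tensor_relations R M N \<Longrightarrow> b \<in> tensor_relations R M N \<Longrightarrow> a - b \<in> tensor_relations R M N"
proof -
  note sg = tensor_relations_subgroup[OF assms]
  show "0 \<in> tensor_relations R M N" using subgroup.one_closed[OF sg] by simp
  show p: "a + b \<in> tensor_relations R M N" if "a \<in> tensor_relations R M N" "b \<in> tensor_relations R M N" for a b
    using subgroup.m_closed[OF sg that] by simp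
  show m: "- a \<in> tensor_relations R M N" if "a \<in> tensor_relations R M N" for a
    using subgroup.m_inv_closed[OF sg that] tensor_relations_carrier[OF assms that]
    by simp
  show "a - b \<in> tensor_relations R M N" if "a \<in> tensor_relations R M N" "b \<in> tensor_relations R M N" for a b
    using p[OF that(1) m[OF that(2)]] by simp
qed

lemma tensor_relations_sum:
  assumes "module R M" "module R N" "\<And>c. c \<in> C \<Longrightarrow> f c \<in> tensor_relations R M N"
  shows "sum f C \<in> tensor_relations R M N"
  using assms(3)
  by (induction C rule: infinite_finite_induct) (auto intro: tensor_relations_closed[OF assms(1,2)])

lemma tensor_coset_eq_iff:
  assumes "module R M" "module R N"
  shows "tensor_relations R M N #>\<^bsub>free_Abelian_group (carrier M \<times> carrier N)\<^esub> a =
      tensor_relations R M N #>\<^bsub>free_Abelian_group (carrier M \<times> carrier N)\<^esub> b \<longleftrightarrow>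
      a - b \<in> tensor_relations R M N" (is "?L = ?R \<longleftrightarrow> _")
proof
  note cl = tensor_relations_closed[OF assms]
  assume eq: "?L = ?R"
  have "0 + a \<in> ?L" unfolding r_coset_def using cl(1) by (auto intro!: bexI[of _ 0])
  then have "a \<in> ?R" using eq by simp
  then obtain h where "h \<in> tensor_relations R M N" "a = h + b" unfolding r_coset_def by auto
  then show "a - b \<in> tensor_relations R M N" by simp
next
  note cl = tensor_relations_closed[OF assms]
  assume d: "a - b \<in> tensor_relations R M N"
  show "?L = ?R"
  proof (intro equalityI subsetI)
    fix x assume "x \<in> ?L"
    then obtain h where "h \<in> tensor_relations R M N" "x = h + a" unfolding r_coset_def by auto
    then show "x \<in> ?R" unfolding r_coset_def
      using cl(2)[OF _ d, of h] by (auto intro!: bexI[of _ "h + (a - b)"] simp: algebra_simps)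
  next
    fix x assume "x \<in> ?R"
    then obtain h where "h \<in> tensor_relations R M N" "x = h + b" unfolding r_coset_def by auto
    then show "x \<in> ?L" unfolding r_coset_def
      using cl(4)[OF _ d, of h] by (auto intro!: bexI[of _ "h - (a - b)"] simp: algebra_simps)
  qed
qed

text \<open>Additivity reduces this to the generators, and each bilinearity generator over
  \<open>N\<close> is sent to a generator of the same kind over \<open>N'\<close> because
  \<open>f\<close> is linear.\<close>

lemma frag_extend_tensor_relations:
  assumes mods: "module R M" "module R N" "module R N'" and f: "f \<in> module_homs R N N'"
    and c: "c \<in> tensor_relations R M N"
  shows "frag_extend (\<lambda>(x, z). frag_of (x, f z)) c \<in> tensor_relations R M N'"
proof -
  interpret M: module R M by fact
  interpret N: module R N by fact
  let ?g = "frag_extend (\<lambda>(x, z). frag_of (x, f z))"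
  have fc: "f z \<in> carrier N'" if "z \<in> carrier N" for z using f that by (auto simp: module_homs_def)
  note car = tensor_relations_carrier[OF mods(1,2), unfolded tensor_relations_def]
  note cl = tensor_relations_closed[OF mods(1,3)]
  have gen: "?g h \<in> tensor_relations R M N'" if "h \<in> {frag_of (x \<oplus>\<^bsub>M\<^esub> y, z) - frag_of (x, z) - frag_of (y, z) | x y z.
         x \<in> carrier M \<and> y \<in> carrier M \<and> z \<in> carrier N} \<union>
      {frag_of (x, y \<oplus>\<^bsub>N\<^esub> z) - frag_of (x, y) - frag_of (x, z) | x y z.
         x \<in> carrier M \<and> y \<in> carrier N \<and> z \<in> carrier N} \<union>
      {frag_of (r \<odot>\<^bsub>M\<^esub> x, z) - frag_of (x, r \<odot>\<^bsub>N\<^esub> z) | r x z.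
         r \<in> carrier R \<and> x \<in> carrier M \<and> z \<in> carrier N}" for h
    using that f fc
    by (auto simp: frag_extend_diff module_homs_def intro!: tensor_relations_intros)
  from c show ?thesis unfolding tensor_relations_def[of R M N]
  proof (induction rule: generate.induct)
    case one then show ?case using cl(1) by simp
  next
    case (incl h) then show ?case by (rule gen)
  next
    case (inv h)
    have "h \<in> carrier (free_Abelian_group (carrier M \<times> carrier N))"
      by (rule car, rule generate.incl, rule inv)
    then show ?case using gen[OF inv] cl(3) by (simp add: frag_extend_minus)
  next
    case (eng h1 h2) then show ?case using cl(2) by (simp add: frag_extend_add)
  qed
qed

text \<open>\<open>tensor_map\<close> takes the union over all representatives of a class; these
  differ by relations, so every member of the union is the same coset.\<close>

lemma tensor_map_coset:
  assumes mods: "module R M" "module R N" "module R N'" and f: "f \<in> module_homs R N N'"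
  shows "tensor_map R M N' f
      (tensor_relations R M N #>\<^bsub>free_Abelian_group (carrier M \<times> carrier N)\<^esub> a) =
    tensor_relations R M N' #>\<^bsub>free_Abelian_group (carrier M \<times> carrier N')\<^esub>
      frag_extend (\<lambda>(x, z). frag_of (x, f z)) a"
proof -
  let ?g = "frag_extend (\<lambda>(x, z). frag_of (x, f z))"
  let ?K = "\<lambda>a. tensor_relations R M N' #>\<^bsub>free_Abelian_group (carrier M \<times> carrier N')\<^esub> ?g a"
  have "?K c = ?K a" if "c \<in> tensor_relations R M N #>\<^bsub>free_Abelian_group (carrier M \<times> carrier N)\<^esub> a" for c
  proof -
    from that obtain h where "h \<in> tensor_relations R M N" "c = h + a" unfolding r_coset_def by auto
    then show ?thesis
      using frag_extend_tensor_relations[OF mods f, of h]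
      by (simp add: tensor_coset_eq_iff[OF mods(1,3)] frag_extend_add)
  qed
  moreover have "a \<in> tensor_relations R M N #>\<^bsub>free_Abelian_group (carrier M \<times> carrier N)\<^esub> a"
    unfolding r_coset_def using tensor_relations_closed(1)[OF mods(1,2)]
    by (auto intro!: bexI[of _ 0])
  ultimately show ?thesis unfolding tensor_map_def by blast
qed

text \<open>A relation in \<open>M \<otimes> N\<close> involves only finitely many elements of \<open>M\<close>; it is therefore killed by
  every bilinear map that is only defined on a submodule containing these.\<close>

lemma tensor_relations_finite_support:
  assumes mods: "module R M" "module R N" and c: "c \<in> tensor_relations R M N"
  shows "\<exists>S. finite S \<and> S \<subseteq> carrier M \<and>
    (\<forall>F k h. S \<subseteq> F \<and> F \<subseteq> carrier M \<and> (\<forall>x\<in>F. \<forall>y\<in>F. x \<oplus>\<^bsub>M\<^esub> y \<in> F) \<and>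
        (\<forall>r\<in>carrier R. \<forall>x\<in>F. r \<odot>\<^bsub>M\<^esub> x \<in> F) \<and> k \<in> F \<rightarrow> carrier R \<and>
        (\<forall>x\<in>F. \<forall>y\<in>F. k (x \<oplus>\<^bsub>M\<^esub> y) = k x \<oplus>\<^bsub>R\<^esub> k y) \<and>
        (\<forall>r\<in>carrier R. \<forall>x\<in>F. k (r \<odot>\<^bsub>M\<^esub> x) = r \<otimes>\<^bsub>R\<^esub> k x) \<and>
        h \<in> hom (free_Abelian_group (carrier M \<times> carrier N)) (add_monoid N) \<and>
        (\<forall>x\<in>F. \<forall>z\<in>carrier N. h (frag_of (x, z)) = k x \<odot>\<^bsub>N\<^esub> z) \<longrightarrow> h c = \<zero>\<^bsub>N\<^esub>)"
proof -
  interpret M: module R M by fact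
  interpret N: module R N by fact
  let ?G = "free_Abelian_group (carrier M \<times> carrier N)"
  define good where "good = (\<lambda>S c. \<forall>F k h. S \<subseteq> F \<and> F \<subseteq> carrier M \<and> (\<forall>x\<in>F. \<forall>y\<in>F. x \<oplus>\<^bsub>M\<^esub> y \<in> F) \<and>
        (\<forall>r\<in>carrier R. \<forall>x\<in>F. r \<odot>\<^bsub>M\<^esub> x \<in> F) \<and> k \<in> F \<rightarrow> carrier R \<and>
        (\<forall>x\<in>F. \<forall>y\<in>F. k (x \<oplus>\<^bsub>M\<^esub> y) = k x \<oplus>\<^bsub>R\<^esub> k y) \<and>
        (\<forall>r\<in>carrier R. \<forall>x\<in>F. k (r \<odot>\<^bsub>M\<^esub> x) = r \<otimes>\<^bsub>R\<^esub> k x) \<and>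
        h \<in> hom ?G (add_monoid N) \<and>
        (\<forall>x\<in>F. \<forall>z\<in>carrier N. h (frag_of (x, z)) = k x \<odot>\<^bsub>N\<^esub> z) \<longrightarrow> h c = \<zero>\<^bsub>N\<^esub>)"
  let ?gen = "{frag_of (x \<oplus>\<^bsub>M\<^esub> y, z) - frag_of (x, z) - frag_of (y, z) | x y z.
         x \<in> carrier M \<and> y \<in> carrier M \<and> z \<in> carrier N} \<union>
      {frag_of (x, y \<oplus>\<^bsub>N\<^esub> z) - frag_of (x, y) - frag_of (x, z) | x y z.
         x \<in> carrier M \<and> y \<in> carrier N \<and> z \<in> carrier N} \<union>
      {frag_of (r \<odot>\<^bsub>M\<^esub> x, z) - frag_of (x, r \<odot>\<^bsub>N\<^esub> z) | r x z.
         r \<in> carrier R \<and> x \<in> carrier M \<and> z \<in> carrier N}"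
  have hadd: "h (a + b) = h a \<oplus>\<^bsub>N\<^esub> h b"
    if "h \<in> hom ?G (add_monoid N)" "a \<in> carrier ?G" "b \<in> carrier ?G" for h a b
    using hom_mult[OF that] by simp
  have hcl: "h a \<in> carrier N" if "h \<in> hom ?G (add_monoid N)" "a \<in> carrier ?G" for h a
    using hom_in_carrier[OF that(1)] that(2) by auto
  have hneg: "h (- a) = \<ominus>\<^bsub>N\<^esub> h a" if "h \<in> hom ?G (add_monoid N)" "a \<in> carrier ?G" for h a
  proof -
    have "h (inv\<^bsub>?G\<^esub> a) = inv\<^bsub>add_monoid N\<^esub> (h a)"
      using group_hom.hom_inv[of ?G "add_monoid N" h a] that N.a_group
      by (simp add: group_hom_def group_hom_axioms_def)
    then show ?thesis using that by (simp add: a_inv_def)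
  qed
  have hdiff: "h (a - b) = h a \<oplus>\<^bsub>N\<^esub> (\<ominus>\<^bsub>N\<^esub> h b)"
    if "h \<in> hom ?G (add_monoid N)" "a \<in> carrier ?G" "b \<in> carrier ?G" for h a b
    using hadd[OF that(1,2), of "- b"] hneg[OF that(1,3)] that by simp
  have fin_gen: "\<exists>S. finite S \<and> S \<subseteq> carrier M \<and> good S c" if "c \<in> ?gen" for c
    using that
  proof (elim UnE CollectE exE conjE)
    fix x y z assume c: "c = frag_of (x \<oplus>\<^bsub>M\<^esub> y, z) - frag_of (x, z) - frag_of (y, z)"
      and in': "x \<in> carrier M" "y \<in> carrier M" "z \<in> carrier N"
    \<comment> \<open>\<open>x \<oplus> y\<close> need not be listed: a set \<open>F\<close> that
      contains \<open>x\<close> and \<open>y\<close> is closed under addition.\<close>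
    have "good {x, y} c" unfolding good_def
    proof (intro allI impI, elim conjE)
      fix F k h assume *: "{x, y} \<subseteq> F" "F \<subseteq> carrier M" "\<forall>x\<in>F. \<forall>y\<in>F. x \<oplus>\<^bsub>M\<^esub> y \<in> F"
        "k \<in> F \<rightarrow> carrier R" "\<forall>x\<in>F. \<forall>y\<in>F. k (x \<oplus>\<^bsub>M\<^esub> y) = k x \<oplus>\<^bsub>R\<^esub> k y"
        "h \<in> hom ?G (add_monoid N)" "\<forall>x\<in>F. \<forall>z\<in>carrier N. h (frag_of (x, z)) = k x \<odot>\<^bsub>N\<^esub> z"
      have kx: "k x \<in> carrier R" "k y \<in> carrier R" using *(1,4) by auto
      have d: "frag_of (x \<oplus>\<^bsub>M\<^esub> y, z) - frag_of (x, z) \<in> carrier ?G"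
        using in' by (auto dest!: subsetD[OF keys_diff] simp: keys_frag_of)
      have "h c = (k x \<oplus>\<^bsub>R\<^esub> k y) \<odot>\<^bsub>N\<^esub> z \<oplus>\<^bsub>N\<^esub> (\<ominus>\<^bsub>N\<^esub> (k x \<odot>\<^bsub>N\<^esub> z)) \<oplus>\<^bsub>N\<^esub> (\<ominus>\<^bsub>N\<^esub> (k y \<odot>\<^bsub>N\<^esub> z))"
        unfolding c using * in' d by (simp add: hdiff keys_frag_of)
      also have "\<dots> = \<zero>\<^bsub>N\<^esub>" using kx in' N.r_neg[of "k x \<odot>\<^bsub>N\<^esub> z \<oplus>\<^bsub>N\<^esub> k y \<odot>\<^bsub>N\<^esub> z"]
        by (simp add: N.smult_l_distr N.minus_add N.a_assoc)
      finally show "h c = \<zero>\<^bsub>N\<^esub>" .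
    qed
    then show ?thesis using in' by (intro exI[of _ "{x, y}"]) auto
  next
    fix x y z assume c: "c = frag_of (x, y \<oplus>\<^bsub>N\<^esub> z) - frag_of (x, y) - frag_of (x, z)"
      and in': "x \<in> carrier M" "y \<in> carrier N" "z \<in> carrier N"
    have "good {x} c" unfolding good_def
    proof (intro allI impI, elim conjE)
      fix F k h assume *: "{x} \<subseteq> F" "F \<subseteq> carrier M"
        "k \<in> F \<rightarrow> carrier R"
        "h \<in> hom ?G (add_monoid N)" "\<forall>x\<in>F. \<forall>z\<in>carrier N. h (frag_of (x, z)) = k x \<odot>\<^bsub>N\<^esub> z"
      have kx: "k x \<in> carrier R" using * by auto
      have d: "frag_of (x, y \<oplus>\<^bsub>N\<^esub> z) - frag_of (x, y) \<in> carrier ?G"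
        using in' by (auto dest!: subsetD[OF keys_diff] simp: keys_frag_of)
      have "h c = k x \<odot>\<^bsub>N\<^esub> (y \<oplus>\<^bsub>N\<^esub> z) \<oplus>\<^bsub>N\<^esub> (\<ominus>\<^bsub>N\<^esub> (k x \<odot>\<^bsub>N\<^esub> y)) \<oplus>\<^bsub>N\<^esub> (\<ominus>\<^bsub>N\<^esub> (k x \<odot>\<^bsub>N\<^esub> z))"
        unfolding c using * in' d by (simp add: hdiff keys_frag_of)
      also have "\<dots> = \<zero>\<^bsub>N\<^esub>" using kx in' N.r_neg[of "k x \<odot>\<^bsub>N\<^esub> y \<oplus>\<^bsub>N\<^esub> k x \<odot>\<^bsub>N\<^esub> z"]
        by (simp add: N.smult_r_distr N.minus_add N.a_assoc)
      finally show "h c = \<zero>\<^bsub>N\<^esub>" .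
    qed
    then show ?thesis using in' by (intro exI[of _ "{x}"]) auto
  next
    fix r x z assume c: "c = frag_of (r \<odot>\<^bsub>M\<^esub> x, z) - frag_of (x, r \<odot>\<^bsub>N\<^esub> z)"
      and in': "r \<in> carrier R" "x \<in> carrier M" "z \<in> carrier N"
    have "good {x} c" unfolding good_def
    proof (intro allI impI, elim conjE)
      fix F k h assume *: "{x} \<subseteq> F" "F \<subseteq> carrier M" "\<forall>r\<in>carrier R. \<forall>x\<in>F. r \<odot>\<^bsub>M\<^esub> x \<in> F"
        "k \<in> F \<rightarrow> carrier R" "\<forall>r\<in>carrier R. \<forall>x\<in>F. k (r \<odot>\<^bsub>M\<^esub> x) = r \<otimes>\<^bsub>R\<^esub> k x"
        "h \<in> hom ?G (add_monoid N)" "\<forall>x\<in>F. \<forall>z\<in>carrier N. h (frag_of (x, z)) = k x \<odot>\<^bsub>N\<^esub> z"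
      have kx: "k x \<in> carrier R" using * by auto
      have "h c = (r \<otimes>\<^bsub>R\<^esub> k x) \<odot>\<^bsub>N\<^esub> z \<oplus>\<^bsub>N\<^esub> (\<ominus>\<^bsub>N\<^esub> (k x \<odot>\<^bsub>N\<^esub> (r \<odot>\<^bsub>N\<^esub> z)))"
        unfolding c using * in' by (simp add: hdiff keys_frag_of)
      also have "(r \<otimes>\<^bsub>R\<^esub> k x) \<odot>\<^bsub>N\<^esub> z = k x \<odot>\<^bsub>N\<^esub> (r \<odot>\<^bsub>N\<^esub> z)"
        using in' kx by (metis N.smult_assoc1 M.R.m_comm)
      finally show "h c = \<zero>\<^bsub>N\<^esub>" using in' kx by (simp add: N.r_neg)
    qed
    then show ?thesis using in' by (intro exI[of _ "{x}"]) auto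
  qed
  have "\<exists>S. finite S \<and> S \<subseteq> carrier M \<and> good S c \<and> c \<in> carrier ?G" using c
    unfolding tensor_relations_def
  proof (induction rule: generate.induct)
    case one
    have "h 0 = \<zero>\<^bsub>N\<^esub>" if "h \<in> hom ?G (add_monoid N)" for h
      using group_hom.hom_one[of ?G "add_monoid N" h] that N.a_group
      by (simp add: group_hom_def group_hom_axioms_def)
    then show ?case by (intro exI[of _ "{}"]) (auto simp: good_def)
  next
    case (incl h)
    have "h \<in> carrier ?G" using tensor_relations_carrier[OF mods] incl
      unfolding tensor_relations_def by (meson generate.incl)
    then show ?case using fin_gen[OF incl] by blast
  next
    case (inv h)
    have hc: "h \<in> carrier ?G" using tensor_relations_carrier[OF mods] inv
      unfolding tensor_relations_def by (meson generate.incl)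
    from fin_gen[OF inv] obtain S where S: "finite S" "S \<subseteq> carrier M" "good S h" by blast
    have z: "\<ominus>\<^bsub>N\<^esub> \<zero>\<^bsub>N\<^esub> = \<zero>\<^bsub>N\<^esub>" by (rule N.minus_equality) auto
    have "good S (- h)" unfolding good_def
    proof (intro allI impI, goal_cases)
      case (1 F k h')
      have "h' h = \<zero>\<^bsub>N\<^esub>" using S(3)[unfolded good_def, THEN spec, of F, THEN spec, of k, THEN spec, of h'] 1 by simp
      then show ?case using hneg[of h', OF _ hc] 1 z by simp
    qed
    then show ?case using S hc by (intro exI[of _ S]) simp
  next
    case (eng h1 h2)
    then obtain S1 S2 where S: "finite S1" "S1 \<subseteq> carrier M" "good S1 h1" "finite S2" "S2 \<subseteq> carrier M" "good S2 h2"
       "h1 \<in> carrier ?G" "h2 \<in> carrier ?G"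
      by blast
    have "good (S1 \<union> S2) (h1 + h2)" unfolding good_def
    proof (intro allI impI, goal_cases)
      case (1 F k h)
      have "h h1 = \<zero>\<^bsub>N\<^esub>" using S(3)[unfolded good_def, THEN spec, of F, THEN spec, of k, THEN spec, of h] 1 by simp
      moreover have "h h2 = \<zero>\<^bsub>N\<^esub>" using S(6)[unfolded good_def, THEN spec, of F, THEN spec, of k, THEN spec, of h] 1 by simp
      ultimately show ?case using hadd[of h h1 h2] 1 S(7,8) by simp
    qed
    then show ?case using S group.is_monoid[OF group_free_Abelian_group[of "carrier M \<times> carrier N"]]
      by (intro exI[of _ "S1 \<union> S2"]) (auto dest!: subsetD[OF keys_add])
  qed
  then show ?thesis unfolding good_def by blast
qed

lemma tensor_relations_finsum:
  assumes mods: "module R M" "module R N" and "finite C" "e \<in> C \<rightarrow> carrier M" "z \<in> carrier N"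
  shows "frag_of (finsum M e C, z) - (\<Sum>c\<in>C. frag_of (e c, z)) \<in> tensor_relations R M N"
  using assms(3,4)
proof (induction C rule: finite_induct)
  case empty
  interpret M: module R M by fact
  \<comment> \<open>The relation for \<open>0 + 0 = 0\<close> is the negative of the generator
    \<open>(0, z)\<close>.\<close>
  show ?case using tensor_relations_intros(1)[of "\<zero>\<^bsub>M\<^esub>" M "\<zero>\<^bsub>M\<^esub>" z N R] tensor_relations_closed(3)[OF mods] assms(5)
    by fastforce
next
  case (insert c C)
  interpret M: module R M by fact
  have "frag_of (finsum M e (insert c C), z) - (\<Sum>c\<in>insert c C. frag_of (e c, z)) =
     (frag_of (e c \<oplus>\<^bsub>M\<^esub> finsum M e C, z) - frag_of (e c, z) - frag_of (finsum M e C, z))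
     + (frag_of (finsum M e C, z) - (\<Sum>c\<in>C. frag_of (e c, z)))"
    using insert by simp
  also have "\<dots> \<in> tensor_relations R M N"
    using insert assms(5) by (intro tensor_relations_closed(2)[OF mods] tensor_relations_intros(1)) auto
  finally show ?case .
qed

text \<open>The inclusion of \<open>F\<close> factors through the free module on \<open>C\<close>:
  \<open>x\<close> goes to the coordinates \<open>k c x\<close>, the basis vector \<open>c\<close>
  to \<open>e c\<close>, which may lie outside \<open>F\<close>. If the image of a tensor in
  \<open>M \<otimes> N'\<close> vanishes, choose \<open>F\<close> large enough to contain the first
  entries of the tensor and of all relations that prove this. The coordinates then give
  \<open>0\<close> in \<open>N'\<close>, hence \<open>0\<close> in \<open>N\<close> by injectivity,
  and the tensor is the sum of the \<open>e c\<close> tensored with its coordinates.\<close>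

lemma flat_moduleI:
  fixes R :: "('r, 'x) ring_scheme" and M :: "('r, 'a) module"
  assumes "module R M"
    and dual_basis: "\<And>S. finite S \<Longrightarrow> S \<subseteq> carrier M \<Longrightarrow>
      \<exists>F (C :: 'k set) e k. S \<subseteq> F \<and> F \<subseteq> carrier M \<and> (\<forall>x\<in>F. \<forall>y\<in>F. x \<oplus>\<^bsub>M\<^esub> y \<in> F) \<and>
        (\<forall>r\<in>carrier R. \<forall>x\<in>F. r \<odot>\<^bsub>M\<^esub> x \<in> F) \<and> finite C \<and> e \<in> C \<rightarrow> carrier M \<and>
        (\<forall>c\<in>C. k c \<in> F \<rightarrow> carrier R \<and>
          (\<forall>x\<in>F. \<forall>y\<in>F. k c (x \<oplus>\<^bsub>M\<^esub> y) = k c x \<oplus>\<^bsub>R\<^esub> k c y) \<and>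
          (\<forall>r\<in>carrier R. \<forall>x\<in>F. k c (r \<odot>\<^bsub>M\<^esub> x) = r \<otimes>\<^bsub>R\<^esub> k c x)) \<and>
        (\<forall>x\<in>F. x = (\<Oplus>\<^bsub>M\<^esub>c\<in>C. k c x \<odot>\<^bsub>M\<^esub> e c))"
  shows "flat_module tb tc R M"
  unfolding flat_module_def
proof (intro conjI allI impI, fact, elim conjE)
  interpret M: module R M by fact
  fix N :: "('r, 'b) module" and N' :: "('r, 'c) module" and f
  assume N: "module R N" and N': "module R N'" and f: "f \<in> module_homs R N N'"
    and inj: "inj_on f (carrier N)"
  interpret N: module R N by fact
  interpret N': module R N' by fact
  note mods = \<open>module R M\<close> N N'
  let ?G = "free_Abelian_group (carrier M \<times> carrier N)"
  let ?G' = "free_Abelian_group (carrier M \<times> carrier N')"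
  let ?T = "tensor_relations R M N"
  let ?T' = "tensor_relations R M N'"
  let ?g = "frag_extend (\<lambda>(x, z). frag_of (x, f z))"
  have fc: "f z \<in> carrier N'" if "z \<in> carrier N" for z using f that by (auto simp: module_homs_def)
  have fadd: "f (x \<oplus>\<^bsub>N\<^esub> y) = f x \<oplus>\<^bsub>N'\<^esub> f y" if "x \<in> carrier N" "y \<in> carrier N" for x y
    using f that by (auto simp: module_homs_def)
  have fsm: "f (r \<odot>\<^bsub>N\<^esub> y) = r \<odot>\<^bsub>N'\<^esub> f y" if "r \<in> carrier R" "y \<in> carrier N" for r y
    using f that by (auto simp: module_homs_def)
  have fhom: "group_hom (add_monoid N) (add_monoid N') f"
    using N.a_group N'.a_group fc fadd
    by (auto simp: group_hom_def group_hom_axioms_def hom_def)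
  have fdiff: "f (x \<ominus>\<^bsub>N\<^esub> y) = f x \<ominus>\<^bsub>N'\<^esub> f y" if "x \<in> carrier N" "y \<in> carrier N" for x y
    using that group_hom.hom_inv[OF fhom, of y] fc by (simp add: a_minus_def fadd a_inv_def)
  have f0: "f \<zero>\<^bsub>N\<^esub> = \<zero>\<^bsub>N'\<^esub>" using group_hom.hom_one[OF fhom] by simp
  have main: "a \<in> ?T" if a: "a \<in> carrier ?G" and ga: "?g a \<in> ?T'" for a
  proof -
    from tensor_relations_finite_support[OF mods(1,3) ga] obtain S where
      S: "finite S" "S \<subseteq> carrier M" and
      good0: "\<forall>F k h. S \<subseteq> F \<and> F \<subseteq> carrier M \<and> (\<forall>x\<in>F. \<forall>y\<in>F. x \<oplus>\<^bsub>M\<^esub> y \<in> F) \<and>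
        (\<forall>r\<in>carrier R. \<forall>x\<in>F. r \<odot>\<^bsub>M\<^esub> x \<in> F) \<and> k \<in> F \<rightarrow> carrier R \<and>
        (\<forall>x\<in>F. \<forall>y\<in>F. k (x \<oplus>\<^bsub>M\<^esub> y) = k x \<oplus>\<^bsub>R\<^esub> k y) \<and>
        (\<forall>r\<in>carrier R. \<forall>x\<in>F. k (r \<odot>\<^bsub>M\<^esub> x) = r \<otimes>\<^bsub>R\<^esub> k x) \<and>
        h \<in> hom ?G' (add_monoid N') \<and>
        (\<forall>x\<in>F. \<forall>z\<in>carrier N'. h (frag_of (x, z)) = k x \<odot>\<^bsub>N'\<^esub> z) \<longrightarrow> h (?g a) = \<zero>\<^bsub>N'\<^esub>"
      by (elim exE conjE) (rule that)
    \<comment> \<open>\<open>S\<close> makes the functionals kill the relation; the first entries of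
      \<open>a\<close> are added so that \<open>a\<close> itself can be expanded.\<close>
    have "finite (S \<union> fst ` keys a)" "S \<union> fst ` keys a \<subseteq> carrier M"
      using S a by auto
    from dual_basis[OF this] obtain F C e k where
      F: "S \<union> fst ` keys a \<subseteq> F" "F \<subseteq> carrier M" "\<forall>x\<in>F. \<forall>y\<in>F. x \<oplus>\<^bsub>M\<^esub> y \<in> F"
        "\<forall>r\<in>carrier R. \<forall>x\<in>F. r \<odot>\<^bsub>M\<^esub> x \<in> F" and C: "finite (C :: 'k set)" "e \<in> C \<rightarrow> carrier M" and
      k0: "\<forall>c\<in>C. k c \<in> F \<rightarrow> carrier R \<and>
          (\<forall>x\<in>F. \<forall>y\<in>F. k c (x \<oplus>\<^bsub>M\<^esub> y) = k c x \<oplus>\<^bsub>R\<^esub> k c y) \<and>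
          (\<forall>r\<in>carrier R. \<forall>x\<in>F. k c (r \<odot>\<^bsub>M\<^esub> x) = r \<otimes>\<^bsub>R\<^esub> k c x)" and
      ex0: "\<forall>x\<in>F. x = (\<Oplus>\<^bsub>M\<^esub>c\<in>C. k c x \<odot>\<^bsub>M\<^esub> e c)"
      by (elim exE conjE) (rule that)
    note k = bspec[OF k0, THEN conjunct1] bspec[OF k0, THEN conjunct2, THEN conjunct1]
      bspec[OF k0, THEN conjunct2, THEN conjunct2]
    note ex = bspec[OF ex0]
    have kc: "k c x \<in> carrier R" if "c \<in> C" "x \<in> F" for c x using k(1) that by auto
    have "\<exists>h. h \<in> hom ?G (add_monoid N) \<and> (\<forall>x\<in>F. \<forall>z\<in>carrier N. h (frag_of (x, z)) = k c x \<odot>\<^bsub>N\<^esub> z)"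
      if "c \<in> C" for c
    proof -
      \<comment> \<open>The universal property wants a value on every pair; outside
        \<open>F\<close>, where \<open>k c\<close> is not linear, zero is taken as a
        default.\<close>
      have "(\<lambda>(x, z). if x \<in> F then k c x \<odot>\<^bsub>N\<^esub> z else \<zero>\<^bsub>N\<^esub>) ` (carrier M \<times> carrier N)
        \<subseteq> carrier (add_monoid N)" using kc[OF that] by auto
      then obtain h where "h \<in> hom ?G (add_monoid N)"
        "\<And>x. x \<in> carrier M \<times> carrier N \<Longrightarrow> h (frag_of x) = (\<lambda>(x, z). if x \<in> F then k c x \<odot>\<^bsub>N\<^esub> z else \<zero>\<^bsub>N\<^esub>) x"
        by (rule comm_group.free_Abelian_group_universal[OF N.a_comm_group]) (rule that)
      then show ?thesis using F(2) by (intro exI[of _ h]) auto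
    qed
    then have "\<forall>c\<in>C. \<exists>h. h \<in> hom ?G (add_monoid N) \<and>
       (\<forall>x\<in>F. \<forall>z\<in>carrier N. h (frag_of (x, z)) = k c x \<odot>\<^bsub>N\<^esub> z)" by blast
    then obtain h where h0: "\<forall>c\<in>C. h c \<in> hom ?G (add_monoid N) \<and>
       (\<forall>x\<in>F. \<forall>z\<in>carrier N. h c (frag_of (x, z)) = k c x \<odot>\<^bsub>N\<^esub> z)" by (rule bchoice[elim_format]) blast
    have h: "c \<in> C \<Longrightarrow> h c \<in> hom ?G (add_monoid N)"
      "c \<in> C \<Longrightarrow> x \<in> F \<Longrightarrow> z \<in> carrier N \<Longrightarrow> h c (frag_of (x, z)) = k c x \<odot>\<^bsub>N\<^esub> z" for c x z
      using h0 by blast+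
    have "\<exists>h. h \<in> hom ?G' (add_monoid N') \<and> (\<forall>x\<in>F. \<forall>z\<in>carrier N'. h (frag_of (x, z)) = k c x \<odot>\<^bsub>N'\<^esub> z)"
      if "c \<in> C" for c
    proof -
      have "(\<lambda>(x, z). if x \<in> F then k c x \<odot>\<^bsub>N'\<^esub> z else \<zero>\<^bsub>N'\<^esub>) ` (carrier M \<times> carrier N')
        \<subseteq> carrier (add_monoid N')" using kc[OF that] by auto
      then obtain h where "h \<in> hom ?G' (add_monoid N')"
        "\<And>x. x \<in> carrier M \<times> carrier N' \<Longrightarrow> h (frag_of x) = (\<lambda>(x, z). if x \<in> F then k c x \<odot>\<^bsub>N'\<^esub> z else \<zero>\<^bsub>N'\<^esub>) x"
        by (rule comm_group.free_Abelian_group_universal[OF N'.a_comm_group]) (rule that)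
      then show ?thesis using F(2) by (intro exI[of _ h]) auto
    qed
    then have "\<forall>c\<in>C. \<exists>h. h \<in> hom ?G' (add_monoid N') \<and>
       (\<forall>x\<in>F. \<forall>z\<in>carrier N'. h (frag_of (x, z)) = k c x \<odot>\<^bsub>N'\<^esub> z)" by blast
    then obtain h' where h'0: "\<forall>c\<in>C. h' c \<in> hom ?G' (add_monoid N') \<and>
       (\<forall>x\<in>F. \<forall>z\<in>carrier N'. h' c (frag_of (x, z)) = k c x \<odot>\<^bsub>N'\<^esub> z)" by (rule bchoice[elim_format]) blast
    have h': "c \<in> C \<Longrightarrow> h' c \<in> hom ?G' (add_monoid N')"
      "c \<in> C \<Longrightarrow> x \<in> F \<Longrightarrow> z \<in> carrier N' \<Longrightarrow> h' c (frag_of (x, z)) = k c x \<odot>\<^bsub>N'\<^esub> z" for c x z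
      using h'0 by blast+
    have sub: "keys a \<subseteq> F \<times> carrier N" using F(1) a by auto
    have hdiff: "h c (b - b') = h c b \<ominus>\<^bsub>N\<^esub> h c b'"
      if "c \<in> C" "b \<in> carrier ?G" "b' \<in> carrier ?G" for c b b'
    proof -
      have gh: "group_hom ?G (add_monoid N) (h c)"
        using h(1)[OF that(1)] N.a_group by (simp add: group_hom_def group_hom_axioms_def)
      have "h c (b + - b') = h c b \<oplus>\<^bsub>N\<^esub> h c (- b')"
        using hom_mult[OF h(1)[OF that(1)], of b "- b'"] that by simp
      then show ?thesis using group_hom.hom_inv[OF gh, of b'] that by (simp add: a_minus_def a_inv_def)
    qed
    have hdiff': "h' c (b - b') = h' c b \<ominus>\<^bsub>N'\<^esub> h' c b'"
      if "c \<in> C" "b \<in> carrier ?G'" "b' \<in> carrier ?G'" for c b b'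
    proof -
      have gh: "group_hom ?G' (add_monoid N') (h' c)"
        using h'(1)[OF that(1)] N'.a_group by (simp add: group_hom_def group_hom_axioms_def)
      have "h' c (b + - b') = h' c b \<oplus>\<^bsub>N'\<^esub> h' c (- b')"
        using hom_mult[OF h'(1)[OF that(1)], of b "- b'"] that by simp
      then show ?thesis using group_hom.hom_inv[OF gh, of b'] that by (simp add: a_minus_def a_inv_def)
    qed
    have hcl: "h c b \<in> carrier N" if "c \<in> C" "b \<in> carrier ?G" for c b
      using hom_in_carrier[OF h(1)[OF that(1)]] that(2) by auto
    have h0: "h c 0 = \<zero>\<^bsub>N\<^esub>" if "c \<in> C" for c
      using hdiff[OF that, of 0 0] hcl[OF that, of 0] by (simp add: N.r_neg a_minus_def)
    have h'0: "h' c 0 = \<zero>\<^bsub>N'\<^esub>" if "c \<in> C" for c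
      using hdiff'[OF that, of 0 0] hom_in_carrier[OF h'(1)[OF that], of 0] by (simp add: N'.r_neg a_minus_def)
    have gcar: "?g b \<in> carrier ?G'" if "keys b \<subseteq> F \<times> carrier N" for b
    proof -
      have "q \<in> carrier M \<times> carrier N'" if q: "q \<in> keys (?g b)" for q
      proof -
        obtain p where p: "p \<in> keys b" "q \<in> keys (case p of (x, z) \<Rightarrow> frag_of (x, f z))"
          using subsetD[OF keys_frag_extend q] by blast
        then have "q = (fst p, f (snd p))" by (auto simp: keys_frag_of split: prod.splits)
        moreover have "fst p \<in> F" "snd p \<in> carrier N" using p(1) \<open>keys b \<subseteq> _\<close> by auto
        ultimately show ?thesis using fc F(2) by auto
      qed
      then show ?thesis by auto
    qed
    have car: "b \<in> carrier ?G" if "keys b \<subseteq> F \<times> carrier N" for b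
      using that F(2) by auto
    have 1: "h' c (?g b) = f (h c b)" if "c \<in> C" "keys b \<subseteq> F \<times> carrier N" for c b
    proof -
      have "keys b \<subseteq> F \<times> carrier N \<and> h' c (?g b) = f (h c b)" using that(2)
      proof (induction b rule: frag_induction)
        case zero then show ?case using h0 h'0 f0 that by simp
      next
        case (one x) then show ?case using h h' fc fsm that kc
          by (auto simp: keys_frag_of)
      next
        case (diff a b)
        then have "keys (a - b) \<subseteq> F \<times> carrier N"
          using keys_diff[of a b] by blast
        then show ?case using diff hcl[OF that(1)] car gcar
          by (simp only: frag_extend_diff hdiff hdiff' that fdiff)
      qed
      then show ?thesis by simp
    qed
    \<comment> \<open>The expansion of \<open>x\<close> by means of \<open>k c x\<close> and
      \<open>e c\<close>, tensored with \<open>N\<close>; it holds modulo the relations, by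
      induction over chains.\<close>
    have 2: "b - (\<Sum>c\<in>C. frag_of (e c, h c b)) \<in> ?T" if "keys b \<subseteq> F \<times> carrier N" for b
    proof -
      have "keys b \<subseteq> F \<times> carrier N \<and> b - (\<Sum>c\<in>C. frag_of (e c, h c b)) \<in> ?T" using that
      proof (induction b rule: frag_induction)
        case zero
        have "- (\<Sum>c\<in>C. frag_of (e c, h c 0)) \<in> ?T"
        proof -
          have "- frag_of (e c, \<zero>\<^bsub>N\<^esub>) \<in> ?T" if "c \<in> C" for c
            using tensor_relations_intros(2)[of "e c" M "\<zero>\<^bsub>N\<^esub>" N "\<zero>\<^bsub>N\<^esub>" R] C(2) that by auto
          then have "(\<Sum>c\<in>C. - frag_of (e c, \<zero>\<^bsub>N\<^esub>)) \<in> ?T"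
            by (rule tensor_relations_sum[OF mods(1,2)])
          then show ?thesis using h0 by (simp add: sum_negf)
        qed
        then show ?case by simp
      next
        case (one x)
        then obtain m z where x: "x = (m, z)" "m \<in> F" "z \<in> carrier N" by auto
        have e': "(\<lambda>c. k c m \<odot>\<^bsub>M\<^esub> e c) \<in> C \<rightarrow> carrier M" using C kc x by auto
        have A: "frag_of (m, z) - (\<Sum>c\<in>C. frag_of (k c m \<odot>\<^bsub>M\<^esub> e c, z)) \<in> ?T"
          using tensor_relations_finsum[OF mods(1,2) C(1) e' x(3)] ex[OF x(2)] by simp
        have "frag_of (k c m \<odot>\<^bsub>M\<^esub> e c, z) - frag_of (e c, k c m \<odot>\<^bsub>N\<^esub> z) \<in> ?T" if "c \<in> C" for c
          using that C kc x by (intro tensor_relations_intros(3)) auto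
        then have "(\<Sum>c\<in>C. frag_of (k c m \<odot>\<^bsub>M\<^esub> e c, z) - frag_of (e c, k c m \<odot>\<^bsub>N\<^esub> z)) \<in> ?T"
          by (rule tensor_relations_sum[OF mods(1,2)])
        from tensor_relations_closed(2)[OF mods(1,2) A this]
        have "frag_of (m, z) - (\<Sum>c\<in>C. frag_of (e c, k c m \<odot>\<^bsub>N\<^esub> z)) \<in> ?T"
          by (simp add: sum_subtractf algebra_simps)
        then show ?case using x h by (simp add: keys_frag_of)
      next
        case (diff a b)
        have ab: "keys (a - b) \<subseteq> F \<times> carrier N" using diff keys_diff[of a b] by blast
        have "frag_of (e c, h c a) - frag_of (e c, h c b) - frag_of (e c, h c (a - b)) \<in> ?T" if "c \<in> C" for c
        proof -
          have c1: "h c a \<in> carrier N" "h c b \<in> carrier N" "h c (a - b) \<in> carrier N"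
            using diff ab hcl[OF that] car by auto
          have "h c b \<oplus>\<^bsub>N\<^esub> h c (a - b) = h c a"
          proof -
            have "h c (a - b) = h c a \<ominus>\<^bsub>N\<^esub> h c b"
              using diff by (intro hdiff[OF that] car) auto
            then show ?thesis using c1 by (simp add: a_minus_def N.a_ac N.r_neg N.r_neg1 N.r_neg2)
          qed
          then show ?thesis using tensor_relations_intros(2)[of "e c" M "h c b" N "h c (a - b)" R] c1 C(2) that
            by auto
        qed
        then have "(\<Sum>c\<in>C. frag_of (e c, h c a) - frag_of (e c, h c b) - frag_of (e c, h c (a - b))) \<in> ?T"
          by (rule tensor_relations_sum[OF mods(1,2)])
        from tensor_relations_closed(2)[OF mods(1,2) tensor_relations_closed(4)[OF mods(1,2) conjunct2[OF diff.IH(1)] conjunct2[OF diff.IH(2)]] this]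
        show ?case using ab by (simp add: sum_subtractf sum.distrib algebra_simps)
      qed
      then show ?thesis by simp
    qed
    have h_a: "h c a = \<zero>\<^bsub>N\<^esub>" if "c \<in> C" for c
    proof -
      have "h' c (?g a) = \<zero>\<^bsub>N'\<^esub>"
        by (rule good0[THEN spec, THEN spec, THEN spec, THEN mp, of F "k c"])
          (use F k[OF that] h'(1)[OF that] h'(2)[OF that] in \<open>intro conjI; simp\<close>)
      then have "f (h c a) = f \<zero>\<^bsub>N\<^esub>" using 1[OF that sub] f0 by simp
      then show ?thesis using inj hcl[OF that car[OF sub]] by (auto dest: inj_onD)
    qed
    have "frag_of (e c, \<zero>\<^bsub>N\<^esub>) \<in> ?T" if "c \<in> C" for c
      using tensor_relations_closed(3)[OF mods(1,2) tensor_relations_intros(2)[of "e c" M "\<zero>\<^bsub>N\<^esub>" N "\<zero>\<^bsub>N\<^esub>" R]] C(2) that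
      by auto
    then have "(\<Sum>c\<in>C. frag_of (e c, h c a)) \<in> ?T"
      by (intro tensor_relations_sum[OF mods(1,2)]) (simp add: h_a)
    from tensor_relations_closed(2)[OF mods(1,2) 2[OF sub] this] show ?thesis by simp
  qed
  show "inj_on (tensor_map R M N' f) (carrier (tensor_product R M N))"
  proof (rule inj_onI)
    fix X Y assume X: "X \<in> carrier (tensor_product R M N)" and Y: "Y \<in> carrier (tensor_product R M N)"
      and eq: "tensor_map R M N' f X = tensor_map R M N' f Y"
    from X obtain a where a: "a \<in> carrier ?G" "X = ?T #>\<^bsub>?G\<^esub> a"
      unfolding tensor_product_def FactGroup_def RCOSETS_def by auto
    from Y obtain b where b: "b \<in> carrier ?G" "Y = ?T #>\<^bsub>?G\<^esub> b"
      unfolding tensor_product_def FactGroup_def RCOSETS_def by auto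
    have "?g (a - b) \<in> ?T'"
      using eq by (simp add: a(2) b(2) tensor_map_coset[OF mods f] tensor_coset_eq_iff[OF mods(1,3)] frag_extend_diff)
    moreover have "a - b \<in> carrier ?G" using a(1) b(1) keys_diff[of a b] by auto
    ultimately have "a - b \<in> ?T" by (rule main[rotated])
    then show "X = Y" by (simp add: a(2) b(2) tensor_coset_eq_iff[OF mods(1,2)])
  qed
qed

subsection \<open>Flat morphisms of spectra\<close>

definition subring_closed :: "'a::comm_ring_1 set \<Rightarrow> bool" where
  "subring_closed S \<longleftrightarrow> 1 \<in> S \<and> (\<forall>a\<in>S. \<forall>b\<in>S. a + b \<in> S \<and> a * b \<in> S) \<and> (\<forall>a\<in>S. - a \<in> S)"

lemma subring_closedD:
  assumes "subring_closed S"
  shows "1 \<in> S" "0 \<in> S" "a \<in> S \<Longrightarrow> b \<in> S \<Longrightarrow> a + b \<in> S" "a \<in> S \<Longrightarrow> b \<in> S \<Longrightarrow> a * b \<in> S"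
    "a \<in> S \<Longrightarrow> - a \<in> S" "a \<in> S \<Longrightarrow> b \<in> S \<Longrightarrow> a - b \<in> S"
    "(\<And>i. i \<in> I \<Longrightarrow> f i \<in> S) \<Longrightarrow> sum f I \<in> S" "(\<And>i. i \<in> I \<Longrightarrow> f i \<in> S) \<Longrightarrow> prod f I \<in> S"
proof -
  have one: "1 \<in> S" and add: "a + b \<in> S" and mult: "a * b \<in> S" and neg: "- a \<in> S"
    if "a \<in> S" "b \<in> S" for a b
    using assms that unfolding subring_closed_def by blast+
  show o: "1 \<in> S" using assms unfolding subring_closed_def by blast
  show z: "0 \<in> S" using add[OF o neg[OF o o]] by simp
  show "a + b \<in> S" "a * b \<in> S" "a - b \<in> S" if "a \<in> S" "b \<in> S"
    using add[OF that] mult[OF that] neg[OF that] add[OF that(1) neg[OF that(2) that(2)]] by auto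
  show "- a \<in> S" if "a \<in> S" using neg[OF that that] .
  show "sum f I \<in> S" if "\<And>i. i \<in> I \<Longrightarrow> f i \<in> S" using that
    by (induction I rule: infinite_finite_induct) (auto simp: z add)
  show "prod f I \<in> S" if "\<And>i. i \<in> I \<Longrightarrow> f i \<in> S" using that
    by (induction I rule: infinite_finite_induct) (auto simp: o mult)
qed

lemma subring_of_simps [simp]:
  "carrier (subring_of S) = S" "a \<otimes>\<^bsub>subring_of S\<^esub> b = a * b" "a \<oplus>\<^bsub>subring_of S\<^esub> b = a + b"
  "\<one>\<^bsub>subring_of S\<^esub> = 1" "\<zero>\<^bsub>subring_of S\<^esub> = 0"
  by (simp_all add: subring_of_def)

lemma cring_subring_of:
  assumes "subring_closed S"
  shows "cring (subring_of S)"
proof (rule cringI)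
  note S = subring_closedD[OF assms]
  show "abelian_group (subring_of S)"
    by (rule abelian_groupI) (auto simp: algebra_simps S intro!: bexI[of _ "- _"])
  show "comm_monoid (subring_of S)"
    by (rule comm_monoidI) (auto simp: algebra_simps S)
qed (auto simp: algebra_simps)

lemma a_inv_subring_of:
  assumes "subring_closed S" "a \<in> S"
  shows "\<ominus>\<^bsub>subring_of S\<^esub> a = - a"
proof -
  interpret cring "subring_of S" by (rule cring_subring_of) fact
  show ?thesis by (rule minus_equality) (auto simp: assms subring_closedD(5)[OF assms(1)])
qed

lemma a_minus_subring_of:
  assumes "subring_closed S" "a \<in> S" "b \<in> S"
  shows "a \<ominus>\<^bsub>subring_of S\<^esub> b = a - b"
  using assms by (simp add: a_minus_def a_inv_subring_of)

text \<open>Of primality the multiplicativity of the complement is kept, so that the contraction of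
  a prime to the base ring qualifies without being shown to be a prime ideal.\<close>

locale prime_complement =
  fixes S :: "'a::idom set" and p :: "'a set"
  assumes subring: "subring_closed S"
    and zero: "0 \<in> p" and one: "1 \<notin> p"
    and mult: "s \<in> S - p \<Longrightarrow> t \<in> S - p \<Longrightarrow> s * t \<in> S - p"
begin

lemmas S = subring_closedD[OF subring]

lemma one_in: "1 \<in> S - p"
  using one S by auto

lemma nz: "s \<in> S - p \<Longrightarrow> s \<noteq> 0"
  using zero by auto

text \<open>In a domain the auxiliary factor \<open>w\<close> of \<open>pfrac\<close> can be
  cancelled, which leaves plain cross-multiplication.\<close>

lemma pfrac_eq: "a \<in> S \<Longrightarrow> s \<in> S - p \<Longrightarrow>
    pfrac (subring_of S) p a s = {(b, t). b \<in> S \<and> t \<in> S - p \<and> a * t = b * s}"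
  unfolding pfrac_def using one_in nz
  by (auto simp: a_minus_subring_of[OF subring] S intro!: bexI[of _ 1])

lemma pfrac_eq_iff:
  assumes "a \<in> S" "s \<in> S - p" "b \<in> S" "t \<in> S - p"
  shows "pfrac (subring_of S) p a s = pfrac (subring_of S) p b t \<longleftrightarrow> a * t = b * s"
proof
  assume "pfrac (subring_of S) p a s = pfrac (subring_of S) p b t"
  moreover have "(b, t) \<in> pfrac (subring_of S) p b t" using assms by (simp add: pfrac_eq)
  ultimately have "(b, t) \<in> pfrac (subring_of S) p a s" by simp
  then show "a * t = b * s" using assms by (simp add: pfrac_eq)
next
  assume eq: "a * t = b * s"
  have "a * v = c * s \<longleftrightarrow> b * v = c * t" for c v
  proof -
    have "a * v = c * s \<longleftrightarrow> (a * t) * v = c * s * t" using nz[OF assms(4)] by (simp add: mult_ac)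
    also have "\<dots> \<longleftrightarrow> b * v = c * t" unfolding eq using nz[OF assms(2)] by (simp add: mult_ac)
    finally show ?thesis .
  qed
  then show "pfrac (subring_of S) p a s = pfrac (subring_of S) p b t"
    using assms by (simp add: pfrac_eq)
qed

abbreviation "L \<equiv> localization (subring_of S) p"
abbreviation "fr \<equiv> pfrac (subring_of S) p"

lemma mem_pfrac: "a \<in> S \<Longrightarrow> s \<in> S - p \<Longrightarrow> (a, s) \<in> fr a s"
  by (simp add: pfrac_eq)

text \<open>The operations of \<open>localization\<close> are unions over all representatives of
  their arguments; when the members do not depend on the representative, the union equals any one of
  them.\<close>

lemma pfrac_UN:
  assumes "a \<in> S" "s \<in> S - p" "\<And>b t. b \<in> S \<Longrightarrow> t \<in> S - p \<Longrightarrow> a * t = b * s \<Longrightarrow> f b t = f a s"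
  shows "(\<Union>(b, t)\<in>fr a s. f b t) = f a s"
proof (intro equalityI UN_least)
  fix z assume "z \<in> fr a s"
  then have "fst z \<in> S" "snd z \<in> S - p" "a * snd z = fst z * s" using pfrac_eq[OF assms(1,2)] by auto
  then have "f (fst z) (snd z) = f a s" by (rule assms(3))
  then show "(case z of (b, t) \<Rightarrow> f b t) \<subseteq> f a s" by (simp add: split_beta)
next
  show "f a s \<subseteq> (\<Union>(b, t)\<in>fr a s. f b t)"
    using UN_upper[OF mem_pfrac[OF assms(1,2)], of "\<lambda>(b, t). f b t"] by simp
qed

lemma carrier_L: "carrier L = {fr a s | a s. a \<in> S \<and> s \<in> S - p}"
  by (simp add: localization_def)

lemma fr_in_L [simp]: "a \<in> S \<Longrightarrow> s \<in> S - p \<Longrightarrow> fr a s \<in> carrier L"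
  by (auto simp: carrier_L)

lemma L_cases:
  assumes "x \<in> carrier L"
  obtains a s where "a \<in> S" "s \<in> S - p" "x = fr a s"
  using assms by (auto simp: carrier_L)

lemma one_L: "\<one>\<^bsub>L\<^esub> = fr 1 1" and zero_L: "\<zero>\<^bsub>L\<^esub> = fr 0 1"
  by (simp_all add: localization_def)

lemma mult_L:
  assumes "a \<in> S" "s \<in> S - p" "b \<in> S" "t \<in> S - p"
  shows "fr a s \<otimes>\<^bsub>L\<^esub> fr b t = fr (a * b) (s * t)"
proof -
  have 1: "(\<Union>(b', t')\<in>fr b t. fr (a' * b') (s' * t')) = fr (a' * b) (s' * t)" if "a' \<in> S" "s' \<in> S - p" for a' s'
  proof (rule pfrac_UN[OF assms(3,4), of "\<lambda>b' t'. fr (a' * b') (s' * t')"])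
    fix b' t' assume *: "b' \<in> S" "t' \<in> S - p" "b * t' = b' * t"
    have "a' * b' * (s' * t) = a' * s' * (b' * t)" by (simp add: mult_ac)
    also have "\<dots> = a' * b * (s' * t')" unfolding *(3)[symmetric] by (simp add: mult_ac)
    finally show "fr (a' * b') (s' * t') = fr (a' * b) (s' * t)"
      using assms that *(1,2) S(4) mult by (intro pfrac_eq_iff[THEN iffD2]) blast+
  qed
  have "fr a s \<otimes>\<^bsub>L\<^esub> fr b t = (\<Union>(a', s')\<in>fr a s. \<Union>(b', t')\<in>fr b t. fr (a' * b') (s' * t'))"
    by (simp add: localization_def)
  also have "\<dots> = (\<Union>(a', s')\<in>fr a s. fr (a' * b) (s' * t))"
  proof (rule SUP_cong[OF refl])
    fix z assume "z \<in> fr a s"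
    then have "fst z \<in> S" "snd z \<in> S - p" using pfrac_eq[OF assms(1,2)] by auto
    from 1[OF this] show "(case z of (a', s') \<Rightarrow> \<Union>(b', t')\<in>fr b t. fr (a' * b') (s' * t')) = (case z of (a', s') \<Rightarrow> fr (a' * b) (s' * t))"
      by (simp only: split_beta)
  qed
  also have "\<dots> = fr (a * b) (s * t)"
  proof (rule pfrac_UN[OF assms(1,2), of "\<lambda>a' s'. fr (a' * b) (s' * t)"])
    fix a' s' assume *: "a' \<in> S" "s' \<in> S - p" "a * s' = a' * s"
    have "a' * b * (s * t) = b * t * (a' * s)" by (simp add: mult_ac)
    also have "\<dots> = a * b * (s' * t)" unfolding *(3)[symmetric] by (simp add: mult_ac)
    finally show "fr (a' * b) (s' * t) = fr (a * b) (s * t)"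
      using assms *(1,2) S(4) mult by (intro pfrac_eq_iff[THEN iffD2]) blast+
  qed
  finally show ?thesis .
qed

lemma add_L:
  assumes "a \<in> S" "s \<in> S - p" "b \<in> S" "t \<in> S - p"
  shows "fr a s \<oplus>\<^bsub>L\<^esub> fr b t = fr (a * t + b * s) (s * t)"
proof -
  have 1: "(\<Union>(b', t')\<in>fr b t. fr (a' * t' + b' * s') (s' * t')) = fr (a' * t + b * s') (s' * t)"
    if "a' \<in> S" "s' \<in> S - p" for a' s'
  proof (rule pfrac_UN[OF assms(3,4), of "\<lambda>b' t'. fr (a' * t' + b' * s') (s' * t')"])
    fix b' t' assume *: "b' \<in> S" "t' \<in> S - p" "b * t' = b' * t"
    have "(a' * t' + b' * s') * (s' * t) = (a' * t + b * s') * (s' * t')"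
    proof -
      have "(a' * t' + b' * s') * (s' * t) = a' * t' * (s' * t) + s' * s' * (b' * t)"
        by (simp add: algebra_simps)
      also have "\<dots> = (a' * t + b * s') * (s' * t')"
        unfolding *(3)[symmetric] by (simp add: algebra_simps)
      finally show ?thesis .
    qed
    then show "fr (a' * t' + b' * s') (s' * t') = fr (a' * t + b * s') (s' * t)"
    proof (rule pfrac_eq_iff[THEN iffD2, rotated 4])
      show "a' * t' + b' * s' \<in> S" "a' * t + b * s' \<in> S" using assms that *(1,2) by (auto intro!: S(3,4))
      show "s' * t' \<in> S - p" "s' * t \<in> S - p" using assms that *(1,2) mult by blast+
    qed
  qed
  have "fr a s \<oplus>\<^bsub>L\<^esub> fr b t = (\<Union>(a', s')\<in>fr a s. \<Union>(b', t')\<in>fr b t. fr (a' * t' + b' * s') (s' * t'))"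
    by (simp add: localization_def)
  also have "\<dots> = (\<Union>(a', s')\<in>fr a s. fr (a' * t + b * s') (s' * t))"
  proof (rule SUP_cong[OF refl])
    fix z assume "z \<in> fr a s"
    then have "fst z \<in> S" "snd z \<in> S - p" using pfrac_eq[OF assms(1,2)] by auto
    from 1[OF this] show "(case z of (a', s') \<Rightarrow> \<Union>(b', t')\<in>fr b t. fr (a' * t' + b' * s') (s' * t')) = (case z of (a', s') \<Rightarrow> fr (a' * t + b * s') (s' * t))"
      by (simp only: split_beta)
  qed
  also have "\<dots> = fr (a * t + b * s) (s * t)"
  proof (rule pfrac_UN[OF assms(1,2), of "\<lambda>a' s'. fr (a' * t + b * s') (s' * t)"])
    fix b' t' assume *: "b' \<in> S" "t' \<in> S - p" "a * t' = b' * s"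
    have "(b' * t + b * t') * (s * t) = (a * t + b * s) * (t' * t)"
    proof -
      have "(b' * t + b * t') * (s * t) = t * t * (b' * s) + b * t' * (s * t)"
        by (simp add: algebra_simps)
      also have "\<dots> = (a * t + b * s) * (t' * t)"
        unfolding *(3)[symmetric] by (simp add: algebra_simps)
      finally show ?thesis .
    qed
    then show "fr (b' * t + b * t') (t' * t) = fr (a * t + b * s) (s * t)"
    proof (rule pfrac_eq_iff[THEN iffD2, rotated 4])
      show "b' * t + b * t' \<in> S" "a * t + b * s \<in> S" using assms *(1,2) by (auto intro!: S(3,4))
      show "t' * t \<in> S - p" "s * t \<in> S - p" using assms *(1,2) mult by blast+
    qed
  qed
  finally show ?thesis .
qed

lemma add_L_same:
  assumes "a \<in> S" "s \<in> S - p" "b \<in> S"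
  shows "fr a s \<oplus>\<^bsub>L\<^esub> fr b s = fr (a + b) s"
  using assms mult[of s s] by (subst add_L) (auto simp: pfrac_eq_iff S algebra_simps)

lemma mult': "s \<in> S \<Longrightarrow> s \<notin> p \<Longrightarrow> t \<in> S \<Longrightarrow> t \<notin> p \<Longrightarrow> s * t \<in> S"
  "s \<in> S \<Longrightarrow> s \<notin> p \<Longrightarrow> t \<in> S \<Longrightarrow> t \<notin> p \<Longrightarrow> s * t \<notin> p" "1 \<in> S" "1 \<notin> p"
  using mult[of s t] one_in by auto

lemma cring_L: "cring L"
proof (rule cringI)
  note [simp] = mult' one_L zero_L mult_L add_L S(2,3,5)
  have [simp]: "a * b \<in> S" if "a \<in> S" "b \<in> S" for a b using S(4) that .
  note eqI = pfrac_eq_iff[THEN iffD2]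
  show "abelian_group L"
  proof (rule abelian_groupI)
    fix x assume "x \<in> carrier L"
    then obtain a s where x: "a \<in> S" "s \<in> S - p" "x = fr a s" by (rule L_cases)
    then show "\<zero>\<^bsub>L\<^esub> \<oplus>\<^bsub>L\<^esub> x = x" by simp
    have "fr (- a) s \<oplus>\<^bsub>L\<^esub> x = \<zero>\<^bsub>L\<^esub>" using x by (simp, intro eqI) (simp_all add: mult_ac)
    moreover have "fr (- a) s \<in> carrier L" using x by simp
    ultimately show "\<exists>y\<in>carrier L. y \<oplus>\<^bsub>L\<^esub> x = \<zero>\<^bsub>L\<^esub>" by blast
    fix y assume "y \<in> carrier L"
    then obtain b t where y: "b \<in> S" "t \<in> S - p" "y = fr b t" by (rule L_cases)
    show "x \<oplus>\<^bsub>L\<^esub> y \<in> carrier L" using x y by simp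
    show "x \<oplus>\<^bsub>L\<^esub> y = y \<oplus>\<^bsub>L\<^esub> x" using x y by (simp, intro eqI) (simp_all add: algebra_simps)
    fix z assume "z \<in> carrier L"
    then obtain c u where z: "c \<in> S" "u \<in> S - p" "z = fr c u" by (rule L_cases)
    show "x \<oplus>\<^bsub>L\<^esub> y \<oplus>\<^bsub>L\<^esub> z = x \<oplus>\<^bsub>L\<^esub> (y \<oplus>\<^bsub>L\<^esub> z)"
      using x y z by (simp, intro eqI) (simp_all add: algebra_simps)
  qed simp
  show "comm_monoid L"
  proof (rule comm_monoidI)
    fix x assume "x \<in> carrier L"
    then obtain a s where x: "a \<in> S" "s \<in> S - p" "x = fr a s" by (rule L_cases)
    then show "\<one>\<^bsub>L\<^esub> \<otimes>\<^bsub>L\<^esub> x = x" by simp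
    fix y assume "y \<in> carrier L"
    then obtain b t where y: "b \<in> S" "t \<in> S - p" "y = fr b t" by (rule L_cases)
    show "x \<otimes>\<^bsub>L\<^esub> y \<in> carrier L" using x y by simp
    show "x \<otimes>\<^bsub>L\<^esub> y = y \<otimes>\<^bsub>L\<^esub> x" using x y by (simp add: mult.commute)
    fix z assume "z \<in> carrier L"
    then obtain c u where z: "c \<in> S" "u \<in> S - p" "z = fr c u" by (rule L_cases)
    show "x \<otimes>\<^bsub>L\<^esub> y \<otimes>\<^bsub>L\<^esub> z = x \<otimes>\<^bsub>L\<^esub> (y \<otimes>\<^bsub>L\<^esub> z)"
      using x y z by (simp add: mult.assoc)
  qed simp
  fix x y z assume "x \<in> carrier L" "y \<in> carrier L" "z \<in> carrier L"
  then obtain a s b t c u where *: "a \<in> S" "s \<in> S - p" "x = fr a s" "b \<in> S" "t \<in> S - p" "y = fr b t"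
    "c \<in> S" "u \<in> S - p" "z = fr c u" by (elim L_cases)
  then show "(x \<oplus>\<^bsub>L\<^esub> y) \<otimes>\<^bsub>L\<^esub> z = x \<otimes>\<^bsub>L\<^esub> z \<oplus>\<^bsub>L\<^esub> y \<otimes>\<^bsub>L\<^esub> z"
    by (simp, intro eqI) (simp_all add: algebra_simps)
qed

end

lemma primeideal_prime_complement:
  assumes "subring_closed S" "primeideal p (subring_of S)"
  shows "prime_complement S p" "p \<subseteq> S"
proof -
  interpret primeideal p "subring_of S" by fact
  show ps: "p \<subseteq> S" using a_subset by simp
  have "1 \<notin> p" using I_notcarr one_imp_carrier by auto
  then show "prime_complement S p"
    using assms(1) additive_subgroup.zero_closed[OF is_additive_subgroup] I_prime
    by unfold_locales (auto simp: subring_closedD)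
qed

text \<open>Dual bases localise. After a finite set of fractions has been put over one denominator
  \<open>s\<close>, the stage consists of the fractions \<open>a / (\<iota> w * s)\<close> with
  \<open>a\<close> in \<open>F\<close> and \<open>w\<close> outside the contraction of
  \<open>p\<close>. Denominators from \<open>R\<close> can be passed through the linear maps
  \<open>k c\<close>, while \<open>s\<close> stays fixed and is absorbed into the vectors
  \<open>e c / s\<close>.\<close>

lemma flat_morphism_subringI:
  fixes R :: "'r::idom set" and A :: "'a::idom set" and \<iota> :: "'r \<Rightarrow> 'a"
  assumes R: "subring_closed R" and A: "subring_closed A"
    and iota: "\<iota> ` R \<subseteq> A" "\<iota> 1 = 1" "\<And>a b. a \<in> R \<Longrightarrow> b \<in> R \<Longrightarrow> \<iota> (a + b) = \<iota> a + \<iota> b"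
      "\<And>a b. a \<in> R \<Longrightarrow> b \<in> R \<Longrightarrow> \<iota> (a * b) = \<iota> a * \<iota> b"
    and dual_basis: "\<And>T. finite T \<Longrightarrow> T \<subseteq> A \<Longrightarrow>
      \<exists>F (C :: 'k set) e k. T \<subseteq> F \<and> F \<subseteq> A \<and> (\<forall>x\<in>F. \<forall>y\<in>F. x + y \<in> F) \<and>
        (\<forall>r\<in>R. \<forall>x\<in>F. \<iota> r * x \<in> F) \<and> finite C \<and> e \<in> C \<rightarrow> A \<and>
        (\<forall>c\<in>C. k c \<in> F \<rightarrow> R \<and> (\<forall>x\<in>F. \<forall>y\<in>F. k c (x + y) = k c x + k c y) \<and>
          (\<forall>r\<in>R. \<forall>x\<in>F. k c (\<iota> r * x) = r * k c x)) \<and>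
        (\<forall>x\<in>F. x = (\<Sum>c\<in>C. \<iota> (k c x) * e c))"
  shows "flat_morphism tb tc (subring_of R) (subring_of A) \<iota>"
  unfolding flat_morphism_def
proof (intro conjI ballI)
  show "\<iota> \<in> ring_hom (subring_of R) (subring_of A)"
    using iota by (auto simp: ring_hom_def)
  fix p assume "p \<in> prime_spectrum (subring_of A)"
  then have p: "prime_complement A p"
    using primeideal_prime_complement[OF A] by (simp add: prime_spectrum_def)
  define q where "q = contraction (subring_of R) \<iota> p"
  interpret A: prime_complement A p by fact
  have "\<iota> (0 + 0) = \<iota> 0 + \<iota> 0" by (rule iota(3)) (rule subring_closedD(2)[OF R])+
  then have i0: "\<iota> 0 = 0" by (metis add_0 add_cancel_right_right)
  have iA: "\<iota> r \<in> A" if "r \<in> R" for r using iota(1) that by auto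
  have qiff: "w \<in> R - q \<longleftrightarrow> w \<in> R \<and> \<iota> w \<notin> p" for w by (auto simp: q_def contraction_def)
  interpret R: prime_complement R q
    using R iota A.zero A.one i0 A.mult iA subring_closedD[OF R]
    by unfold_locales (auto simp: q_def contraction_def)
  have iS: "\<iota> w \<in> A - p" if "w \<in> R - q" for w using that iA qiff by auto
  define M where "M = local_module (subring_of R) (subring_of A) \<iota> p"
  have M_simps: "carrier M = carrier A.L" "ring.zero M = ring.zero A.L" "add M = add A.L"
    by (simp_all add: M_def local_module_def Let_def)
  have smult: "R.fr r w \<odot>\<^bsub>M\<^esub> A.fr a s = A.fr (\<iota> r * a) (\<iota> w * s)"
    if "r \<in> R" "w \<in> R - q" "a \<in> A" "s \<in> A - p" for r w a s
  proof -
    have "(\<Union>(r', w')\<in>R.fr r w. A.fr (\<iota> r') (\<iota> w')) = A.fr (\<iota> r) (\<iota> w)"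
    proof (rule R.pfrac_UN[OF that(1,2), of "\<lambda>r' w'. A.fr (\<iota> r') (\<iota> w')"])
      fix r' w' assume *: "r' \<in> R" "w' \<in> R - q" "r * w' = r' * w"
      show "A.fr (\<iota> r') (\<iota> w') = A.fr (\<iota> r) (\<iota> w)"
        using that * iS iA iota(4)[of r w'] iota(4)[of r' w] by (subst A.pfrac_eq_iff) auto
    qed
    then show ?thesis using A.mult_L[of "\<iota> r" "\<iota> w" a s] that iA iS
      by (simp add: M_def local_module_def Let_def)
  qed
  interpret AL: cring A.L by (rule A.cring_L)
  interpret RL: cring R.L by (rule R.cring_L)
  have Aprod: "s * t \<in> A" "s * t \<notin> p" if "s \<in> A" "s \<notin> p" "t \<in> A" "t \<notin> p" for s t
    using A.mult[of s t] that by auto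
  have Rprod: "s * t \<in> R" "s * t \<notin> q" if "s \<in> R" "s \<notin> q" "t \<in> R" "t \<notin> q" for s t
    using R.mult[of s t] that by auto
  have iA': "\<iota> w \<in> A" "\<iota> w \<notin> p" if "w \<in> R" "w \<notin> q" for w using iS[of w] that by auto
  have agM: "abelian_group M"
  proof (rule abelian_groupI)
    fix x assume "x \<in> carrier M"
    then show "\<exists>y\<in>carrier M. y \<oplus>\<^bsub>M\<^esub> x = \<zero>\<^bsub>M\<^esub>"
      using AL.l_neg[of x] AL.a_inv_closed[of x] by (auto simp: M_simps)
  qed (simp_all add: M_simps AL.a_assoc AL.a_comm AL.a_lcomm)
  have [simp]: "a * b \<in> A" if "a \<in> A" "b \<in> A" for a b using A.S(4) that .
  have [simp]: "a * b \<in> R" if "a \<in> R" "b \<in> R" for a b using R.S(4) that .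
  note eqI = A.pfrac_eq_iff[THEN iffD2]
  note rules = M_simps(2,3) smult Aprod Rprod iA iA' R.mult_L R.add_L A.add_L R.S(3) A.S(3)
  have m1: "\<one>\<^bsub>R.L\<^esub> \<odot>\<^bsub>M\<^esub> x = x" if "x \<in> carrier M" for x
  proof -
    from that obtain a s where x: "a \<in> A" "s \<in> A - p" "x = A.fr a s" unfolding M_simps by (rule A.L_cases)
    show ?thesis using x R.mult'(3,4) iota(2) by (simp add: R.one_L rules)
  qed
  have m2: "b \<odot>\<^bsub>M\<^esub> x \<in> carrier M \<and> b \<odot>\<^bsub>M\<^esub> (x \<oplus>\<^bsub>M\<^esub> y) = b \<odot>\<^bsub>M\<^esub> x \<oplus>\<^bsub>M\<^esub> b \<odot>\<^bsub>M\<^esub> y"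
    if "b \<in> carrier R.L" "x \<in> carrier M" "y \<in> carrier M" for b x y
  proof -
    from that(1) obtain r v where b: "r \<in> R" "v \<in> R - q" "b = R.fr r v" by (rule R.L_cases)
    from that(2) obtain a s where x: "a \<in> A" "s \<in> A - p" "x = A.fr a s" unfolding M_simps by (rule A.L_cases)
    from that(3) obtain a' t where y: "a' \<in> A" "t \<in> A - p" "y = A.fr a' t" unfolding M_simps by (rule A.L_cases)
    have "A.fr (\<iota> r * (a * t + a' * s)) (\<iota> v * (s * t)) =
      A.fr (\<iota> r * a * (\<iota> v * t) + \<iota> r * a' * (\<iota> v * s)) (\<iota> v * s * (\<iota> v * t))"
      using x y b by (intro eqI) (simp_all add: rules, simp add: algebra_simps)
    then show ?thesis using x y b by (simp add: rules M_simps(1))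
  qed
  have m3: "(b \<otimes>\<^bsub>R.L\<^esub> c) \<odot>\<^bsub>M\<^esub> x = b \<odot>\<^bsub>M\<^esub> (c \<odot>\<^bsub>M\<^esub> x) \<and>
      (b \<oplus>\<^bsub>R.L\<^esub> c) \<odot>\<^bsub>M\<^esub> x = b \<odot>\<^bsub>M\<^esub> x \<oplus>\<^bsub>M\<^esub> c \<odot>\<^bsub>M\<^esub> x"
    if "b \<in> carrier R.L" "c \<in> carrier R.L" "x \<in> carrier M" for b c x
  proof -
    from that(1) obtain r v where b: "r \<in> R" "v \<in> R - q" "b = R.fr r v" by (rule R.L_cases)
    from that(2) obtain r' w where c: "r' \<in> R" "w \<in> R - q" "c = R.fr r' w" by (rule R.L_cases)
    from that(3) obtain a s where x: "a \<in> A" "s \<in> A - p" "x = A.fr a s" unfolding M_simps by (rule A.L_cases)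
    have "A.fr ((\<iota> r * \<iota> w + \<iota> r' * \<iota> v) * a) (\<iota> v * \<iota> w * s) =
      A.fr (\<iota> r * a * (\<iota> w * s) + \<iota> r' * a * (\<iota> v * s)) (\<iota> v * s * (\<iota> w * s))"
      using x b c by (intro eqI) (simp_all add: rules, simp add: algebra_simps)
    then show ?thesis using x b c by (simp add: rules iota(3,4) mult.assoc)
  qed
  have modM: "module R.L M"
    by (intro module.intro module_axioms.intro R.cring_L agM) (simp_all add: m1 m2 m3)
  interpret M: module R.L M by (rule modM)
  have finsum: "(\<Oplus>\<^bsub>M\<^esub>c\<in>C. A.fr (f c) d) = A.fr (sum f C) d"
    if "finite C" "f \<in> C \<rightarrow> A" "d \<in> A - p" for C :: "'k set" and f d
    using that(1,2)
  proof (induction C rule: finite_induct)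
    case empty then show ?case using that(3) A.one
      by (simp add: M_simps A.zero_L A.pfrac_eq_iff A.S)
  next
    case (insert c C)
    then show ?case using that(3)
      by (subst M.finsum_insert) (auto simp: M_simps A.add_L_same A.S Pi_iff)
  qed
  show "flat_module tb tc (localization (subring_of R) (contraction (subring_of R) \<iota> p))
     (local_module (subring_of R) (subring_of A) \<iota> p)"
    unfolding q_def[symmetric] M_def[symmetric]
  proof (rule flat_moduleI[OF modM])
    fix T assume T: "finite T" "T \<subseteq> carrier M"
    then have "\<forall>x\<in>T. \<exists>as. fst as \<in> A \<and> snd as \<in> A - p \<and> x = A.fr (fst as) (snd as)"
      unfolding M_simps A.carrier_L by fastforce
    then obtain as where as: "\<And>x. x \<in> T \<Longrightarrow> fst (as x) \<in> A" "\<And>x. x \<in> T \<Longrightarrow> snd (as x) \<in> A - p"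
      "\<And>x. x \<in> T \<Longrightarrow> x = A.fr (fst (as x)) (snd (as x))" by metis
    define s where "s = (\<Prod>x\<in>T. snd (as x))"
    have sp: "(\<Prod>x\<in>T'. snd (as x)) \<in> A - p" if "T' \<subseteq> T" for T'
      using finite_subset[OF that T(1)] that
      by (induction T' rule: finite_induct) (use A.one_in A.mult as in auto)
    have s: "s \<in> A - p" unfolding s_def by (rule sp) simp
    define num where "num x = fst (as x) * (\<Prod>y\<in>T - {x}. snd (as y))" for x
    have num: "num x \<in> A" if "x \<in> T" for x
      unfolding num_def using as(1)[OF that] sp[of "T - {x}"] by (auto intro: A.S)
    have xnum: "x = A.fr (num x) s" if "x \<in> T" for x
    proof -
      have "s = snd (as x) * (\<Prod>y\<in>T - {x}. snd (as y))"
        unfolding s_def using T(1) that by (rule prod.remove)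
      then have "A.fr (fst (as x)) (snd (as x)) = A.fr (num x) s"
        using that as s num by (subst A.pfrac_eq_iff) (auto simp: num_def)
      then show ?thesis using as(3)[OF that] by simp
    qed
    from dual_basis[of "num ` T"] T(1) num obtain F C e k where
      F: "num ` T \<subseteq> F" "F \<subseteq> A" "\<forall>x\<in>F. \<forall>y\<in>F. x + y \<in> F"
        "\<forall>r\<in>R. \<forall>x\<in>F. \<iota> r * x \<in> F" and C: "finite (C :: 'k set)" "e \<in> C \<rightarrow> A" and
      k: "\<forall>c\<in>C. k c \<in> F \<rightarrow> R \<and> (\<forall>x\<in>F. \<forall>y\<in>F. k c (x + y) = k c x + k c y) \<and>
          (\<forall>r\<in>R. \<forall>x\<in>F. k c (\<iota> r * x) = r * k c x)" and
      ex: "\<forall>x\<in>F. x = (\<Sum>c\<in>C. \<iota> (k c x) * e c)"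
      by blast
    have kR: "k c x \<in> R" if "c \<in> C" "x \<in> F" for c x using k that by auto
    have kadd: "k c (x + y) = k c x + k c y" if "c \<in> C" "x \<in> F" "y \<in> F" for c x y using k that by blast
    have kmul: "k c (\<iota> r * x) = r * k c x" if "c \<in> C" "r \<in> R" "x \<in> F" for c x r using k that by blast
    have FA: "x \<in> A" if "x \<in> F" for x using F that by blast
    have Fadd: "x + y \<in> F" if "x \<in> F" "y \<in> F" for x y using F that by blast
    have Fmul: "\<iota> r * x \<in> F" if "r \<in> R" "x \<in> F" for r x using F that by blast
    define F' where "F' = {A.fr a (\<iota> w * s) | a w. a \<in> F \<and> w \<in> R - q}"
    have ws: "\<iota> w * s \<in> A - p" if "w \<in> R - q" for w using A.mult[OF iS[OF that] s] .
    define k' where "k' c x = (SOME z. \<exists>a w. a \<in> F \<and> w \<in> R - q \<and> x = A.fr a (\<iota> w * s) \<and> z = R.fr (k c a) w)" for c x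
    have k': "k' c (A.fr a (\<iota> w * s)) = R.fr (k c a) w" if "c \<in> C" "a \<in> F" "w \<in> R - q" for c a w
    proof -
      have "z = R.fr (k c a) w"
        if "\<exists>a' w'. a' \<in> F \<and> w' \<in> R - q \<and> A.fr a (\<iota> w * s) = A.fr a' (\<iota> w' * s) \<and> z = R.fr (k c a') w'" for z
      proof -
        from that obtain a' w' where *: "a' \<in> F" "w' \<in> R - q" "A.fr a (\<iota> w * s) = A.fr a' (\<iota> w' * s)"
          "z = R.fr (k c a') w'" by blast
        have "a * (\<iota> w' * s) = a' * (\<iota> w * s)"
          using * \<open>a \<in> F\<close> \<open>w \<in> R - q\<close> FA ws by (simp add: A.pfrac_eq_iff)
        \<comment> \<open>Cancelling \<open>s\<close> leaves an equality in \<open>F\<close>, to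
          which the \<open>R\<close>-linear map \<open>k c\<close> applies; so \<open>k'\<close>
          does not depend on the chosen fraction.\<close>
        then have "\<iota> w' * a = \<iota> w * a'" using A.nz[OF s] by (simp add: mult_ac)
        then have "k c (\<iota> w' * a) = k c (\<iota> w * a')" by simp
        then have "w' * k c a = w * k c a'"
          using * \<open>a \<in> F\<close> \<open>w \<in> R - q\<close> kmul[OF \<open>c \<in> C\<close>] by auto
        then show ?thesis using * \<open>a \<in> F\<close> \<open>w \<in> R - q\<close> kR[OF \<open>c \<in> C\<close>]
          by (simp add: R.pfrac_eq_iff mult_ac)
      qed
      then show ?thesis unfolding k'_def using that by (intro some_equality) blast+
    qed
    have add': "A.fr a (\<iota> w * s) \<oplus>\<^bsub>M\<^esub> A.fr b (\<iota> v * s) = A.fr (\<iota> v * a + \<iota> w * b) (\<iota> (w * v) * s)"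
      if "a \<in> F" "b \<in> F" "w \<in> R - q" "v \<in> R - q" for a b w v
    proof -
      have "A.fr a (\<iota> w * s) \<oplus>\<^bsub>M\<^esub> A.fr b (\<iota> v * s) =
        A.fr (a * (\<iota> v * s) + b * (\<iota> w * s)) (\<iota> w * s * (\<iota> v * s))"
        unfolding M_simps by (rule A.add_L[OF FA[OF that(1)] ws[OF that(3)] FA[OF that(2)] ws[OF that(4)]])
      also have "\<dots> = A.fr (\<iota> v * a + \<iota> w * b) (\<iota> (w * v) * s)"
      proof (rule eqI)
        show "\<iota> w * s * (\<iota> v * s) \<in> A - p" by (rule A.mult[OF ws[OF that(3)] ws[OF that(4)]])
        show "\<iota> (w * v) * s \<in> A - p" by (rule ws[OF R.mult[OF that(3,4)]])
        show "a * (\<iota> v * s) + b * (\<iota> w * s) \<in> A" "\<iota> v * a + \<iota> w * b \<in> A"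
          using that FA[OF that(1)] FA[OF that(2)] s iA by (auto intro!: A.S(3))
        show "(a * (\<iota> v * s) + b * (\<iota> w * s)) * (\<iota> (w * v) * s) = (\<iota> v * a + \<iota> w * b) * (\<iota> w * s * (\<iota> v * s))"
          using that iota(4)[of w v] by (simp add: algebra_simps)
      qed
      finally show ?thesis .
    qed
    have smult': "R.fr r v \<odot>\<^bsub>M\<^esub> A.fr a (\<iota> w * s) = A.fr (\<iota> r * a) (\<iota> (v * w) * s)"
      if "r \<in> R" "v \<in> R - q" "a \<in> F" "w \<in> R - q" for r v a w
      using smult[OF that(1,2) FA[OF that(3)] ws[OF that(4)]] iota(4)[of v w] that by (simp add: mult.assoc)
    show "\<exists>F (C :: 'k set) e k. T \<subseteq> F \<and> F \<subseteq> carrier M \<and> (\<forall>x\<in>F. \<forall>y\<in>F. x \<oplus>\<^bsub>M\<^esub> y \<in> F) \<and>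
        (\<forall>r\<in>carrier R.L. \<forall>x\<in>F. r \<odot>\<^bsub>M\<^esub> x \<in> F) \<and> finite C \<and> e \<in> C \<rightarrow> carrier M \<and>
        (\<forall>c\<in>C. k c \<in> F \<rightarrow> carrier R.L \<and>
          (\<forall>x\<in>F. \<forall>y\<in>F. k c (x \<oplus>\<^bsub>M\<^esub> y) = k c x \<oplus>\<^bsub>R.L\<^esub> k c y) \<and>
          (\<forall>r\<in>carrier R.L. \<forall>x\<in>F. k c (r \<odot>\<^bsub>M\<^esub> x) = r \<otimes>\<^bsub>R.L\<^esub> k c x)) \<and>
        (\<forall>x\<in>F. x = (\<Oplus>\<^bsub>M\<^esub>c\<in>C. k c x \<odot>\<^bsub>M\<^esub> e c))"
    proof (intro exI conjI ballI)
      show "T \<subseteq> F'"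
      proof
        fix x assume "x \<in> T"
        then have "x = A.fr (num x) (\<iota> 1 * s)" "num x \<in> F" using xnum F(1) iota(2) by auto
        then show "x \<in> F'" unfolding F'_def using R.one_in by blast
      qed
      show "F' \<subseteq> carrier M" using FA ws by (auto simp: F'_def M_simps)
      show "finite C" by fact
      show "x \<oplus>\<^bsub>M\<^esub> y \<in> F'" if "x \<in> F'" "y \<in> F'" for x y
      proof -
        from that obtain a w b v where *: "a \<in> F" "b \<in> F" "w \<in> R - q" "v \<in> R - q"
          "x = A.fr a (\<iota> w * s)" "y = A.fr b (\<iota> v * s)" unfolding F'_def by blast
        have "\<iota> v * a + \<iota> w * b \<in> F" using * Fmul Fadd by blast
        moreover have "w * v \<in> R - q" using * R.mult by blast
        ultimately show ?thesis unfolding *(5,6) add'[OF *(1-4)] F'_def by blast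
      qed
      show "r \<odot>\<^bsub>M\<^esub> x \<in> F'" if "r \<in> carrier R.L" "x \<in> F'" for r x
      proof -
        from that obtain a w b v where *: "b \<in> R" "v \<in> R - q" "a \<in> F" "w \<in> R - q"
          "x = A.fr a (\<iota> w * s)" "r = R.fr b v" unfolding F'_def R.carrier_L by blast
        have "\<iota> b * a \<in> F" using * Fmul by blast
        moreover have "v * w \<in> R - q" using * R.mult by blast
        ultimately show ?thesis unfolding *(5,6) smult'[OF *(1-4)] F'_def by blast
      qed
      show "(\<lambda>c. A.fr (e c) s) \<in> C \<rightarrow> carrier M" unfolding M_simps by (rule Pi_I) (rule A.fr_in_L[OF Pi_mem[OF C(2)] s])
      show "k' c \<in> F' \<rightarrow> carrier R.L" if "c \<in> C" for c
      proof
        fix x assume "x \<in> F'"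
        then obtain a w where *: "a \<in> F" "w \<in> R - q" "x = A.fr a (\<iota> w * s)" unfolding F'_def by blast
        then show "k' c x \<in> carrier R.L" using k'[OF that *(1,2)] R.fr_in_L[OF kR[OF that *(1)] *(2)] by simp
      qed
      show "k' c (x \<oplus>\<^bsub>M\<^esub> y) = k' c x \<oplus>\<^bsub>R.L\<^esub> k' c y" if "c \<in> C" "x \<in> F'" "y \<in> F'" for c x y
      proof -
        from that obtain a w b v where *: "a \<in> F" "b \<in> F" "w \<in> R - q" "v \<in> R - q"
          "x = A.fr a (\<iota> w * s)" "y = A.fr b (\<iota> v * s)" unfolding F'_def by blast
        have f: "\<iota> v * a \<in> F" "\<iota> w * b \<in> F" using * Fmul by auto
        have "k' c (x \<oplus>\<^bsub>M\<^esub> y) = R.fr (k c (\<iota> v * a + \<iota> w * b)) (w * v)"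
          unfolding *(5,6) add'[OF *(1-4)] by (rule k'[OF that(1) Fadd[OF f] R.mult[OF *(3,4)]])
        also have "k c (\<iota> v * a + \<iota> w * b) = v * k c a + w * k c b"
          using that(1) f * kadd kmul by auto
        also have "R.fr \<dots> (w * v) = R.fr (k c a) w \<oplus>\<^bsub>R.L\<^esub> R.fr (k c b) v"
          using R.add_L[OF kR[OF that(1) *(1)] *(3) kR[OF that(1) *(2)] *(4)] by (simp add: mult_ac)
        finally show ?thesis unfolding *(5,6) k'[OF that(1) *(1,3)] k'[OF that(1) *(2,4)] .
      qed
      show "k' c (r \<odot>\<^bsub>M\<^esub> x) = r \<otimes>\<^bsub>R.L\<^esub> k' c x" if "c \<in> C" "r \<in> carrier R.L" "x \<in> F'" for c r x
      proof -
        from that obtain a w b v where *: "a \<in> F" "w \<in> R - q" "b \<in> R" "v \<in> R - q"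
          "x = A.fr a (\<iota> w * s)" "r = R.fr b v" unfolding F'_def R.carrier_L by blast
        have "k' c (r \<odot>\<^bsub>M\<^esub> x) = R.fr (k c (\<iota> b * a)) (v * w)"
          unfolding *(5,6) smult'[OF *(3,4,1,2)] by (rule k'[OF that(1) Fmul[OF *(3,1)] R.mult[OF *(4,2)]])
        then show ?thesis
          unfolding *(5,6) k'[OF that(1) *(1,2)] kmul[OF that(1) *(3,1)] R.mult_L[OF *(3,4) kR[OF that(1) *(1)] *(2)] .
      qed
      show "x = (\<Oplus>\<^bsub>M\<^esub>c\<in>C. k' c x \<odot>\<^bsub>M\<^esub> A.fr (e c) s)" if "x \<in> F'" for x
      proof -
        from that obtain a w where *: "a \<in> F" "w \<in> R - q" "x = A.fr a (\<iota> w * s)" unfolding F'_def by blast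
        have "(\<Oplus>\<^bsub>M\<^esub>c\<in>C. k' c x \<odot>\<^bsub>M\<^esub> A.fr (e c) s) = (\<Oplus>\<^bsub>M\<^esub>c\<in>C. A.fr (\<iota> (k c a) * e c) (\<iota> w * s))"
        proof (rule M.finsum_cong'[OF refl])
          show "(\<lambda>c. A.fr (\<iota> (k c a) * e c) (\<iota> w * s)) \<in> C \<rightarrow> carrier M"
            unfolding M_simps using C(2) kR[OF _ *(1)] iA
            by (intro Pi_I A.fr_in_L ws[OF *(2)] A.S(4)) auto
          fix c assume "c \<in> C"
          then show "k' c x \<odot>\<^bsub>M\<^esub> A.fr (e c) s = A.fr (\<iota> (k c a) * e c) (\<iota> w * s)"
            using k'[OF \<open>c \<in> C\<close> *(1,2)] smult[OF kR[OF \<open>c \<in> C\<close> *(1)] *(2) _ s, of "e c"] C(2) *(3) by auto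
        qed
        also have "\<dots> = A.fr (\<Sum>c\<in>C. \<iota> (k c a) * e c) (\<iota> w * s)"
          using C(2) kR[OF _ *(1)] iA by (intro finsum C(1) ws *(2)) (auto intro!: A.S)
        also have "\<dots> = x" using ex *(1,3) by auto
        finally show ?thesis ..
      qed
    qed
  qed
qed

subsection \<open>Isomorphisms of spectra\<close>

lemma image_image_id: "(\<And>x. x \<in> A \<Longrightarrow> g (f x) = x) \<Longrightarrow> g ` f ` A = A"
  using image_cong[of A A "\<lambda>x. g (f x)" id] by (simp add: image_image)

lemma pfrac_subset: "pfrac R p a s \<subseteq> carrier R \<times> (carrier R - p)"
  by (auto simp: pfrac_def)

lemma localization_carrier_subset: "X \<in> carrier (localization R p) \<Longrightarrow> X \<subseteq> carrier R \<times> (carrier R - p)"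
  using pfrac_subset by (fastforce simp: localization_def)

text \<open>The inverse is part of the data, so that every lemma can also be used with
  \<open>R\<close> and \<open>S\<close> exchanged, through the interpretation
  \<open>inv\<close>.\<close>

locale ring_iso_pair = R: cring R + S: cring S
  for R :: "'a ring" and S :: "'b ring" +
  fixes h :: "'a \<Rightarrow> 'b" and g :: "'b \<Rightarrow> 'a"
  assumes h: "h \<in> ring_hom R S" and g: "g \<in> ring_hom S R"
    and gh: "a \<in> carrier R \<Longrightarrow> g (h a) = a" and hg: "b \<in> carrier S \<Longrightarrow> h (g b) = b"
begin

lemma h_closed: "a \<in> carrier R \<Longrightarrow> h a \<in> carrier S" using ring_hom_closed[OF h] .
lemma g_closed: "b \<in> carrier S \<Longrightarrow> g b \<in> carrier R" using ring_hom_closed[OF g] .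

sublocale hom: ring_hom_cring R S h
  by unfold_locales (rule h)

lemma h_image_iff: "p \<subseteq> carrier R \<Longrightarrow> a \<in> carrier R \<Longrightarrow> h a \<in> h ` p \<longleftrightarrow> a \<in> p"
  using gh by (metis (no_types) imageE imageI subsetD)

lemma h_image_iff': "p \<subseteq> carrier R \<Longrightarrow> b \<in> carrier S \<Longrightarrow> b \<in> h ` p \<longleftrightarrow> g b \<in> p"
  using h_image_iff[of p "g b"] g_closed[of b] hg[of b] by simp

lemma gh_image: "p \<subseteq> carrier R \<Longrightarrow> g ` h ` p = p"
  by (rule image_image_id) (use gh in blast)

lemma image_prime:
  assumes "p \<in> prime_spectrum R"
  shows "h ` p \<in> prime_spectrum S"
proof -
  interpret p: primeideal p R using assms by (simp add: prime_spectrum_def)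
  have ps: "p \<subseteq> carrier R" by (rule p.a_subset)
  have "ideal (h ` p) S"
  proof (rule idealI)
    show "ring S" by (rule S.ring_axioms)
    show "subgroup (h ` p) (add_monoid S)"
    proof (rule S.add.subgroupI)
      show "h ` p \<subseteq> carrier S" using ps h_closed by auto
      show "h ` p \<noteq> {}" using additive_subgroup.zero_closed[OF p.is_additive_subgroup] by blast
      fix x assume "x \<in> h ` p"
      then obtain a where a: "a \<in> p" "x = h a" by auto
      then have "\<ominus>\<^bsub>S\<^esub> x = h (\<ominus>\<^bsub>R\<^esub> a)" using ps by (auto simp: hom.hom_a_inv)
      moreover have "\<ominus>\<^bsub>R\<^esub> a \<in> p"
        using subgroup.m_inv_closed[OF additive_subgroup.a_subgroup[OF p.is_additive_subgroup] a(1)]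
        by (simp add: a_inv_def)
      ultimately show "\<ominus>\<^bsub>S\<^esub> x \<in> h ` p" by (simp only: imageI)
      fix y assume "y \<in> h ` p"
      then obtain b where b: "b \<in> p" "y = h b" by auto
      then have "x \<oplus>\<^bsub>S\<^esub> y = h (a \<oplus>\<^bsub>R\<^esub> b)" using a ps by auto
      moreover have "a \<oplus>\<^bsub>R\<^esub> b \<in> p" using a b p.a_closed by auto
      ultimately show "x \<oplus>\<^bsub>S\<^esub> y \<in> h ` p" by (simp only: imageI)
    qed
    fix x y assume "x \<in> h ` p" and y: "y \<in> carrier S"
    then obtain a where a: "a \<in> p" "x = h a" by auto
    have "y \<otimes>\<^bsub>S\<^esub> x = h (g y \<otimes>\<^bsub>R\<^esub> a)" "x \<otimes>\<^bsub>S\<^esub> y = h (a \<otimes>\<^bsub>R\<^esub> g y)"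
      using a y ps g_closed[OF y] hg[OF y] by auto
    moreover have "g y \<otimes>\<^bsub>R\<^esub> a \<in> p" "a \<otimes>\<^bsub>R\<^esub> g y \<in> p"
      using a g_closed[OF y] p.I_l_closed p.I_r_closed by blast+
    ultimately show "y \<otimes>\<^bsub>S\<^esub> x \<in> h ` p" "x \<otimes>\<^bsub>S\<^esub> y \<in> h ` p"
      by (simp_all only: imageI)
  qed
  then have "primeideal (h ` p) S"
  proof (rule primeidealI)
    show "cring S" by (rule S.is_cring)
    show "carrier S \<noteq> h ` p"
    proof
      assume "carrier S = h ` p"
      then have "carrier R \<subseteq> p" using h_image_iff[OF ps] h_closed by blast
      then show False using p.I_notcarr ps by auto
    qed
    fix x y assume *: "x \<in> carrier S" "y \<in> carrier S" "x \<otimes>\<^bsub>S\<^esub> y \<in> h ` p"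
    then have "g (x \<otimes>\<^bsub>S\<^esub> y) \<in> p" using h_image_iff'[OF ps] by auto
    then have "g x \<otimes>\<^bsub>R\<^esub> g y \<in> p" using ring_hom_mult[OF g *(1,2)] by simp
    then show "x \<in> h ` p \<or> y \<in> h ` p"
      using p.I_prime g_closed * h_image_iff'[OF ps] by blast
  qed
  then show ?thesis by (simp add: prime_spectrum_def)
qed

lemma spectrum_subset: "p \<in> prime_spectrum R \<Longrightarrow> p \<subseteq> carrier R"
  using primeideal.axioms(1) ideal.axioms(1) additive_subgroup.a_subset
  by (fastforce simp: prime_spectrum_def)

text \<open>Elements of a local ring are sets of pairs, so \<open>h\<close> acts on them by direct
  image, and the local rings of \<open>S\<close> become images of those of \<open>R\<close>.\<close>

abbreviation "H \<equiv> image (map_prod h h)"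

lemma pfrac_image:
  assumes "p \<subseteq> carrier R" "a \<in> carrier R" "s \<in> carrier R"
  shows "pfrac S (h ` p) (h a) (h s) = H (pfrac R p a s)"
proof -
  have eq: "h w \<otimes>\<^bsub>S\<^esub> (h a \<otimes>\<^bsub>S\<^esub> h t \<ominus>\<^bsub>S\<^esub> h b \<otimes>\<^bsub>S\<^esub> h s) = \<zero>\<^bsub>S\<^esub> \<longleftrightarrow>
     w \<otimes>\<^bsub>R\<^esub> (a \<otimes>\<^bsub>R\<^esub> t \<ominus>\<^bsub>R\<^esub> b \<otimes>\<^bsub>R\<^esub> s) = \<zero>\<^bsub>R\<^esub>"
    if "w \<in> carrier R" "t \<in> carrier R" "b \<in> carrier R" for w t b
  proof -
    have "h w \<otimes>\<^bsub>S\<^esub> (h a \<otimes>\<^bsub>S\<^esub> h t \<ominus>\<^bsub>S\<^esub> h b \<otimes>\<^bsub>S\<^esub> h s) = h (w \<otimes>\<^bsub>R\<^esub> (a \<otimes>\<^bsub>R\<^esub> t \<ominus>\<^bsub>R\<^esub> b \<otimes>\<^bsub>R\<^esub> s))"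
      using that assms by (simp add: a_minus_def hom.hom_a_inv)
    moreover have "h x = \<zero>\<^bsub>S\<^esub> \<longleftrightarrow> x = \<zero>\<^bsub>R\<^esub>" if "x \<in> carrier R" for x
      using gh[OF that] gh[of "\<zero>\<^bsub>R\<^esub>"] by auto
    ultimately show ?thesis
      using that assms by (simp only: R.m_closed R.minus_closed)
  qed
  show ?thesis
  proof (intro equalityI subsetI)
    fix z assume "z \<in> pfrac S (h ` p) (h a) (h s)"
    then obtain b t w where z: "z = (b, t)" "b \<in> carrier S" "t \<in> carrier S" "t \<notin> h ` p" "w \<in> carrier S" "w \<notin> h ` p"
      "w \<otimes>\<^bsub>S\<^esub> (h a \<otimes>\<^bsub>S\<^esub> t \<ominus>\<^bsub>S\<^esub> b \<otimes>\<^bsub>S\<^esub> h s) = \<zero>\<^bsub>S\<^esub>" by (auto simp: pfrac_def)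
    have "(g b, g t) \<in> pfrac R p a s"
      using z eq[of "g w" "g t" "g b"] g_closed hg h_image_iff'[OF assms(1)]
      by (auto simp: pfrac_def intro!: bexI[of _ "g w"])
    then show "z \<in> H (pfrac R p a s)" using z hg by (auto intro!: image_eqI[of _ _ "(g b, g t)"])
  next
    fix z assume "z \<in> H (pfrac R p a s)"
    then obtain b t w where z: "z = (h b, h t)" "b \<in> carrier R" "t \<in> carrier R" "t \<notin> p" "w \<in> carrier R" "w \<notin> p"
      "w \<otimes>\<^bsub>R\<^esub> (a \<otimes>\<^bsub>R\<^esub> t \<ominus>\<^bsub>R\<^esub> b \<otimes>\<^bsub>R\<^esub> s) = \<zero>\<^bsub>R\<^esub>" by (auto simp: pfrac_def)
    then show "z \<in> pfrac S (h ` p) (h a) (h s)"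
      using eq[of w t b] h_closed h_image_iff[OF assms(1)]
      by (auto simp: pfrac_def intro!: bexI[of _ "h w"])
  qed
qed

lemma localization_image:
  assumes "p \<subseteq> carrier R"
  shows "carrier (localization S (h ` p)) = H ` carrier (localization R p)"
    and "\<one>\<^bsub>localization S (h ` p)\<^esub> = H \<one>\<^bsub>localization R p\<^esub>"
    and "\<zero>\<^bsub>localization S (h ` p)\<^esub> = H \<zero>\<^bsub>localization R p\<^esub>"
    and "X \<in> carrier (localization R p) \<Longrightarrow> Y \<in> carrier (localization R p) \<Longrightarrow>
      H X \<otimes>\<^bsub>localization S (h ` p)\<^esub> H Y = H (X \<otimes>\<^bsub>localization R p\<^esub> Y)"
    and "X \<in> carrier (localization R p) \<Longrightarrow> Y \<in> carrier (localization R p) \<Longrightarrow>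
      H X \<oplus>\<^bsub>localization S (h ` p)\<^esub> H Y = H (X \<oplus>\<^bsub>localization R p\<^esub> Y)"
proof -
  show "carrier (localization S (h ` p)) = H ` carrier (localization R p)"
  proof (intro equalityI subsetI)
    fix X assume "X \<in> carrier (localization S (h ` p))"
    then obtain a s where X: "X = pfrac S (h ` p) a s" "a \<in> carrier S" "s \<in> carrier S" "s \<notin> h ` p"
      by (auto simp: localization_def)
    then have "X = H (pfrac R p (g a) (g s))"
      using pfrac_image[OF assms, of "g a" "g s"] g_closed hg by simp
    moreover have "pfrac R p (g a) (g s) \<in> carrier (localization R p)"
      using X g_closed h_image_iff'[OF assms] by (auto simp: localization_def)
    ultimately show "X \<in> H ` carrier (localization R p)" by blast
  next
    fix X assume "X \<in> H ` carrier (localization R p)"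
    then obtain a s where X: "X = H (pfrac R p a s)" "a \<in> carrier R" "s \<in> carrier R" "s \<notin> p"
      by (auto simp: localization_def)
    then have "X = pfrac S (h ` p) (h a) (h s)" using pfrac_image[OF assms] by simp
    moreover have "h a \<in> carrier S" "h s \<in> carrier S - h ` p"
      using X h_closed h_image_iff[OF assms] by auto
    ultimately show "X \<in> carrier (localization S (h ` p))" unfolding localization_def by auto
  qed
  show "\<one>\<^bsub>localization S (h ` p)\<^esub> = H \<one>\<^bsub>localization R p\<^esub>"
    using pfrac_image[OF assms, of "\<one>\<^bsub>R\<^esub>" "\<one>\<^bsub>R\<^esub>"] by (simp add: localization_def)
  show "\<zero>\<^bsub>localization S (h ` p)\<^esub> = H \<zero>\<^bsub>localization R p\<^esub>"
    using pfrac_image[OF assms, of "\<zero>\<^bsub>R\<^esub>" "\<one>\<^bsub>R\<^esub>"] by (simp add: localization_def)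
  assume X: "X \<in> carrier (localization R p)" and Y: "Y \<in> carrier (localization R p)"
  note sub = subsetD[OF localization_carrier_subset[OF X]] subsetD[OF localization_carrier_subset[OF Y]]
  have "H X \<otimes>\<^bsub>localization S (h ` p)\<^esub> H Y =
     (\<Union>x\<in>X. \<Union>y\<in>Y. pfrac S (h ` p) (h (fst x) \<otimes>\<^bsub>S\<^esub> h (fst y)) (h (snd x) \<otimes>\<^bsub>S\<^esub> h (snd y)))"
    by (simp add: localization_def split_beta)
  also have "\<dots> = (\<Union>x\<in>X. \<Union>y\<in>Y. H (pfrac R p (fst x \<otimes>\<^bsub>R\<^esub> fst y) (snd x \<otimes>\<^bsub>R\<^esub> snd y)))"
  proof (intro SUP_cong refl)
    fix x y assume "x \<in> X" "y \<in> Y"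
    then have "fst x \<in> carrier R" "snd x \<in> carrier R" "fst y \<in> carrier R" "snd y \<in> carrier R"
      using sub(1)[of x] sub(2)[of y] by auto
    then show "pfrac S (h ` p) (h (fst x) \<otimes>\<^bsub>S\<^esub> h (fst y)) (h (snd x) \<otimes>\<^bsub>S\<^esub> h (snd y)) =
        H (pfrac R p (fst x \<otimes>\<^bsub>R\<^esub> fst y) (snd x \<otimes>\<^bsub>R\<^esub> snd y))"
      using pfrac_image[OF assms, of "fst x \<otimes>\<^bsub>R\<^esub> fst y" "snd x \<otimes>\<^bsub>R\<^esub> snd y"] by simp
  qed
  also have "\<dots> = H (X \<otimes>\<^bsub>localization R p\<^esub> Y)"
    by (simp add: localization_def split_beta image_UN)
  finally show "H X \<otimes>\<^bsub>localization S (h ` p)\<^esub> H Y = H (X \<otimes>\<^bsub>localization R p\<^esub> Y)" .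
  have "H X \<oplus>\<^bsub>localization S (h ` p)\<^esub> H Y =
     (\<Union>x\<in>X. \<Union>y\<in>Y. pfrac S (h ` p) (h (fst x) \<otimes>\<^bsub>S\<^esub> h (snd y) \<oplus>\<^bsub>S\<^esub> h (fst y) \<otimes>\<^bsub>S\<^esub> h (snd x)) (h (snd x) \<otimes>\<^bsub>S\<^esub> h (snd y)))"
    by (simp add: localization_def split_beta)
  also have "\<dots> = (\<Union>x\<in>X. \<Union>y\<in>Y. H (pfrac R p (fst x \<otimes>\<^bsub>R\<^esub> snd y \<oplus>\<^bsub>R\<^esub> fst y \<otimes>\<^bsub>R\<^esub> snd x) (snd x \<otimes>\<^bsub>R\<^esub> snd y)))"
  proof (intro SUP_cong refl)
    fix x y assume "x \<in> X" "y \<in> Y"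
    then have "fst x \<in> carrier R" "snd x \<in> carrier R" "fst y \<in> carrier R" "snd y \<in> carrier R"
      using sub(1)[of x] sub(2)[of y] by auto
    then show "pfrac S (h ` p) (h (fst x) \<otimes>\<^bsub>S\<^esub> h (snd y) \<oplus>\<^bsub>S\<^esub> h (fst y) \<otimes>\<^bsub>S\<^esub> h (snd x)) (h (snd x) \<otimes>\<^bsub>S\<^esub> h (snd y)) =
        H (pfrac R p (fst x \<otimes>\<^bsub>R\<^esub> snd y \<oplus>\<^bsub>R\<^esub> fst y \<otimes>\<^bsub>R\<^esub> snd x) (snd x \<otimes>\<^bsub>R\<^esub> snd y))"
      using pfrac_image[OF assms, of "fst x \<otimes>\<^bsub>R\<^esub> snd y \<oplus>\<^bsub>R\<^esub> fst y \<otimes>\<^bsub>R\<^esub> snd x" "snd x \<otimes>\<^bsub>R\<^esub> snd y"] by simp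
  qed
  also have "\<dots> = H (X \<oplus>\<^bsub>localization R p\<^esub> Y)"
    by (simp add: localization_def split_beta image_UN)
  finally show "H X \<oplus>\<^bsub>localization S (h ` p)\<^esub> H Y = H (X \<oplus>\<^bsub>localization R p\<^esub> Y)" .
qed

lemma image_opens:
  assumes "U \<in> spec_opens R"
  shows "(`) h ` U \<in> spec_opens S"
proof -
  from assms obtain T where T: "T \<subseteq> carrier R" "U = {p \<in> prime_spectrum R. \<not> T \<subseteq> p}"
    by (auto simp: spec_opens_def)
  interpret inv: ring_iso_pair S R g h by unfold_locales (auto simp: g h gh hg)
  have "(`) h ` U = {p \<in> prime_spectrum S. \<not> h ` T \<subseteq> p}"
  proof (intro equalityI subsetI)
    fix q assume "q \<in> (`) h ` U"
    then obtain p where p: "p \<in> prime_spectrum R" "\<not> T \<subseteq> p" "q = h ` p" using T by auto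
    then have "\<not> h ` T \<subseteq> h ` p" using h_image_iff[OF spectrum_subset[OF p(1)]] T(1) by blast
    then show "q \<in> {p \<in> prime_spectrum S. \<not> h ` T \<subseteq> p}" using p image_prime by auto
  next
    fix q assume q: "q \<in> {p \<in> prime_spectrum S. \<not> h ` T \<subseteq> p}"
    then have gq: "g ` q \<in> prime_spectrum R" and hgq: "h ` g ` q = q"
      using inv.image_prime inv.gh_image inv.spectrum_subset by auto
    have "\<not> T \<subseteq> g ` q" using q hgq by blast
    then show "q \<in> (`) h ` U" using gq hgq T(2) by (metis (mono_tags, lifting) image_eqI mem_Collect_eq)
  qed
  then show ?thesis unfolding spec_opens_def using T(1) h_closed by (auto intro!: exI[of _ "h ` T"])
qed

lemma opens_subset: "U \<in> spec_opens R \<Longrightarrow> U \<subseteq> prime_spectrum R"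
  by (auto simp: spec_opens_def)

text \<open>Functions are pulled back against the map on points, which is the direction that
  \<open>isomorphic_over_C\<close> asks for; their values are transported by the inverse
  \<open>g\<close>.\<close>

definition pull :: "'a set set \<Rightarrow> ('b set \<Rightarrow> ('b \<times> 'b) set) \<Rightarrow> 'a set \<Rightarrow> ('a \<times> 'a) set" where
  "pull U s = (\<lambda>p\<in>U. map_prod g g ` s (h ` p))"

text \<open>A local presentation \<open>a / f\<close> of \<open>s\<close> on \<open>V\<close>
  becomes \<open>g a / g f\<close> on the image of \<open>V\<close>.\<close>

lemma pull_closed:
  assumes U: "U \<in> spec_opens R" and s: "s \<in> carrier (structure_sheaf S ((`) h ` U))"
  shows "pull U s \<in> carrier (structure_sheaf R U)"
proof -
  interpret inv: ring_iso_pair S R g h by unfold_locales (auto simp: g h gh hg)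
  note US = opens_subset[OF U]
  have ghp: "g ` h ` p = p" if "p \<in> U" for p using that US spectrum_subset gh_image by blast
  have hp: "h ` p \<in> prime_spectrum S" if "p \<in> U" for p using that US image_prime by blast
  have "pull U s \<in> (\<Pi>\<^sub>E p\<in>U. carrier (localization R p))"
  proof
    fix p assume p: "p \<in> U"
    have "s (h ` p) \<in> carrier (localization S (h ` p))"
      using s p by (auto simp: structure_sheaf_def PiE_def Pi_def)
    then have "map_prod g g ` s (h ` p) \<in> carrier (localization R (g ` h ` p))"
      using inv.localization_image(1)[OF inv.spectrum_subset[OF hp[OF p]]] by blast
    then show "pull U s p \<in> carrier (localization R p)" using ghp[OF p] p by (simp add: pull_def)
  qed (simp add: pull_def)
  moreover have "\<exists>V\<in>spec_opens R. p \<in> V \<and> V \<subseteq> U \<and>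
          (\<exists>a\<in>carrier R. \<exists>f\<in>carrier R. \<forall>q\<in>V. f \<notin> q \<and> pull U s q = pfrac R q a f)" if p: "p \<in> U" for p
  proof -
    have "\<forall>p\<in>(`) h ` U. \<exists>V\<in>spec_opens S. p \<in> V \<and> V \<subseteq> (`) h ` U \<and>
          (\<exists>a\<in>carrier S. \<exists>f\<in>carrier S. \<forall>q\<in>V. f \<notin> q \<and> s q = pfrac S q a f)"
      using s by (simp only: structure_sheaf_def partial_object.simps mem_Collect_eq) (rule conjunct2)
    from bspec[OF this imageI[OF p]] obtain V a f where
      V: "V \<in> spec_opens S" "h ` p \<in> V" "V \<subseteq> (`) h ` U" "a \<in> carrier S" "f \<in> carrier S"
      and eq0: "\<forall>q\<in>V. f \<notin> q \<and> s q = pfrac S q a f"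
      by (elim bexE conjE)
    note eq = bspec[OF eq0]
    have V': "(`) g ` V \<in> spec_opens R" by (rule inv.image_opens) fact
    have "p \<in> (`) g ` V" using V(2) ghp[OF p] by (metis image_eqI)
    moreover have VU: "(`) g ` V \<subseteq> U"
    proof
      fix q assume "q \<in> (`) g ` V"
      then obtain p' where "p' \<in> U" "q = g ` h ` p'" using V(3) by blast
      then show "q \<in> U" using ghp by simp
    qed
    moreover have "g f \<notin> q \<and> pull U s q = pfrac R q (g a) (g f)" if q: "q \<in> (`) g ` V" for q
    proof -
      from q obtain q' where q': "q' \<in> V" "q = g ` q'" by auto
      have qs: "q' \<subseteq> carrier S" using q'(1) inv.opens_subset[OF V(1)] inv.spectrum_subset by blast
      have "h ` q = q'" using q'(2) inv.gh_image[OF qs] by simp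
      moreover have "q \<in> U" using q VU by blast
      ultimately have "pull U s q = map_prod g g ` pfrac S q' a f" using eq[OF q'(1)] by (simp add: pull_def)
      also have "\<dots> = pfrac R q (g a) (g f)" using inv.pfrac_image[OF qs V(4,5)] q'(2) by simp
      finally show ?thesis using inv.h_image_iff[OF qs V(5)] eq[OF q'(1)] q'(2) by simp
    qed
    ultimately show ?thesis
      by (intro bexI[OF _ V'] conjI bexI[OF _ g_closed[OF V(4)]] bexI[OF _ g_closed[OF V(5)]]) auto
  qed
  ultimately show ?thesis by (simp add: structure_sheaf_def)
qed

lemma pull_iso:
  assumes U: "U \<in> spec_opens R"
  shows "pull U \<in> ring_iso (structure_sheaf S ((`) h ` U)) (structure_sheaf R U)"
proof -
  interpret inv: ring_iso_pair S R g h by unfold_locales (auto simp: g h gh hg)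
  note US = opens_subset[OF U]
  have ghp: "g ` h ` p = p" if "p \<in> U" for p using that US spectrum_subset gh_image by blast
  have hps: "h ` p \<subseteq> carrier S" if "p \<in> U" for p using that US image_prime inv.spectrum_subset by blast
  have ghU: "(`) g ` (`) h ` U = U" by (rule image_image_id) (rule ghp)
  have hU: "(`) h ` U \<in> spec_opens S" by (rule image_opens[OF U])
  have sc: "s (h ` p) \<in> carrier (localization S (h ` p))"
    if "s \<in> carrier (structure_sheaf S ((`) h ` U))" "p \<in> U" for s p
    using that by (auto simp: structure_sheaf_def PiE_def Pi_def)
  have "bij_betw (pull U) (carrier (structure_sheaf S ((`) h ` U))) (carrier (structure_sheaf R U))"
  proof (rule bij_betw_byWitness[where f' = "inv.pull ((`) h ` U)"])
    show "pull U ` carrier (structure_sheaf S ((`) h ` U)) \<subseteq> carrier (structure_sheaf R U)"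
      using pull_closed[OF U] by blast
    show "inv.pull ((`) h ` U) ` carrier (structure_sheaf R U) \<subseteq> carrier (structure_sheaf S ((`) h ` U))"
      using inv.pull_closed[OF hU] ghU by auto
    show "\<forall>s\<in>carrier (structure_sheaf S ((`) h ` U)). inv.pull ((`) h ` U) (pull U s) = s"
    proof (intro ballI ext)
      fix s q assume s: "s \<in> carrier (structure_sheaf S ((`) h ` U))"
      show "inv.pull ((`) h ` U) (pull U s) q = s q"
      proof (cases "q \<in> (`) h ` U")
        case True
        then obtain p where p: "p \<in> U" "q = h ` p" by auto
        have "map_prod h h ` map_prod g g ` s q = s q"
        proof -
          have "s q \<subseteq> carrier S \<times> carrier S"
            using localization_carrier_subset[OF sc[OF s p(1)]] p(2) by auto
          then have "map_prod h h (map_prod g g x) = x" if "x \<in> s q" for x using hg that by (cases x) auto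
          then show ?thesis by (rule image_image_id)
        qed
        then show ?thesis using True p ghp[OF p(1)] by (simp add: inv.pull_def pull_def)
      next
        case False
        then show ?thesis using s by (auto simp: inv.pull_def structure_sheaf_def PiE_def extensional_def)
      qed
    qed
    show "\<forall>s\<in>carrier (structure_sheaf R U). pull U (inv.pull ((`) h ` U) s) = s"
    proof (intro ballI ext)
      fix s p assume s: "s \<in> carrier (structure_sheaf R U)"
      show "pull U (inv.pull ((`) h ` U) s) p = s p"
      proof (cases "p \<in> U")
        case True
        have "map_prod g g ` map_prod h h ` s p = s p"
        proof -
          have "s p \<in> carrier (localization R p)" using s True by (auto simp: structure_sheaf_def PiE_def Pi_def)
          then have "s p \<subseteq> carrier R \<times> carrier R" using localization_carrier_subset by fastforce
          then have "map_prod g g (map_prod h h x) = x" if "x \<in> s p" for x using gh that by (cases x) auto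
          then show ?thesis by (rule image_image_id)
        qed
        then show ?thesis using True ghp[OF True] by (simp add: inv.pull_def pull_def)
      next
        case False
        then show ?thesis using s by (auto simp: pull_def structure_sheaf_def PiE_def extensional_def)
      qed
    qed
  qed
  moreover have "pull U \<in> ring_hom (structure_sheaf S ((`) h ` U)) (structure_sheaf R U)"
  proof (rule ring_hom_memI)
    fix s t assume s: "s \<in> carrier (structure_sheaf S ((`) h ` U))"
    show "pull U s \<in> carrier (structure_sheaf R U)" by (rule pull_closed[OF U s])
    assume t: "t \<in> carrier (structure_sheaf S ((`) h ` U))"
    show "pull U (s \<otimes>\<^bsub>structure_sheaf S ((`) h ` U)\<^esub> t) = pull U s \<otimes>\<^bsub>structure_sheaf R U\<^esub> pull U t"
      using inv.localization_image(4)[OF hps sc[OF s] sc[OF t]] ghp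
      by (auto simp: pull_def structure_sheaf_def fun_eq_iff)
    show "pull U (s \<oplus>\<^bsub>structure_sheaf S ((`) h ` U)\<^esub> t) = pull U s \<oplus>\<^bsub>structure_sheaf R U\<^esub> pull U t"
      using inv.localization_image(5)[OF hps sc[OF s] sc[OF t]] ghp
      by (auto simp: pull_def structure_sheaf_def fun_eq_iff)
  next
    show "pull U \<one>\<^bsub>structure_sheaf S ((`) h ` U)\<^esub> = \<one>\<^bsub>structure_sheaf R U\<^esub>"
      using inv.localization_image(2)[OF hps] ghp
      by (auto simp: pull_def structure_sheaf_def fun_eq_iff)
  qed
  ultimately show ?thesis by (simp add: ring_iso_def)
qed

lemma isomorphic_Spec:
  assumes \<kappa>: "\<And>c. \<kappa> c \<in> carrier R" "\<And>c. h (\<kappa> c) = \<kappa>' c"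
  shows "isomorphic_over_C (Spec R \<kappa>) (Spec S \<kappa>')"
proof -
  interpret inv: ring_iso_pair S R g h by unfold_locales (auto simp: g h gh hg)
  have ghp: "g ` h ` p = p" if "p \<in> prime_spectrum R" for p by (rule gh_image[OF spectrum_subset[OF that]])
  have hgp: "h ` g ` p = p" if "p \<in> prime_spectrum S" for p by (rule inv.gh_image[OF inv.spectrum_subset[OF that]])
  have bij: "bij_betw ((`) h) (prime_spectrum R) (prime_spectrum S)"
    by (rule bij_betw_byWitness[where f' = "(`) g"]) (use ghp hgp image_prime inv.image_prime in auto)
  have op: "U \<in> spec_opens R \<longleftrightarrow> (`) h ` U \<in> spec_opens S" if "U \<subseteq> prime_spectrum R" for U
  proof
    assume "(`) h ` U \<in> spec_opens S"
    then have "(`) g ` (`) h ` U \<in> spec_opens R" by (rule inv.image_opens)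
    moreover have "(`) g ` (`) h ` U = U" by (rule image_image_id) (use ghp that in blast)
    ultimately show "U \<in> spec_opens R" by simp
  qed (rule image_opens)
  have res: "pull V (restrict s ((`) h ` V)) = restrict (pull U s) V" if "V \<subseteq> U" for U V s
    using that by (auto simp: pull_def fun_eq_iff)
  have sc: "pull U (\<lambda>p\<in>(`) h ` U. pfrac S p (\<kappa>' c) \<one>\<^bsub>S\<^esub>) = (\<lambda>p\<in>U. pfrac R p (\<kappa> c) \<one>\<^bsub>R\<^esub>)"
    if U: "U \<in> spec_opens R" for U c
  proof
    fix p
    show "pull U (\<lambda>p\<in>(`) h ` U. pfrac S p (\<kappa>' c) \<one>\<^bsub>S\<^esub>) p = (\<lambda>p\<in>U. pfrac R p (\<kappa> c) \<one>\<^bsub>R\<^esub>) p"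
    proof (cases "p \<in> U")
      case True
      then have p: "p \<in> prime_spectrum R" using opens_subset[OF U] by blast
      have "map_prod g g ` pfrac S (h ` p) (\<kappa>' c) \<one>\<^bsub>S\<^esub> = pfrac R (g ` h ` p) (g (\<kappa>' c)) (g \<one>\<^bsub>S\<^esub>)"
        using inv.pfrac_image[OF inv.spectrum_subset[OF image_prime[OF p]], of "\<kappa>' c" "\<one>\<^bsub>S\<^esub>"] h_closed[OF \<kappa>(1)] \<kappa>(2)
        by simp
      also have "\<dots> = pfrac R p (\<kappa> c) \<one>\<^bsub>R\<^esub>"
        using ghp[OF p] \<kappa> gh by (metis inv.hom.hom_one)
      finally show ?thesis using True by (simp add: pull_def)
    qed (simp add: pull_def)
  qed
  show ?thesis
    unfolding isomorphic_over_C_def Spec_def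
    by (rule exI[of _ "(`) h"], rule exI[of _ pull]) (use bij op pull_iso res sc in auto)
qed

end

lemma isomorphic_Spec_ring_iso:
  assumes "cring R" "cring S" "h \<in> ring_iso R S"
    and "\<And>c. \<kappa> c \<in> carrier R" "\<And>c. h (\<kappa> c) = \<kappa>' c"
  shows "isomorphic_over_C (Spec R \<kappa>) (Spec S \<kappa>')"
proof -
  interpret R: cring R by fact
  interpret S: cring S by fact
  have h: "h \<in> ring_hom R S" "bij_betw h (carrier R) (carrier S)" using assms(3) by (auto simp: ring_iso_def)
  have "inv_into (carrier R) h \<in> ring_iso S R"
    by (rule ring_iso_set_sym[OF R.ring_axioms assms(3)])
  then have g: "inv_into (carrier R) h \<in> ring_hom S R" by (auto simp: ring_iso_def)
  have "ring_iso_pair R S h (inv_into (carrier R) h)"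
    using h g bij_betw_inv_into_left[OF h(2)] bij_betw_inv_into_right[OF h(2)]
    by unfold_locales auto
  from ring_iso_pair.isomorphic_Spec[OF this assms(4,5)] show ?thesis .
qed

text \<open>The quotient that defines the fibre is a quotient by the kernel of \<open>h\<close>,
  hence isomorphic to \<open>S\<close> by the first isomorphism theorem. What remains for the family
  is to find a surjective homomorphism and to compute its kernel.\<close>

lemma isomorphic_fibre:
  assumes A: "cring A" and S: "cring S" and h: "h \<in> ring_hom A S" "h ` carrier A = carrier S"
    and ker: "a_kernel A S h = genideal A (\<iota> ` J)"
    and \<kappa>: "\<And>c. \<kappa> c \<in> carrier A" "\<And>c. h (\<kappa> c) = \<kappa>' c"
  shows "isomorphic_over_C (fibre A \<kappa> \<iota> J) (Spec S \<kappa>')"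
proof -
  interpret A: cring A by fact
  interpret S: cring S by fact
  interpret h: ring_hom_cring A S h using h by unfold_locales
  have hr: "ring_hom_ring A S h" by unfold_locales (rule h)
  have iso: "(\<lambda>X. the_elem (h ` X)) \<in> ring_iso (A Quot a_kernel A S h) S"
    by (rule ring_hom_ring.FactRing_iso_set[OF hr h(2)])
  interpret I: ideal "a_kernel A S h" A by (rule ring_hom_ring.kernel_is_ideal[OF hr])
  have q: "cring (A Quot a_kernel A S h)" by (rule I.quotient_is_cring[OF A])
  have "isomorphic_over_C (Spec (A Quot a_kernel A S h) (\<lambda>c. a_kernel A S h +>\<^bsub>A\<^esub> \<kappa> c)) (Spec S \<kappa>')"
  proof (rule isomorphic_Spec_ring_iso[OF q S iso])
    fix c
    show "a_kernel A S h +>\<^bsub>A\<^esub> \<kappa> c \<in> carrier (A Quot a_kernel A S h)"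
      by (rule ring_hom_closed[OF I.rcos_ring_hom \<kappa>(1)])
    show "the_elem (h ` (a_kernel A S h +>\<^bsub>A\<^esub> \<kappa> c)) = \<kappa>' c"
      unfolding ring_hom_ring.the_elem_simp[OF hr \<kappa>(1)] by (rule \<kappa>(2))
  qed
  then show ?thesis by (simp add: fibre_def ker Let_def)
qed

subsection \<open>Minima over polyhedra\<close>

lemma lookup_scaleq [simp]: "lookup (scaleq s v) i = s * lookup v i"
  by (simp add: scaleq_def Poly_Mapping.map.rep_eq when_def)

lemma pairing_eq_sum: "finite A \<Longrightarrow> keys v \<subseteq> A \<Longrightarrow> pairing v u = (\<Sum>i\<in>A. lookup v i * lookup u i)"
  unfolding pairing_def by (rule sum.mono_neutral_left) (auto simp: in_keys_iff)

lemma pairing_add_left: "pairing (v + w) u = pairing v u + pairing w u"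
proof -
  have "keys (v + w) \<subseteq> keys v \<union> keys w" by (rule keys_add)
  then show ?thesis
    using pairing_eq_sum[of "keys v \<union> keys w" "v + w" u] pairing_eq_sum[of "keys v \<union> keys w" v u]
      pairing_eq_sum[of "keys v \<union> keys w" w u]
    by (simp add: lookup_add algebra_simps sum.distrib)
qed

lemma pairing_scaleq_left: "pairing (scaleq s v) u = s * pairing v u"
proof -
  have "keys (scaleq s v) \<subseteq> keys v" by (auto simp: in_keys_iff)
  then show ?thesis
    using pairing_eq_sum[of "keys v" "scaleq s v" u] pairing_eq_sum[of "keys v" v u]
    by (simp add: sum_distrib_left mult.assoc)
qed

lemma pairing_add_right: "pairing v (u + w) = pairing v u + pairing v w"
  by (simp add: pairing_def lookup_add algebra_simps sum.distrib)

lemma pairing_zero_left [simp]: "pairing 0 u = 0"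
  by (simp add: pairing_def)

lemma pairing_zero_right [simp]: "pairing v 0 = 0"
  by (simp add: pairing_def)

lemma qspace_add: "v \<in> qspace n \<Longrightarrow> w \<in> qspace n \<Longrightarrow> v + w \<in> qspace n"
  using keys_add[of v w] by (auto simp: qspace_def)

lemma qspace_scaleq: "v \<in> qspace n \<Longrightarrow> scaleq s v \<in> qspace n"
  by (auto simp: qspace_def in_keys_iff)

lemma qspace_0 [simp]: "0 \<in> qspace n"
  by (simp add: qspace_def)

lemma scaleq_0 [simp]: "scaleq s 0 = 0" "scaleq 0 v = 0" and scaleq_1 [simp]: "scaleq 1 v = v"
  by (auto intro!: poly_mapping_eqI)

lemma rat_vec_add: "rat_vec (u + w) = rat_vec u + rat_vec w"
  by (auto intro!: poly_mapping_eqI simp: rat_vec_def Poly_Mapping.map.rep_eq lookup_add when_def)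

lemma rat_vec_0 [simp]: "rat_vec 0 = 0"
  by (auto intro!: poly_mapping_eqI simp: rat_vec_def Poly_Mapping.map.rep_eq when_def)

text \<open>Among the points with value at most that of \<open>v\<close>, one lying on a maximal set of facets attains a
  value that only depends on that set of facets; hence the infimum is a minimum over finitely many
  values.\<close>

lemma polyhedron_pairing_attains_min:
  assumes "polyhedron n \<Delta>" "\<Delta> \<noteq> {}" and u: "\<And>w. w \<in> tail n \<Delta> \<Longrightarrow> 0 \<le> pairing w u"
  obtains v where "v \<in> \<Delta>" "\<And>v'. v' \<in> \<Delta> \<Longrightarrow> pairing v u \<le> pairing v' u"
proof -
  from assms(1) obtain H where H: "finite H" "\<Delta> = {v \<in> qspace n. \<forall>(w, a)\<in>H. a \<le> pairing v w}"
    by (auto simp: polyhedron_def)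
  \<comment> \<open>The inequalities that are equalities at \<open>v\<close>.\<close>
  define T where "T v = {(w, a) \<in> H. pairing v w = a}" for v
  have finT: "finite (T v)" for v by (rule finite_subset[OF _ H(1)]) (auto simp: T_def)
  have cardT: "card (T v) \<le> card H" for v by (rule card_mono[OF H(1)]) (auto simp: T_def)
  have key: "\<exists>v'\<in>\<Delta>. pairing v' u \<le> pairing v u \<and> (\<forall>v''\<in>\<Delta>. T v'' = T v' \<longrightarrow> pairing v' u = pairing v'' u)"
    if v: "v \<in> \<Delta>" for v
  proof -
    define Q where "Q v' \<longleftrightarrow> v' \<in> \<Delta> \<and> pairing v' u \<le> pairing v u" for v'
    have "Q v" using v by (simp add: Q_def)
    \<comment> \<open>Among the points that are no worse than \<open>v\<close>, take one with the
      largest number of tight inequalities.\<close>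
    then obtain v' where v': "Q v'" "\<And>z. Q z \<Longrightarrow> card (T z) \<le> card (T v')"
      using ex_has_greatest_nat[of Q v "\<lambda>z. card (T z)" "Suc (card H)"] cardT le_imp_less_Suc by blast
    \<comment> \<open>A direction that keeps all tight inequalities tight cannot change the value.
      Otherwise walk along it in the decreasing sense: either a further inequality becomes tight,
      which contradicts maximality, or the walk never ends and the direction lies in the tail cone,
      which contradicts the assumption on \<open>u\<close>.\<close>
    have const: "pairing d u = 0" if d: "d \<in> qspace n" "\<And>w a. (w, a) \<in> T v' \<Longrightarrow> pairing d w = 0" for d
    proof -
      have nonneg: "0 \<le> pairing d u" if d: "d \<in> qspace n" "\<And>w a. (w, a) \<in> T v' \<Longrightarrow> pairing d w = 0" for d
      proof (rule ccontr)
        assume neg: "\<not> 0 \<le> pairing d u"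
        have v'D: "v' \<in> qspace n" "\<And>w a. (w, a) \<in> H \<Longrightarrow> a \<le> pairing v' w"
          using v'(1) H(2) by (auto simp: Q_def)
        define N where "N = {(w, a) \<in> H. pairing d w < 0}"
        have Nfin: "finite N" by (rule finite_subset[OF _ H(1)]) (auto simp: N_def)
        show False
        proof (cases "N = {}")
          case True
          have "d \<in> tail n \<Delta>" unfolding tail_def
          proof (intro CollectI conjI ballI allI impI)
            fix z and s :: rat assume z: "z \<in> \<Delta>" "0 \<le> s"
            have "a \<le> pairing (z + scaleq s d) w" if "(w, a) \<in> H" for w a
            proof -
              have "0 \<le> pairing d w" using True that by (auto simp: N_def not_less)
              then have "0 \<le> s * pairing d w" using z by simp
              moreover have "a \<le> pairing z w" using z that H(2) by auto
              ultimately show ?thesis by (simp add: pairing_add_left pairing_scaleq_left)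
            qed
            then show "z + scaleq s d \<in> \<Delta>" using z d H(2) by (auto intro!: qspace_add qspace_scaleq)
          qed (rule d)
          then show False using u neg by blast
        next
          case False
          \<comment> \<open>The ratio test of the simplex method: \<open>s\<close> is the longest
            step along \<open>d\<close> that stays in \<open>\<Delta>\<close>, and
            \<open>(w0, a0)\<close> is an inequality that stops it.\<close>
          define r where "r = (\<lambda>(w, a). (pairing v' w - a) / (- pairing d w))"
          define s where "s = Min (r ` N)"
          obtain w0 a0 where wa0: "(w0, a0) \<in> N" "s = r (w0, a0)"
          proof -
            have "s \<in> r ` N" unfolding s_def using Nfin False by (intro Min_in) auto
            then show ?thesis using that by auto
          qed
          have s_le: "s \<le> r (w, a)" if "(w, a) \<in> N" for w a
            using Nfin that by (auto simp: s_def intro!: Min_le)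
          have s0: "0 \<le> s"
          proof -
            have "0 \<le> (pairing v' w0 - a0) / (- pairing d w0)"
              using wa0(1) v'D(2)[of w0 a0] by (intro divide_nonneg_pos) (auto simp: N_def)
            then show ?thesis by (simp only: wa0(2) r_def prod.case)
          qed
          define z where "z = v' + scaleq s d"
          have pz: "pairing z w = pairing v' w + s * pairing d w" for w
            by (simp add: z_def pairing_add_left pairing_scaleq_left)
          have "a \<le> pairing z w" if wa: "(w, a) \<in> H" for w a
          proof (cases "pairing d w < 0")
            case True
            then have "s \<le> (pairing v' w - a) / (- pairing d w)" using s_le wa by (auto simp: N_def r_def)
            then show ?thesis using True by (simp add: pz field_simps)
          next
            case False
            then have "0 \<le> s * pairing d w" using s0 by simp
            then show ?thesis using v'D(2)[OF wa] by (simp add: pz)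
          qed
          then have "z \<in> \<Delta>" using H(2) v'D d by (auto simp: z_def intro!: qspace_add qspace_scaleq)
          moreover have "pairing z u \<le> pairing v' u" using neg s0 by (simp add: pz mult_nonneg_nonpos)
          ultimately have "Q z" using v'(1) by (auto simp: Q_def)
          have "T v' \<subseteq> T z" using d(2) by (auto simp: T_def pz)
          moreover have "(w0, a0) \<in> T z"
          proof -
            have "pairing d w0 < 0" using wa0 by (simp add: N_def)
            then have "s * pairing d w0 = a0 - pairing v' w0" using wa0(2) by (simp add: r_def field_simps)
            then show ?thesis using wa0 by (auto simp: T_def pz N_def)
          qed
          moreover have "(w0, a0) \<notin> T v'" using d(2) wa0(1) by (auto simp: N_def)
          ultimately have "T v' \<subset> T z" by blast
          then have "card (T v') < card (T z)" by (rule psubset_card_mono[OF finT])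
          then show False using v'(2)[OF \<open>Q z\<close>] by simp
        qed
      qed
      have "0 \<le> pairing (scaleq (- 1) d) u"
        using d by (intro nonneg) (auto simp: pairing_scaleq_left intro: qspace_scaleq)
      then show ?thesis using nonneg[of d] d by (simp add: pairing_scaleq_left)
    qed
    have "pairing v' u = pairing v'' u" if v'': "v'' \<in> \<Delta>" "T v'' = T v'" for v''
    proof -
      have "pairing (v'' + scaleq (- 1) v') u = 0"
      proof (rule const)
        show "v'' + scaleq (- 1) v' \<in> qspace n"
          using v'' v'(1) H(2) by (auto simp: Q_def intro!: qspace_add qspace_scaleq)
        fix w a assume wa: "(w, a) \<in> T v'"
        then have "(w, a) \<in> T v''" using v''(2) by simp
        then show "pairing (v'' + scaleq (- 1) v') w = 0"
          using wa by (simp add: T_def pairing_add_left pairing_scaleq_left)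
      qed
      then show ?thesis by (simp add: pairing_add_left pairing_scaleq_left)
    qed
    then show ?thesis using v'(1) unfolding Q_def by blast
  qed
  then have "\<forall>v\<in>\<Delta>. \<exists>v'. v' \<in> \<Delta> \<and> pairing v' u \<le> pairing v u \<and> (\<forall>v''\<in>\<Delta>. T v'' = T v' \<longrightarrow> pairing v' u = pairing v'' u)"
    by blast
  then obtain m where m: "\<And>v. v \<in> \<Delta> \<Longrightarrow> m v \<in> \<Delta>" "\<And>v. v \<in> \<Delta> \<Longrightarrow> pairing (m v) u \<le> pairing v u"
    "\<And>v v''. v \<in> \<Delta> \<Longrightarrow> v'' \<in> \<Delta> \<Longrightarrow> T v'' = T (m v) \<Longrightarrow> pairing (m v) u = pairing v'' u"
    by metis
  define W where "W = (\<lambda>v. pairing (m v) u) ` \<Delta>"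
  \<comment> \<open>Each value in \<open>W\<close> is determined by a set of tight inequalities, of
    which there are finitely many.\<close>
  have "W \<subseteq> (\<lambda>t. pairing (m (SOME v. v \<in> \<Delta> \<and> T (m v) = t)) u) ` Pow H"
  proof
    fix x assume "x \<in> W"
    then obtain v where v: "v \<in> \<Delta>" "x = pairing (m v) u" by (auto simp: W_def)
    define v2 where "v2 = (SOME v'. v' \<in> \<Delta> \<and> T (m v') = T (m v))"
    have "v2 \<in> \<Delta> \<and> T (m v2) = T (m v)" unfolding v2_def by (rule someI[of _ v]) (use v in simp)
    then have "x = pairing (m v2) u" using m(3)[of v "m v2"] m(1) v by auto
    then show "x \<in> (\<lambda>t. pairing (m (SOME v. v \<in> \<Delta> \<and> T (m v) = t)) u) ` Pow H"
      unfolding v2_def by (intro image_eqI[of _ _ "T (m v)"]) (auto simp: T_def)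
  qed
  then have finW: "finite W" using H(1) by (meson finite_Pow_iff finite_imageI finite_subset)
  have Wne: "W \<noteq> {}" using assms(2) by (simp add: W_def)
  from Min_in[OF finW Wne] obtain v where v: "v \<in> \<Delta>" "Min W = pairing (m v) u" by (auto simp: W_def)
  show thesis
  proof (rule that)
    show "m v \<in> \<Delta>" using m v by blast
    fix v' assume v': "v' \<in> \<Delta>"
    have "pairing (m v) u \<le> pairing (m v') u"
      unfolding v(2)[symmetric] by (rule Min_le[OF finW]) (use v' in \<open>simp add: W_def\<close>)
    then show "pairing (m v) u \<le> pairing v' u" using m(2)[OF v'] by simp
  qed
qed

text \<open>An attained minimum gives the \<open>LEAST\<close> in \<open>minval\<close> a meaning.
  The predicate also excludes the empty set, and it is inherited by Minkowski sums.\<close>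

definition has_min :: "qvec set \<Rightarrow> zvec \<Rightarrow> bool" where
  "has_min \<Delta> u \<longleftrightarrow> (\<exists>v\<in>\<Delta>. \<forall>v'\<in>\<Delta>. pairing v (rat_vec u) \<le> pairing v' (rat_vec u))"

lemma minval_eqI:
  assumes "v \<in> \<Delta>" "\<And>v'. v' \<in> \<Delta> \<Longrightarrow> pairing v (rat_vec u) \<le> pairing v' (rat_vec u)"
  shows "minval \<Delta> u = pairing v (rat_vec u)"
  unfolding minval_def by (rule Least_equality) (use assms in auto)

lemma has_minE:
  assumes "has_min \<Delta> u"
  obtains v where "v \<in> \<Delta>" "minval \<Delta> u = pairing v (rat_vec u)"
    "\<And>v'. v' \<in> \<Delta> \<Longrightarrow> minval \<Delta> u \<le> pairing v' (rat_vec u)"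
  using assms minval_eqI unfolding has_min_def by metis

lemma has_min_polyhedron:
  assumes "polyhedron n \<Delta>" "\<Delta> \<noteq> {}" "tail n \<Delta> = \<delta>" "u \<in> weights n \<delta>"
  shows "has_min \<Delta> u"
proof -
  have "0 \<le> pairing w (rat_vec u)" if "w \<in> tail n \<Delta>" for w
    using that assms(3,4) by (auto simp: weights_def dual_cone_def)
  from polyhedron_pairing_attains_min[OF assms(1,2) this] show ?thesis
    unfolding has_min_def by metis
qed

lemma minval_plus:
  assumes "has_min A u" "has_min B u"
  shows "has_min (A + B) u" "minval (A + B) u = minval A u + minval B u"
proof -
  from assms(1) obtain v where v: "v \<in> A" "minval A u = pairing v (rat_vec u)"
    "\<And>v'. v' \<in> A \<Longrightarrow> minval A u \<le> pairing v' (rat_vec u)" by (rule has_minE) blast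
  from assms(2) obtain w where w: "w \<in> B" "minval B u = pairing w (rat_vec u)"
    "\<And>v'. v' \<in> B \<Longrightarrow> minval B u \<le> pairing v' (rat_vec u)" by (rule has_minE) blast
  have *: "v + w \<in> A + B" using v w by (auto simp: set_plus_def)
  have **: "pairing (v + w) (rat_vec u) \<le> pairing z (rat_vec u)" if "z \<in> A + B" for z
  proof -
    from that obtain a b where "a \<in> A" "b \<in> B" "z = a + b" by (auto simp: set_plus_def)
    then show ?thesis using v(2) w(2) v(3)[of a] w(3)[of b] by (simp add: pairing_add_left)
  qed
  show "has_min (A + B) u" unfolding has_min_def using * ** by blast
  show "minval (A + B) u = minval A u + minval B u"
    using minval_eqI[OF * **] v w by (simp add: pairing_add_left)
qed

lemma minval_zero: "has_min 0 u" "minval 0 u = 0"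
  using minval_eqI[of 0 "0 :: qvec set" u] by (auto simp: has_min_def)

lemma minval_sum:
  assumes "\<And>j. j \<in> J \<Longrightarrow> has_min (\<Delta> j) u"
  shows "has_min (\<Sum>j\<in>J. \<Delta> j) u \<and> minval (\<Sum>j\<in>J. \<Delta> j) u = (\<Sum>j\<in>J. minval (\<Delta> j) u)"
  using assms
  by (induction J rule: infinite_finite_induct) (simp_all add: minval_zero minval_plus del: set_zero)

text \<open>One point that minimises \<open>u + w\<close> bounds both minima from above. After
  rounding down, this is what makes the product of two homogeneous sections a section.\<close>

lemma minval_superadditive:
  assumes "has_min \<Delta> u" "has_min \<Delta> w" "has_min \<Delta> (u + w)"
  shows "minval \<Delta> u + minval \<Delta> w \<le> minval \<Delta> (u + w)"
proof -
  from assms(3) obtain v where v: "v \<in> \<Delta>" "minval \<Delta> (u + w) = pairing v (rat_vec (u + w))" by (rule has_minE)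
  have "minval \<Delta> u \<le> pairing v (rat_vec u)" by (rule has_minE[OF assms(1)]) (use v(1) in blast)
  moreover have "minval \<Delta> w \<le> pairing v (rat_vec w)" by (rule has_minE[OF assms(2)]) (use v(1) in blast)
  ultimately show ?thesis using v(2) by (simp add: rat_vec_add pairing_add_right)
qed

lemma minval_weight_0: "\<Delta> \<noteq> {} \<Longrightarrow> minval \<Delta> 0 = 0"
  using minval_eqI[of _ \<Delta> 0] by fastforce

lemma set_sum_empty: "finite J \<Longrightarrow> (\<Sum>j\<in>J. \<Delta> j) = {} \<longleftrightarrow> (\<exists>j\<in>J. \<Delta> j = {})" for \<Delta> :: "'j \<Rightarrow> qvec set"
  by (induction J rule: finite_induct) (auto simp: set_plus_def set_zero)

lemma pointed_cone_0: "pointed_cone n \<delta> \<Longrightarrow> 0 \<in> \<delta>"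
  unfolding pointed_cone_def by (metis all_not_in_conv order_refl scaleq_0(2))

lemma minval_cone:
  assumes "pointed_cone n \<delta>" "u \<in> weights n \<delta>"
  shows "has_min \<delta> u" "minval \<delta> u = 0"
proof -
  have "\<And>v'. v' \<in> \<delta> \<Longrightarrow> pairing 0 (rat_vec u) \<le> pairing v' (rat_vec u)"
    using assms(2) by (auto simp: weights_def dual_cone_def)
  then show "has_min \<delta> u" "minval \<delta> u = 0"
    using minval_eqI[of 0 \<delta> u] pointed_cone_0[OF assms(1)] unfolding has_min_def by (auto intro!: bexI[of _ 0])
qed

lemma weights_add: "u \<in> weights n \<delta> \<Longrightarrow> w \<in> weights n \<delta> \<Longrightarrow> u + w \<in> weights n \<delta>"
  using keys_add[of u w]
  by (auto simp: weights_def dual_lattice_def dual_cone_def rat_vec_add pairing_add_right qspace_add)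

lemma weights_0: "0 \<in> weights n \<delta>"
  by (auto simp: weights_def dual_lattice_def dual_cone_def)

text \<open>\<open>divisor_sum\<close> adds \<open>\<delta>\<close> to each coefficient; polyhedra
  with that tail cone, and the empty set, absorb it.\<close>

lemma cone_plus_tail:
  assumes "0 \<in> \<delta>" "\<Delta> \<noteq> {} \<Longrightarrow> tail n \<Delta> = \<delta>"
  shows "\<delta> + \<Delta> = \<Delta>"
proof (cases "\<Delta> = {}")
  case False
  have "v + w \<in> \<Delta>" if "w \<in> \<delta>" "v \<in> \<Delta>" for v w
  proof -
    have "w \<in> tail n \<Delta>" using that assms(2)[OF False] by simp
    then have "v + scaleq 1 w \<in> \<Delta>" using that(2) unfolding tail_def by (auto dest!: bspec[of _ _ v] spec[of _ 1])
    then show ?thesis by simp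
  qed
  then have "\<delta> + \<Delta> \<subseteq> \<Delta>" by (auto simp: set_plus_def add.commute)
  moreover have "\<Delta> \<subseteq> \<delta> + \<Delta>" using set_zero_plus2[OF assms(1)] .
  ultimately show ?thesis by blast
qed (simp add: set_plus_def)

text \<open>At most one summand contributes a fractional part, so rounding down commutes with the sum.\<close>

lemma floor_sum_admissible:
  fixes x :: "'j \<Rightarrow> rat"
  assumes "finite J" "\<And>i j. i \<in> J \<Longrightarrow> j \<in> J \<Longrightarrow> x i \<notin> \<int> \<Longrightarrow> x j \<notin> \<int> \<Longrightarrow> i = j"
  shows "\<lfloor>\<Sum>j\<in>J. x j\<rfloor> = (\<Sum>j\<in>J. \<lfloor>x j\<rfloor>)"
proof (cases "\<forall>j\<in>J. x j \<in> \<int>")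
  case True
  then have "(\<Sum>j\<in>J. x j) = of_int (\<Sum>j\<in>J. \<lfloor>x j\<rfloor>)" by (simp add: of_int_floor)
  then show ?thesis by (simp only: floor_of_int)
next
  case False
  then obtain i where i: "i \<in> J" "x i \<notin> \<int>" by blast
  have "(\<Sum>j\<in>J. x j) = x i + (\<Sum>j\<in>J - {i}. x j)" by (rule sum.remove) (use assms i in auto)
  also have "(\<Sum>j\<in>J - {i}. x j) = (\<Sum>j\<in>J - {i}. of_int \<lfloor>x j\<rfloor>)"
  proof (rule sum.cong[OF refl])
    fix j assume "j \<in> J - {i}"
    then have "x j \<in> \<int>" using assms(2)[of i j] i by blast
    then show "x j = of_int \<lfloor>x j\<rfloor>" by (simp add: of_int_floor)
  qed
  also have "\<dots> = of_int (\<Sum>j\<in>J - {i}. \<lfloor>x j\<rfloor>)" by simp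
  finally have "\<lfloor>\<Sum>j\<in>J. x j\<rfloor> = \<lfloor>x i\<rfloor> + (\<Sum>j\<in>J - {i}. \<lfloor>x j\<rfloor>)"
    by (metis floor_add_int)
  also have "\<dots> = (\<Sum>j\<in>J. \<lfloor>x j\<rfloor>)" by (rule sum.remove[symmetric]) (use assms i in auto)
  finally show ?thesis .
qed

subsection \<open>Polynomials\<close>

definition ring_homo :: "('a::comm_ring_1 \<Rightarrow> 'b::comm_ring_1) \<Rightarrow> bool" where
  "ring_homo \<phi> \<longleftrightarrow> \<phi> 1 = 1 \<and> (\<forall>a b. \<phi> (a + b) = \<phi> a + \<phi> b \<and> \<phi> (a * b) = \<phi> a * \<phi> b)"

lemma ring_homoD:
  assumes "ring_homo \<phi>"
  shows "\<phi> 1 = 1" "\<phi> (a + b) = \<phi> a + \<phi> b" "\<phi> (a * b) = \<phi> a * \<phi> b" "\<phi> 0 = 0" "\<phi> (- a) = - \<phi> a"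
    "\<phi> (a - b) = \<phi> a - \<phi> b" "\<phi> (sum f A) = (\<Sum>x\<in>A. \<phi> (f x))" "\<phi> (prod f A) = (\<Prod>x\<in>A. \<phi> (f x))"
    "\<phi> (a ^ k) = \<phi> a ^ k"
proof -
  have one: "\<phi> 1 = 1" and add: "\<phi> (a + b) = \<phi> a + \<phi> b" and mult: "\<phi> (a * b) = \<phi> a * \<phi> b" for a b
    using assms by (auto simp: ring_homo_def)
  have zero: "\<phi> 0 = 0" using add[of 0 0] by simp
  have neg: "\<phi> (- a) = - \<phi> a" for a using add[of a "- a"] zero by (simp add: eq_neg_iff_add_eq_0 add.commute)
  show "\<phi> 1 = 1" "\<phi> (a + b) = \<phi> a + \<phi> b" "\<phi> (a * b) = \<phi> a * \<phi> b" "\<phi> 0 = 0" "\<phi> (- a) = - \<phi> a"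
    by (fact one add mult zero neg)+
  show "\<phi> (a - b) = \<phi> a - \<phi> b" using add[of a "- b"] neg by simp
  show "\<phi> (sum f A) = (\<Sum>x\<in>A. \<phi> (f x))" by (induction A rule: infinite_finite_induct) (auto simp: zero add)
  show "\<phi> (prod f A) = (\<Prod>x\<in>A. \<phi> (f x))" by (induction A rule: infinite_finite_induct) (auto simp: one mult)
  show "\<phi> (a ^ k) = \<phi> a ^ k" by (induction k) (auto simp: one mult)
qed

definition mono_val :: "(coord \<Rightarrow> 'a::comm_ring_1) \<Rightarrow> (coord \<Rightarrow>\<^sub>0 nat) \<Rightarrow> 'a" where
  "mono_val \<sigma> m = (\<Prod>v\<in>keys m. \<sigma> v ^ lookup m v)"

text \<open>The map \<open>\<kappa>\<close> on coefficients is a parameter, so that evaluation at a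
  point, substitution of polynomials and the passage to one variable are instances of one
  construction.\<close>

definition insertion :: "(complex \<Rightarrow> 'a::comm_ring_1) \<Rightarrow> (coord \<Rightarrow> 'a) \<Rightarrow> Defs.poly \<Rightarrow> 'a" where
  "insertion \<kappa> \<sigma> F = (\<Sum>m\<in>keys F. \<kappa> (lookup F m) * mono_val \<sigma> m)"

lemma poly_eval_insertion: "poly_eval x = insertion (\<lambda>c. c) x"
  by (rule ext) (simp add: poly_eval_def insertion_def mono_val_def)

lemma mono_val_superset: "finite A \<Longrightarrow> keys m \<subseteq> A \<Longrightarrow> mono_val \<sigma> m = (\<Prod>v\<in>A. \<sigma> v ^ lookup m v)"
  unfolding mono_val_def by (rule prod.mono_neutral_left) (auto simp: in_keys_iff)

lemma mono_val_add: "mono_val \<sigma> (m + m') = mono_val \<sigma> m * mono_val \<sigma> m'"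
  using mono_val_superset[of "keys m \<union> keys m'" m \<sigma>] mono_val_superset[of "keys m \<union> keys m'" m' \<sigma>]
    mono_val_superset[of "keys m \<union> keys m'" "m + m'" \<sigma>] keys_add[of m m']
  by (simp add: lookup_add power_add prod.distrib)

lemma mono_val_0 [simp]: "mono_val \<sigma> 0 = 1"
  by (simp add: mono_val_def)

lemma mono_val_single: "mono_val \<sigma> (Poly_Mapping.single v k) = \<sigma> v ^ k"
  by (cases "k = 0") (auto simp: mono_val_def)

lemma insertion_superset:
  "ring_homo \<kappa> \<Longrightarrow> finite A \<Longrightarrow> keys F \<subseteq> A \<Longrightarrow> insertion \<kappa> \<sigma> F = (\<Sum>m\<in>A. \<kappa> (lookup F m) * mono_val \<sigma> m)"
  unfolding insertion_def by (rule sum.mono_neutral_left) (auto simp: in_keys_iff ring_homoD(4))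

lemma insertion_single: "ring_homo \<kappa> \<Longrightarrow> insertion \<kappa> \<sigma> (Poly_Mapping.single m c) = \<kappa> c * mono_val \<sigma> m"
  by (cases "c = 0") (auto simp: insertion_def ring_homoD(4))

lemma poly_mapping_sum_single: "F = (\<Sum>m\<in>keys F. Poly_Mapping.single m (lookup F m))"
  by (rule poly_mapping_eqI) (simp add: lookup_sum lookup_single when_def in_keys_iff sum.delta)

lemma insertion_add: "ring_homo \<kappa> \<Longrightarrow> insertion \<kappa> \<sigma> (F + G) = insertion \<kappa> \<sigma> F + insertion \<kappa> \<sigma> G"
  using insertion_superset[of \<kappa> "keys F \<union> keys G" F \<sigma>] insertion_superset[of \<kappa> "keys F \<union> keys G" G \<sigma>]
    insertion_superset[of \<kappa> "keys F \<union> keys G" "F + G" \<sigma>] keys_add[of F G]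
  by (simp add: lookup_add ring_homoD(2) algebra_simps sum.distrib)

lemma insertion_sum: "ring_homo \<kappa> \<Longrightarrow> insertion \<kappa> \<sigma> (sum f A) = (\<Sum>x\<in>A. insertion \<kappa> \<sigma> (f x))"
  by (induction A rule: infinite_finite_induct) (auto simp: insertion_add, auto simp: insertion_def)

lemma ring_homo_insertion:
  assumes "ring_homo \<kappa>"
  shows "ring_homo (insertion \<kappa> \<sigma>)"
  unfolding ring_homo_def
proof (intro conjI allI)
  show "insertion \<kappa> \<sigma> 1 = 1" using insertion_single[OF assms, of \<sigma> 0 1] ring_homoD(1)[OF assms] by simp
  show "insertion \<kappa> \<sigma> (F + G) = insertion \<kappa> \<sigma> F + insertion \<kappa> \<sigma> G" for F G by (rule insertion_add[OF assms])
  fix F G :: Defs.poly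
  have "F * G = (\<Sum>m\<in>keys F. \<Sum>m'\<in>keys G. Poly_Mapping.single (m + m') (lookup F m * lookup G m'))"
    by (subst (1) poly_mapping_sum_single[of F], subst (1) poly_mapping_sum_single[of G])
      (simp add: sum_product mult_single)
  then have "insertion \<kappa> \<sigma> (F * G) =
     (\<Sum>m\<in>keys F. \<Sum>m'\<in>keys G. \<kappa> (lookup F m) * mono_val \<sigma> m * (\<kappa> (lookup G m') * mono_val \<sigma> m'))"
    by (simp add: insertion_sum[OF assms] insertion_single[OF assms] ring_homoD(3)[OF assms] mono_val_add mult_ac)
  then show "insertion \<kappa> \<sigma> (F * G) = insertion \<kappa> \<sigma> F * insertion \<kappa> \<sigma> G"
    by (simp add: insertion_def sum_product)
qed

lemma insertion_poly_var: "ring_homo \<kappa> \<Longrightarrow> insertion \<kappa> \<sigma> (poly_var v) = \<sigma> v"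
  by (simp add: poly_var_def insertion_single mono_val_single ring_homoD(1))

lemma insertion_const: "ring_homo \<kappa> \<Longrightarrow> insertion \<kappa> \<sigma> (Poly_Mapping.single 0 c) = \<kappa> c"
  by (simp add: insertion_single)

lemma hom_insertion:
  assumes "ring_homo \<phi>"
  shows "\<phi> (insertion \<kappa> \<sigma> F) = insertion (\<lambda>c. \<phi> (\<kappa> c)) (\<lambda>v. \<phi> (\<sigma> v)) F"
  by (simp add: insertion_def mono_val_def ring_homoD[OF assms])

lemma insertion_cong:
  assumes "\<And>c. \<kappa> c = \<kappa>' c" "\<And>m v. m \<in> keys F \<Longrightarrow> v \<in> keys m \<Longrightarrow> \<sigma> v = \<tau> v"
  shows "insertion \<kappa> \<sigma> F = insertion \<kappa>' \<tau> F"
  using assms by (simp add: insertion_def mono_val_def)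

lemma ring_homo_id: "ring_homo (\<lambda>x. x)" and ring_homo_single: "ring_homo (Poly_Mapping.single (0 :: coord \<Rightarrow>\<^sub>0 nat) :: complex \<Rightarrow> _)"
  and ring_homo_pCons: "ring_homo (\<lambda>c. [:c:] :: complex Polynomial.poly)"
  by (auto simp: ring_homo_def single_add mult_single)

lemma ring_homo_poly_eval: "ring_homo (poly_eval x)"
  unfolding poly_eval_insertion by (rule ring_homo_insertion[OF ring_homo_id])

lemmas poly_eval_simps = ring_homoD[OF ring_homo_poly_eval]

definition psubst :: "(coord \<Rightarrow> Defs.poly) \<Rightarrow> Defs.poly \<Rightarrow> Defs.poly" where
  "psubst = insertion (Poly_Mapping.single 0)"

lemma ring_homo_psubst: "ring_homo (psubst \<sigma>)"
  unfolding psubst_def by (rule ring_homo_insertion[OF ring_homo_single])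

lemma psubst_poly_var: "psubst \<sigma> (poly_var v) = \<sigma> v"
  unfolding psubst_def by (rule insertion_poly_var[OF ring_homo_single])

lemma psubst_const: "psubst \<sigma> (Poly_Mapping.single 0 c) = Poly_Mapping.single 0 c"
  unfolding psubst_def by (rule insertion_const[OF ring_homo_single])

lemma poly_eval_psubst: "poly_eval x (psubst \<sigma> F) = poly_eval (\<lambda>v. poly_eval x (\<sigma> v)) F"
proof -
  have "poly_eval x (psubst \<sigma> F) =
      insertion (\<lambda>c. poly_eval x (Poly_Mapping.single 0 c)) (\<lambda>v. poly_eval x (\<sigma> v)) F"
    unfolding psubst_def by (rule hom_insertion[OF ring_homo_poly_eval])
  also have "\<dots> = poly_eval (\<lambda>v. poly_eval x (\<sigma> v)) F"
    unfolding poly_eval_insertion by (rule insertion_cong) (simp_all add: insertion_const[OF ring_homo_id])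
  finally show ?thesis .
qed

lemma poly_var_power: "poly_var v ^ k = Poly_Mapping.single (Poly_Mapping.single v k) 1"
  by (induction k) (simp_all add: poly_var_def mult_single single_add[symmetric])

lemma mono_val_poly_var: "mono_val poly_var m = Poly_Mapping.single m 1"
proof -
  have "(\<Prod>v\<in>A. poly_var v ^ lookup m v) = Poly_Mapping.single (\<Sum>v\<in>A. Poly_Mapping.single v (lookup m v)) 1" for A
    by (induction A rule: infinite_finite_induct) (auto simp: poly_var_power mult_single)
  then show ?thesis using poly_mapping_sum_single[of m] by (simp add: mono_val_def)
qed

lemma psubst_id:
  assumes "\<And>m v. m \<in> keys F \<Longrightarrow> v \<in> keys m \<Longrightarrow> \<sigma> v = poly_var v"
  shows "psubst \<sigma> F = F"
proof -
  have "psubst \<sigma> F = insertion (Poly_Mapping.single 0) poly_var F"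
    unfolding psubst_def by (rule insertion_cong) (use assms in auto)
  also have "\<dots> = F"
    using poly_mapping_sum_single[of F] by (simp add: insertion_def mono_val_poly_var mult_single)
  finally show ?thesis .
qed

subsection \<open>Polynomials homogeneous in the coordinates of the projective line\<close>

lemma hpolys_0 [simp]: "0 \<in> hpolys V d"
  by (simp add: hpolys_def)

lemma hpolys_add: "F \<in> hpolys V d \<Longrightarrow> G \<in> hpolys V d \<Longrightarrow> F + G \<in> hpolys V d"
  using keys_add[of F G] by (auto simp: hpolys_def)

lemma hpolys_sum: "(\<And>i. i \<in> A \<Longrightarrow> f i \<in> hpolys V d) \<Longrightarrow> sum f A \<in> hpolys V d"
  by (induction A rule: infinite_finite_induct) (auto simp: hpolys_add)

lemma hpolys_uminus: "F \<in> hpolys V d \<Longrightarrow> - F \<in> hpolys V d"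
  by (simp add: hpolys_def)

lemma hpolys_diff: "F \<in> hpolys V d \<Longrightarrow> G \<in> hpolys V d \<Longrightarrow> F - G \<in> hpolys V d"
  using hpolys_add[of F V d "- G"] hpolys_uminus[of G V d] by simp

lemma hpolys_mult:
  assumes "F \<in> hpolys V d" "G \<in> hpolys V e"
  shows "F * G \<in> hpolys V (d + e)"
  unfolding hpolys_def
proof (intro CollectI ballI)
  fix m assume "m \<in> keys (F * G)"
  then obtain a b where ab: "m = a + b" "a \<in> keys F" "b \<in> keys G" using keys_mult[of F G] by auto
  then have "keys a \<subseteq> V \<and> lookup a X0 + lookup a X1 = d" "keys b \<subseteq> V \<and> lookup b X0 + lookup b X1 = e"
    using assms by (auto simp: hpolys_def)
  then show "keys m \<subseteq> V \<and> lookup m X0 + lookup m X1 = d + e"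
    using keys_add[of a b] ab(1) by (auto simp: lookup_add)
qed

lemma hpolys_mult': "F \<in> hpolys V d \<Longrightarrow> G \<in> hpolys V e \<Longrightarrow> k = d + e \<Longrightarrow> F * G \<in> hpolys V k"
  using hpolys_mult by simp

lemma hpolys_const [simp]: "Poly_Mapping.single 0 c \<in> hpolys V 0"
  by (cases "c = 0") (auto simp: hpolys_def)

lemma hpolys_1 [simp]: "1 \<in> hpolys V 0"
  using hpolys_const[of 1 V] by simp

lemma hpolys_power: "F \<in> hpolys V d \<Longrightarrow> F ^ k \<in> hpolys V (k * d)"
  by (induction k) (auto intro: hpolys_mult)

lemma hpolys_prod: "(\<And>v. v \<in> A \<Longrightarrow> f v \<in> hpolys V (d v)) \<Longrightarrow> prod f A \<in> hpolys V (sum d A)"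
  by (induction A rule: infinite_finite_induct) (auto intro: hpolys_mult)

lemma hpolys_poly_var: "v \<in> V \<Longrightarrow> poly_var v \<in> hpolys V (if v \<in> {X0, X1} then 1 else 0)"
  by (auto simp: hpolys_def poly_var_def lookup_single when_def)

lemma hpolys_mono: "F \<in> hpolys V d \<Longrightarrow> V \<subseteq> W \<Longrightarrow> F \<in> hpolys W d"
  by (auto simp: hpolys_def)

text \<open>Used with \<open>e = 0\<close>, when a form is restricted to a section of the projection
  to the parameters, and with \<open>e = 1\<close>, when only the parameters are replaced.\<close>

lemma hpolys_psubst:
  assumes F: "F \<in> hpolys V d" and "\<sigma> X0 \<in> hpolys W e" "\<sigma> X1 \<in> hpolys W e"
    and "\<And>P i. T P i \<in> V \<Longrightarrow> \<sigma> (T P i) \<in> hpolys W 0"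
  shows "psubst \<sigma> F \<in> hpolys W (d * e)"
  unfolding psubst_def insertion_def
proof (rule hpolys_sum)
  fix m assume m: "m \<in> keys F"
  define dg where "dg v = (if v \<in> {X0, X1} then e else 0)" for v
  have s: "\<sigma> v \<in> hpolys W (dg v)" if "v \<in> keys m" for v
  proof (cases v)
    case (T P i)
    then have "T P i \<in> V" using that F m by (auto simp: hpolys_def)
    then show ?thesis using assms(4) T by (simp add: dg_def)
  qed (use assms(2,3) in \<open>simp_all add: dg_def\<close>)
  have "mono_val \<sigma> m \<in> hpolys W (\<Sum>v\<in>keys m. lookup m v * dg v)"
    unfolding mono_val_def by (intro hpolys_prod hpolys_power s)
  also have "(\<Sum>v\<in>keys m. lookup m v * dg v) = (\<Sum>v\<in>keys m \<union> {X0, X1}. lookup m v * dg v)"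
    by (rule sum.mono_neutral_left) (auto simp: in_keys_iff)
  also have "\<dots> = (\<Sum>v\<in>{X0, X1}. lookup m v * dg v)"
    by (rule sum.mono_neutral_right) (auto simp: dg_def)
  also have "\<dots> = d * e" using F m by (auto simp: dg_def hpolys_def algebra_simps)
  finally show "Poly_Mapping.single 0 (lookup F m) * mono_val \<sigma> m \<in> hpolys W (d * e)"
    using hpolys_mult[OF hpolys_const] by fastforce
qed

abbreviation PX :: Defs.poly where "PX \<equiv> poly_var X0"
abbreviation PY :: Defs.poly where "PY \<equiv> poly_var X1"

lemma hpolys_expand:
  assumes "F \<in> hpolys V d"
  obtains G where "\<And>i. G i \<in> hpolys V 0" "F = (\<Sum>i\<le>d. G i * PX ^ i * PY ^ (d - i))"
proof -
  define E where "E F \<longleftrightarrow> (\<exists>G. (\<forall>i. G i \<in> hpolys V 0) \<and> F = (\<Sum>i\<le>d. G i * PX ^ i * PY ^ (d - i)))" for F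
  have E0: "E 0" unfolding E_def by (rule exI[of _ "\<lambda>_. 0"]) simp
  have Eadd: "E (F + F')" if "E F" "E F'" for F F'
  proof -
    from that obtain G G' where "\<forall>i. G i \<in> hpolys V 0" "F = (\<Sum>i\<le>d. G i * PX ^ i * PY ^ (d - i))"
      "\<forall>i. G' i \<in> hpolys V 0" "F' = (\<Sum>i\<le>d. G' i * PX ^ i * PY ^ (d - i))" unfolding E_def by blast
    then show ?thesis unfolding E_def
      by (intro exI[of _ "\<lambda>i. G i + G' i"]) (simp add: hpolys_add algebra_simps sum.distrib)
  qed
  have Esum: "E (sum f A)" if "\<And>i. i \<in> A \<Longrightarrow> E (f i)" for f and A :: "(coord \<Rightarrow>\<^sub>0 nat) set"
    using that by (induction A rule: infinite_finite_induct) (auto simp: E0 Eadd)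
  have "E (Poly_Mapping.single m c)" if m: "keys m \<subseteq> V" "lookup m X0 + lookup m X1 = d" for m c
  proof -
    \<comment> \<open>The parameter part of the monomial \<open>m\<close>.\<close>
    define m' where "m' = Poly_Mapping.update X0 0 (Poly_Mapping.update X1 0 m)"
    have meq: "m = m' + Poly_Mapping.single X0 (lookup m X0) + Poly_Mapping.single X1 (lookup m X1)"
      by (rule poly_mapping_eqI) (auto simp: m'_def lookup_add lookup_update lookup_single when_def)
    have "keys m' \<subseteq> V \<and> lookup m' X0 + lookup m' X1 = 0"
      using m(1) by (auto simp: m'_def keys_update lookup_update split: if_splits)
    then have m'H: "Poly_Mapping.single m' c \<in> hpolys V 0" by (cases "c = 0") (auto simp: hpolys_def)
    define G where "G i = (if i = lookup m X0 then Poly_Mapping.single m' c else 0)" for i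
    have "(\<Sum>i\<le>d. G i * PX ^ i * PY ^ (d - i)) = (\<Sum>i\<in>{lookup m X0}. G i * PX ^ i * PY ^ (d - i))"
      by (rule sum.mono_neutral_right) (use m(2) in \<open>auto simp: G_def\<close>)
    also have "\<dots> = Poly_Mapping.single m' c * PX ^ lookup m X0 * PY ^ lookup m X1"
      using m(2) by (auto simp: G_def)
    also have "\<dots> = Poly_Mapping.single
        (m' + Poly_Mapping.single X0 (lookup m X0) + Poly_Mapping.single X1 (lookup m X1)) c"
      by (simp add: poly_var_power mult_single)
    also have "\<dots> = Poly_Mapping.single m c" by (simp only: meq[symmetric])
    finally show ?thesis unfolding E_def using m'H by (intro exI[of _ G]) (auto simp: G_def)
  qed
  then have "E (\<Sum>m\<in>keys F. Poly_Mapping.single m (lookup F m))"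
    using assms by (intro Esum) (auto simp: hpolys_def)
  then show thesis using that poly_mapping_sum_single[of F] unfolding E_def by auto
qed

definition PV :: "(p1 \<times> nat) set \<Rightarrow> coord set" where
  "PV I = {X0, X1} \<union> {T P i | P i. (P, i) \<in> I}"

lemma PX_hpolys [simp]: "PX \<in> hpolys (PV I) 1" and PY_hpolys [simp]: "PY \<in> hpolys (PV I) 1"
  using hpolys_poly_var[of X0 "PV I"] hpolys_poly_var[of X1 "PV I"] by (auto simp: PV_def)

lemma PX_power [simp]: "PX ^ k \<in> hpolys (PV I) k" and PY_power [simp]: "PY ^ k \<in> hpolys (PV I) k"
  using hpolys_power[OF PX_hpolys[of I], of k] hpolys_power[OF PY_hpolys[of I], of k] by auto

lemma hpolys_0_no_X:
  assumes "F \<in> hpolys V 0" "m \<in> keys F" "v \<in> keys m"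
  shows "v \<in> V" "\<exists>P i. v = T P i"
proof -
  have *: "keys m \<subseteq> V" "lookup m X0 = 0" "lookup m X1 = 0" using assms(1,2) by (auto simp: hpolys_def)
  show "v \<in> V" using * assms(3) by blast
  have "v \<noteq> X0" "v \<noteq> X1" using * assms(3) by (auto simp: in_keys_iff)
  then show "\<exists>P i. v = T P i" by (cases v) auto
qed

text \<open>Any pair of homogeneous coordinates is allowed here, in contrast to the normalised
  vectors \<open>p1_coords\<close>.\<close>

definition pc :: "complex \<Rightarrow> complex \<Rightarrow> (p1 \<times> nat \<Rightarrow> complex) \<Rightarrow> coord \<Rightarrow> complex" where
  "pc z w b v = (case v of X0 \<Rightarrow> z | X1 \<Rightarrow> w | T P i \<Rightarrow> b (P, i))"

lemma pc_simps [simp]: "pc z w b X0 = z" "pc z w b X1 = w" "pc z w b (T P i) = b (P, i)"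
  by (simp_all add: pc_def)

abbreviation ev :: "(p1 \<times> nat \<Rightarrow> complex) \<Rightarrow> Defs.poly \<Rightarrow> complex" where
  "ev b \<equiv> poly_eval (aff_coords b)"

lemma poly_eval_var: "poly_eval x (poly_var v) = x v"
  unfolding poly_eval_insertion by (rule insertion_poly_var[OF ring_homo_id])

lemma poly_eval_const: "poly_eval x (Poly_Mapping.single 0 c) = c"
  unfolding poly_eval_insertion by (rule insertion_const[OF ring_homo_id])

lemma poly_eval_hpolys_0:
  assumes "F \<in> hpolys V 0"
  shows "poly_eval (pc z w b) F = ev b F"
  unfolding poly_eval_insertion
proof (rule insertion_cong)
  fix m v assume "m \<in> keys F" "v \<in> keys m"
  from hpolys_0_no_X(2)[OF assms this] show "pc z w b v = aff_coords b v" by (auto simp: aff_coords_def)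
qed simp

text \<open>Restriction to the fibre over \<open>b\<close>, in the chart where \<open>X1\<close> is
  \<open>1\<close>. For a form of known degree \<open>d\<close> nothing is lost: its value at
  infinity is the coefficient of degree \<open>d\<close>.\<close>

definition uni :: "(p1 \<times> nat \<Rightarrow> complex) \<Rightarrow> Defs.poly \<Rightarrow> complex Polynomial.poly" where
  "uni b = insertion (\<lambda>c. [:c:]) (\<lambda>v. case v of X0 \<Rightarrow> [:0, 1:] | X1 \<Rightarrow> 1 | T P i \<Rightarrow> [:b (P, i):])"

lemma ring_homo_uni: "ring_homo (uni b)"
  unfolding uni_def by (rule ring_homo_insertion[OF ring_homo_pCons])

lemmas uni_simps = ring_homoD[OF ring_homo_uni]

lemma poly_uni: "poly (uni b F) z = poly_eval (pc z 1 b) F"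
proof -
  have h: "ring_homo (\<lambda>p. poly p z)" by (simp add: ring_homo_def)
  show ?thesis unfolding uni_def poly_eval_insertion hom_insertion[OF h]
    by (rule insertion_cong) (auto simp: pc_def split: coord.split)
qed

lemma uni_X: "uni b PX = [:0, 1:]" "uni b PY = 1"
  by (simp_all add: uni_def insertion_poly_var[OF ring_homo_pCons])

lemma uni_hpolys_0:
  assumes "F \<in> hpolys V 0"
  shows "uni b F = [:ev b F:]"
proof -
  have "uni b F = insertion (\<lambda>c. [:c:]) (\<lambda>v. [:aff_coords b v:]) F"
    unfolding uni_def
  proof (rule insertion_cong)
    fix m v assume "m \<in> keys F" "v \<in> keys m"
    from hpolys_0_no_X(2)[OF assms this]
    show "(case v of X0 \<Rightarrow> [:0, 1:] | X1 \<Rightarrow> 1 | T P i \<Rightarrow> [:b (P, i):]) = [:aff_coords b v:]" by (auto simp: aff_coords_def)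
  qed simp
  also have "\<dots> = [:ev b F:]" unfolding poly_eval_insertion hom_insertion[OF ring_homo_pCons] ..
  finally show ?thesis .
qed

lemma hpolys_expand_eval:
  assumes "\<And>i. G i \<in> hpolys V 0" "F = (\<Sum>i\<le>d. G i * PX ^ i * PY ^ (d - i))"
  shows "poly_eval (pc z w b) F = (\<Sum>i\<le>d. ev b (G i) * z ^ i * w ^ (d - i))"
    and "coeff (uni b F) i = (if i \<le> d then ev b (G i) else 0)"
proof -
  show "poly_eval (pc z w b) F = (\<Sum>i\<le>d. ev b (G i) * z ^ i * w ^ (d - i))"
    unfolding assms(2) by (simp add: poly_eval_simps poly_eval_var poly_eval_hpolys_0[OF assms(1)])
  have "uni b F = (\<Sum>i\<le>d. monom (ev b (G i)) i)"
    unfolding assms(2) by (simp add: uni_simps uni_X uni_hpolys_0[OF assms(1)] monom_altdef)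
  then show "coeff (uni b F) i = (if i \<le> d then ev b (G i) else 0)"
    by (simp add: coeff_sum coeff_monom)
qed

lemma degree_uni:
  assumes "F \<in> hpolys V d"
  shows "Polynomial.degree (uni b F) \<le> d" "coeff (uni b F) d = poly_eval (pc 1 0 b) F"
proof -
  obtain G where G: "\<And>i. G i \<in> hpolys V 0" "F = (\<Sum>i\<le>d. G i * PX ^ i * PY ^ (d - i))"
    by (rule hpolys_expand[OF assms]) blast
  note e = hpolys_expand_eval[OF G]
  show "Polynomial.degree (uni b F) \<le> d" by (rule degree_le) (simp add: e)
  have "(\<Sum>i\<le>d. ev b (G i) * 1 ^ i * 0 ^ (d - i)) = (\<Sum>i\<in>{d}. ev b (G i) * 1 ^ i * 0 ^ (d - i))"
    by (rule sum.mono_neutral_right) auto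
  then show "coeff (uni b F) d = poly_eval (pc 1 0 b) F" by (simp add: e)
qed

lemma uni_eq_0D:
  assumes "F \<in> hpolys V d" "uni b F = 0"
  shows "poly_eval (pc z w b) F = 0"
proof -
  obtain G where G: "\<And>i. G i \<in> hpolys V 0" "F = (\<Sum>i\<le>d. G i * PX ^ i * PY ^ (d - i))"
    by (rule hpolys_expand[OF assms(1)]) blast
  note e = hpolys_expand_eval[OF G]
  have "ev b (G i) = 0" if "i \<le> d" for i using e(2)[of b i] assms(2) that by simp
  then show ?thesis by (simp add: e)
qed

lemma poly_eval_scale:
  assumes "F \<in> hpolys V d"
  shows "poly_eval (pc (c * z) (c * w) b) F = c ^ d * poly_eval (pc z w b) F"
proof -
  obtain G where G: "\<And>i. G i \<in> hpolys V 0" "F = (\<Sum>i\<le>d. G i * PX ^ i * PY ^ (d - i))"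
    by (rule hpolys_expand[OF assms(1)]) blast
  have "(c * z) ^ i * (c * w) ^ (d - i) = c ^ d * (z ^ i * w ^ (d - i))" if "i \<le> d" for i
    using that by (simp add: power_mult_distrib mult_ac) (simp add: power_add[symmetric] mult.assoc[symmetric])
  then show ?thesis unfolding hpolys_expand_eval(1)[OF G] sum_distrib_left
    by (intro sum.cong) (auto simp: mult_ac)
qed

section \<open>Zariski density of the base, tested on polynomials in the parameters\<close>

definition dense :: "(p1 \<times> nat) set \<Rightarrow> (p1 \<times> nat \<Rightarrow> complex) set \<Rightarrow> bool" where
  "dense I B \<longleftrightarrow> (\<forall>F\<in>hpolys (PV I) 0. (\<forall>b\<in>B. ev b F = 0) \<longrightarrow> F = 0)"

lemma dense_uni_eq_0:
  assumes "dense I B" "F \<in> hpolys (PV I) d" "\<And>b. b \<in> B \<Longrightarrow> uni b F = 0"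
  shows "F = 0"
proof -
  obtain G where G: "\<And>i. G i \<in> hpolys (PV I) 0" "F = (\<Sum>i\<le>d. G i * PX ^ i * PY ^ (d - i))"
    by (rule hpolys_expand[OF assms(2)]) blast
  have "G i = 0" if "i \<le> d" for i
  proof -
    have "ev b (G i) = 0" if "b \<in> B" for b
      using hpolys_expand_eval(2)[OF G, of b i] assms(3)[OF that] \<open>i \<le> d\<close> by simp
    then show ?thesis using assms(1) G(1) unfolding dense_def by blast
  qed
  then show ?thesis unfolding G(2) by simp
qed

text \<open>Induction over the variables: sorted by powers of \<open>v\<close>, the polynomial
  becomes at each \<open>x\<close> a polynomial in one variable \<open>t\<close> that vanishes
  identically, so its coefficients, the values of the \<open>C k\<close>, vanish. Test points that
  are zero outside \<open>A\<close> suffice; this keeps them inside \<open>aff_points\<close> later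
  on.\<close>

lemma poly_eval_all_0:
  assumes "finite A" "\<And>m. m \<in> keys F \<Longrightarrow> keys m \<subseteq> A"
    and "\<And>x. (\<And>v. v \<notin> A \<Longrightarrow> x v = 0) \<Longrightarrow> poly_eval x F = 0"
  shows "F = 0"
  using assms
proof (induction A arbitrary: F rule: finite_induct)
  case empty
  then have "keys F \<subseteq> {0}" by auto
  have "poly_eval (\<lambda>_. 0) F = (\<Sum>m\<in>{0}. lookup F m * mono_val (\<lambda>_. 0) m)"
    unfolding poly_eval_insertion using \<open>keys F \<subseteq> {0}\<close> by (intro insertion_superset[OF ring_homo_id]) auto
  then have "lookup F 0 = 0" using empty(2) by simp
  then have "keys F = {}" using \<open>keys F \<subseteq> {0}\<close> by (auto simp: in_keys_iff subset_singleton_iff)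
  then show ?case by simp
next
  case (insert v A)
  define C where "C k = (\<Sum>m\<in>{m \<in> keys F. lookup m v = k}. Poly_Mapping.single (Poly_Mapping.update v 0 m) (lookup F m))" for k
  define K where "K = (\<lambda>m. lookup m v) ` keys F"
  have msplit: "m = Poly_Mapping.update v 0 m + Poly_Mapping.single v (lookup m v)" for m :: "coord \<Rightarrow>\<^sub>0 nat"
    by (rule poly_mapping_eqI) (auto simp: lookup_add lookup_update lookup_single when_def)
  have C0: "C k = 0" for k
  proof (rule insert.IH)
    fix m assume "m \<in> keys (C k)"
    then have "m \<in> (\<Union>m\<in>{m \<in> keys F. lookup m v = k}. keys (Poly_Mapping.single (Poly_Mapping.update v 0 m) (lookup F m)))"
      unfolding C_def by (rule subsetD[OF keys_sum])
    then obtain m' where "m' \<in> keys F" "m = Poly_Mapping.update v 0 m'" by (auto split: if_splits)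
    then show "keys m \<subseteq> A" using insert.prems(1)[of m'] by (auto simp: keys_update)
  next
    fix x :: "coord \<Rightarrow> complex" assume x: "\<And>w. w \<notin> A \<Longrightarrow> x w = 0"
    define p where "p = (\<Sum>k\<in>K. monom (poly_eval x (C k)) k)"
    have "poly p t = 0" for t
    proof -
      have mv: "mono_val (x(v := t)) m = mono_val x (Poly_Mapping.update v 0 m) * t ^ lookup m v" for m
      proof -
        have "mono_val (x(v := t)) m = mono_val (x(v := t)) (Poly_Mapping.update v 0 m) * t ^ lookup m v"
          by (subst msplit) (simp only: mono_val_add mono_val_single fun_upd_same)
        also have "mono_val (x(v := t)) (Poly_Mapping.update v 0 m) = mono_val x (Poly_Mapping.update v 0 m)"
          unfolding mono_val_def by (rule prod.cong) (auto simp: keys_update)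
        finally show ?thesis .
      qed
      have "poly p t = (\<Sum>k\<in>K. poly_eval x (C k) * t ^ k)" by (simp add: p_def poly_sum poly_monom)
      also have "\<dots> = (\<Sum>k\<in>K. \<Sum>m\<in>{m \<in> keys F. lookup m v = k}. lookup F m * mono_val (x(v := t)) m)"
      proof (rule sum.cong[OF refl])
        fix k
        have "poly_eval x (C k) * t ^ k =
           (\<Sum>m\<in>{m \<in> keys F. lookup m v = k}. lookup F m * mono_val x (Poly_Mapping.update v 0 m) * t ^ k)"
          unfolding C_def poly_eval_insertion
          by (simp add: insertion_sum[OF ring_homo_id] insertion_single[OF ring_homo_id] sum_distrib_right)
        also have "\<dots> = (\<Sum>m\<in>{m \<in> keys F. lookup m v = k}. lookup F m * mono_val (x(v := t)) m)"
          by (rule sum.cong) (auto simp: mv)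
        finally show "poly_eval x (C k) * t ^ k = \<dots>" .
      qed
      also have "\<dots> = (\<Sum>m\<in>keys F. lookup F m * mono_val (x(v := t)) m)"
        unfolding K_def by (rule sum.image_gen[symmetric]) simp
      also have "\<dots> = poly_eval (x(v := t)) F"
        unfolding poly_eval_insertion insertion_def ..
      also have "\<dots> = 0" by (rule insert.prems(2)) (use x in auto)
      finally show ?thesis .
    qed
    then have "p = 0" by (simp add: poly_all_0_iff_0[symmetric])
    show "poly_eval x (C k) = 0"
    proof (cases "k \<in> K")
      case True
      have "coeff p k = poly_eval x (C k)" using True by (simp add: p_def coeff_sum coeff_monom K_def)
      then show ?thesis using \<open>p = 0\<close> by simp
    next
      case False
      then have "{m \<in> keys F. lookup m v = k} = {}" by (auto simp: K_def)
      then have "C k = 0" unfolding C_def by (simp only: sum.empty)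
      then show ?thesis by (simp add: poly_eval_simps)
    qed
  qed
  show ?case
  proof (rule poly_mapping_eqI)
    fix m
    show "lookup F m = lookup 0 m"
    proof (cases "m \<in> keys F")
      case True
      have "lookup (C (lookup m v)) (Poly_Mapping.update v 0 m) =
        (\<Sum>m'\<in>{m' \<in> keys F. lookup m' v = lookup m v}. lookup F m' when Poly_Mapping.update v 0 m' = Poly_Mapping.update v 0 m)"
        unfolding C_def by (simp add: lookup_sum lookup_single)
      also have "\<dots> = (\<Sum>m'\<in>{m' \<in> keys F. lookup m' v = lookup m v}. lookup F m' when m' = m)"
      proof (rule sum.cong[OF refl])
        fix m' assume "m' \<in> {m' \<in> keys F. lookup m' v = lookup m v}"
        then have "Poly_Mapping.update v 0 m' = Poly_Mapping.update v 0 m \<longleftrightarrow> m' = m"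
          using msplit[of m] msplit[of m'] by auto
        then show "(lookup F m' when Poly_Mapping.update v 0 m' = Poly_Mapping.update v 0 m) = (lookup F m' when m' = m)"
          by simp
      qed
      also have "\<dots> = lookup F m" using True by (simp add: when_def)
      finally show ?thesis using C0 by simp
    qed (simp add: in_keys_iff)
  qed
qed

text \<open>\<open>F * F0\<close> vanishes at every point of the affine space, at those of
  \<open>B\<close> because of \<open>F\<close> and elsewhere because of \<open>F0\<close>.\<close>

lemma dense_open:
  assumes "F0 \<in> hpolys (PV I) 0" "b0 \<in> B" "ev b0 F0 \<noteq> 0" "\<And>b. b \<in> aff_points I \<Longrightarrow> ev b F0 \<noteq> 0 \<Longrightarrow> b \<in> B"
  shows "dense I B"
  unfolding dense_def
proof (intro ballI impI)
  fix F assume F: "F \<in> hpolys (PV I) 0" "\<forall>b\<in>B. ev b F = 0"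
  have FF: "F * F0 \<in> hpolys (PV I) 0" using hpolys_mult[OF F(1) assms(1)] by simp
  have "F * F0 = 0"
  proof (rule poly_eval_all_0)
    show "finite (\<Union>m\<in>keys (F * F0). keys m)" by simp
    show "keys m \<subseteq> (\<Union>m\<in>keys (F * F0). keys m)" if "m \<in> keys (F * F0)" for m using that by blast
    fix x :: "coord \<Rightarrow> complex" assume x: "\<And>v. v \<notin> (\<Union>m\<in>keys (F * F0). keys m) \<Longrightarrow> x v = 0"
    define b where "b = (\<lambda>(P, i). x (T P i))"
    have "b \<in> aff_points I" unfolding aff_points_def
    proof (intro CollectI allI impI)
      fix k :: "p1 \<times> nat" assume k: "k \<notin> I"
      have "T (fst k) (snd k) \<notin> PV I" using k by (cases k) (auto simp: PV_def)
      then have "T (fst k) (snd k) \<notin> (\<Union>m\<in>keys (F * F0). keys m)"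
        using hpolys_0_no_X(1)[OF FF] by blast
      then show "b k = 0" using x by (simp add: b_def split_beta)
    qed
    then have "ev b (F * F0) = 0" using F(2) assms(4)[of b] by (cases "ev b F0 = 0") (auto simp: poly_eval_simps)
    also have "ev b (F * F0) = poly_eval x (F * F0)"
      unfolding poly_eval_insertion
    proof (rule insertion_cong)
      fix m v assume "m \<in> keys (F * F0)" "v \<in> keys m"
      from hpolys_0_no_X(2)[OF FF this] show "aff_coords b v = x v" by (auto simp: aff_coords_def b_def)
    qed simp
    finally show "poly_eval x (F * F0) = 0" .
  qed
  moreover have "F0 \<noteq> 0" using assms(3) by (auto simp: poly_eval_simps)
  ultimately show "F = 0" by simp
qed

text \<open>Without parameters the forms of degree \<open>0\<close> are constants. This lets the
  projective line itself be treated as a family, over a one-point base.\<close>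

lemma dense_singleton: "dense {} {b}"
  unfolding dense_def
proof (intro ballI impI)
  fix F assume F: "F \<in> hpolys (PV {}) 0" "\<forall>b\<in>{b}. ev b F = 0"
  have k: "keys F \<subseteq> {0}"
  proof
    fix m assume "m \<in> keys F"
    have "v \<notin> keys m" for v
    proof
      assume "v \<in> keys m"
      from hpolys_0_no_X[OF F(1) \<open>m \<in> keys F\<close> this] show False by (auto simp: PV_def)
    qed
    then have "keys m = {}" by blast
    then show "m \<in> {0}" by simp
  qed
  have "ev b F = (\<Sum>m\<in>{0}. lookup F m * mono_val (aff_coords b) m)"
    unfolding poly_eval_insertion using k by (intro insertion_superset[OF ring_homo_id]) auto
  then have "lookup F 0 = 0" using F(2) by simp
  then have "keys F = {}" using k by (auto simp: in_keys_iff subset_singleton_iff)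
  then show "F = 0" by simp
qed

text \<open>Restriction of a form to the section \<open>[a : b]\<close> of the projection to the
  parameter space.\<close>

definition sub0 :: "Defs.poly \<Rightarrow> Defs.poly \<Rightarrow> Defs.poly \<Rightarrow> Defs.poly" where
  "sub0 a b = psubst (\<lambda>v. case v of X0 \<Rightarrow> a | X1 \<Rightarrow> b | T P i \<Rightarrow> poly_var (T P i))"

lemma ring_homo_sub0: "ring_homo (sub0 a b)"
  unfolding sub0_def by (rule ring_homo_psubst)

lemmas sub0_simps = ring_homoD[OF ring_homo_sub0]

lemma sub0_X: "sub0 a b PX = a" "sub0 a b PY = b"
  by (simp_all add: sub0_def psubst_poly_var)

lemma sub0_hpolys_0:
  assumes "F \<in> hpolys V 0"
  shows "sub0 a b F = F"
  unfolding sub0_def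
proof (rule psubst_id)
  fix m v assume "m \<in> keys F" "v \<in> keys m"
  from hpolys_0_no_X(2)[OF assms this]
  show "(case v of X0 \<Rightarrow> a | X1 \<Rightarrow> b | T P i \<Rightarrow> poly_var (T P i)) = poly_var v" by auto
qed

lemma sub0_hpolys:
  assumes "F \<in> hpolys (PV I) d" "a \<in> hpolys (PV I) 0" "b \<in> hpolys (PV I) 0"
  shows "sub0 a b F \<in> hpolys (PV I) 0"
proof -
  have "sub0 a b F \<in> hpolys (PV I) (d * 0)" unfolding sub0_def
    by (rule hpolys_psubst[OF assms(1)])
      (use assms(2,3) hpolys_poly_var[of "T _ _" "PV I"] in simp_all)
  then show ?thesis by simp
qed

lemma ev_sub0:
  assumes "a \<in> hpolys V 0" "a' \<in> hpolys V 0"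
  shows "ev b (sub0 a a' F) = poly_eval (pc (ev b a) (ev b a') b) F"
  unfolding sub0_def poly_eval_psubst
  by (rule arg_cong[where f = "\<lambda>x. poly_eval x F"])
    (auto simp: fun_eq_iff pc_def poly_eval_var aff_coords_def split: coord.split)

text \<open>Restriction to the fibre over \<open>b\<close>, with the result again a form in
  \<open>X0\<close> and \<open>X1\<close>, so that a fibre and the total space have their functions
  in the same field.\<close>

definition subT :: "(p1 \<times> nat \<Rightarrow> complex) \<Rightarrow> Defs.poly \<Rightarrow> Defs.poly" where
  "subT b = psubst (\<lambda>v. case v of X0 \<Rightarrow> PX | X1 \<Rightarrow> PY | T P i \<Rightarrow> Poly_Mapping.single 0 (b (P, i)))"

lemma ring_homo_subT: "ring_homo (subT b)"
  unfolding subT_def by (rule ring_homo_psubst)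

lemmas subT_simps = ring_homoD[OF ring_homo_subT]

lemma subT_X: "subT b PX = PX" "subT b PY = PY"
  by (simp_all add: subT_def psubst_poly_var)

lemma subT_const: "subT b (Poly_Mapping.single 0 c) = Poly_Mapping.single 0 c"
  by (simp add: subT_def psubst_const)

lemma subT_T: "subT b (poly_var (T P i)) = Poly_Mapping.single 0 (b (P, i))"
  by (simp add: subT_def psubst_poly_var)

lemma subT_hpolys:
  assumes "F \<in> hpolys (PV I) d"
  shows "subT b F \<in> hpolys (PV {}) d"
proof -
  have "subT b F \<in> hpolys (PV {}) (d * 1)" unfolding subT_def
    by (rule hpolys_psubst[OF assms]) (use PX_hpolys[of "{}"] PY_hpolys[of "{}"] in simp_all)
  then show ?thesis by simp
qed

lemma poly_eval_subT: "poly_eval (pc z w b') (subT b F) = poly_eval (pc z w b) F"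
  unfolding subT_def poly_eval_psubst
  by (rule arg_cong[where f = "\<lambda>x. poly_eval x F"])
    (auto simp: fun_eq_iff pc_def poly_eval_var poly_eval_const split: coord.split)

lemma subT_hpolys_0:
  assumes "F \<in> hpolys V 0"
  shows "subT b F = Poly_Mapping.single 0 (ev b F)"
proof -
  have "subT b F = insertion (Poly_Mapping.single 0) (\<lambda>v. Poly_Mapping.single 0 (aff_coords b v)) F"
    unfolding subT_def psubst_def
  proof (rule insertion_cong)
    fix m v assume "m \<in> keys F" "v \<in> keys m"
    from hpolys_0_no_X(2)[OF assms this]
    show "(case v of X0 \<Rightarrow> PX | X1 \<Rightarrow> PY | T P i \<Rightarrow> Poly_Mapping.single 0 (b (P, i))) = Poly_Mapping.single 0 (aff_coords b v)"
      by (auto simp: aff_coords_def)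
  qed simp
  also have "\<dots> = Poly_Mapping.single 0 (ev b F)"
    unfolding poly_eval_insertion hom_insertion[OF ring_homo_single] ..
  finally show ?thesis .
qed

lemma subT_id:
  assumes "F \<in> hpolys (PV {}) d"
  shows "subT b F = F"
  unfolding subT_def
proof (rule psubst_id)
  fix m v assume "m \<in> keys F" "v \<in> keys m"
  then have "v \<in> {X0, X1}" using assms by (auto simp: hpolys_def PV_def)
  then show "(case v of X0 \<Rightarrow> PX | X1 \<Rightarrow> PY | T P i \<Rightarrow> Poly_Mapping.single 0 (b (P, i))) = poly_var v" by auto
qed

subsection \<open>Rational functions on products with the projective line\<close>

definition emb :: "Defs.poly \<Rightarrow> ratfun" where
  "emb F = Fract F 1"

lemma ring_homo_emb: "ring_homo emb"
  by (simp add: ring_homo_def emb_def One_fract_def)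

lemmas emb_simps = ring_homoD[OF ring_homo_emb]

lemma emb_eq_iff [simp]: "emb F = emb G \<longleftrightarrow> F = G"
  by (simp add: emb_def eq_fract)

lemma emb_eq_0_iff [simp]: "emb F = 0 \<longleftrightarrow> F = 0"
  using emb_eq_iff[of F 0] by (simp add: emb_simps)

lemma Fract_emb: "Fract F G = emb F / emb G"
  by (simp add: emb_def)

lemma const_emb: "const c = emb (Poly_Mapping.single 0 c)"
  by (simp add: const_def emb_def)

lemma emb_divide_eq_iff: "G \<noteq> 0 \<Longrightarrow> G' \<noteq> 0 \<Longrightarrow> emb F / emb G = emb F' / emb G' \<longleftrightarrow> F * G' = F' * G"
proof -
  assume "G \<noteq> 0" "G' \<noteq> 0"
  then have "emb F / emb G = emb F' / emb G' \<longleftrightarrow> emb F * emb G' = emb F' * emb G" by (simp add: frac_eq_eq)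
  also have "\<dots> \<longleftrightarrow> F * G' = F' * G" by (simp only: emb_simps(3)[symmetric] emb_eq_iff)
  finally show ?thesis .
qed

text \<open>Rational sections of \<open>\<O>(d)\<close> that are regular at \<open>x\<close>.\<close>

definition reg :: "coord set \<Rightarrow> int \<Rightarrow> (coord \<Rightarrow> complex) \<Rightarrow> ratfun set" where
  "reg V d x = {emb F / emb G | F G a b. F \<in> hpolys V a \<and> G \<in> hpolys V b \<and> int a = int b + d \<and> poly_eval x G \<noteq> 0}"

lemma poly_eval_nz: "poly_eval x G \<noteq> 0 \<Longrightarrow> G \<noteq> 0"
  by (auto simp: poly_eval_simps)

lemma regI: "F \<in> hpolys V a \<Longrightarrow> G \<in> hpolys V b \<Longrightarrow> int a = int b + d \<Longrightarrow> poly_eval x G \<noteq> 0 \<Longrightarrow>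
    emb F / emb G \<in> reg V d x"
  unfolding reg_def by blast

lemma regE:
  assumes "f \<in> reg V d x"
  obtains F G a b where "F \<in> hpolys V a" "G \<in> hpolys V b" "int a = int b + d" "poly_eval x G \<noteq> 0" "f = emb F / emb G"
  using assms unfolding reg_def by blast

lemma reg_emb: "F \<in> hpolys V a \<Longrightarrow> emb F \<in> reg V (int a) x"
  using regI[of F V a 1 0 "int a" x] by (simp add: emb_simps poly_eval_simps)

lemma reg_emb_inverse: "G \<in> hpolys V b \<Longrightarrow> poly_eval x G \<noteq> 0 \<Longrightarrow> inverse (emb G) \<in> reg V (- int b) x"
  using regI[of 1 V 0 G b "- int b" x] by (simp add: emb_simps inverse_eq_divide)

lemma reg_mult: "f \<in> reg V d x \<Longrightarrow> g \<in> reg V e x \<Longrightarrow> f * g \<in> reg V (d + e) x"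
proof (elim regE)
  fix F G a b F' G' a' b'
  assume *: "F \<in> hpolys V a" "G \<in> hpolys V b" "int a = int b + d" "poly_eval x G \<noteq> 0" "f = emb F / emb G"
    "F' \<in> hpolys V a'" "G' \<in> hpolys V b'" "int a' = int b' + e" "poly_eval x G' \<noteq> 0" "g = emb F' / emb G'"
  have "emb (F * F') / emb (G * G') \<in> reg V (d + e) x"
    by (rule regI[OF hpolys_mult[OF *(1,6)] hpolys_mult[OF *(2,7)]]) (use * in \<open>auto simp: poly_eval_simps\<close>)
  then show ?thesis using * by (simp add: emb_simps)
qed

lemma reg_add: "f \<in> reg V d x \<Longrightarrow> g \<in> reg V d x \<Longrightarrow> f + g \<in> reg V d x"
proof (elim regE)
  fix F G a b F' G' a' b'
  assume *: "F \<in> hpolys V a" "G \<in> hpolys V b" "int a = int b + d" "poly_eval x G \<noteq> 0" "f = emb F / emb G"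
    "F' \<in> hpolys V a'" "G' \<in> hpolys V b'" "int a' = int b' + d" "poly_eval x G' \<noteq> 0" "g = emb F' / emb G'"
  have "F * G' + F' * G \<in> hpolys V (a + b')"
    using * by (intro hpolys_add hpolys_mult'[OF *(1,7)] hpolys_mult'[OF *(6,2)]) auto
  from regI[OF this hpolys_mult[OF *(2,7)]] have "emb (F * G' + F' * G) / emb (G * G') \<in> reg V d x"
    using * by (auto simp: poly_eval_simps)
  then show ?thesis using * poly_eval_nz[OF *(4)] poly_eval_nz[OF *(9)] by (simp add: emb_simps add_frac_eq)
qed

lemma reg_0: "0 \<in> reg V (int k) x"
  using reg_emb[of 0 V k x] by (simp add: emb_simps)

lemma reg_sum: "(\<And>i. i \<in> A \<Longrightarrow> f i \<in> reg V (int d) x) \<Longrightarrow> sum f A \<in> reg V (int d) x"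
  by (induction A rule: infinite_finite_induct) (auto simp: reg_0 reg_add)

lemma reg_1: "1 \<in> reg V 0 x"
  using reg_emb[of 1 V 0 x] by (simp add: emb_simps)

lemma reg_power: "f \<in> reg V d x \<Longrightarrow> f ^ k \<in> reg V (int k * d) x"
  by (induction k) (auto simp: reg_1 algebra_simps dest: reg_mult)

lemma reg_powi: "f \<in> reg V d x \<Longrightarrow> inverse f \<in> reg V (- d) x \<Longrightarrow> f powi k \<in> reg V (k * d) x"
proof (cases "k \<ge> 0")
  case True
  assume "f \<in> reg V d x"
  from reg_power[OF this, of "nat k"] show ?thesis using True by (simp add: power_int_def)
next
  case False
  assume "inverse f \<in> reg V (- d) x"
  from reg_power[OF this, of "nat (- k)"] show ?thesis using False by (simp add: power_int_def)
qed

text \<open>Every root \<open>z\<close> of \<open>g\<close> is a root of \<open>f\<close>, as one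
  sees from the local equation at \<open>z\<close>; splitting off the common factor lowers the
  degree of \<open>g\<close>.\<close>

lemma locally_dvd_imp_dvd:
  fixes f g :: "complex Polynomial.poly"
  assumes "g \<noteq> 0" "\<And>z. \<exists>f1 g1. f * g1 = f1 * g \<and> poly g1 z \<noteq> 0"
  shows "g dvd f"
  using assms
proof (induction "Polynomial.degree g" arbitrary: f g)
  case 0
  then have "is_unit g" by (simp add: is_unit_iff_degree)
  then show ?case by (rule unit_imp_dvd)
next
  case (Suc n)
  have "\<not> constant (poly g)" using Suc(2) constant_degree[of g] by simp
  then obtain z where z: "poly g z = 0" using fundamental_theorem_of_algebra by blast
  from Suc(4)[of z] obtain f1 g1 where 1: "f * g1 = f1 * g" "poly g1 z \<noteq> 0" by blast
  have "poly f z * poly g1 z = 0" using arg_cong[OF 1(1), of "\<lambda>p. poly p z"] z by simp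
  then have "poly f z = 0" using 1(2) by simp
  then obtain f' where f': "f = [:- z, 1:] * f'" by (auto simp: poly_eq_0_iff_dvd elim: dvdE)
  obtain g' where g': "g = [:- z, 1:] * g'" using z by (auto simp: poly_eq_0_iff_dvd elim: dvdE)
  have ne: "[:- z, 1:] \<noteq> 0" by simp
  have "g' \<noteq> 0" using Suc(3) g' by auto
  moreover have "n = Polynomial.degree g'"
    using Suc(2) degree_mult_eq[OF ne \<open>g' \<noteq> 0\<close>] g' by simp
  moreover have "\<exists>f1 g1. f' * g1 = f1 * g' \<and> poly g1 w \<noteq> 0" for w
  proof -
    from Suc(4)[of w] obtain f1 g1 where 2: "f * g1 = f1 * g" "poly g1 w \<noteq> 0" by blast
    have "[:- z, 1:] * (f' * g1) = [:- z, 1:] * (f1 * g')" using 2(1) unfolding f' g' by (simp only: mult_ac)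
    then have "f' * g1 = f1 * g'" by (rule mult_left_cancel[OF ne, THEN iffD1])
    then show ?thesis using 2(2) by blast
  qed
  ultimately have "g' dvd f'" using Suc(1) by blast
  then show ?case unfolding f' g' by (rule mult_dvd_mono[OF dvd_refl])
qed

text \<open>The sections of a line bundle on a single projective line: regularity on the affine
  chart makes the quotient a polynomial, and regularity at infinity bounds its degree.\<close>

lemma section_of_P1:
  fixes f g :: "complex Polynomial.poly" and d :: int
  assumes "g \<noteq> 0" "\<And>z. \<exists>f1 g1. f * g1 = f1 * g \<and> poly g1 z \<noteq> 0"
    and inf: "\<exists>f1 g1. f * g1 = f1 * g \<and> g1 \<noteq> 0 \<and> int (Polynomial.degree f1) \<le> int (Polynomial.degree g1) + d"
  obtains p where "f = g * p" "p = 0 \<or> int (Polynomial.degree p) \<le> d"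
proof -
  from locally_dvd_imp_dvd[OF assms(1,2)] obtain p where p: "f = g * p" by (rule dvdE)
  from inf obtain f1 g1 where 1: "f * g1 = f1 * g" "g1 \<noteq> 0" "int (Polynomial.degree f1) \<le> int (Polynomial.degree g1) + d"
    by blast
  have "g * (p * g1) = g * f1" using 1(1) p by (simp add: mult_ac)
  then have "p * g1 = f1" using assms(1) by simp
  then have "p = 0 \<or> Polynomial.degree p + Polynomial.degree g1 = Polynomial.degree f1"
    using degree_mult_eq[of p g1] 1(2) by (cases "p = 0") auto
  then have "p = 0 \<or> int (Polynomial.degree p) \<le> d" using 1(3) by linarith
  with p show thesis by (rule that)
qed

text \<open>The local ring of the parameter space at \<open>b\<close>: forms of degree
  \<open>0\<close> in \<open>PV I\<close> involve the parameters only.\<close>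

definition lr :: "(p1 \<times> nat) set \<Rightarrow> (p1 \<times> nat \<Rightarrow> complex) \<Rightarrow> ratfun set" where
  "lr I b = {emb F / emb G | F G. F \<in> hpolys (PV I) 0 \<and> G \<in> hpolys (PV I) 0 \<and> ev b G \<noteq> 0}"

lemma lr_subset_reg: "lr I b \<subseteq> reg (PV I) 0 (pc z w b)"
proof
  fix f assume "f \<in> lr I b"
  then obtain F G where "f = emb F / emb G" "F \<in> hpolys (PV I) 0" "G \<in> hpolys (PV I) 0" "ev b G \<noteq> 0"
    unfolding lr_def by blast
  then show "f \<in> reg (PV I) 0 (pc z w b)"
    using regI[of F "PV I" 0 G 0 0 "pc z w b"] poly_eval_hpolys_0[of G "PV I" z w b] by simp
qed

lemma lrI: "F \<in> hpolys (PV I) 0 \<Longrightarrow> G \<in> hpolys (PV I) 0 \<Longrightarrow> ev b G \<noteq> 0 \<Longrightarrow> emb F / emb G \<in> lr I b"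
  unfolding lr_def by blast

lemma lrE:
  assumes "f \<in> lr I b"
  obtains F G where "F \<in> hpolys (PV I) 0" "G \<in> hpolys (PV I) 0" "ev b G \<noteq> 0" "f = emb F / emb G"
  using assms unfolding lr_def by blast

lemma lr_emb: "F \<in> hpolys (PV I) 0 \<Longrightarrow> emb F \<in> lr I b"
  using lrI[of F I 1 b] by (simp add: emb_simps poly_eval_simps)

lemma subring_closed_lr: "subring_closed (lr I b)"
  unfolding subring_closed_def
proof (intro conjI ballI)
  show "1 \<in> lr I b" using lr_emb[of 1 I b] by (simp add: emb_simps)
  have mult: "f * g \<in> lr I b" and add: "f + g \<in> lr I b" if "f \<in> lr I b" "g \<in> lr I b" for f g
  proof -
    from that(1) obtain F G where 1: "F \<in> hpolys (PV I) 0" "G \<in> hpolys (PV I) 0" "ev b G \<noteq> 0" "f = emb F / emb G" by (rule lrE)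
    from that(2) obtain F' G' where 2: "F' \<in> hpolys (PV I) 0" "G' \<in> hpolys (PV I) 0" "ev b G' \<noteq> 0" "g = emb F' / emb G'" by (rule lrE)
    have G: "G * G' \<in> hpolys (PV I) 0" "ev b (G * G') \<noteq> 0"
      using hpolys_mult[OF 1(2) 2(2)] 1 2 by (auto simp: poly_eval_simps)
    have "emb (F * F') / emb (G * G') \<in> lr I b" using hpolys_mult[OF 1(1) 2(1)] G by (intro lrI) auto
    then show "f * g \<in> lr I b" using 1 2 by (simp add: emb_simps)
    have "emb (F * G' + F' * G) / emb (G * G') \<in> lr I b"
      using hpolys_mult[OF 1(1) 2(2)] hpolys_mult[OF 2(1) 1(2)] G by (intro lrI hpolys_add) auto
    then show "f + g \<in> lr I b" using 1 2 poly_eval_nz[OF 1(3)] poly_eval_nz[OF 2(3)]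
      by (simp add: emb_simps add_frac_eq)
  qed
  show "f * g \<in> lr I b" "f + g \<in> lr I b" if "f \<in> lr I b" "g \<in> lr I b" for f g
    using mult[OF that] add[OF that] by auto
  show "- f \<in> lr I b" if "f \<in> lr I b" for f
  proof -
    have "emb (- 1) \<in> lr I b" by (rule lr_emb) (simp add: hpolys_uminus)
    from mult[OF this that] show ?thesis by (simp add: emb_simps)
  qed
qed

text \<open>\<open>l = \<alpha> X0 + \<beta> X1\<close> is completed to a unimodular system of coordinates by \<open>c = \<gamma> X0 + \<epsilon> X1\<close>.\<close>

locale linear_form =
  fixes I :: "(p1 \<times> nat) set" and \<alpha> \<beta> \<gamma> \<epsilon> :: Defs.poly
  assumes coeffs: "\<alpha> \<in> hpolys (PV I) 0" "\<beta> \<in> hpolys (PV I) 0" "\<gamma> \<in> hpolys (PV I) 0" "\<epsilon> \<in> hpolys (PV I) 0"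
    and det: "\<alpha> * \<epsilon> - \<beta> * \<gamma> = 1"
begin

abbreviation "H \<equiv> hpolys (PV I)"
definition "l = \<alpha> * PX + \<beta> * PY"
definition "c = \<gamma> * PX + \<epsilon> * PY"
text \<open>The zero of \<open>l\<close> is the section \<open>[- \<beta> : \<alpha>]\<close>, at
  which \<open>c\<close> takes the value \<open>1\<close> by \<open>det\<close>; so
  \<open>rs\<close> is restriction to the zero set of \<open>l\<close>, read in the
  parameters.\<close>

definition "rs = sub0 (- \<beta>) \<alpha>"

lemma l_H: "l \<in> H 1" and c_H: "c \<in> H 1"
  unfolding l_def c_def
  using hpolys_mult[OF coeffs(1) PX_hpolys] hpolys_mult[OF coeffs(2) PY_hpolys]
    hpolys_mult[OF coeffs(3) PX_hpolys] hpolys_mult[OF coeffs(4) PY_hpolys] hpolys_add by auto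

lemma rs_simps: "rs (F + G) = rs F + rs G" "rs (F * G) = rs F * rs G" "rs 1 = 1" "rs 0 = 0" "rs (F ^ k) = rs F ^ k"
  "rs (sum f A) = (\<Sum>x\<in>A. rs (f x))" "rs (- F) = - rs F" "rs (F - G) = rs F - rs G" "rs (prod f A) = (\<Prod>x\<in>A. rs (f x))"
  unfolding rs_def by (rule sub0_simps)+

lemma rs_0: "F \<in> H 0 \<Longrightarrow> rs F = F" unfolding rs_def by (rule sub0_hpolys_0)

lemma rs_X: "rs PX = - \<beta>" "rs PY = \<alpha>" by (simp_all add: rs_def sub0_X)

lemma rs_l: "rs l = 0" and rs_c: "rs c = 1"
  using det by (simp_all add: l_def c_def rs_simps rs_X rs_0 coeffs algebra_simps)

lemma rs_H: "F \<in> H d \<Longrightarrow> rs F \<in> H 0"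
  unfolding rs_def by (rule sub0_hpolys) (auto simp: coeffs hpolys_uminus)

lemma PX_eq: "PX = \<epsilon> * l - \<beta> * c" and PY_eq: "PY = \<alpha> * c - \<gamma> * l"
proof -
  have "\<epsilon> * l - \<beta> * c = (\<alpha> * \<epsilon> - \<beta> * \<gamma>) * PX" "\<alpha> * c - \<gamma> * l = (\<alpha> * \<epsilon> - \<beta> * \<gamma>) * PY"
    by (simp_all add: l_def c_def algebra_simps)
  then show "PX = \<epsilon> * l - \<beta> * c" "PY = \<alpha> * c - \<gamma> * l" by (simp_all add: det)
qed

text \<open>Divisibility by \<open>l\<close> with a quotient of the right degree. The last clause
  treats \<open>d = 0\<close>, where the truncated \<open>d - 1\<close> would admit a quotient of
  degree \<open>0\<close>.\<close>

definition Dv :: "nat \<Rightarrow> Defs.poly \<Rightarrow> bool" where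
  "Dv d F \<longleftrightarrow> (\<exists>Q. F = l * Q \<and> Q \<in> H (d - 1) \<and> (d = 0 \<longrightarrow> Q = 0))"

lemma Dv_0: "Dv d 0"
  unfolding Dv_def by (rule exI[of _ 0]) simp

lemma Dv_add: "Dv d F \<Longrightarrow> Dv d G \<Longrightarrow> Dv d (F + G)"
  unfolding Dv_def
proof (elim exE conjE)
  fix Q Q' assume "F = l * Q" "Q \<in> H (d - 1)" "d = 0 \<longrightarrow> Q = 0" "G = l * Q'" "Q' \<in> H (d - 1)" "d = 0 \<longrightarrow> Q' = 0"
  then show "\<exists>Q. F + G = l * Q \<and> Q \<in> H (d - 1) \<and> (d = 0 \<longrightarrow> Q = 0)"
    by (intro exI[of _ "Q + Q'"]) (auto simp: hpolys_add algebra_simps)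
qed

lemma Dv_sum: "(\<And>i. i \<in> A \<Longrightarrow> Dv d (f i)) \<Longrightarrow> Dv d (sum f A)"
  by (induction A rule: infinite_finite_induct) (auto simp: Dv_0 Dv_add)

lemma Dv_mult: "Dv d F \<Longrightarrow> G \<in> H e \<Longrightarrow> Dv (d + e) (F * G)"
  unfolding Dv_def
proof (elim exE conjE)
  fix Q assume *: "F = l * Q" "Q \<in> H (d - 1)" "d = 0 \<longrightarrow> Q = 0" "G \<in> H e"
  show "\<exists>Q. F * G = l * Q \<and> Q \<in> H (d + e - 1) \<and> (d + e = 0 \<longrightarrow> Q = 0)"
  proof (cases "d = 0")
    case True then show ?thesis using * by (intro exI[of _ 0]) auto
  next
    case False
    then have "Q * G \<in> H (d + e - 1)" using * by (intro hpolys_mult'[OF *(2,4)]) auto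
    then show ?thesis using * False by (intro exI[of _ "Q * G"]) (auto simp: mult_ac)
  qed
qed

lemma Dv_mult_cong:
  assumes "Dv d (F - F')" "Dv e (G - G')" "G \<in> H e" "F' \<in> H d"
  shows "Dv (d + e) (F * G - F' * G')"
proof -
  have "Dv (d + e) ((F - F') * G)" by (rule Dv_mult[OF assms(1,3)])
  moreover have "Dv (e + d) ((G - G') * F')" by (rule Dv_mult[OF assms(2,4)])
  ultimately have "Dv (d + e) ((F - F') * G + (G - G') * F')" by (intro Dv_add) (auto simp: add.commute)
  then show ?thesis by (simp add: algebra_simps)
qed

lemma Dv_power:
  assumes "Dv 1 (F - F')" "F \<in> H 1" "F' \<in> H 1"
  shows "Dv k (F ^ k - F' ^ k)"
proof (induction k)
  case (Suc k)
  have "Dv (1 + k) (F * F ^ k - F' * F' ^ k)"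
    using hpolys_power[OF assms(2), of k] by (intro Dv_mult_cong assms Suc) auto
  then show ?case by simp
qed (simp add: Dv_0)

text \<open>Modulo \<open>l\<close> the coordinates are \<open>- \<beta> * c\<close> and
  \<open>\<alpha> * c\<close>, by the inverse of the unimodular change of coordinates. A form of
  degree \<open>d\<close> therefore reduces to its value at \<open>(- \<beta>, \<alpha>)\<close>
  times \<open>c ^ d\<close>.\<close>

lemma division:
  assumes "F \<in> H d"
  shows "Dv d (F - rs F * c ^ d)"
proof -
  obtain G where G: "\<And>i. G i \<in> H 0" "F = (\<Sum>i\<le>d. G i * PX ^ i * PY ^ (d - i))"
    by (rule hpolys_expand[OF assms]) blast
  have cX: "- \<beta> * c \<in> H 1" "\<alpha> * c \<in> H 1"
    using hpolys_mult[OF hpolys_uminus[OF coeffs(2)] c_H] hpolys_mult[OF coeffs(1) c_H] by auto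
  have dX: "Dv 1 (PX - (- \<beta> * c))" "Dv 1 (PY - \<alpha> * c)"
  proof -
    have "PX - (- \<beta> * c) = l * \<epsilon>" "PY - \<alpha> * c = l * (- \<gamma>)"
      using PX_eq PY_eq by (simp_all add: algebra_simps)
    then show "Dv 1 (PX - (- \<beta> * c))" "Dv 1 (PY - \<alpha> * c)"
      unfolding Dv_def using coeffs(4) hpolys_uminus[OF coeffs(3)] by (auto simp only: diff_self_eq_0)
  qed
  have "Dv d (G i * (PX ^ i * PY ^ (d - i) - (- \<beta> * c) ^ i * (\<alpha> * c) ^ (d - i)))" if "i \<le> d" for i
  proof -
    have "Dv (i + (d - i)) (PX ^ i * PY ^ (d - i) - (- \<beta> * c) ^ i * (\<alpha> * c) ^ (d - i))"
      using hpolys_power[OF cX(1), of i]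
      by (intro Dv_mult_cong Dv_power dX cX PX_hpolys PY_hpolys PY_power) auto
    from Dv_mult[OF this G(1)[of i]] show ?thesis using that by (simp add: mult.commute)
  qed
  then have "Dv d (\<Sum>i\<le>d. G i * (PX ^ i * PY ^ (d - i) - (- \<beta> * c) ^ i * (\<alpha> * c) ^ (d - i)))"
    by (intro Dv_sum) auto
  also have "(\<Sum>i\<le>d. G i * (PX ^ i * PY ^ (d - i) - (- \<beta> * c) ^ i * (\<alpha> * c) ^ (d - i))) = F - rs F * c ^ d"
  proof -
    have "rs F * c ^ d = (\<Sum>i\<le>d. G i * ((- \<beta>) ^ i * \<alpha> ^ (d - i)) * c ^ d)"
      unfolding G(2) sum_distrib_right[symmetric] by (simp add: rs_simps rs_X rs_0[OF G(1)] mult.assoc)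
    also have "\<dots> = (\<Sum>i\<le>d. G i * ((- \<beta> * c) ^ i * (\<alpha> * c) ^ (d - i)))"
    proof (rule sum.cong[OF refl])
      fix i assume "i \<in> {..d}"
      then have "c ^ d = c ^ i * c ^ (d - i)" by (simp add: power_add[symmetric])
      then show "G i * ((- \<beta>) ^ i * \<alpha> ^ (d - i)) * c ^ d = G i * ((- \<beta> * c) ^ i * (\<alpha> * c) ^ (d - i))"
        by (simp only: power_mult_distrib mult_ac)
    qed
    finally show ?thesis unfolding G(2) by (simp add: right_diff_distrib sum_subtractf mult.assoc)
  qed
  finally show ?thesis .
qed

lemma dvd_of_rs_0:
  assumes "F \<in> H d" "rs F = 0"
  obtains Q where "F = l * Q" "Q \<in> H (d - 1)" "d = 0 \<Longrightarrow> F = 0"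
  using division[OF assms(1)] assms(2) that unfolding Dv_def by auto

lemma l_nz: "l \<noteq> 0" and c_nz: "c \<noteq> 0"
proof -
  \<comment> \<open>At the zero \<open>[\<epsilon> : - \<gamma>]\<close> of \<open>c\<close> the
    form \<open>l\<close> is \<open>1\<close>, again by \<open>det\<close>.\<close>
  have "sub0 \<epsilon> (- \<gamma>) l = 1"
    using det by (simp add: l_def sub0_simps sub0_X sub0_hpolys_0[OF coeffs(1)] sub0_hpolys_0[OF coeffs(2)])
  then show "l \<noteq> 0" by (auto simp: sub0_simps)
  show "c \<noteq> 0" using rs_c by (auto simp: rs_simps)
qed

lemma poly_eval_l: "poly_eval (pc z w b) l = ev b \<alpha> * z + ev b \<beta> * w"
  and poly_eval_c: "poly_eval (pc z w b) c = ev b \<gamma> * z + ev b \<epsilon> * w"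
  by (simp_all add: l_def c_def poly_eval_simps poly_eval_var poly_eval_hpolys_0[OF coeffs(1)]
      poly_eval_hpolys_0[OF coeffs(2)] poly_eval_hpolys_0[OF coeffs(3)] poly_eval_hpolys_0[OF coeffs(4)])

lemma poly_eval_on_zero:
  assumes "F \<in> H d" "poly_eval (pc z w b) l = 0"
  shows "poly_eval (pc z w b) F = ev b (rs F) * poly_eval (pc z w b) c ^ d"
proof -
  from division[OF assms(1)] obtain Q where "F = rs F * c ^ d + l * Q"
    unfolding Dv_def by (auto simp: algebra_simps)
  then have "poly_eval (pc z w b) F = poly_eval (pc z w b) (rs F * c ^ d + l * Q)" by simp
  then show ?thesis using assms(2) poly_eval_hpolys_0[OF rs_H[OF assms(1)]] by (simp add: poly_eval_simps)
qed

lemma c_nz_on_zero: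
  assumes "poly_eval (pc z w b) l = 0" "z \<noteq> 0 \<or> w \<noteq> 0"
  shows "poly_eval (pc z w b) c \<noteq> 0"
proof
  assume c0: "poly_eval (pc z w b) c = 0"
  have "poly_eval (pc z w b) PX = 0" by (subst PX_eq) (simp add: poly_eval_simps assms(1) c0)
  moreover have "poly_eval (pc z w b) PY = 0" by (subst PY_eq) (simp add: poly_eval_simps assms(1) c0)
  ultimately show False using assms(2) by (simp add: poly_eval_var)
qed

lemma zero_exists:
  "(\<exists>z. poly_eval (pc z 1 b) l = 0) \<or> poly_eval (pc 1 0 b) l = 0"
proof (cases "ev b \<alpha> = 0")
  case True then show ?thesis by (simp add: poly_eval_l)
next
  case False
  then have "poly_eval (pc (- ev b \<beta> / ev b \<alpha>) 1 b) l = 0" by (simp add: poly_eval_l)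
  then show ?thesis by blast
qed

lemma det_ev: "ev b \<alpha> * ev b \<epsilon> - ev b \<beta> * ev b \<gamma> = 1"
  using arg_cong[OF det, of "ev b"] by (simp add: poly_eval_simps)

lemma uni_l_nz: "uni b l \<noteq> 0"
proof
  assume "uni b l = 0"
  from uni_eq_0D[OF l_H this] have "poly_eval (pc 1 0 b) l = 0" "poly_eval (pc 0 1 b) l = 0" by auto
  then have "ev b \<alpha> = 0" "ev b \<beta> = 0" by (auto simp: poly_eval_l)
  then show False using det_ev[of b] by simp
qed

end

section \<open>Functions on the base and forms with coefficients in them\<close>

locale base =
  fixes I :: "(p1 \<times> nat) set" and B :: "(p1 \<times> nat \<Rightarrow> complex) set"
  assumes dense: "dense I B" and B_ne: "B \<noteq> {}"
begin

abbreviation "H \<equiv> hpolys (PV I)"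

definition R :: "ratfun set" where "R = (\<Inter>b\<in>B. lr I b)"

lemma subring_closed_R: "subring_closed R"
proof -
  note lr = subring_closedD[OF subring_closed_lr]
  show ?thesis unfolding subring_closed_def R_def
    by (intro conjI ballI INT_I) (simp_all add: lr)
qed

lemma emb_R: "F \<in> H 0 \<Longrightarrow> emb F \<in> R"
  by (auto simp: R_def lr_emb)

text \<open>A dense set stays dense after the zeros of \<open>D\<close> are removed:
  \<open>F * D\<close> vanishes on all fibres over \<open>B\<close>.\<close>

lemma H_eq_0:
  assumes "F \<in> H d" "D \<in> H 0" "D \<noteq> 0" "\<And>b. b \<in> B \<Longrightarrow> ev b D \<noteq> 0 \<Longrightarrow> uni b F = 0"
  shows "F = 0"
proof -
  have "F * D \<in> H d" using hpolys_mult[OF assms(1,2)] by simp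
  moreover have "uni b (F * D) = 0" if "b \<in> B" for b
    using assms(4)[OF that] uni_hpolys_0[OF assms(2), of b] by (cases "ev b D = 0") (auto simp: uni_simps)
  ultimately have "F * D = 0" using dense_uni_eq_0[OF dense] by blast
  then show ?thesis using assms(3) by simp
qed

definition form :: "nat \<Rightarrow> (nat \<Rightarrow> ratfun) \<Rightarrow> ratfun" where
  "form d s = (\<Sum>i\<le>d. s i * emb (PX ^ i * PY ^ (d - i)))"

text \<open>The monomials in \<open>X0\<close> and \<open>X1\<close> are linearly independent over
  the field of functions of the parameters. Each coefficient may be regular at a point of its own,
  so the proof passes to a common denominator \<open>GG\<close>.\<close>

lemma form_eq_0:
  assumes "\<And>i. i \<le> d \<Longrightarrow> \<exists>b. s i \<in> lr I b" "form d s = 0" "i \<le> d"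
  shows "s i = 0"
proof -
  have "\<forall>i. \<exists>F G. i \<le> d \<longrightarrow> F \<in> H 0 \<and> G \<in> H 0 \<and> G \<noteq> 0 \<and> s i = emb F / emb G"
  proof
    fix i
    show "\<exists>F G. i \<le> d \<longrightarrow> F \<in> H 0 \<and> G \<in> H 0 \<and> G \<noteq> 0 \<and> s i = emb F / emb G"
    proof (cases "i \<le> d")
      case True
      then obtain b where "s i \<in> lr I b" using assms(1) by blast
      then obtain F G where "F \<in> H 0" "G \<in> H 0" "ev b G \<noteq> 0" "s i = emb F / emb G" by (rule lrE)
      then show ?thesis using poly_eval_nz by blast
    qed auto
  qed
  then obtain F G where FG: "\<And>i. i \<le> d \<Longrightarrow> F i \<in> H 0" "\<And>i. i \<le> d \<Longrightarrow> G i \<in> H 0" "\<And>i. i \<le> d \<Longrightarrow> G i \<noteq> 0"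
    "\<And>i. i \<le> d \<Longrightarrow> s i = emb (F i) / emb (G i)" by metis
  define K where "K i = F i * (\<Prod>k\<in>{..d} - {i}. G k)" for i
  define GG where "GG = (\<Prod>k\<le>d. G k)"
  have GG: "emb GG \<noteq> 0" using FG(3) by (simp add: GG_def)
  have KH: "K i \<in> H 0" if "i \<le> d" for i
    using hpolys_mult[OF FG(1)[OF that] hpolys_prod[of "{..d} - {i}" G _ "\<lambda>_. 0"]] FG(2) by (auto simp: K_def)
  have sK: "s i * emb GG = emb (K i)" if "i \<le> d" for i
  proof -
    have "GG = G i * (\<Prod>k\<in>{..d} - {i}. G k)" unfolding GG_def using that by (intro prod.remove) auto
    then show ?thesis using FG(3,4)[OF that] by (simp add: K_def emb_simps)
  qed
  \<comment> \<open>\<open>K i\<close> is under control for \<open>i \<le> d\<close> only, whereas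
    \<open>hpolys_expand_eval\<close> wants a coefficient for every index.\<close>
  define G' where "G' i = (if i \<le> d then K i else 0)" for i
  define Q where "Q = (\<Sum>i\<le>d. G' i * PX ^ i * PY ^ (d - i))"
  have "emb Q = form d s * emb GG"
    unfolding Q_def form_def sum_distrib_right emb_simps(7)
  proof (rule sum.cong[OF refl])
    fix i assume "i \<in> {..d}"
    then have "i \<le> d" by simp
    have "s i * emb (PX ^ i * PY ^ (d - i)) * emb GG = s i * emb GG * emb (PX ^ i * PY ^ (d - i))" by simp
    also have "\<dots> = emb (G' i * PX ^ i * PY ^ (d - i))"
      using sK[OF \<open>i \<le> d\<close>] \<open>i \<le> d\<close> by (simp add: emb_simps G'_def mult.assoc)
    finally show "emb (G' i * PX ^ i * PY ^ (d - i)) = s i * emb (PX ^ i * PY ^ (d - i)) * emb GG" ..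
  qed
  then have "Q = 0" using assms(2) by (simp add: emb_eq_0_iff[symmetric] del: emb_eq_0_iff)
  have G'H: "G' i \<in> H 0" for i using KH by (simp add: G'_def)
  have "K i = 0"
  proof -
    have "ev b (K i) = 0" for b
      using hpolys_expand_eval(2)[OF G'H Q_def, of b i] \<open>Q = 0\<close> assms(3) by (simp add: uni_simps G'_def)
    then show ?thesis using dense KH[OF assms(3)] unfolding dense_def by blast
  qed
  then show ?thesis using sK[OF assms(3)] GG by (simp add: emb_simps)
qed

lemma form_diff: "form d s - form d t = form d (\<lambda>i. s i - t i)"
  by (simp add: form_def left_diff_distrib sum_subtractf)

end

text \<open>The global sections of \<open>\<O>(d)\<close> over \<open>\<bbbP>\<^sup>1 \<times> B\<close>: interpolation at \<open>d + 1\<close> constant sections gives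
  coefficients that are regular on \<open>B\<close>; the identity can be checked on the generic fibres. The section is
  only assumed to be regular away from the zeros of the \<open>l j\<close>, none of which divides its denominator.\<close>

locale linear_forms = base +
  fixes J :: "'j set" and \<alpha> \<beta> \<gamma> \<epsilon> :: "'j \<Rightarrow> Defs.poly"
  assumes finite_J: "finite J" and lin: "j \<in> J \<Longrightarrow> linear_form I (\<alpha> j) (\<beta> j) (\<gamma> j) (\<epsilon> j)"
begin

abbreviation "l j \<equiv> linear_form.l (\<alpha> j) (\<beta> j)"
abbreviation "c j \<equiv> linear_form.c (\<gamma> j) (\<epsilon> j)"
abbreviation "rs j \<equiv> linear_form.rs (\<alpha> j) (\<beta> j)"

context
  fixes K :: "'j set" and F G :: Defs.poly and a g0 :: nat and d :: int
  assumes K: "K \<subseteq> J" and F: "F \<in> H a" and G: "G \<in> H g0" "G \<noteq> 0" and d: "int a = int g0 + d"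
    and regular: "\<And>b z w. b \<in> B \<Longrightarrow> z \<noteq> 0 \<or> w \<noteq> 0 \<Longrightarrow> (\<And>j. j \<in> K \<Longrightarrow> poly_eval (pc z w b) (l j) \<noteq> 0) \<Longrightarrow>
        emb F / emb G \<in> reg (PV I) d (pc z w b)"
    and rsG: "\<And>j. j \<in> K \<Longrightarrow> rs j G \<noteq> 0"
begin

lemma local_rep:
  assumes "b \<in> B" "z \<noteq> 0 \<or> w \<noteq> 0" "\<And>j. j \<in> K \<Longrightarrow> poly_eval (pc z w b) (l j) \<noteq> 0"
  obtains F1 G1 a1 b1 where "F1 \<in> H a1" "G1 \<in> H b1" "int a1 = int b1 + d" "poly_eval (pc z w b) G1 \<noteq> 0" "F * G1 = F1 * G"
proof -
  from regular[OF assms] obtain F1 G1 a1 b1 where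
    1: "F1 \<in> H a1" "G1 \<in> H b1" "int a1 = int b1 + d" "poly_eval (pc z w b) G1 \<noteq> 0" "emb F / emb G = emb F1 / emb G1"
    by (rule regE)
  then have "F * G1 = F1 * G" using emb_divide_eq_iff[OF G(2) poly_eval_nz[OF 1(4)]] by blast
  with 1 that show thesis by blast
qed

text \<open>Where \<open>disc\<close> does not vanish, \<open>G\<close> is nonzero on the fibre and
  at the zeros of the \<open>l j\<close> in it. A polynomial \<open>P\<close> as demanded is
  supplied by a nonzero coefficient of \<open>G\<close>.\<close>

definition disc :: Defs.poly where
  "disc = (\<Prod>j\<in>K. rs j G) * (SOME P. P \<in> H 0 \<and> P \<noteq> 0 \<and> (\<forall>b. ev b P \<noteq> 0 \<longrightarrow> uni b G \<noteq> 0))"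

lemma disc_some: "\<exists>P. P \<in> H 0 \<and> P \<noteq> 0 \<and> (\<forall>b. ev b P \<noteq> 0 \<longrightarrow> uni b G \<noteq> 0)"
proof -
  obtain P where P: "\<And>i. P i \<in> H 0" "G = (\<Sum>i\<le>g0. P i * PX ^ i * PY ^ (g0 - i))"
    by (rule hpolys_expand[OF G(1)]) blast
  have "\<exists>i\<le>g0. P i \<noteq> 0"
  proof (rule ccontr)
    assume "\<not> (\<exists>i\<le>g0. P i \<noteq> 0)"
    then have "G = 0" unfolding P(2) by simp
    then show False using G(2) by simp
  qed
  then obtain i where i: "i \<le> g0" "P i \<noteq> 0" by blast
  have "uni b G \<noteq> 0" if "ev b (P i) \<noteq> 0" for b
    using hpolys_expand_eval(2)[OF P, of b i] that i by auto
  then show ?thesis using P i by blast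
qed

lemma disc: "disc \<in> H 0" "disc \<noteq> 0" "ev b disc \<noteq> 0 \<Longrightarrow> uni b G \<noteq> 0"
  "ev b disc \<noteq> 0 \<Longrightarrow> j \<in> K \<Longrightarrow> ev b (rs j G) \<noteq> 0"
proof -
  define P where "P = (SOME P. P \<in> H 0 \<and> P \<noteq> 0 \<and> (\<forall>b. ev b P \<noteq> 0 \<longrightarrow> uni b G \<noteq> 0))"
  have P: "P \<in> H 0" "P \<noteq> 0" "\<And>b. ev b P \<noteq> 0 \<Longrightarrow> uni b G \<noteq> 0"
    using someI_ex[OF disc_some] unfolding P_def by blast+
  have deq: "disc = (\<Prod>j\<in>K. rs j G) * P" by (simp add: disc_def P_def)
  have fK: "finite K" using K finite_J by (rule finite_subset)
  have "rs j G \<in> H 0" if "j \<in> K" for j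
    using linear_form.rs_H[OF lin G(1)] that K by blast
  then have "(\<Prod>j\<in>K. rs j G) \<in> H 0" using hpolys_prod[of K "\<lambda>j. rs j G" "PV I" "\<lambda>_. 0"] by simp
  then show "disc \<in> H 0" using hpolys_mult[OF _ P(1)] deq by fastforce
  show "disc \<noteq> 0" using P(2) rsG fK by (simp add: deq)
  show "uni b G \<noteq> 0" if "ev b disc \<noteq> 0" using that P(3)[of b] by (auto simp: deq poly_eval_simps)
  show "ev b (rs j G) \<noteq> 0" if "ev b disc \<noteq> 0" "j \<in> K"
    using that fK by (auto simp: deq poly_eval_simps)
qed

text \<open>At the zeros of the \<open>l j\<close> no regularity is assumed, but there
  \<open>G\<close> itself does not vanish, so that \<open>F / G\<close> is its own local
  representation.\<close>

lemma generic_fibre: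
  assumes b: "b \<in> B" "ev b disc \<noteq> 0"
  obtains p where "uni b F = uni b G * p" "p = 0 \<or> int (Polynomial.degree p) \<le> d"
proof (rule section_of_P1)
  show "uni b G \<noteq> 0" by (rule disc(3)[OF b(2)])
  have bad: "poly_eval (pc z w b) G \<noteq> 0" if "j \<in> K" "poly_eval (pc z w b) (l j) = 0" "z \<noteq> 0 \<or> w \<noteq> 0" for z w j
  proof -
    interpret L: linear_form I "\<alpha> j" "\<beta> j" "\<gamma> j" "\<epsilon> j" using lin that(1) K by blast
    show ?thesis using L.poly_eval_on_zero[OF G(1) that(2)] L.c_nz_on_zero[OF that(2,3)] disc(4)[OF b(2) that(1)] by simp
  qed
  show "\<exists>f1 g1. uni b F * g1 = f1 * uni b G \<and> poly g1 z \<noteq> 0" for z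
  proof (cases "\<exists>j\<in>K. poly_eval (pc z 1 b) (l j) = 0")
    case True
    then have "poly_eval (pc z 1 b) G \<noteq> 0" using bad by auto
    then show ?thesis by (intro exI[of _ "uni b F"] exI[of _ "uni b G"]) (simp add: poly_uni)
  next
    case False
    then have nl: "\<And>j. j \<in> K \<Longrightarrow> poly_eval (pc z 1 b) (l j) \<noteq> 0" by blast
    have "z \<noteq> 0 \<or> (1 :: complex) \<noteq> 0" by simp
    obtain F1 G1 a1 b1 where "F1 \<in> H a1" "G1 \<in> H b1" "int a1 = int b1 + d"
      "poly_eval (pc z 1 b) G1 \<noteq> 0" "F * G1 = F1 * G"
      by (rule local_rep[OF b(1) \<open>z \<noteq> 0 \<or> _\<close> nl])
    then show ?thesis
      by (intro exI[of _ "uni b F1"] exI[of _ "uni b G1"]) (simp add: poly_uni uni_simps(3)[symmetric])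
  qed
  show "\<exists>f1 g1. uni b F * g1 = f1 * uni b G \<and> g1 \<noteq> 0 \<and> int (Polynomial.degree f1) \<le> int (Polynomial.degree g1) + d"
  proof (cases "\<exists>j\<in>K. poly_eval (pc 1 0 b) (l j) = 0")
    case True
    then have "poly_eval (pc 1 0 b) G \<noteq> 0" using bad by auto
    \<comment> \<open>Nonvanishing at infinity means that the degree of \<open>G\<close> does not
      drop, which yields the comparison of degrees.\<close>
    then have "coeff (uni b G) g0 \<noteq> 0" using degree_uni(2)[OF G(1)] by simp
    then have "g0 \<le> Polynomial.degree (uni b G)" "uni b G \<noteq> 0" by (auto intro: le_degree)
    then show ?thesis using degree_uni(1)[OF F, of b] d
      by (intro exI[of _ "uni b F"] exI[of _ "uni b G"]) auto
  next
    case False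
    then have nl: "\<And>j. j \<in> K \<Longrightarrow> poly_eval (pc 1 0 b) (l j) \<noteq> 0" by blast
    have "(1 :: complex) \<noteq> 0 \<or> (0 :: complex) \<noteq> 0" by simp
    obtain F1 G1 a1 b1 where
      1: "F1 \<in> H a1" "G1 \<in> H b1" "int a1 = int b1 + d" "poly_eval (pc 1 0 b) G1 \<noteq> 0" "F * G1 = F1 * G"
      by (rule local_rep[OF b(1) \<open>1 \<noteq> 0 \<or> _\<close> nl])
    then have "coeff (uni b G1) b1 \<noteq> 0" using degree_uni(2)[OF 1(2)] by simp
    then have "b1 \<le> Polynomial.degree (uni b G1)" "uni b G1 \<noteq> 0" by (auto intro: le_degree)
    then show ?thesis using degree_uni(1)[OF 1(1), of b] 1(3,5)
      by (intro exI[of _ "uni b F1"] exI[of _ "uni b G1"]) (auto simp: uni_simps(3)[symmetric])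
  qed
qed (rule that)

lemma negative_degree: "d < 0 \<Longrightarrow> F = 0"
proof (rule H_eq_0[OF F disc(1,2)])
  fix b assume "d < 0" "b \<in> B" "ev b disc \<noteq> 0"
  from generic_fibre[OF this(2,3)] obtain p where "uni b F = uni b G * p" "p = 0 \<or> int (Polynomial.degree p) \<le> d" .
  then show "uni b F = 0" using \<open>d < 0\<close> by auto
qed

text \<open>Two kinds of points are excluded: zeros of the \<open>l j\<close> on the fibre over
  \<open>b0\<close>, where regularity is not known, and points whose constant section lies in the
  zero set of \<open>G\<close>. For the latter it is enough to look at one fibre, over some
  \<open>b1\<close>.\<close>

lemma interpolation_points:
  assumes b0: "b0 \<in> B"
  shows "\<exists>z :: nat \<Rightarrow> complex. inj z \<and> (\<forall>i. \<forall>j\<in>K. poly_eval (pc (z i) 1 b0) (l j) \<noteq> 0) \<and>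
    (\<forall>i. sub0 (Poly_Mapping.single 0 (z i)) 1 G \<noteq> 0)"
proof -
  have "\<exists>b1\<in>B. uni b1 G \<noteq> 0" using dense_uni_eq_0[OF dense G(1)] G(2) by blast
  then obtain b1 where b1: "b1 \<in> B" "uni b1 G \<noteq> 0" by blast
  define Bad where "Bad = {z. poly (uni b1 G) z = 0} \<union> (\<Union>j\<in>K. {z. poly (uni b0 (l j)) z = 0})"
  have "finite Bad" unfolding Bad_def
  proof (intro finite_UnI finite_UN_I)
    show "finite {z. poly (uni b1 G) z = 0}" by (rule poly_roots_finite[OF b1(2)])
    show "finite K" using K finite_J by (rule finite_subset)
    show "finite {z. poly (uni b0 (l j)) z = 0}" if "j \<in> K" for j
      using linear_form.uni_l_nz[OF lin] that K by (intro poly_roots_finite) blast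
  qed
  then have "infinite (UNIV - Bad)" using infinite_UNIV_char_0 by (rule Diff_infinite_finite)
  then obtain z :: "nat \<Rightarrow> complex" where z: "inj z" "range z \<subseteq> UNIV - Bad"
    using infinite_countable_subset by blast
  show ?thesis
  proof (intro exI[of _ z] conjI allI ballI z(1))
    show "poly_eval (pc (z i) 1 b0) (l j) \<noteq> 0" if "j \<in> K" for i j
      using z(2) that by (auto simp: Bad_def poly_uni)
    fix i
    have "ev b1 (sub0 (Poly_Mapping.single 0 (z i)) 1 G) = poly_eval (pc (z i) 1 b1) G"
      using ev_sub0[of "Poly_Mapping.single 0 (z i)" "PV I" 1 b1 G] by (simp add: poly_eval_const poly_eval_simps)
    also have "\<dots> \<noteq> 0" using z(2) by (auto simp: Bad_def poly_uni)
    finally show "sub0 (Poly_Mapping.single 0 (z i)) 1 G \<noteq> 0" by (auto simp: poly_eval_simps)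
  qed
qed

text \<open>The point \<open>b0\<close> may be special: \<open>disc\<close> may vanish there, and
  \<open>G\<close> may even vanish on the whole fibre. The coefficients are therefore built from the
  values of \<open>F / G\<close> along constant sections, which are regular at
  \<open>b0\<close>.\<close>

lemma local_form:
  assumes b0: "b0 \<in> B" and d0: "0 \<le> d"
  obtains s where "\<And>i. s i \<in> lr I b0" "emb F / emb G = form (nat d) s"
proof -
  define n where "n = nat d"
  have an: "a = g0 + n" using d d0 by (simp add: n_def)
  from interpolation_points[OF b0] obtain z :: "nat \<Rightarrow> complex" where z0: "inj z \<and>
    (\<forall>i. \<forall>j\<in>K. poly_eval (pc (z i) 1 b0) (l j) \<noteq> 0) \<and> (\<forall>i. sub0 (Poly_Mapping.single 0 (z i)) 1 G \<noteq> 0)"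
    by (elim exE) (rule that)
  have z: "inj z" "\<And>i j. j \<in> K \<Longrightarrow> poly_eval (pc (z i) 1 b0) (l j) \<noteq> 0"
    "\<And>i. sub0 (Poly_Mapping.single 0 (z i)) 1 G \<noteq> 0" using z0 by blast+
  define ct where "ct = (Poly_Mapping.single 0 :: complex \<Rightarrow> Defs.poly)"
  define f where "f i = sub0 (ct (z i)) 1 F" for i
  define g where "g i = sub0 (ct (z i)) 1 G" for i
  \<comment> \<open>The Lagrange basis for the nodes \<open>z 0, ..., z n\<close>, as forms of
    degree \<open>n\<close>.\<close>
  define \<Lambda> where "\<Lambda> i = ct (1 / (\<Prod>k\<in>{..n} - {i}. z i - z k)) * (\<Prod>k\<in>{..n} - {i}. PX - ct (z k) * PY)" for i
  have ctH: "ct x \<in> H 0" for x by (simp add: ct_def)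
  have fH: "f i \<in> H 0" for i unfolding f_def by (rule sub0_hpolys[OF F]) (auto simp: ct_def)
  have gH: "g i \<in> H 0" for i unfolding g_def by (rule sub0_hpolys[OF G(1)]) (auto simp: ct_def)
  have g0: "g i \<noteq> 0" for i using z(3) by (simp add: g_def ct_def)
  have evf: "ev b (f i) = poly (uni b F) (z i)" and evg: "ev b (g i) = poly (uni b G) (z i)" for b i
    unfolding f_def g_def poly_uni ct_def
    using ev_sub0[of "Poly_Mapping.single 0 (z i)" "PV I" 1 b] by (simp_all add: poly_eval_const poly_eval_simps)
  have \<Lambda>H: "\<Lambda> i \<in> H n" if "i \<le> n" for i
  proof -
    have "PX - ct (z k) * PY \<in> H 1" for k using hpolys_mult[OF ctH PY_hpolys, of "z k"] by (intro hpolys_diff PX_hpolys) simp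
    then have "(\<Prod>k\<in>{..n} - {i}. PX - ct (z k) * PY) \<in> H (\<Sum>k\<in>{..n} - {i}. 1)" by (intro hpolys_prod)
    also have "(\<Sum>k\<in>{..n} - {i}. 1) = n" using that by simp
    finally show ?thesis unfolding \<Lambda>_def using hpolys_mult[OF ctH] by fastforce
  qed
  have uni_ct: "uni b (ct x) = [:x:]" for b x
    using uni_hpolys_0[OF ctH, of b x] by (simp add: ct_def poly_eval_const)
  have \<Lambda>val: "poly (uni b (\<Lambda> i)) (z m) = (if m = i then 1 else 0)" if "i \<le> n" "m \<le> n" for b i m
  proof -
    have e: "poly (uni b (\<Lambda> i)) (z m) = 1 / (\<Prod>k\<in>{..n} - {i}. z i - z k) * (\<Prod>k\<in>{..n} - {i}. z m - z k)"
      by (simp add: \<Lambda>_def uni_simps uni_ct uni_X poly_prod)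
    have "(\<Prod>k\<in>{..n} - {i}. z i - z k) \<noteq> 0" using z(1) by (auto simp: inj_eq)
    then show ?thesis unfolding e using that by (auto simp: inj_eq[OF z(1)])
  qed
  define gg where "gg = (\<Prod>k\<le>n. g k)"
  define rem where "rem i = (\<Prod>k\<in>{..n} - {i}. g k)" for i
  have ggr: "gg = g i * rem i" if "i \<le> n" for i
    unfolding gg_def rem_def using that by (intro prod.remove) auto
  have ggH: "gg \<in> H 0" unfolding gg_def using hpolys_prod[of "{..n}" g "PV I" "\<lambda>_. 0"] gH by simp
  have remH: "rem i \<in> H 0" for i unfolding rem_def using hpolys_prod[of "{..n} - {i}" g "PV I" "\<lambda>_. 0"] gH by simp
  have gg0: "gg \<noteq> 0" using g0 by (simp add: gg_def)
  \<comment> \<open>The interpolation identity, with the denominators \<open>g i\<close> cleared by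
    their product \<open>gg\<close>.\<close>
  define \<Psi> where "\<Psi> = gg * F - G * (\<Sum>i\<le>n. f i * rem i * \<Lambda> i)"
  have "\<Psi> = 0"
  proof (rule H_eq_0[OF _ disc(1,2)])
    have "f i * rem i * \<Lambda> i \<in> H n" if "i \<le> n" for i
      using hpolys_mult[OF hpolys_mult[OF fH remH] \<Lambda>H[OF that]] by simp
    then have "(\<Sum>i\<le>n. f i * rem i * \<Lambda> i) \<in> H n" by (intro hpolys_sum) auto
    then show "\<Psi> \<in> H a" unfolding \<Psi>_def an
      using hpolys_mult[OF ggH F] hpolys_mult[OF G(1)] an by (intro hpolys_diff) auto
    fix b assume b: "b \<in> B" "ev b disc \<noteq> 0"
    from generic_fibre[OF this] obtain p where p: "uni b F = uni b G * p" "p = 0 \<or> int (Polynomial.degree p) \<le> d" .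
    define q where "q = Polynomial.smult (ev b gg) p - (\<Sum>i\<le>n. Polynomial.smult (ev b (f i) * ev b (rem i)) (uni b (\<Lambda> i)))"
    have "uni b \<Psi> = uni b G * q"
      by (simp add: \<Psi>_def q_def uni_simps uni_hpolys_0[OF ggH] uni_hpolys_0[OF fH] uni_hpolys_0[OF remH] p(1)
          algebra_simps)
    moreover have "q = 0"
    proof (rule ccontr)
      assume "q \<noteq> 0"
      have "Polynomial.degree q \<le> n" unfolding q_def
      proof (intro degree_diff_le degree_sum_le)
        show "Polynomial.degree (Polynomial.smult (ev b gg) p) \<le> n"
          using p(2) d0 by (intro order_trans[OF degree_smult_le]) (auto simp: n_def)
        show "Polynomial.degree (Polynomial.smult (ev b (f i) * ev b (rem i)) (uni b (\<Lambda> i))) \<le> n" if "i \<in> {..n}" for i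
          using that by (intro order_trans[OF degree_smult_le] degree_uni(1)[OF \<Lambda>H]) auto
      qed simp
      have "poly q (z m) = 0" if "m \<le> n" for m
      proof -
        have "poly q (z m) = ev b gg * poly p (z m) - (\<Sum>i\<le>n. ev b (f i) * ev b (rem i) * (if m = i then 1 else 0))"
          using \<Lambda>val that by (simp add: q_def poly_sum)
        also have "(\<Sum>i\<le>n. ev b (f i) * ev b (rem i) * (if m = i then 1 else 0)) =
            (\<Sum>i\<in>{m}. ev b (f i) * ev b (rem i) * (if m = i then 1 else 0))"
          by (rule sum.mono_neutral_right) (use that in auto)
        also have "\<dots> = ev b (f m) * ev b (rem m)" by simp
        also have "ev b gg * poly p (z m) = ev b (f m) * ev b (rem m)"
          by (simp add: ggr[OF that] poly_eval_simps evf evg p(1) mult_ac)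
        finally show ?thesis by simp
      qed
      then have sub: "z ` {..n} \<subseteq> {x. poly q x = 0}" by blast
      have "card (z ` {..n}) = Suc n" using card_image[OF inj_on_subset[OF z(1) subset_UNIV], of "{..n}"] by simp
      then have "Suc n \<le> card {x. poly q x = 0}"
        using card_mono[OF poly_roots_finite[OF \<open>q \<noteq> 0\<close>] sub] by simp
      also have "\<dots> \<le> Polynomial.degree q" by (rule card_poly_roots_bound[OF \<open>q \<noteq> 0\<close>])
      finally show False using \<open>Polynomial.degree q \<le> n\<close> by simp
    qed
    ultimately show "uni b \<Psi> = 0" by simp
  qed
  then have \<Psi>0: "gg * F = G * (\<Sum>i\<le>n. f i * rem i * \<Lambda> i)" by (simp add: \<Psi>_def)
  \<comment> \<open>A fraction that represents \<open>F / G\<close> near \<open>[z i : 1]\<close>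
    over \<open>b0\<close> has, when restricted to that section, a denominator that does not vanish
    at \<open>b0\<close>.\<close>
  have r_lr: "emb (f i) / emb (g i) \<in> lr I b0" for i
  proof -
    have "z i \<noteq> 0 \<or> (1 :: complex) \<noteq> 0" by simp
    obtain F1 G1 a1 b1 where
      1: "F1 \<in> H a1" "G1 \<in> H b1" "int a1 = int b1 + d" "poly_eval (pc (z i) 1 b0) G1 \<noteq> 0" "F * G1 = F1 * G"
      by (rule local_rep[OF b0 \<open>z i \<noteq> 0 \<or> _\<close> z(2)])
    define f1 where "f1 = sub0 (ct (z i)) 1 F1"
    define g1 where "g1 = sub0 (ct (z i)) 1 G1"
    have "f1 \<in> H 0" unfolding f1_def by (rule sub0_hpolys[OF 1(1)]) (auto simp: ct_def)
    moreover have "g1 \<in> H 0" unfolding g1_def by (rule sub0_hpolys[OF 1(2)]) (auto simp: ct_def)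
    moreover have "ev b0 g1 \<noteq> 0" unfolding g1_def ct_def
      using ev_sub0[of "Poly_Mapping.single 0 (z i)" "PV I" 1 b0 G1] 1(4) by (simp add: poly_eval_const poly_eval_simps)
    ultimately have "emb f1 / emb g1 \<in> lr I b0" "g1 \<noteq> 0" using lrI poly_eval_nz by blast+
    moreover have "f i * g1 = f1 * g i"
      using arg_cong[OF 1(5), of "sub0 (ct (z i)) 1"] by (simp add: f_def g_def f1_def g1_def sub0_simps)
    ultimately show ?thesis using emb_divide_eq_iff[OF g0 \<open>g1 \<noteq> 0\<close>, of "f i" i f1] by simp
  qed
  have "\<forall>i. \<exists>P. i \<le> n \<longrightarrow> (\<forall>m. P m \<in> H 0) \<and> \<Lambda> i = (\<Sum>m\<le>n. P m * PX ^ m * PY ^ (n - m))"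
  proof
    fix i
    show "\<exists>P. i \<le> n \<longrightarrow> (\<forall>m. P m \<in> H 0) \<and> \<Lambda> i = (\<Sum>m\<le>n. P m * PX ^ m * PY ^ (n - m))"
    proof (cases "i \<le> n")
      case True
      obtain P where "\<And>m. P m \<in> H 0" "\<Lambda> i = (\<Sum>m\<le>n. P m * PX ^ m * PY ^ (n - m))"
        by (rule hpolys_expand[OF \<Lambda>H[OF True]]) blast
      then show ?thesis by blast
    qed simp
  qed
  from choice[OF this] obtain P where P0: "\<forall>i. i \<le> n \<longrightarrow> (\<forall>m. P i m \<in> H 0) \<and> \<Lambda> i = (\<Sum>m\<le>n. P i m * PX ^ m * PY ^ (n - m))"
    by (elim exE) (rule that)
  have P: "P i m \<in> H 0" "\<Lambda> i = (\<Sum>m\<le>n. P i m * PX ^ m * PY ^ (n - m))" if "i \<le> n" for i m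
    using P0 that by blast+
  define s where "s m = (\<Sum>i\<le>n. emb (f i) / emb (g i) * emb (P i m))" for m
  have "s m \<in> lr I b0" for m
    unfolding s_def
  proof (rule subring_closedD(7)[OF subring_closed_lr])
    fix i assume "i \<in> {..n}"
    then have "emb (P i m) \<in> lr I b0" by (intro lr_emb P(1)) simp
    then show "emb (f i) / emb (g i) * emb (P i m) \<in> lr I b0"
      by (rule subring_closedD(4)[OF subring_closed_lr r_lr])
  qed
  moreover have "emb F / emb G = form (nat d) s"
  proof -
    have "emb gg * (emb F / emb G) = (\<Sum>i\<le>n. emb (f i) * emb (rem i) * emb (\<Lambda> i))"
    proof -
      have "emb gg * emb F = emb G * (\<Sum>i\<le>n. emb (f i) * emb (rem i) * emb (\<Lambda> i))"
        using arg_cong[OF \<Psi>0, of emb] by (simp add: emb_simps)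
      then show ?thesis using G(2) by (simp add: field_simps)
    qed
    also have "\<dots> = (\<Sum>i\<le>n. emb gg * (emb (f i) / emb (g i) * emb (\<Lambda> i)))"
      by (rule sum.cong) (use g0 in \<open>auto simp: ggr emb_simps\<close>)
    also have "\<dots> = emb gg * (\<Sum>i\<le>n. emb (f i) / emb (g i) * emb (\<Lambda> i))" by (simp add: sum_distrib_left)
    finally have "emb F / emb G = (\<Sum>i\<le>n. emb (f i) / emb (g i) * emb (\<Lambda> i))"
      by (rule mult_left_cancel[THEN iffD1, rotated]) (simp add: gg0)
    also have "\<dots> = (\<Sum>i\<le>n. \<Sum>m\<le>n. emb (f i) / emb (g i) * emb (P i m) * emb (PX ^ m * PY ^ (n - m)))"
      by (rule sum.cong) (auto simp: P(2) emb_simps sum_distrib_left mult_ac)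
    also have "\<dots> = form (nat d) s"
      unfolding form_def s_def n_def[symmetric] sum_distrib_right by (rule sum.swap)
    finally show ?thesis .
  qed
  ultimately show thesis by (rule that)
qed

text \<open>The coefficients found near different points coincide, by the linear independence of the
  monomials, and so lie in every local ring.\<close>

lemma global_form:
  assumes d0: "0 \<le> d"
  obtains s where "\<And>i. s i \<in> R" "emb F / emb G = form (nat d) s"
proof -
  have "\<forall>b\<in>B. \<exists>s. (\<forall>i. s i \<in> lr I b) \<and> emb F / emb G = form (nat d) s"
  proof
    fix b assume "b \<in> B"
    from local_form[OF this d0] obtain s where "\<And>i. s i \<in> lr I b" "emb F / emb G = form (nat d) s" by blast
    then show "\<exists>s. (\<forall>i. s i \<in> lr I b) \<and> emb F / emb G = form (nat d) s" by blast
  qed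
  from bchoice[OF this] obtain s where s0: "\<forall>b\<in>B. (\<forall>i. s b i \<in> lr I b) \<and> emb F / emb G = form (nat d) (s b)"
    by (elim exE) (rule that)
  have s: "\<And>b i. b \<in> B \<Longrightarrow> s b i \<in> lr I b" "\<And>b. b \<in> B \<Longrightarrow> emb F / emb G = form (nat d) (s b)"
    using s0 by blast+
  obtain b0 where b0: "b0 \<in> B" using B_ne by blast
  \<comment> \<open>Beyond \<open>nat d\<close> the coefficients are not determined by the form and
    need not agree; they are set to zero.\<close>
  define t where "t i = (if i \<le> nat d then s b0 i else 0)" for i
  have "t i \<in> lr I b" if bB: "b \<in> B" for b i
  proof (cases "i \<le> nat d")
    case True
    have f0: "form (nat d) (\<lambda>i. s b0 i - s b i) = 0"
      using s(2)[OF b0] s(2)[OF bB] by (simp add: form_diff[symmetric])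
    have "s b0 i - s b i = 0"
    proof (rule form_eq_0[OF _ f0 True])
      fix i
      obtain F1 G1 where 1: "F1 \<in> H 0" "G1 \<in> H 0" "ev b0 G1 \<noteq> 0" "s b0 i = emb F1 / emb G1"
        by (rule lrE[OF s(1)[OF b0]])
      obtain F2 G2 where 2: "F2 \<in> H 0" "G2 \<in> H 0" "ev b G2 \<noteq> 0" "s b i = emb F2 / emb G2"
        by (rule lrE[OF s(1)[OF bB]])
      have GG: "G1 * G2 \<in> H 0" "G1 * G2 \<noteq> 0" using hpolys_mult[OF 1(2) 2(2)] poly_eval_nz[OF 1(3)] poly_eval_nz[OF 2(3)] by auto
      then obtain b' where "b' \<in> B" "ev b' (G1 * G2) \<noteq> 0" using dense unfolding dense_def by blast
      moreover have "s b0 i - s b i = emb (F1 * G2 - F2 * G1) / emb (G1 * G2)"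
        using 1(4) 2(4) poly_eval_nz[OF 1(3)] poly_eval_nz[OF 2(3)] by (simp add: emb_simps diff_frac_eq)
      moreover have "F1 * G2 - F2 * G1 \<in> H 0" using hpolys_mult[OF 1(1) 2(2)] hpolys_mult[OF 2(1) 1(2)] hpolys_diff by auto
      ultimately show "\<exists>b'. s b0 i - s b i \<in> lr I b'" using lrI[OF _ GG(1)] by metis
    qed
    then show ?thesis using s(1)[OF bB, of i] True by (simp add: t_def)
  next
    case False
    then show ?thesis using subring_closedD(2)[OF subring_closed_lr] by (simp add: t_def)
  qed
  then have "t i \<in> R" for i by (simp add: R_def)
  moreover have "emb F / emb G = form (nat d) t" using s(2)[OF b0] by (simp add: form_def t_def)
  ultimately show thesis by (rule that)
qed

end

end

subsection \<open>Divisors defined by linear forms\<close>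

text \<open>A local generator of the line bundle of degree \<open>d\<close> at
  \<open>x\<close>.\<close>

definition runit :: "coord set \<Rightarrow> int \<Rightarrow> (coord \<Rightarrow> complex) \<Rightarrow> ratfun \<Rightarrow> bool" where
  "runit V d x f \<longleftrightarrow> f \<noteq> 0 \<and> f \<in> reg V d x \<and> inverse f \<in> reg V (- d) x"

lemma runit_emb: "G \<in> hpolys V b \<Longrightarrow> poly_eval x G \<noteq> 0 \<Longrightarrow> runit V (int b) x (emb G)"
  using reg_emb[of G V b x] reg_emb_inverse[of G V b x] poly_eval_nz[of x G] by (simp add: runit_def)

lemma runit_mult:
  assumes "runit V d x f" "runit V e x g"
  shows "runit V (d + e) x (f * g)"
proof -
  have "inverse f * inverse g \<in> reg V (- d + - e) x" using assms reg_mult unfolding runit_def by blast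
  moreover have "f * g \<in> reg V (d + e) x" using assms reg_mult unfolding runit_def by blast
  ultimately show ?thesis using assms by (simp add: runit_def algebra_simps)
qed

lemma runit_1: "runit V 0 x 1"
  by (simp add: runit_def reg_1)

lemma runit_powi: "runit V d x f \<Longrightarrow> runit V (k * d) x (f powi k)"
  using reg_powi[of f V d x k] reg_powi[of "inverse f" V "- d" x k]
  by (simp add: runit_def power_int_inverse)

lemma runit_prod: "(\<And>i. i \<in> A \<Longrightarrow> runit V (d i) x (f i)) \<Longrightarrow> runit V (sum d A) x (prod f A)"
  by (induction A rule: infinite_finite_induct) (auto simp: runit_1 runit_mult)

lemma runit_reg_iff:
  assumes "runit V d x a"
  shows "f * a \<in> reg V (e + d) x \<longleftrightarrow> f \<in> reg V e x"
proof
  assume "f * a \<in> reg V (e + d) x"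
  from reg_mult[OF this, of "inverse a" "- d"] assms show "f \<in> reg V e x" by (simp add: runit_def mult.assoc)
next
  assume "f \<in> reg V e x"
  then show "f * a \<in> reg V (e + d) x" using assms reg_mult unfolding runit_def by blast
qed

lemma reg_scale:
  assumes "f \<in> reg (PV I) d (pc (k * z) (k * w) b)" "k \<noteq> 0"
  shows "f \<in> reg (PV I) d (pc z w b)"
proof -
  from assms(1) obtain F G a b' where *: "F \<in> hpolys (PV I) a" "G \<in> hpolys (PV I) b'" "int a = int b' + d"
    "poly_eval (pc (k * z) (k * w) b) G \<noteq> 0" "f = emb F / emb G" by (rule regE)
  have "poly_eval (pc z w b) G \<noteq> 0" using *(4) poly_eval_scale[OF *(2)] by auto
  with * show ?thesis using regI by blast
qed

text \<open>For negative \<open>d\<close> even the zero section needs a denominator of positive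
  degree that does not vanish at the point; a power of \<open>X0\<close> or of \<open>X1\<close>
  will do.\<close>

lemma reg_0': "z \<noteq> 0 \<or> w \<noteq> 0 \<Longrightarrow> 0 \<in> reg (PV I) d (pc z w b)"
proof (cases "d \<ge> 0")
  case True
  then show ?thesis using reg_0[of "PV I" "nat d"] by simp
next
  case False
  assume "z \<noteq> 0 \<or> w \<noteq> 0"
  then have "poly_eval (pc z w b) (PX ^ nat (- d)) \<noteq> 0 \<or> poly_eval (pc z w b) (PY ^ nat (- d)) \<noteq> 0"
    by (auto simp: poly_eval_simps poly_eval_var)
  then show ?thesis
    using regI[of 0 "PV I" 0 "PX ^ nat (- d)" "nat (- d)" d "pc z w b"]
      regI[of 0 "PV I" 0 "PY ^ nat (- d)" "nat (- d)" d "pc z w b"] False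
    by (auto simp: emb_simps)
qed

lemma ideal_power_SucE:
  assumes "z \<in> ideal_power L N (Suc k)"
  obtains m :: nat and a b where "z = (\<Sum>i<m. a i * b i)" "\<forall>i<m. a i \<in> N \<and> b i \<in> ideal_power L N k"
  using assms unfolding ideal_power.simps by (elim CollectE exE conjE) (rule that)

text \<open>Covers the projective line and its product with the base at once. The factor
  \<open>k\<close> in \<open>Y_all\<close> is there because a point carries one fixed vector of
  homogeneous coordinates.\<close>

locale variety_family = linear_forms I B J \<alpha> \<beta> \<gamma> \<epsilon>
  for I B and J :: "'j set" and \<alpha> \<beta> \<gamma> \<epsilon> +
  fixes Y :: "'p variety" and x :: "'p \<Rightarrow> coord \<Rightarrow> complex"
  assumes Y_closed: "closed_sets Y = {{p \<in> pts Y. \<forall>F\<in>S. poly_eval (x p) F = 0} | S. S \<subseteq> (\<Union>d. hpolys (PV I) d)}"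
    and Y_funs: "funs Y = {Fract F G | F G d. F \<in> hpolys (PV I) d \<and> G \<in> hpolys (PV I) d \<and> G \<noteq> 0}"
    and Y_lring: "lring Y p = reg (PV I) 0 (x p)"
    and Y_pts: "p \<in> pts Y \<Longrightarrow> \<exists>b\<in>B. \<exists>z w. (z \<noteq> 0 \<or> w \<noteq> 0) \<and> x p = pc z w b"
    and Y_all: "b \<in> B \<Longrightarrow> z \<noteq> 0 \<or> w \<noteq> 0 \<Longrightarrow> \<exists>p\<in>pts Y. \<exists>k. k \<noteq> 0 \<and> x p = pc (k * z) (k * w) b"
begin

definition "Z j = {p \<in> pts Y. poly_eval (x p) (l j) = 0}"
text \<open>The linear form made into a rational function: \<open>c j\<close> has no zeros on
  \<open>Z j\<close>, so this is a local equation of \<open>Z j\<close> at each of its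
  points.\<close>

definition "t j = emb (l j) / emb (c j)"

lemmas L = linear_form.l_H[OF lin] linear_form.c_H[OF lin] linear_form.l_nz[OF lin] linear_form.c_nz[OF lin]

lemma c_nz_on_Z: "j \<in> J \<Longrightarrow> p \<in> Z j \<Longrightarrow> poly_eval (x p) (c j) \<noteq> 0"
  using Y_pts[of p] linear_form.c_nz_on_zero[OF lin, of j] unfolding Z_def by auto

text \<open>Every fibre over \<open>B\<close> contains a point of \<open>Z j\<close>, and there the
  value of \<open>F\<close> is that of \<open>rs j F\<close> up to a power of the nonzero value of
  \<open>c j\<close>; density does the rest.\<close>

lemma vanish_iff:
  assumes "j \<in> J" "F \<in> H d"
  shows "(\<forall>p\<in>Z j. poly_eval (x p) F = 0) \<longleftrightarrow> rs j F = 0"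
proof -
  interpret L: linear_form I "\<alpha> j" "\<beta> j" "\<gamma> j" "\<epsilon> j" by (rule lin[OF assms(1)])
  show ?thesis
  proof
    assume van: "\<forall>p\<in>Z j. poly_eval (x p) F = 0"
    have "ev b (rs j F) = 0" if b: "b \<in> B" for b
    proof -
      obtain z w where zw: "z \<noteq> 0 \<or> w \<noteq> 0" "poly_eval (pc z w b) (l j) = 0"
        using L.zero_exists[of b] zero_neq_one by metis
      from Y_all[OF b zw(1)] obtain p k where p: "p \<in> pts Y" "k \<noteq> 0" "x p = pc (k * z) (k * w) b" by blast
      have "p \<in> Z j" using p zw(2) poly_eval_scale[OF L.l_H, of k z w b] by (simp add: Z_def)
      then have "poly_eval (pc z w b) F = 0" using van p poly_eval_scale[OF assms(2), of k z w b] by auto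
      then show ?thesis using L.poly_eval_on_zero[OF assms(2) zw(2)] L.c_nz_on_zero[OF zw(2,1)] by simp
    qed
    then show "rs j F = 0" using dense L.rs_H[OF assms(2)] unfolding dense_def by blast
  next
    assume "rs j F = 0"
    then have "poly_eval (pc z w b) F = 0" if "poly_eval (pc z w b) (l j) = 0" for z w b
      using L.poly_eval_on_zero[OF assms(2) that] by (simp add: poly_eval_simps)
    then show "\<forall>p\<in>Z j. poly_eval (x p) F = 0" using Y_pts unfolding Z_def by fastforce
  qed
qed

lemma rs_nz: "j \<in> J \<Longrightarrow> F \<in> H d \<Longrightarrow> p \<in> Z j \<Longrightarrow> poly_eval (x p) F \<noteq> 0 \<Longrightarrow> rs j F \<noteq> 0"
  using vanish_iff by blast

lemma Z_dvd:
  assumes "j \<in> J" "F \<in> H d" "rs j F = 0"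
  obtains Q where "F = l j * Q" "Q \<in> H (d - 1)" "d = 0 \<Longrightarrow> F = 0"
  using linear_form.dvd_of_rs_0[OF lin[OF assms(1)] assms(2,3)] by blast

lemma closedI: "F \<in> H d \<Longrightarrow> {p \<in> pts Y. poly_eval (x p) F = 0} \<in> closed_sets Y"
  unfolding Y_closed by (intro CollectI exI[of _ "{F}"]) auto

lemma irreducible_mult:
  assumes W: "irreducible_closed Y W" and "F \<in> H d" "G \<in> H e" "\<And>p. p \<in> W \<Longrightarrow> poly_eval (x p) (F * G) = 0"
  shows "(\<forall>p\<in>W. poly_eval (x p) F = 0) \<or> (\<forall>p\<in>W. poly_eval (x p) G = 0)"
proof -
  have "W \<subseteq> pts Y" using W unfolding irreducible_closed_def Y_closed by auto
  then have "W \<subseteq> {p \<in> pts Y. poly_eval (x p) F = 0} \<union> {p \<in> pts Y. poly_eval (x p) G = 0}"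
    using assms(4) by (auto simp: poly_eval_simps)
  then have "W \<subseteq> {p \<in> pts Y. poly_eval (x p) F = 0} \<or> W \<subseteq> {p \<in> pts Y. poly_eval (x p) G = 0}"
    using W closedI[OF assms(2)] closedI[OF assms(3)] unfolding irreducible_closed_def by blast
  then show ?thesis by blast
qed

lemma Z_ne: "j \<in> J \<Longrightarrow> Z j \<noteq> {}"
proof -
  assume j: "j \<in> J"
  interpret L: linear_form I "\<alpha> j" "\<beta> j" "\<gamma> j" "\<epsilon> j" by (rule lin[OF j])
  show ?thesis using vanish_iff[OF j, of 1 0] L.rs_simps(3) by auto
qed

text \<open>The forms that vanish on \<open>Z j\<close> are those killed by \<open>rs j\<close>, a
  homomorphism into a domain.\<close>

lemma Z_irreducible:
  assumes "j \<in> J"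
  shows "irreducible_closed Y (Z j)"
  unfolding irreducible_closed_def
proof (intro conjI ballI impI)
  interpret L: linear_form I "\<alpha> j" "\<beta> j" "\<gamma> j" "\<epsilon> j" by (rule lin[OF assms])
  show "Z j \<in> closed_sets Y" unfolding Z_def by (rule closedI[OF L.l_H])
  show "Z j \<noteq> {}" by (rule Z_ne[OF assms])
  fix A A' assume A: "A \<in> closed_sets Y" "A' \<in> closed_sets Y" "Z j \<subseteq> A \<union> A'"
  from A(1) obtain S where S: "S \<subseteq> (\<Union>d. H d)" "A = {p \<in> pts Y. \<forall>F\<in>S. poly_eval (x p) F = 0}" unfolding Y_closed by blast
  from A(2) obtain S' where S': "S' \<subseteq> (\<Union>d. H d)" "A' = {p \<in> pts Y. \<forall>F\<in>S'. poly_eval (x p) F = 0}" unfolding Y_closed by blast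
  show "Z j \<subseteq> A \<or> Z j \<subseteq> A'"
  proof (rule ccontr)
    assume "\<not> (Z j \<subseteq> A \<or> Z j \<subseteq> A')"
    then obtain p p' where p: "p \<in> Z j" "p \<notin> A" "p' \<in> Z j" "p' \<notin> A'" by blast
    then obtain F G where FG: "F \<in> S" "poly_eval (x p) F \<noteq> 0" "G \<in> S'" "poly_eval (x p') G \<noteq> 0"
      using S(2) S'(2) unfolding Z_def by blast
    obtain d e where de: "F \<in> H d" "G \<in> H e" using FG S(1) S'(1) by blast
    have "\<forall>q\<in>Z j. poly_eval (x q) (F * G) = 0"
    proof
      fix q assume "q \<in> Z j"
      then have "q \<in> A \<or> q \<in> A'" using A(3) by blast
      then show "poly_eval (x q) (F * G) = 0" using FG(1,3) unfolding S(2) S'(2) by (auto simp: poly_eval_simps)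
    qed
    then have "rs j (F * G) = 0" using vanish_iff[OF assms hpolys_mult[OF de]] by blast
    then have "rs j F = 0 \<or> rs j G = 0" by (simp add: L.rs_simps)
    then show False using rs_nz[OF assms de(1) p(1) FG(2)] rs_nz[OF assms de(2) p(3) FG(4)] by blast
  qed
qed

lemma ex_pts_nz:
  assumes "F \<in> H d" "F \<noteq> 0"
  shows "\<exists>p\<in>pts Y. poly_eval (x p) F \<noteq> 0"
proof -
  from dense_uni_eq_0[OF dense assms(1)] assms(2) obtain b where b: "b \<in> B" "uni b F \<noteq> 0" by blast
  then obtain z where "poly (uni b F) z \<noteq> 0" using poly_all_0_iff_0 by blast
  then have z: "poly_eval (pc z 1 b) F \<noteq> 0" by (simp add: poly_uni)
  from Y_all[OF b(1), of z 1] obtain p k where p: "p \<in> pts Y" "k \<noteq> 0" "x p = pc (k * z) (k * 1) b" by auto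
  then have "poly_eval (x p) F \<noteq> 0" using z poly_eval_scale[OF assms(1), of k z 1 b] by auto
  with p(1) show ?thesis by blast
qed

lemma Z_ne_pts: "j \<in> J \<Longrightarrow> Z j \<noteq> pts Y"
  using ex_pts_nz[OF L(1,3)] unfolding Z_def by blast

lemma strip:
  assumes "j \<in> J" "F \<in> H d" "F \<noteq> 0"
  shows "\<exists>k F' d'. F = l j ^ k * F' \<and> F' \<in> H d' \<and> rs j F' \<noteq> 0"
  using assms(2,3)
proof (induction d arbitrary: F rule: less_induct)
  case (less d)
  show ?case
  proof (cases "rs j F = 0")
    case False
    then show ?thesis using less.prems by (intro exI[of _ 0] exI[of _ F] exI[of _ d]) auto
  next
    case True
    from Z_dvd[OF assms(1) less.prems(1) True] obtain Q where Q: "F = l j * Q" "Q \<in> H (d - 1)" "d = 0 \<Longrightarrow> F = 0" by blast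
    have "d \<noteq> 0" using Q(3) less.prems(2) by blast
    then have "d - 1 < d" "Q \<noteq> 0" using Q(1) less.prems(2) by auto
    from less.IH[OF this(1) Q(2) this(2)] obtain k F' d' where "Q = l j ^ k * F'" "F' \<in> H d'" "rs j F' \<noteq> 0" by blast
    then show ?thesis using Q(1) by (intro exI[of _ "Suc k"] exI[of _ F'] exI[of _ d']) (auto simp: mult.assoc)
  qed
qed

text \<open>An irreducible closed set \<open>W\<close> that contains \<open>Z j\<close> and is not
  everything lies in the zero set of some \<open>F = l j ^ k * F'\<close> with \<open>F'\<close> not
  identically zero on \<open>Z j\<close>; hence it lies in the zero set of
  \<open>l j\<close>.\<close>

lemma Z_prime:
  assumes j: "j \<in> J"
  shows "Z j \<in> prime_divisors Y"
  unfolding prime_divisors_def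
proof (intro CollectI conjI allI impI)
  show "irreducible_closed Y (Z j)" by (rule Z_irreducible[OF j])
  show "Z j \<noteq> pts Y" by (rule Z_ne_pts[OF j])
  fix W assume W: "irreducible_closed Y W \<and> Z j \<subseteq> W"
  interpret L: linear_form I "\<alpha> j" "\<beta> j" "\<gamma> j" "\<epsilon> j" by (rule lin[OF j])
  have "W \<in> closed_sets Y" using W by (simp only: irreducible_closed_def)
  then obtain S where S: "S \<subseteq> (\<Union>d. H d)" "W = {p \<in> pts Y. \<forall>F\<in>S. poly_eval (x p) F = 0}"
    unfolding Y_closed by blast
  show "W = Z j \<or> W = pts Y"
  proof (cases "\<forall>F\<in>S. F = 0")
    case True
    then have "W = pts Y" unfolding S(2) by (auto simp: poly_eval_simps)
    then show ?thesis ..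
  next
    case False
    then obtain F d where F: "F \<in> S" "F \<noteq> 0" "F \<in> H d" using S(1) by blast
    from strip[OF j F(3,2)] obtain k F' d' where s: "F = l j ^ k * F'" "F' \<in> H d'" "rs j F' \<noteq> 0" by blast
    have lk: "l j ^ k \<in> H k" using hpolys_power[OF L.l_H, of k] by simp
    have "(\<forall>p\<in>W. poly_eval (x p) (l j ^ k) = 0) \<or> (\<forall>p\<in>W. poly_eval (x p) F' = 0)"
      using W F(1) s(1) S(2) by (intro irreducible_mult[OF _ lk s(2)]) auto
    moreover have "\<not> (\<forall>p\<in>W. poly_eval (x p) F' = 0)"
      using vanish_iff[OF j s(2)] s(3) W by blast
    ultimately have "\<forall>p\<in>W. poly_eval (x p) (l j ^ k) = 0" by blast
    then have "W \<subseteq> Z j" using S(2) by (auto simp: Z_def poly_eval_simps)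
    then show ?thesis using W by blast
  qed
qed

section \<open>The local ring along an irreducible closed set\<close>

context
  fixes W assumes W: "irreducible_closed Y W"
begin

abbreviation "LW \<equiv> lring_along Y W"

lemma W_pts: "W \<subseteq> pts Y" using W unfolding irreducible_closed_def Y_closed by auto

lemma LW_I: "F \<in> H d \<Longrightarrow> G \<in> H d \<Longrightarrow> p \<in> W \<Longrightarrow> poly_eval (x p) G \<noteq> 0 \<Longrightarrow> emb F / emb G \<in> LW"
  unfolding lring_along_def Y_lring using regI[of F "PV I" d G d 0] by auto

lemma LW_E:
  assumes "f \<in> LW"
  obtains F G d p where "F \<in> H d" "G \<in> H d" "p \<in> W" "poly_eval (x p) G \<noteq> 0" "f = emb F / emb G"
proof -
  from assms obtain p where p: "p \<in> W" "f \<in> reg (PV I) 0 (x p)" unfolding lring_along_def Y_lring by blast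
  from p(2) obtain F G a b where "F \<in> H a" "G \<in> H b" "int a = int b + 0" "poly_eval (x p) G \<noteq> 0" "f = emb F / emb G"
    by (rule regE)
  with p(1) that show thesis by simp
qed

text \<open>Fractions in \<open>LW\<close> may be regular at different points of \<open>W\<close>;
  irreducibility provides a point at which two denominators are nonzero together.\<close>

lemma mult_nz:
  assumes "F \<in> H d" "G \<in> H e" "p \<in> W" "poly_eval (x p) F \<noteq> 0" "q \<in> W" "poly_eval (x q) G \<noteq> 0"
  obtains r where "r \<in> W" "poly_eval (x r) (F * G) \<noteq> 0"
  using irreducible_mult[OF W assms(1,2)] assms(3-6) that by blast

text \<open>If \<open>F\<close> vanishes on \<open>W\<close>, an inverse \<open>F1 / G1\<close>
  would give \<open>G * G1 = F1 * F\<close>, and by irreducibility the left side cannot vanish on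
  all of \<open>W\<close>.\<close>

lemma LW_nonunits_iff:
  assumes "F \<in> H d" "G \<in> H d" "p \<in> W" "poly_eval (x p) G \<noteq> 0"
  shows "emb F / emb G \<in> nonunits LW \<longleftrightarrow> (\<forall>q\<in>W. poly_eval (x q) F = 0)"
proof
  assume non: "emb F / emb G \<in> nonunits LW"
  show "\<forall>q\<in>W. poly_eval (x q) F = 0"
  proof (rule ccontr)
    assume "\<not> (\<forall>q\<in>W. poly_eval (x q) F = 0)"
    then obtain q where q: "q \<in> W" "poly_eval (x q) F \<noteq> 0" by blast
    have "emb G / emb F \<in> LW" by (rule LW_I[OF assms(2,1) q])
    then show False using non poly_eval_nz[OF q(2)] poly_eval_nz[OF assms(4)] unfolding nonunits_def by simp
  qed
next
  assume van: "\<forall>q\<in>W. poly_eval (x q) F = 0"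
  have in': "emb F / emb G \<in> LW" by (rule LW_I[OF assms])
  have "inverse (emb F / emb G) \<notin> LW" if "F \<noteq> 0"
  proof
    assume "inverse (emb F / emb G) \<in> LW"
    then obtain F1 G1 e q where 1: "F1 \<in> H e" "G1 \<in> H e" "q \<in> W" "poly_eval (x q) G1 \<noteq> 0" "inverse (emb F / emb G) = emb F1 / emb G1"
      by (rule LW_E)
    have "emb G / emb F = emb F1 / emb G1" using 1(5) by simp
    then have "G * G1 = F1 * F" using emb_divide_eq_iff[OF that poly_eval_nz[OF 1(4)]] by blast
    moreover obtain r where "r \<in> W" "poly_eval (x r) (G * G1) \<noteq> 0" by (rule mult_nz[OF assms(2) 1(2) assms(3,4) 1(3,4)])
    ultimately show False using van by (simp add: poly_eval_simps)
  qed
  then show "emb F / emb G \<in> nonunits LW" using in' unfolding nonunits_def by (auto simp: emb_simps)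
qed

lemma LW_mult: "f \<in> LW \<Longrightarrow> g \<in> LW \<Longrightarrow> f * g \<in> LW"
proof (elim LW_E)
  fix F G d p F' G' e q assume *: "F \<in> H d" "G \<in> H d" "p \<in> W" "poly_eval (x p) G \<noteq> 0" "f = emb F / emb G"
    "F' \<in> H e" "G' \<in> H e" "q \<in> W" "poly_eval (x q) G' \<noteq> 0" "g = emb F' / emb G'"
  obtain r where "r \<in> W" "poly_eval (x r) (G * G') \<noteq> 0" by (rule mult_nz[OF *(2,7,3,4,8,9)])
  from LW_I[OF hpolys_mult[OF *(1,6)] hpolys_mult[OF *(2,7)] this] show ?thesis using * by (simp add: emb_simps)
qed

lemma LW_add: "f \<in> LW \<Longrightarrow> g \<in> LW \<Longrightarrow> f + g \<in> LW"
proof (elim LW_E)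
  fix F G d p F' G' e q assume *: "F \<in> H d" "G \<in> H d" "p \<in> W" "poly_eval (x p) G \<noteq> 0" "f = emb F / emb G"
    "F' \<in> H e" "G' \<in> H e" "q \<in> W" "poly_eval (x q) G' \<noteq> 0" "g = emb F' / emb G'"
  obtain r where r: "r \<in> W" "poly_eval (x r) (G * G') \<noteq> 0" by (rule mult_nz[OF *(2,7,3,4,8,9)])
  have "F * G' + F' * G \<in> H (d + e)"
    by (intro hpolys_add hpolys_mult[OF *(1,7)] hpolys_mult'[OF *(6,2)]) simp
  from LW_I[OF this hpolys_mult[OF *(2,7)] r] show ?thesis
    using * poly_eval_nz[OF *(4)] poly_eval_nz[OF *(9)] by (simp add: emb_simps add_frac_eq)
qed

lemma W_ex: "\<exists>p. p \<in> W" using W unfolding irreducible_closed_def by blast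

lemma LW_emb: "F \<in> H 0 \<Longrightarrow> emb F \<in> LW"
  using W_ex LW_I[of F 0 1] by (auto simp: emb_simps poly_eval_simps)

lemma LW_0: "0 \<in> LW" and LW_1: "1 \<in> LW"
  using LW_emb[of 0] LW_emb[of 1] by (auto simp: emb_simps)

lemma nonunits_mult_LW: "f \<in> nonunits LW \<Longrightarrow> g \<in> LW \<Longrightarrow> f * g \<in> nonunits LW"
proof -
  assume f: "f \<in> nonunits LW" and g: "g \<in> LW"
  then have fL: "f \<in> LW" by (simp add: nonunits_def)
  from fL obtain F G d p where 1: "F \<in> H d" "G \<in> H d" "p \<in> W" "poly_eval (x p) G \<noteq> 0" "f = emb F / emb G" by (rule LW_E)
  from g obtain F' G' e q where 2: "F' \<in> H e" "G' \<in> H e" "q \<in> W" "poly_eval (x q) G' \<noteq> 0" "g = emb F' / emb G'" by (rule LW_E)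
  obtain r where r: "r \<in> W" "poly_eval (x r) (G * G') \<noteq> 0" by (rule mult_nz[OF 1(2) 2(2) 1(3,4) 2(3,4)])
  have "\<forall>q\<in>W. poly_eval (x q) F = 0" using f LW_nonunits_iff[OF 1(1-4)] 1(5) by simp
  then have "emb (F * F') / emb (G * G') \<in> nonunits LW"
    by (subst LW_nonunits_iff[OF hpolys_mult[OF 1(1) 2(1)] hpolys_mult[OF 1(2) 2(2)] r]) (simp add: poly_eval_simps)
  then show ?thesis using 1 2 by (simp add: emb_simps)
qed

lemma nonunits_add: "f \<in> nonunits LW \<Longrightarrow> g \<in> nonunits LW \<Longrightarrow> f + g \<in> nonunits LW"
proof -
  assume f: "f \<in> nonunits LW" and g: "g \<in> nonunits LW"
  then have L: "f \<in> LW" "g \<in> LW" by (simp_all add: nonunits_def)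
  from L(1) obtain F G d p where 1: "F \<in> H d" "G \<in> H d" "p \<in> W" "poly_eval (x p) G \<noteq> 0" "f = emb F / emb G" by (rule LW_E)
  from L(2) obtain F' G' e q where 2: "F' \<in> H e" "G' \<in> H e" "q \<in> W" "poly_eval (x q) G' \<noteq> 0" "g = emb F' / emb G'" by (rule LW_E)
  obtain r where r: "r \<in> W" "poly_eval (x r) (G * G') \<noteq> 0" by (rule mult_nz[OF 1(2) 2(2) 1(3,4) 2(3,4)])
  have v: "\<forall>q\<in>W. poly_eval (x q) F = 0" "\<forall>q\<in>W. poly_eval (x q) F' = 0"
    using f LW_nonunits_iff[OF 1(1-4)] 1(5) g LW_nonunits_iff[OF 2(1-4)] 2(5) by simp_all
  have "F * G' + F' * G \<in> H (d + e)"
    by (intro hpolys_add hpolys_mult[OF 1(1) 2(2)] hpolys_mult'[OF 2(1) 1(2)]) simp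
  from LW_nonunits_iff[OF this hpolys_mult[OF 1(2) 2(2)] r] v
  have "emb (F * G' + F' * G) / emb (G * G') \<in> nonunits LW" by (simp add: poly_eval_simps)
  then show ?thesis using 1(5) 2(5) poly_eval_nz[OF 1(4)] poly_eval_nz[OF 2(4)] by (simp add: emb_simps add_frac_eq)
qed

lemma nonunits_0: "0 \<in> nonunits LW" using LW_0 by (simp add: nonunits_def)

lemma ideal_power_subset: "ideal_power LW (nonunits LW) k \<subseteq> LW" and
  ideal_power_Suc_subset: "ideal_power LW (nonunits LW) (Suc k) \<subseteq> nonunits LW"
proof -
  have s: "(\<Sum>i<m. a i * b i) \<in> nonunits LW" if "\<forall>i<m. a i \<in> nonunits LW \<and> b i \<in> LW" for m :: nat and a b
    using that by (induction m) (auto simp: nonunits_0 intro: nonunits_add nonunits_mult_LW)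
  have non: "nonunits LW \<subseteq> LW" by (auto simp: nonunits_def)
  have A: "ideal_power LW (nonunits LW) k \<subseteq> LW" for k
  proof (induction k)
    case (Suc k)
    show ?case
    proof
      fix z assume "z \<in> ideal_power LW (nonunits LW) (Suc k)"
      then obtain m :: nat and a b where "z = (\<Sum>i<m. a i * b i)" "\<forall>i<m. a i \<in> nonunits LW \<and> b i \<in> ideal_power LW (nonunits LW) k"
        by (rule ideal_power_SucE)
      then show "z \<in> LW" using s[of m a b] Suc non by blast
    qed
  qed simp
  then show "ideal_power LW (nonunits LW) k \<subseteq> LW" .
  show "ideal_power LW (nonunits LW) (Suc k) \<subseteq> nonunits LW"
  proof
    fix z assume "z \<in> ideal_power LW (nonunits LW) (Suc k)"
    then obtain m :: nat and a b where "z = (\<Sum>i<m. a i * b i)" "\<forall>i<m. a i \<in> nonunits LW \<and> b i \<in> ideal_power LW (nonunits LW) k"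
      by (rule ideal_power_SucE)
    then show "z \<in> nonunits LW" using s[of m a b] A by blast
  qed
qed

lemma ord_unit:
  assumes "f \<in> LW" "f \<notin> nonunits LW"
  shows "ord_along Y W f = 0"
proof -
  have "(GREATEST k. f \<in> ideal_power LW (nonunits LW) k) = 0"
  proof (rule Greatest_equality)
    show "f \<in> ideal_power LW (nonunits LW) 0" using assms by simp
    fix k assume "f \<in> ideal_power LW (nonunits LW) k"
    then show "k \<le> 0" using ideal_power_Suc_subset[of "k - 1"] assms(2) by (cases k) auto
  qed
  then show ?thesis unfolding ord_along_def Let_def using assms(1) by simp
qed

end

section \<open>Orders and stalk ideals along the zero sets of the linear forms\<close>

lemma t_eq: "j \<in> J \<Longrightarrow> t j \<noteq> 0"
  using L(3,4) by (simp add: t_def)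

text \<open>A numerator that vanishes on \<open>Z j\<close> is \<open>l j * Q\<close>; the missing
  degree is made up by \<open>c j\<close>, as in \<open>F / G = t j * (c j * Q / G)\<close>.\<close>

lemma nonunits_Z:
  assumes j: "j \<in> J"
  shows "nonunits (lring_along Y (Z j)) = {t j * a | a. a \<in> lring_along Y (Z j)}"
proof -
  note W = Z_irreducible[OF j]
  show ?thesis
  proof (intro equalityI subsetI)
    fix f assume f: "f \<in> nonunits (lring_along Y (Z j))"
    then have "f \<in> lring_along Y (Z j)" by (simp add: nonunits_def)
    then obtain F G d p where 1: "F \<in> H d" "G \<in> H d" "p \<in> Z j" "poly_eval (x p) G \<noteq> 0" "f = emb F / emb G"
      by (rule LW_E[OF W])
    have "rs j F = 0" using f LW_nonunits_iff[OF W 1(1-4)] 1(5) vanish_iff[OF j 1(1)] by simp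
    from Z_dvd[OF j 1(1) this] obtain Q where Q: "F = l j * Q" "Q \<in> H (d - 1)" "d = 0 \<Longrightarrow> F = 0" by blast
    show "f \<in> {t j * a | a. a \<in> lring_along Y (Z j)}"
    proof (cases "d = 0")
      case True
      then show ?thesis using Q(3) 1(5) LW_0[OF W] by (auto simp: emb_simps intro!: exI[of _ 0])
    next
      case False
      then have "c j * Q \<in> H d" using hpolys_mult[OF L(2)[OF j] Q(2)] by simp
      from LW_I[OF W this 1(2-4)] have "emb (c j * Q) / emb G \<in> lring_along Y (Z j)" .
      moreover have "f = t j * (emb (c j * Q) / emb G)" using L(4)[OF j] by (simp add: 1(5) Q(1) t_def emb_simps)
      ultimately show ?thesis by blast
    qed
  next
    fix f assume "f \<in> {t j * a | a. a \<in> lring_along Y (Z j)}"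
    then obtain a where a: "a \<in> lring_along Y (Z j)" "f = t j * a" by blast
    obtain p where p: "p \<in> Z j" using Z_ne[OF j] by blast
    have "t j \<in> nonunits (lring_along Y (Z j))" unfolding t_def
      by (subst LW_nonunits_iff[OF W L(1,2)[OF j] p c_nz_on_Z[OF j p]]) (simp add: Z_def)
    then show "f \<in> nonunits (lring_along Y (Z j))" using a nonunits_mult_LW[OF W] by simp
  qed
qed

lemma ideal_power_Z:
  assumes j: "j \<in> J"
  shows "ideal_power (lring_along Y (Z j)) (nonunits (lring_along Y (Z j))) k = {t j ^ k * a | a. a \<in> lring_along Y (Z j)}"
proof (induction k)
  case 0
  then show ?case by auto
next
  case (Suc k)
  note W = Z_irreducible[OF j]
  let ?L = "lring_along Y (Z j)"
  show ?case
  proof (intro equalityI subsetI)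
    fix z assume "z \<in> ideal_power ?L (nonunits ?L) (Suc k)"
    then obtain m :: nat and a b where z: "z = (\<Sum>i<m. a i * b i)" "\<forall>i<m. a i \<in> nonunits ?L \<and> b i \<in> ideal_power ?L (nonunits ?L) k"
      by (rule ideal_power_SucE)
    have "\<exists>y\<in>?L. (\<Sum>i<m'. a i * b i) = t j ^ Suc k * y" if "m' \<le> m" for m'
      using that
    proof (induction m')
      case 0
      then show ?case using LW_0[OF W] by (intro bexI[of _ 0]) auto
    next
      case (Suc m')
      then obtain y where y: "y \<in> ?L" "(\<Sum>i<m'. a i * b i) = t j ^ Suc k * y" by auto
      have "a m' \<in> nonunits ?L" "b m' \<in> ideal_power ?L (nonunits ?L) k" using z(2) Suc.prems by auto
      then obtain a' b' where ab: "a' \<in> ?L" "b' \<in> ?L" "a m' = t j * a'" "b m' = t j ^ k * b'"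
        using nonunits_Z[OF j] \<open>ideal_power ?L (nonunits ?L) k = _\<close> by blast
      have "(\<Sum>i<Suc m'. a i * b i) = t j ^ Suc k * (y + a' * b')" using y(2) ab by (simp add: algebra_simps)
      then show ?case using LW_add[OF W y(1) LW_mult[OF W ab(1,2)]] by blast
    qed
    then show "z \<in> {t j ^ Suc k * a | a. a \<in> ?L}" using z(1) by blast
  next
    fix z assume "z \<in> {t j ^ Suc k * a | a. a \<in> ?L}"
    then obtain a where a: "a \<in> ?L" "z = t j ^ Suc k * a" by blast
    have "t j * 1 \<in> nonunits ?L" using LW_1[OF W] nonunits_Z[OF j] by blast
    moreover have "t j ^ k * a \<in> ideal_power ?L (nonunits ?L) k" using Suc a by blast
    moreover have "z = (\<Sum>i<(1::nat). t j * (t j ^ k * a))" using a by simp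
    ultimately show "z \<in> ideal_power ?L (nonunits ?L) (Suc k)"
      by (simp only: ideal_power.simps mem_Collect_eq mult_1_right)
        (intro exI[of _ 1] exI[of _ "\<lambda>_. t j"] exI[of _ "\<lambda>_. t j ^ k * a"], simp)
  qed
qed

text \<open>If \<open>t j ^ n * u\<close> lay in a higher power of the maximal ideal, cancelling
  \<open>t j ^ n\<close> would make the unit \<open>u\<close> a multiple of
  \<open>t j\<close>.\<close>

lemma ord_Z:
  assumes j: "j \<in> J" and u: "u \<in> lring_along Y (Z j)" "u \<notin> nonunits (lring_along Y (Z j))"
  shows "ord_along Y (Z j) (t j ^ n * u) = int n"
proof -
  note W = Z_irreducible[OF j]
  let ?L = "lring_along Y (Z j)"
  have "t j * 1 \<in> nonunits ?L" unfolding nonunits_Z[OF j] using LW_1[OF W] by blast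
  then have tL: "t j \<in> ?L" by (simp add: nonunits_def)
  have tkL: "t j ^ k \<in> ?L" for k by (induction k) (auto intro: LW_1[OF W] LW_mult[OF W tL])
  have "(GREATEST k. t j ^ n * u \<in> ideal_power ?L (nonunits ?L) k) = n"
  proof (rule Greatest_equality)
    show "t j ^ n * u \<in> ideal_power ?L (nonunits ?L) n" using u ideal_power_Z[OF j] by blast
    fix k assume "t j ^ n * u \<in> ideal_power ?L (nonunits ?L) k"
    then obtain a where a: "a \<in> ?L" "t j ^ n * u = t j ^ k * a" using ideal_power_Z[OF j] by blast
    show "k \<le> n"
    proof (rule ccontr)
      assume "\<not> k \<le> n"
      then obtain m where m: "k = n + Suc m" by (metis add_Suc_right less_imp_Suc_add not_le)
      have "t j ^ n * u = t j ^ n * (t j * (t j ^ m * a))" using a(2) m by (simp add: power_add mult_ac)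
      then have "u = t j * (t j ^ m * a)" using t_eq[OF j] by simp
      then show False using u(2) nonunits_Z[OF j] LW_mult[OF W tkL a(1)] by blast
    qed
  qed
  then show ?thesis unfolding ord_along_def Let_def using LW_mult[OF W tkL u(1)] by simp
qed

text \<open>Away from \<open>Z j\<close> the proof gives \<open>ord \<le> 0\<close> rather than
  equality: \<open>t j\<close> has poles along the zeros of \<open>c j\<close>, and
  \<open>zero_divisor\<close> truncates negative orders to zero.\<close>

lemma zero_divisor_t:
  assumes j: "j \<in> J" and W: "W \<in> prime_divisors Y"
  shows "zero_divisor Y (t j) W = (if W = Z j then 1 else 0)"
proof (cases "W = Z j")
  case True
  note Wi = Z_irreducible[OF j]
  have "(1 :: ratfun) \<notin> nonunits (lring_along Y (Z j))" using LW_1[OF Wi] by (simp add: nonunits_def)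
  from ord_Z[OF j LW_1[OF Wi] this, of 1] show ?thesis using True by (simp add: zero_divisor_def)
next
  case False
  have Wi: "irreducible_closed Y W" using W by (simp add: prime_divisors_def)
  have nv: "\<not> (\<forall>q\<in>W. poly_eval (x q) (l j) = 0)"
  proof
    assume "\<forall>q\<in>W. poly_eval (x q) (l j) = 0"
    then have "W \<subseteq> Z j" using W_pts[OF Wi] by (auto simp: Z_def)
    then have "Z j = W \<or> Z j = pts Y" using W Z_irreducible[OF j] unfolding prime_divisors_def by blast
    then show False using False Z_ne_pts[OF j] by blast
  qed
  have "t j \<notin> nonunits (lring_along Y W)" if tL: "t j \<in> lring_along Y W"
  proof
    assume non: "t j \<in> nonunits (lring_along Y W)"
    from tL obtain F G d p where 1: "F \<in> H d" "G \<in> H d" "p \<in> W" "poly_eval (x p) G \<noteq> 0" "t j = emb F / emb G"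
      by (rule LW_E[OF Wi])
    have v: "\<forall>q\<in>W. poly_eval (x q) F = 0" using non LW_nonunits_iff[OF Wi 1(1-4)] 1(5) by simp
    have "l j * G = F * c j"
      using 1(5) emb_divide_eq_iff[OF L(4)[OF j] poly_eval_nz[OF 1(4)]] unfolding t_def by blast
    then have "poly_eval (x q) (l j * G) = 0" if "q \<in> W" for q using v that by (simp add: poly_eval_simps)
    from irreducible_mult[OF Wi L(1)[OF j] 1(2) this] show False using nv 1(3,4) by blast
  qed
  then have "ord_along Y W (t j) \<le> 0"
    using ord_unit[OF Wi] by (cases "t j \<in> lring_along Y W") (auto simp: ord_along_def Let_def)
  then show ?thesis using False by (simp add: zero_divisor_def)
qed

text \<open>For the inclusion from right to left, the cofactor \<open>a\<close> may have poles at
  other points of \<open>Z j\<close> where the product is regular. There the product vanishes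
  because \<open>rs j\<close> kills its numerator, which is a statement about all of
  \<open>Z j\<close>.\<close>

lemma stalk_Z:
  assumes j: "j \<in> J" and y: "y \<in> Z j"
  shows "stalk_ideal Y (Z j) y = {t j * a | a. a \<in> lring Y y}"
proof (intro equalityI subsetI)
  interpret L': linear_form I "\<alpha> j" "\<beta> j" "\<gamma> j" "\<epsilon> j" by (rule lin[OF j])
  fix f assume f: "f \<in> stalk_ideal Y (Z j) y"
  then have "f \<in> reg (PV I) 0 (x y)" by (simp add: stalk_ideal_def Y_lring)
  then obtain F G a b where 1: "F \<in> H a" "G \<in> H b" "int a = int b + 0" "poly_eval (x y) G \<noteq> 0" "f = emb F / emb G"
    by (rule regE)
  have ab: "a = b" using 1(3) by simp
  have "poly_eval (x q) (F * G) = 0" if q: "q \<in> Z j" for q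
  proof (rule ccontr)
    assume "poly_eval (x q) (F * G) \<noteq> 0"
    then have FG: "poly_eval (x q) F \<noteq> 0" "poly_eval (x q) G \<noteq> 0" by (auto simp: poly_eval_simps)
    have "f \<in> lring Y q" "inverse f \<in> lring Y q"
      using regI[OF 1(1,2,3) FG(2)] regI[OF 1(2,1) _ FG(1), of 0] 1(5) ab by (simp_all add: Y_lring)
    moreover have "f \<noteq> 0" using 1(5) poly_eval_nz[OF FG(1)] poly_eval_nz[OF FG(2)] by simp
    ultimately show False using f q unfolding stalk_ideal_def nonunits_def by blast
  qed
  then have "rs j (F * G) = 0" using vanish_iff[OF j hpolys_mult[OF 1(1,2)]] by blast
  then have "rs j F = 0" using rs_nz[OF j 1(2) y 1(4)] by (simp add: L'.rs_simps)
  from Z_dvd[OF j 1(1) this] obtain Q where Q: "F = l j * Q" "Q \<in> H (a - 1)" "a = 0 \<Longrightarrow> F = 0" by blast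
  show "f \<in> {t j * a | a. a \<in> lring Y y}"
  proof (cases "a = 0")
    case True
    then show ?thesis using Q(3) 1(5) reg_0[of "PV I" 0 "x y"] by (auto simp: emb_simps Y_lring intro!: exI[of _ 0])
  next
    case False
    then have "c j * Q \<in> H b" using hpolys_mult[OF L(2)[OF j] Q(2)] ab by simp
    from regI[OF this 1(2) _ 1(4), of 0] have "emb (c j * Q) / emb G \<in> lring Y y" by (simp add: Y_lring)
    moreover have "f = t j * (emb (c j * Q) / emb G)" using L(4)[OF j] by (simp add: 1(5) Q(1) t_def emb_simps)
    ultimately show ?thesis by blast
  qed
next
  interpret L': linear_form I "\<alpha> j" "\<beta> j" "\<gamma> j" "\<epsilon> j" by (rule lin[OF j])
  fix f assume "f \<in> {t j * a | a. a \<in> lring Y y}"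
  then obtain a where a: "a \<in> reg (PV I) 0 (x y)" "f = t j * a" by (auto simp: Y_lring)
  have t: "t j \<in> reg (PV I) 0 (x y)" unfolding t_def
    using regI[OF L(1,2)[OF j] _ c_nz_on_Z[OF j y], of 0] by simp
  from a(1) obtain F G a' b where 1: "F \<in> H a'" "G \<in> H b" "int a' = int b + 0" "poly_eval (x y) G \<noteq> 0" "a = emb F / emb G"
    by (rule regE)
  have "f \<in> nonunits (lring Y q)" if q: "q \<in> Z j" "f \<in> lring Y q" for q
  proof (rule ccontr)
    assume "f \<notin> nonunits (lring Y q)"
    then have f: "f \<noteq> 0" "inverse f \<in> reg (PV I) 0 (x q)" using q(2) by (auto simp: nonunits_def Y_lring)
    from q(2) obtain F1 G1 a1 b1 where 2: "F1 \<in> H a1" "G1 \<in> H b1" "int a1 = int b1 + 0" "poly_eval (x q) G1 \<noteq> 0" "f = emb F1 / emb G1"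
      unfolding Y_lring by (rule regE)
    from f(2) obtain F2 G2 a2 b2 where 3: "F2 \<in> H a2" "G2 \<in> H b2" "int a2 = int b2 + 0" "poly_eval (x q) G2 \<noteq> 0" "inverse f = emb F2 / emb G2"
      by (rule regE)
    have "F1 \<noteq> 0" using f(1) 2(5) by (auto simp: emb_simps)
    have "emb G1 / emb F1 = emb F2 / emb G2" using 2(5) 3(5) by simp
    then have e: "G1 * G2 = F2 * F1" using emb_divide_eq_iff[OF \<open>F1 \<noteq> 0\<close> poly_eval_nz[OF 3(4)]] by blast
    have "emb (l j * F) / emb (c j * G) = emb F1 / emb G1" using a(2) 1(5) 2(5) by (simp add: t_def emb_simps)
    then have "l j * F * G1 = F1 * (c j * G)"
      using emb_divide_eq_iff[of "c j * G" G1] L(4)[OF j] poly_eval_nz[OF 1(4)] poly_eval_nz[OF 2(4)] by simp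
    from arg_cong[OF this, of "rs j"] have "rs j F1 * rs j G = 0" by (simp add: L'.rs_simps L'.rs_l L'.rs_c)
    then have "rs j F1 = 0" using rs_nz[OF j 1(2) y 1(4)] by simp
    then have "poly_eval (x q) F1 = 0" using vanish_iff[OF j 2(1)] q(1) by blast
    then show False using arg_cong[OF e, of "poly_eval (x q)"] 2(4) 3(4) by (simp add: poly_eval_simps)
  qed
  moreover have "f \<in> lring Y y" using reg_mult[OF t a(1)] a(2) by (simp add: Y_lring)
  ultimately show "f \<in> stalk_ideal Y (Z j) y" unfolding stalk_ideal_def by blast
qed

end

subsection \<open>Sections of a polyhedral divisor\<close>

context base
begin

definition FR :: "nat \<Rightarrow> ratfun set" where
  "FR d = {form d s | s. \<forall>i. s i \<in> R}"

lemma FR_0: "0 \<in> FR d"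
  unfolding FR_def using subring_closedD(2)[OF subring_closed_R] by (auto simp: form_def intro!: exI[of _ "\<lambda>_. 0"])

lemma FR_add: "f \<in> FR d \<Longrightarrow> g \<in> FR d \<Longrightarrow> f + g \<in> FR d"
proof -
  assume "f \<in> FR d" "g \<in> FR d"
  then obtain s t where "\<forall>i. s i \<in> R" "f = form d s" "\<forall>i. t i \<in> R" "g = form d t" unfolding FR_def by blast
  then have "f + g = form d (\<lambda>i. s i + t i)" "\<forall>i. s i + t i \<in> R"
    using subring_closedD(3)[OF subring_closed_R] by (auto simp: form_def distrib_right sum.distrib)
  then show ?thesis unfolding FR_def by blast
qed

lemma FR_sum: "(\<And>i. i \<in> A \<Longrightarrow> f i \<in> FR d) \<Longrightarrow> sum f A \<in> FR d"
  by (induction A rule: infinite_finite_induct) (auto simp: FR_0 FR_add)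

lemma FR_smult: "r \<in> R \<Longrightarrow> f \<in> FR d \<Longrightarrow> r * f \<in> FR d"
proof -
  assume r: "r \<in> R" and "f \<in> FR d"
  then obtain s where s: "\<forall>i. s i \<in> R" "f = form d s" unfolding FR_def by blast
  then have "r * f = form d (\<lambda>i. r * s i)" "\<forall>i. r * s i \<in> R"
    using r subring_closedD(4)[OF subring_closed_R] by (auto simp: form_def sum_distrib_left mult.assoc)
  then show ?thesis unfolding FR_def by blast
qed

lemma FR_emb:
  assumes "F \<in> H d"
  shows "emb F \<in> FR d"
proof -
  obtain G where G: "\<And>i. G i \<in> H 0" "F = (\<Sum>i\<le>d. G i * PX ^ i * PY ^ (d - i))"
    by (rule hpolys_expand[OF assms]) blast
  have "emb F = form d (\<lambda>i. emb (G i))" unfolding G(2) form_def by (simp add: emb_simps mult.assoc)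
  then show ?thesis unfolding FR_def using emb_R[OF G(1)] by blast
qed

lemma FR_mult: "f \<in> FR d \<Longrightarrow> P \<in> H m \<Longrightarrow> f * emb P \<in> FR (d + m)"
proof -
  assume "f \<in> FR d" and P: "P \<in> H m"
  then obtain s where s: "\<forall>i. s i \<in> R" "f = form d s" unfolding FR_def by blast
  have "s i * emb (PX ^ i * PY ^ (d - i) * P) \<in> FR (d + m)" if "i \<in> {..d}" for i
  proof (intro FR_smult FR_emb)
    show "s i \<in> R" using s(1) by blast
    show "PX ^ i * PY ^ (d - i) * P \<in> H (d + m)"
      using that by (intro hpolys_mult[OF hpolys_mult'[OF PX_power PY_power] P]) simp
  qed
  then have "(\<Sum>i\<le>d. s i * emb (PX ^ i * PY ^ (d - i) * P)) \<in> FR (d + m)" by (rule FR_sum)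
  also have "(\<Sum>i\<le>d. s i * emb (PX ^ i * PY ^ (d - i) * P)) = f * emb P"
    unfolding s(2) form_def by (simp add: emb_simps sum_distrib_right mult.assoc)
  finally show ?thesis .
qed

text \<open>Exponents of a divisor may be negative, so degrees are integers; in negative degree zero
  is the only section.\<close>

definition FRi :: "int \<Rightarrow> ratfun set" where
  "FRi d = (if d < 0 then {0} else FR (nat d))"

lemma FRi_0: "0 \<in> FRi d" and FRi_add: "f \<in> FRi d \<Longrightarrow> g \<in> FRi d \<Longrightarrow> f + g \<in> FRi d"
  and FRi_smult: "r \<in> R \<Longrightarrow> f \<in> FRi d \<Longrightarrow> r * f \<in> FRi d"
  by (auto simp: FRi_def FR_0 FR_add FR_smult)

lemma FRi_mult: "f \<in> FRi d \<Longrightarrow> P \<in> H m \<Longrightarrow> f * emb P \<in> FRi (d + int m)"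
  using FR_mult[of f "nat d" P m] FRi_0[of "d + int m"] by (auto simp: FRi_def nat_add_distrib split: if_splits)

lemma FR_reg: "f \<in> FR d \<Longrightarrow> b \<in> B \<Longrightarrow> f \<in> reg (PV I) (int d) (pc z w b)"
proof -
  assume "f \<in> FR d" and b: "b \<in> B"
  then obtain s where s: "\<forall>i. s i \<in> R" "f = form d s" unfolding FR_def by blast
  have "s i * emb (PX ^ i * PY ^ (d - i)) \<in> reg (PV I) (int d) (pc z w b)" if "i \<in> {..d}" for i
  proof -
    have "s i \<in> lr I b" using s(1) b by (simp add: R_def)
    then have A: "s i \<in> reg (PV I) 0 (pc z w b)" by (rule subsetD[OF lr_subset_reg])
    have B: "PX ^ i * PY ^ (d - i) \<in> H d" using that by (intro hpolys_mult'[OF PX_power PY_power]) simp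
    show ?thesis using reg_mult[OF A reg_emb[OF B]] by simp
  qed
  then show ?thesis unfolding s(2) form_def by (rule reg_sum)
qed

lemma FRi_reg: "f \<in> FRi d \<Longrightarrow> b \<in> B \<Longrightarrow> z \<noteq> 0 \<or> w \<noteq> 0 \<Longrightarrow> f \<in> reg (PV I) d (pc z w b)"
  using FR_reg[of f "nat d" b z w] reg_0'[of z w I d b] by (auto simp: FRi_def split: if_splits)

text \<open>\<open>form\<close> reads the coefficients up to index \<open>d\<close>; those above are
  arbitrary elements of \<open>R\<close>, which is why the rules for \<open>coef\<close> are
  restricted to \<open>i \<le> d\<close>.\<close>

definition coef :: "nat \<Rightarrow> ratfun \<Rightarrow> nat \<Rightarrow> ratfun" where
  "coef d f = (SOME s. (\<forall>i. s i \<in> R) \<and> f = form d s)"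

lemma coef: "f \<in> FR d \<Longrightarrow> coef d f i \<in> R" "f \<in> FR d \<Longrightarrow> form d (coef d f) = f"
proof -
  assume "f \<in> FR d"
  then have "\<exists>s. (\<forall>i. s i \<in> R) \<and> f = form d s" unfolding FR_def by blast
  from someI_ex[OF this] show "coef d f i \<in> R" "form d (coef d f) = f" unfolding coef_def by auto
qed

lemma form_unique:
  assumes "\<forall>i. s i \<in> R" "\<forall>i. t i \<in> R" "form d s = form d t" "i \<le> d"
  shows "s i = t i"
proof -
  have "s i - t i = 0"
  proof (rule form_eq_0[OF _ _ assms(4)])
    show "form d (\<lambda>i. s i - t i) = 0" using assms(3) by (simp add: form_diff[symmetric])
    fix i
    have "s i - t i \<in> R" by (rule subring_closedD(6)[OF subring_closed_R]) (use assms in blast)+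
    moreover obtain b where "b \<in> B" using B_ne by blast
    ultimately show "\<exists>b. s i - t i \<in> lr I b" by (auto simp: R_def)
  qed
  then show ?thesis by simp
qed

lemma coef_add: "f \<in> FR d \<Longrightarrow> g \<in> FR d \<Longrightarrow> i \<le> d \<Longrightarrow> coef d (f + g) i = coef d f i + coef d g i"
proof (rule form_unique[of "coef d (f + g)" "\<lambda>i. coef d f i + coef d g i" d])
  assume "f \<in> FR d" "g \<in> FR d"
  then show "\<forall>i. coef d (f + g) i \<in> R" "\<forall>i. coef d f i + coef d g i \<in> R"
    by (simp_all add: coef(1) FR_add subring_closedD(3)[OF subring_closed_R])
  show "form d (coef d (f + g)) = form d (\<lambda>i. coef d f i + coef d g i)"
    using coef(2)[OF FR_add[OF \<open>f \<in> FR d\<close> \<open>g \<in> FR d\<close>]] coef(2)[OF \<open>f \<in> FR d\<close>] coef(2)[OF \<open>g \<in> FR d\<close>]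
    by (simp add: form_def distrib_right sum.distrib)
qed

lemma coef_smult: "r \<in> R \<Longrightarrow> f \<in> FR d \<Longrightarrow> i \<le> d \<Longrightarrow> coef d (r * f) i = r * coef d f i"
proof (rule form_unique[of "coef d (r * f)" "\<lambda>i. r * coef d f i" d])
  assume *: "r \<in> R" "f \<in> FR d"
  then show "\<forall>i. coef d (r * f) i \<in> R" "\<forall>i. r * coef d f i \<in> R"
    by (simp_all add: coef(1) FR_smult subring_closedD(4)[OF subring_closed_R])
  have "form d (\<lambda>i. r * coef d f i) = r * form d (coef d f)" by (simp add: form_def sum_distrib_left mult.assoc)
  then show "form d (coef d (r * f)) = form d (\<lambda>i. r * coef d f i)"
    using coef(2)[OF FR_smult[OF *]] coef(2)[OF *(2)] by simp
qed

end

text \<open>Admissibility is required of all summands with the same zero set, whatever their index.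
  In this form it serves the total space as well as a fibre, where zero sets that are distinct over
  the base may fall together.\<close>

locale divisor_family = variety_family I B J \<alpha> \<beta> \<gamma> \<epsilon> Y x
  for I B and J :: "'j set" and \<alpha> \<beta> \<gamma> \<epsilon> and Y :: "'p variety" and x +
  fixes n :: nat and \<delta> :: "qvec set" and \<Delta> :: "'j \<Rightarrow> qvec set"
  assumes cone: "pointed_cone n \<delta>"
    and polyh: "j \<in> J \<Longrightarrow> polyhedron n (\<Delta> j)" "j \<in> J \<Longrightarrow> \<Delta> j \<noteq> {} \<Longrightarrow> tail n (\<Delta> j) = \<delta>"
    and adm: "u \<in> weights n \<delta> \<Longrightarrow> i \<in> J \<Longrightarrow> j \<in> J \<Longrightarrow> Z i = Z j \<Longrightarrow> \<Delta> i \<noteq> {} \<Longrightarrow> \<Delta> j \<noteq> {} \<Longrightarrow>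
      minval (\<Delta> i) u \<notin> \<int> \<Longrightarrow> minval (\<Delta> j) u \<notin> \<int> \<Longrightarrow> i = j"
begin

definition "D = divisor_sum Y \<delta> J \<Delta> t"
definition "J0 = {j \<in> J. \<Delta> j \<noteq> {}}"
definition "Ji = {j \<in> J. \<Delta> j = {}}"
definition e :: "zvec \<Rightarrow> 'j \<Rightarrow> int" where "e u j = \<lfloor>minval (\<Delta> j) u\<rfloor>"
text \<open>A homogeneous equation, of degree \<open>dg u\<close>, of the rounded divisor in weight
  \<open>u\<close> on the locus: multiplication by \<open>N u\<close> turns sections of the divisor
  into sections of a line bundle.\<close>

definition "N u = (\<Prod>j\<in>J0. emb (l j) powi e u j)"
definition "dg u = (\<Sum>j\<in>J0. e u j)"
definition "\<Lambda> = (\<Prod>j\<in>Ji. l j)"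
definition "m = card Ji"
abbreviation "E u W \<equiv> \<lfloor>evaluate D u W\<rfloor>"
definition "Sec u = sections Y (locus Y D) (E u)"

lemma fin: "finite J0" "finite Ji" using finite_J by (auto simp: J0_def Ji_def)

lemma hm: "j \<in> J0 \<Longrightarrow> u \<in> weights n \<delta> \<Longrightarrow> has_min (\<Delta> j) u"
  using has_min_polyhedron polyh unfolding J0_def by blast

lemma D_eq: "W \<in> prime_divisors Y \<Longrightarrow> D W = \<delta> + (\<Sum>j\<in>{j \<in> J. Z j = W}. \<Delta> j)"
proof -
  assume W: "W \<in> prime_divisors Y"
  have "(\<Sum>j\<in>J. \<Sum>k<zero_divisor Y (t j) W. \<Delta> j) = (\<Sum>j\<in>J. if Z j = W then \<Delta> j else 0)"
    by (rule sum.cong) (auto simp: zero_divisor_t[OF _ W])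
  also have "\<dots> = (\<Sum>j\<in>{j \<in> J. Z j = W}. \<Delta> j)" by (rule sum.inter_filter[OF finite_J, symmetric])
  finally show ?thesis by (simp add: D_def divisor_sum_def)
qed

lemma \<delta>_ne: "\<delta> \<noteq> {}" using cone by (simp add: pointed_cone_def)

lemma D_empty: "W \<in> prime_divisors Y \<Longrightarrow> D W = {} \<longleftrightarrow> (\<exists>j\<in>Ji. Z j = W)"
proof -
  assume W: "W \<in> prime_divisors Y"
  have "A + A' = {} \<longleftrightarrow> A = {} \<or> A' = {}" for A A' :: "qvec set" by (auto simp: set_plus_def)
  then have "D W = {} \<longleftrightarrow> (\<Sum>j\<in>{j \<in> J. Z j = W}. \<Delta> j) = {}" using \<delta>_ne by (simp add: D_eq[OF W])
  also have "\<dots> \<longleftrightarrow> (\<exists>j\<in>{j \<in> J. Z j = W}. \<Delta> j = {})" by (rule set_sum_empty) (simp add: finite_J)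
  finally show ?thesis by (auto simp: Ji_def)
qed

lemma locus_eq: "locus Y D = pts Y - (\<Union>j\<in>Ji. Z j)"
proof -
  have "\<Union>{W \<in> prime_divisors Y. D W = {}} = (\<Union>j\<in>Ji. Z j)"
  proof (intro equalityI subsetI)
    fix p assume "p \<in> \<Union>{W \<in> prime_divisors Y. D W = {}}"
    then obtain W where "W \<in> prime_divisors Y" "D W = {}" "p \<in> W" by blast
    then show "p \<in> (\<Union>j\<in>Ji. Z j)" using D_empty by blast
  next
    fix p assume "p \<in> (\<Union>j\<in>Ji. Z j)"
    then obtain j where "j \<in> Ji" "p \<in> Z j" by blast
    moreover have "Z j \<in> prime_divisors Y" using \<open>j \<in> Ji\<close> Z_prime by (simp add: Ji_def)
    ultimately show "p \<in> \<Union>{W \<in> prime_divisors Y. D W = {}}" using D_empty by blast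
  qed
  then show ?thesis by (simp add: locus_def)
qed

text \<open>The last assumption restricts to divisors with a nonempty coefficient; for the others
  \<open>minval\<close> has no meaning.\<close>

lemma E_eq:
  assumes "W \<in> prime_divisors Y" "u \<in> weights n \<delta>" "\<And>j. j \<in> J \<Longrightarrow> Z j = W \<Longrightarrow> j \<in> J0"
  shows "E u W = (\<Sum>j\<in>{j \<in> J. Z j = W}. e u j)"
proof -
  have h: "has_min (\<Delta> j) u" if "j \<in> {j \<in> J. Z j = W}" for j using hm[OF _ assms(2)] assms(3) that by blast
  have ms: "has_min (\<Sum>j\<in>{j \<in> J. Z j = W}. \<Delta> j) u \<and>
      minval (\<Sum>j\<in>{j \<in> J. Z j = W}. \<Delta> j) u = (\<Sum>j\<in>{j \<in> J. Z j = W}. minval (\<Delta> j) u)"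
    by (rule minval_sum) (rule h)
  have "minval (D W) u = minval \<delta> u + minval (\<Sum>j\<in>{j \<in> J. Z j = W}. \<Delta> j) u"
    unfolding D_eq[OF assms(1)]
    by (rule minval_plus(2)[OF minval_cone(1)[OF cone assms(2)] conjunct1[OF ms]])
  also have "\<dots> = (\<Sum>j\<in>{j \<in> J. Z j = W}. minval (\<Delta> j) u)"
    unfolding minval_cone(2)[OF cone assms(2)] conjunct2[OF ms] by (rule add_0)
  finally have "E u W = \<lfloor>\<Sum>j\<in>{j \<in> J. Z j = W}. minval (\<Delta> j) u\<rfloor>" by (simp add: evaluate_def)
  also have "\<dots> = (\<Sum>j\<in>{j \<in> J. Z j = W}. e u j)" unfolding e_def
  proof (rule floor_sum_admissible)
    show "finite {j \<in> J. Z j = W}" using finite_J by simp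
    fix i j assume "i \<in> {j \<in> J. Z j = W}" "j \<in> {j \<in> J. Z j = W}" "minval (\<Delta> i) u \<notin> \<int>" "minval (\<Delta> j) u \<notin> \<int>"
    then show "i = j" using adm[OF assms(2), of i j] assms(3) unfolding J0_def by blast
  qed
  finally show ?thesis .
qed

text \<open>\<open>local_equation\<close> accepts any generators of the stalk ideals; two generators
  of the same ideal differ by a unit of the local ring.\<close>

lemma runit_t_gen:
  assumes "{t' * a | a. a \<in> lring Y y} = {g * a | a. a \<in> lring Y y}" "t' \<noteq> 0"
  obtains v where "runit (PV I) 0 (x y) v" "t' = g * v"
proof -
  have one: "1 \<in> lring Y y" by (simp add: Y_lring reg_1)
  then have "t' * 1 \<in> {g * a | a. a \<in> lring Y y}" using assms(1) by blast
  then obtain a where a: "a \<in> lring Y y" "t' = g * a" by auto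
  have "g * 1 \<in> {t' * a | a. a \<in> lring Y y}" using assms(1) one by blast
  then obtain b where b: "b \<in> lring Y y" "g = t' * b" by auto
  have "t' * (a * b) = t' * b * a" by (simp only: mult_ac)
  also have "\<dots> = g * a" by (simp only: b(2)[symmetric])
  also have "\<dots> = t' * 1" by (simp only: a(2)[symmetric] mult_1_right)
  finally have ab: "a * b = 1" by (rule mult_left_cancel[OF assms(2), THEN iffD1])
  have "inverse a = b" by (rule inverse_unique[OF ab])
  moreover have "a \<noteq> 0" using ab by auto
  ultimately have "runit (PV I) 0 (x y) a" using a(1) b(1) by (simp add: runit_def Y_lring)
  with a(2) show thesis by (rule that[rotated])
qed

lemma prod_powi_unit:
  assumes "finite A" "g \<noteq> 0" "\<And>j. j \<in> A \<Longrightarrow> \<exists>v. runit (PV I) 0 q v \<and> t j = g * v"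
  shows "\<exists>v. runit (PV I) 0 q v \<and> (\<Prod>j\<in>A. t j powi k j) = g powi (\<Sum>j\<in>A. k j) * v"
  using assms(1,3)
proof (induction A rule: finite_induct)
  case empty
  then show ?case using runit_1 by (intro exI[of _ 1]) simp
next
  case (insert j A)
  then obtain v where v: "runit (PV I) 0 q v" "(\<Prod>j\<in>A. t j powi k j) = g powi (\<Sum>j\<in>A. k j) * v" by auto
  from insert.prems[of j] obtain v' where v': "runit (PV I) 0 q v'" "t j = g * v'" by auto
  have "runit (PV I) 0 q (v' powi k j * v)" using runit_mult[OF runit_powi[OF v'(1), of "k j"] v(1)] by simp
  moreover have "(\<Prod>j\<in>insert j A. t j powi k j) = g powi (\<Sum>j\<in>insert j A. k j) * (v' powi k j * v)"
    using insert.hyps assms(2) v(2) v'(2) by (simp add: power_int_mult_distrib power_int_add mult_ac)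
  ultimately show ?case by blast
qed

section \<open>Local equations at a point of the locus\<close>

context
  fixes y u assumes y: "y \<in> locus Y D" and u: "u \<in> weights n \<delta>"
begin

definition "Jy = {j \<in> J. y \<in> Z j}"
text \<open>The reference equation of the rounded divisor at \<open>y\<close>, with which every
  other local equation is compared.\<close>

definition "Ty = (\<Prod>j\<in>Jy. t j powi e u j)"

lemma y_pts: "y \<in> pts Y" and Jy_J0: "Jy \<subseteq> J0"
  using y unfolding locus_eq Jy_def J0_def Ji_def by auto

lemma finJy: "finite Jy" using finite_J by (simp add: Jy_def)

lemma fibre_Jy: "W \<in> Z ` Jy \<Longrightarrow> {j \<in> J. Z j = W} = {j \<in> Jy. Z j = W}"
  by (auto simp: Jy_def)

lemma relevant_divisors: "{W \<in> prime_divisors Y. y \<in> W \<and> E u W \<noteq> 0} = {W \<in> Z ` Jy. E u W \<noteq> 0}"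
proof (intro equalityI subsetI)
  fix W assume W: "W \<in> {W \<in> prime_divisors Y. y \<in> W \<and> E u W \<noteq> 0}"
  have J0: "j \<in> J0" if "j \<in> J" "Z j = W" for j using Jy_J0 that W by (auto simp: Jy_def)
  have "{j \<in> J. Z j = W} \<noteq> {}"
  proof
    assume "{j \<in> J. Z j = W} = {}"
    then have "E u W = 0" using E_eq[OF _ u J0] W by (simp only: sum.empty mem_Collect_eq)
    then show False using W by simp
  qed
  then show "W \<in> {W \<in> Z ` Jy. E u W \<noteq> 0}" using W by (auto simp: Jy_def)
next
  fix W assume "W \<in> {W \<in> Z ` Jy. E u W \<noteq> 0}"
  then show "W \<in> {W \<in> prime_divisors Y. y \<in> W \<and> E u W \<noteq> 0}" using Z_prime by (auto simp: Jy_def)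
qed

text \<open>Summands are grouped by zero set: all \<open>t j\<close> of one group generate the same
  stalk ideal, and their exponents add up to the coefficient \<open>E u W\<close> by
  \<open>E_eq\<close>.\<close>

lemma local_equation_unit:
  assumes "local_equation Y (E u) y h"
  shows "\<exists>v. runit (PV I) 0 (x y) v \<and> Ty = h * v"
proof -
  from assms obtain g where g: "\<forall>W\<in>prime_divisors Y. y \<in> W \<and> E u W \<noteq> 0 \<longrightarrow>
        stalk_ideal Y W y = {g W * a | a. a \<in> lring Y y}"
    and h: "h = (\<Prod>W | W \<in> prime_divisors Y \<and> y \<in> W \<and> E u W \<noteq> 0. g W powi E u W)"
    unfolding local_equation_def by blast
  have stalk: "{t j * a | a. a \<in> lring Y y} = stalk_ideal Y (Z j) y" if "j \<in> Jy" for j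
    using stalk_Z[of j y] that by (simp add: Jy_def)
  have "\<exists>v. runit (PV I) 0 (x y) v \<and>
      (\<Prod>j\<in>{j \<in> Jy. Z j = W}. t j powi e u j) = (if E u W \<noteq> 0 then g W powi E u W else 1) * v"
    if W: "W \<in> Z ` Jy" for W
  proof -
    from W obtain j0 where j0: "j0 \<in> Jy" "W = Z j0" by blast
    have Wp: "W \<in> prime_divisors Y" "y \<in> W" using j0 Z_prime by (auto simp: Jy_def)
    have EW: "E u W = (\<Sum>j\<in>{j \<in> Jy. Z j = W}. e u j)"
      unfolding fibre_Jy[OF W, symmetric]
    proof (rule E_eq[OF Wp(1) u])
      fix j assume "j \<in> J" "Z j = W"
      then show "j \<in> J0" using Jy_J0 Wp(2) by (auto simp: Jy_def)
    qed
    \<comment> \<open>If the exponents of a group cancel to zero, \<open>h\<close> contains no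
      generator for \<open>W\<close>; a function \<open>t j0\<close> of the group then takes its
      place.\<close>
    define gW where "gW = (if E u W \<noteq> 0 then g W else t j0)"
    have sg: "stalk_ideal Y W y = {gW * a | a. a \<in> lring Y y}"
      using g Wp stalk[OF j0(1)] j0(2) by (simp add: gW_def)
    have vj: "\<exists>v. runit (PV I) 0 (x y) v \<and> t j = gW * v" if "j \<in> {j \<in> Jy. Z j = W}" for j
    proof -
      have "{t j * a | a. a \<in> lring Y y} = {gW * a | a. a \<in> lring Y y}" using stalk[of j] sg that by auto
      moreover have "t j \<noteq> 0" using t_eq that by (simp add: Jy_def)
      ultimately show ?thesis by (rule runit_t_gen) blast
    qed
    have "gW \<noteq> 0" using vj[of j0] j0 t_eq[of j0] by (auto simp: Jy_def)
    from prod_powi_unit[OF _ this vj, of "{j \<in> Jy. Z j = W}" "\<lambda>j. e u j"] finJy obtain v where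
      "runit (PV I) 0 (x y) v" "(\<Prod>j\<in>{j \<in> Jy. Z j = W}. t j powi e u j) = gW powi E u W * v"
      unfolding EW by auto
    then show ?thesis by (intro exI[of _ v]) (simp add: gW_def)
  qed
  then have "\<forall>W\<in>Z ` Jy. \<exists>v. runit (PV I) 0 (x y) v \<and>
      (\<Prod>j\<in>{j \<in> Jy. Z j = W}. t j powi e u j) = (if E u W \<noteq> 0 then g W powi E u W else 1) * v" by blast
  from bchoice[OF this] obtain v where v: "\<forall>W\<in>Z ` Jy. runit (PV I) 0 (x y) (v W) \<and>
      (\<Prod>j\<in>{j \<in> Jy. Z j = W}. t j powi e u j) = (if E u W \<noteq> 0 then g W powi E u W else 1) * v W"
    by (elim exE) (rule that)
  have "Ty = (\<Prod>W\<in>Z ` Jy. \<Prod>j\<in>{j \<in> Jy. Z j = W}. t j powi e u j)"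
    unfolding Ty_def by (rule prod.image_gen[OF finJy])
  also have "\<dots> = (\<Prod>W\<in>Z ` Jy. (if E u W \<noteq> 0 then g W powi E u W else 1) * v W)"
    by (rule prod.cong) (use v in auto)
  also have "\<dots> = (\<Prod>W\<in>Z ` Jy. if E u W \<noteq> 0 then g W powi E u W else 1) * (\<Prod>W\<in>Z ` Jy. v W)"
    by (rule prod.distrib)
  also have "(\<Prod>W\<in>Z ` Jy. if E u W \<noteq> 0 then g W powi E u W else 1) = (\<Prod>W\<in>{W \<in> Z ` Jy. E u W \<noteq> 0}. g W powi E u W)"
    by (rule prod.inter_filter[symmetric]) (simp add: finJy)
  also have "\<dots> = h" unfolding h relevant_divisors[symmetric] by simp
  finally have "Ty = h * (\<Prod>W\<in>Z ` Jy. v W)" .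
  moreover have "runit (PV I) 0 (x y) (\<Prod>W\<in>Z ` Jy. v W)"
    using runit_prod[of "Z ` Jy" "PV I" "\<lambda>_. 0" "x y" v] v by simp
  ultimately show ?thesis by blast
qed

lemma local_equation_exists: "\<exists>h. local_equation Y (E u) y h"
proof -
  define g where "g W = t (SOME j. j \<in> J \<and> Z j = W)" for W
  have "stalk_ideal Y W y = {g W * a | a. a \<in> lring Y y}"
    if W: "W \<in> prime_divisors Y" "y \<in> W \<and> E u W \<noteq> 0" for W
  proof -
    have "W \<in> Z ` Jy" using relevant_divisors W by blast
    then have "\<exists>j. j \<in> J \<and> Z j = W" by (auto simp: Jy_def)
    from someI_ex[OF this] have j: "(SOME j. j \<in> J \<and> Z j = W) \<in> J" "Z (SOME j. j \<in> J \<and> Z j = W) = W" by auto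
    show ?thesis using stalk_Z[OF j(1), of y] j(2) W(2) by (simp add: g_def)
  qed
  then show ?thesis unfolding local_equation_def by blast
qed

text \<open>The forms \<open>c j\<close> for the zero sets through \<open>y\<close>, and the forms
  \<open>l j\<close> for the remaining ones, do not vanish at \<open>y\<close>; they carry the
  degree \<open>dg u\<close>.\<close>

lemma N_Ty: "\<exists>M. runit (PV I) (dg u) (x y) M \<and> N u = Ty * M"
proof -
  define M where "M = (\<Prod>j\<in>Jy. emb (c j) powi e u j) * (\<Prod>j\<in>J0 - Jy. emb (l j) powi e u j)"
  have c: "runit (PV I) (e u j) (x y) (emb (c j) powi e u j)" if "j \<in> Jy" for j
  proof -
    have "j \<in> J" "y \<in> Z j" using that by (auto simp: Jy_def)
    from runit_powi[OF runit_emb[OF L(2)[OF this(1)] c_nz_on_Z[OF this]], of "e u j"] show ?thesis by simp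
  qed
  have ln: "runit (PV I) (e u j) (x y) (emb (l j) powi e u j)" if "j \<in> J0 - Jy" for j
  proof -
    have "j \<in> J" "poly_eval (x y) (l j) \<noteq> 0" using that y_pts by (auto simp: Jy_def J0_def Z_def)
    from runit_powi[OF runit_emb[OF L(1)[OF this(1)] this(2)], of "e u j"] show ?thesis by simp
  qed
  have "runit (PV I) ((\<Sum>j\<in>Jy. e u j) + (\<Sum>j\<in>J0 - Jy. e u j)) (x y) M"
    unfolding M_def by (intro runit_mult runit_prod c ln)
  also have "(\<Sum>j\<in>Jy. e u j) + (\<Sum>j\<in>J0 - Jy. e u j) = dg u"
    unfolding dg_def using sum.subset_diff[OF Jy_J0 fin(1), of "e u"] by simp
  finally have "runit (PV I) (dg u) (x y) M" .
  moreover have "N u = Ty * M"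
  proof -
    have "Ty * (\<Prod>j\<in>Jy. emb (c j) powi e u j) = (\<Prod>j\<in>Jy. emb (l j) powi e u j)"
      unfolding Ty_def prod.distrib[symmetric]
    proof (rule prod.cong[OF refl])
      fix j assume "j \<in> Jy"
      then have "emb (c j) \<noteq> 0" using L(4) by (simp add: Jy_def)
      then have "t j * emb (c j) = emb (l j)" by (simp add: t_def)
      then show "t j powi e u j * emb (c j) powi e u j = emb (l j) powi e u j"
        by (simp add: power_int_mult_distrib[symmetric])
    qed
    then show ?thesis unfolding N_def M_def
      using prod.subset_diff[OF Jy_J0 fin(1), of "\<lambda>j. emb (l j) powi e u j"] by (simp add: mult_ac)
  qed
  ultimately show ?thesis by blast
qed

text \<open>\<open>sections\<close> asks for some local equation, so both its existence and the
  independence of the choice enter.\<close>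

lemma local_section_iff: "(\<exists>h. local_equation Y (E u) y h \<and> f * h \<in> lring Y y) \<longleftrightarrow> f * N u \<in> reg (PV I) (dg u) (x y)"
proof -
  have h_iff: "f * h \<in> lring Y y \<longleftrightarrow> f * Ty \<in> reg (PV I) 0 (x y)" if hh: "local_equation Y (E u) y h" for h
  proof -
    from local_equation_unit[OF hh] obtain v where v: "runit (PV I) 0 (x y) v" "Ty = h * v" by blast
    show ?thesis using runit_reg_iff[OF v(1), of "f * h" 0] by (simp add: v(2) Y_lring mult.assoc)
  qed
  from N_Ty obtain M where M: "runit (PV I) (dg u) (x y) M" "N u = Ty * M" by blast
  have "f * N u \<in> reg (PV I) (dg u) (x y) \<longleftrightarrow> f * Ty \<in> reg (PV I) 0 (x y)"
    using runit_reg_iff[OF M(1), of "f * Ty" 0] by (simp add: M(2) mult.assoc)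
  then show ?thesis using h_iff local_equation_exists by blast
qed

end

lemma Sec_iff: "u \<in> weights n \<delta> \<Longrightarrow>
  f \<in> Sec u \<longleftrightarrow> f \<in> funs Y \<and> (\<forall>y\<in>locus Y D. f * N u \<in> reg (PV I) (dg u) (x y))"
  unfolding Sec_def sections_def using local_section_iff[of _ u f] by auto

lemma \<Lambda>: "\<Lambda> \<in> H m" "\<Lambda> \<noteq> 0" "y \<in> locus Y D \<Longrightarrow> poly_eval (x y) \<Lambda> \<noteq> 0"
proof -
  have "\<Lambda> \<in> H (\<Sum>j\<in>Ji. 1)" unfolding \<Lambda>_def using L(1) by (intro hpolys_prod) (auto simp: Ji_def)
  then show "\<Lambda> \<in> H m" by (simp add: m_def)
  show "\<Lambda> \<noteq> 0" unfolding \<Lambda>_def using fin(2) L(3) by (auto simp: Ji_def)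
  show "poly_eval (x y) \<Lambda> \<noteq> 0" if "y \<in> locus Y D"
    unfolding \<Lambda>_def poly_eval_simps(8) using that fin(2) by (auto simp: locus_eq Z_def)
qed

lemma \<Lambda>_pow: "\<Lambda> ^ k \<in> H (k * m)" using hpolys_power[OF \<Lambda>(1)] .

lemma locus_ne: "\<exists>y. y \<in> locus Y D"
proof -
  from ex_pts_nz[OF \<Lambda>(1,2)] obtain p where p: "p \<in> pts Y" "poly_eval (x p) \<Lambda> \<noteq> 0" by blast
  then have "p \<in> locus Y D" using fin(2) by (auto simp: locus_eq Z_def \<Lambda>_def poly_eval_simps)
  then show ?thesis by blast
qed

lemma N_nz: "N u \<noteq> 0" unfolding N_def using fin(1) L(3) by (auto simp: J0_def)

lemma N_frac: "\<exists>F G a b. N u = emb F / emb G \<and> F \<in> H a \<and> G \<in> H b \<and> G \<noteq> 0 \<and> int a = int b + dg u"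
proof -
  have "\<exists>F G a b. (\<Prod>j\<in>A. emb (l j) powi e u j) = emb F / emb G \<and> F \<in> H a \<and> G \<in> H b \<and> G \<noteq> 0 \<and> int a = int b + (\<Sum>j\<in>A. e u j)"
    if "finite A" "A \<subseteq> J" for A
    using that
  proof (induction A rule: finite_induct)
    case empty
    then show ?case by (intro exI[of _ 1] exI[of _ 0]) (simp add: emb_simps)
  next
    case (insert j A)
    then obtain F G a b where *: "(\<Prod>j\<in>A. emb (l j) powi e u j) = emb F / emb G" "F \<in> H a" "G \<in> H b" "G \<noteq> 0"
      "int a = int b + (\<Sum>j\<in>A. e u j)" by auto
    have j: "j \<in> J" using insert by blast
    have lp: "l j ^ k \<in> H k" for k using hpolys_power[OF L(1)[OF j], of k] by simp
    show ?case
    proof (cases "e u j \<ge> 0")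
      case True
      then have "(\<Prod>j\<in>insert j A. emb (l j) powi e u j) = emb (l j ^ nat (e u j) * F) / emb G"
        using insert * by (simp add: power_int_def emb_simps)
      moreover have "int (nat (e u j) + a) = int b + (\<Sum>j\<in>insert j A. e u j)" using insert * True by simp
      ultimately show ?thesis using hpolys_mult[OF lp *(2)] *(3,4) by blast
    next
      case False
      then have pe: "emb (l j) powi e u j = inverse (emb (l j ^ nat (- e u j)))"
        by (simp add: power_int_def emb_simps power_inverse)
      have "(\<Prod>j\<in>insert j A. emb (l j) powi e u j) = emb (l j) powi e u j * (emb F / emb G)"
        unfolding *(1)[symmetric] by (rule prod.insert[OF insert.hyps])
      then have "(\<Prod>j\<in>insert j A. emb (l j) powi e u j) = emb F / emb (l j ^ nat (- e u j) * G)"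
        unfolding pe by (simp add: emb_simps(3) divide_inverse mult_ac)
      moreover have "int a = int (nat (- e u j) + b) + (\<Sum>j\<in>insert j A. e u j)" using insert * False by simp
      moreover have "l j ^ nat (- e u j) * G \<noteq> 0" using L(3)[OF j] *(4) by simp
      ultimately show ?thesis using hpolys_mult[OF lp *(3)] *(2) by blast
    qed
  qed
  from this[OF fin(1)] show ?thesis unfolding N_def dg_def J0_def by auto
qed

text \<open>The poles along the removed divisors are cleared by a power of \<open>\<Lambda>\<close>, after which the section
  extends to \<open>\<bbbP>\<^sup>1 \<times> B\<close>.\<close>

lemma Sec_global:
  assumes u: "u \<in> weights n \<delta>"
  shows "f \<in> Sec u \<longleftrightarrow> (\<exists>k. f * N u * emb \<Lambda> ^ k \<in> FRi (dg u + int (k * m)))"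
proof
  assume f: "f \<in> Sec u"
  then have f1: "f \<in> funs Y" "\<And>y. y \<in> locus Y D \<Longrightarrow> f * N u \<in> reg (PV I) (dg u) (x y)" using Sec_iff[OF u] by auto
  from f1(1) obtain F0 G0 d0 where FG0: "f = emb F0 / emb G0" "F0 \<in> H d0" "G0 \<in> H d0" "G0 \<noteq> 0"
    unfolding Y_funs Fract_emb by blast
  from N_frac obtain F1 G1 a1 b1 where FG1: "N u = emb F1 / emb G1" "F1 \<in> H a1" "G1 \<in> H b1" "G1 \<noteq> 0" "int a1 = int b1 + dg u" by blast
  define Q where "Q b \<longleftrightarrow> (\<exists>k F G a. f * N u * emb \<Lambda> ^ k = emb F / emb G \<and> F \<in> H a \<and> G \<in> H b \<and> G \<noteq> 0 \<and>
      int a = int b + (dg u + int (k * m)))" for b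
  have "Q (d0 + b1)" unfolding Q_def
    by (intro exI[of _ 0] exI[of _ "F0 * F1"] exI[of _ "G0 * G1"] exI[of _ "d0 + a1"])
      (use FG0 FG1 hpolys_mult in \<open>auto simp: emb_simps\<close>)
  then have Q0: "Q (LEAST b. Q b)" by (rule LeastI)
  define n0 where "n0 = (LEAST b. Q b)"
  have "Q n0" using Q0 by (simp only: n0_def)
  then obtain k F G a where FG: "f * N u * emb \<Lambda> ^ k = emb F / emb G" "F \<in> H a" "G \<in> H n0" "G \<noteq> 0"
    "int a = int n0 + (dg u + int (k * m))" unfolding Q_def by blast
  \<comment> \<open>A factor \<open>l j\<close> of \<open>G\<close> would cancel against one more
    factor \<open>\<Lambda>\<close>, and \<open>n0\<close> would not be minimal.\<close>
  have rsG: "rs j G \<noteq> 0" if j: "j \<in> Ji" for j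
  proof
    assume "rs j G = 0"
    have jJ: "j \<in> J" using j by (simp add: Ji_def)
    from Z_dvd[OF jJ FG(3) \<open>rs j G = 0\<close>] obtain G' where G': "G = l j * G'" "G' \<in> H (n0 - 1)" "n0 = 0 \<Longrightarrow> G = 0" by blast
    have pos: "n0 > 0" using G'(3) FG(4) by (cases "n0 = 0") auto
    define P where "P = (\<Prod>i\<in>Ji - {j}. l i)"
    have \<Lambda>P: "\<Lambda> = l j * P" unfolding \<Lambda>_def P_def by (rule prod.remove[OF fin(2) j])
    have mpos: "m > 0" using j fin(2) by (auto simp: m_def card_gt_0_iff)
    have "P \<in> H (\<Sum>i\<in>Ji - {j}. 1)" unfolding P_def using L(1) by (intro hpolys_prod) (auto simp: Ji_def)
    then have PH: "P \<in> H (m - 1)" using fin(2) j by (simp add: m_def)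
    have "f * N u * emb \<Lambda> ^ Suc k = emb F / emb G * emb \<Lambda>" by (simp add: FG(1)[symmetric] mult_ac)
    also have "\<dots> = emb (F * P) / emb G'" using L(3)[OF jJ] by (simp add: G'(1) \<Lambda>P emb_simps)
    finally have "f * N u * emb \<Lambda> ^ Suc k = emb (F * P) / emb G'" .
    moreover have "G' \<noteq> 0" using FG(4) G'(1) by auto
    moreover have "int (a + (m - 1)) = int (n0 - 1) + (dg u + int (Suc k * m))"
      using FG(5) pos mpos by (simp add: of_nat_diff algebra_simps)
    ultimately have "Q (n0 - 1)" unfolding Q_def
      using G'(2) hpolys_mult[OF FG(2) PH]
      by (intro exI[of _ "Suc k"] exI[of _ "F * P"] exI[of _ G'] exI[of _ "a + (m - 1)"] conjI)
    then show False using not_less_Least[of "n0 - 1" Q] pos by (simp add: n0_def[symmetric])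
  qed
  have reg: "emb F / emb G \<in> reg (PV I) (dg u + int (k * m)) (pc z w b)"
    if bB: "b \<in> B" and zw: "z \<noteq> 0 \<or> w \<noteq> 0" and nl: "\<And>j. j \<in> Ji \<Longrightarrow> poly_eval (pc z w b) (l j) \<noteq> 0" for b z w
  proof -
    from Y_all[OF bB zw] obtain p s where p: "p \<in> pts Y" "s \<noteq> 0" "x p = pc (s * z) (s * w) b" by blast
    have "poly_eval (x p) (l j) \<noteq> 0" if "j \<in> Ji" for j
      using nl[OF that] p(2,3) poly_eval_scale[OF L(1)[of j], of s z w b] that by (simp add: Ji_def)
    then have "p \<in> locus Y D" using p(1) by (auto simp: locus_eq Z_def)
    from f1(2)[OF this] have "f * N u \<in> reg (PV I) (dg u) (pc z w b)" using reg_scale p(2,3) by simp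
    from reg_mult[OF this reg_emb[OF \<Lambda>_pow[of k]]] show ?thesis by (simp add: FG(1)[symmetric] emb_simps)
  qed
  have JiJ: "Ji \<subseteq> J" by (auto simp: Ji_def)
  have "emb F / emb G \<in> FRi (dg u + int (k * m))"
  proof (cases "dg u + int (k * m) < 0")
    case True
    have "F = 0"
    proof (rule negative_degree[where G = G and K = Ji, OF JiJ FG(2) FG(3) FG(4) FG(5)])
      show "emb F / emb G \<in> reg (PV I) (dg u + int (k * m)) (pc z w b)"
        if "b \<in> B" "z \<noteq> 0 \<or> w \<noteq> 0" "\<And>j. j \<in> Ji \<Longrightarrow> poly_eval (pc z w b) (l j) \<noteq> 0" for b z w
        using that by (rule reg)
      show "rs j G \<noteq> 0" if "j \<in> Ji" for j using that by (rule rsG)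
      show "dg u + int (k * m) < 0" by (rule True)
    qed
    then show ?thesis using True by (simp add: FRi_def emb_simps)
  next
    case False
    then have "0 \<le> dg u + int (k * m)" by simp
    obtain s where s: "\<And>i. s i \<in> R" "emb F / emb G = form (nat (dg u + int (k * m))) s"
    proof (rule global_form[where K = Ji, OF JiJ FG(2) FG(3) FG(4) FG(5)])
      show "emb F / emb G \<in> reg (PV I) (dg u + int (k * m)) (pc z w b)"
        if "b \<in> B" "z \<noteq> 0 \<or> w \<noteq> 0" "\<And>j. j \<in> Ji \<Longrightarrow> poly_eval (pc z w b) (l j) \<noteq> 0" for b z w
        using that by (rule reg)
      show "rs j G \<noteq> 0" if "j \<in> Ji" for j using that by (rule rsG)
      show "0 \<le> dg u + int (k * m)" by fact
    qed (rule that)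
    have "emb F / emb G \<in> FR (nat (dg u + int (k * m)))" unfolding FR_def s(2) using s(1) by blast
    then show ?thesis using False by (simp add: FRi_def)
  qed
  then show "\<exists>k. f * N u * emb \<Lambda> ^ k \<in> FRi (dg u + int (k * m))" unfolding FG(1)[symmetric] by (rule exI)
next
  assume "\<exists>k. f * N u * emb \<Lambda> ^ k \<in> FRi (dg u + int (k * m))"
  then obtain k where k: "f * N u * emb \<Lambda> ^ k \<in> FRi (dg u + int (k * m))" by blast
  have reg: "f * N u \<in> reg (PV I) (dg u) (x y)" if y: "y \<in> locus Y D" for y
  proof -
    from Y_pts[of y] y obtain b z w where b: "b \<in> B" "z \<noteq> 0 \<or> w \<noteq> 0" "x y = pc z w b" by (auto simp: locus_eq)
    have "f * N u * emb (\<Lambda> ^ k) \<in> reg (PV I) (dg u + int (k * m)) (x y)"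
      using FRi_reg[OF k b(1,2)] b(3) by (simp add: emb_simps)
    moreover have "runit (PV I) (int (k * m)) (x y) (emb (\<Lambda> ^ k))"
      by (rule runit_emb[OF \<Lambda>_pow]) (simp add: poly_eval_simps \<Lambda>(3)[OF y])
    ultimately show ?thesis using runit_reg_iff by blast
  qed
  \<comment> \<open>Regularity at one point already presents \<open>f * N u\<close> as a quotient of
    forms; dividing by \<open>N u\<close> brings the degree back to zero.\<close>
  have "f \<in> funs Y"
  proof -
    obtain y where y: "y \<in> locus Y D" using locus_ne by blast
    from reg[OF y] obtain F G a b where 1: "F \<in> H a" "G \<in> H b" "int a = int b + dg u" "poly_eval (x y) G \<noteq> 0" "f * N u = emb F / emb G"
      by (rule regE)
    from N_frac obtain F1 G1 a1 b1 where 2: "N u = emb F1 / emb G1" "F1 \<in> H a1" "G1 \<in> H b1" "G1 \<noteq> 0" "int a1 = int b1 + dg u" by blast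
    have "F1 \<noteq> 0" using N_nz[of u] 2(1) by (auto simp: emb_simps)
    have nz: "emb F1 \<noteq> 0" "emb G1 \<noteq> 0" using \<open>F1 \<noteq> 0\<close> 2(4) by (simp_all add: emb_eq_0_iff)
    have "f = f * N u / N u" using N_nz[of u] by simp
    also have "\<dots> = Fract (F * G1) (G * F1)" unfolding 1(5) unfolding 2(1) using nz by (simp add: Fract_emb emb_simps)
    finally have "f = Fract (F * G1) (G * F1)" .
    moreover have "F * G1 \<in> H (b + a1)" by (rule hpolys_mult'[OF 1(1) 2(3)]) (use 1(3) 2(5) in linarith)
    moreover have "G * F1 \<in> H (b + a1)" by (rule hpolys_mult[OF 1(2) 2(2)])
    moreover have "G * F1 \<noteq> 0" using poly_eval_nz[OF 1(4)] \<open>F1 \<noteq> 0\<close> by simp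
    ultimately show ?thesis unfolding Y_funs by blast
  qed
  then show "f \<in> Sec u" using reg Sec_iff[OF u] by blast
qed

end

subsection \<open>Flatness of the algebra of a polyhedral divisor\<close>

lemma poly_mapping_mult_sum:
  "(a :: 'a::monoid_add \<Rightarrow>\<^sub>0 'b::comm_semiring_1) * b =
     (\<Sum>u\<in>keys a. \<Sum>v\<in>keys b. Poly_Mapping.single (u + v) (lookup a u * lookup b v))"
proof -
  have "a * b = (\<Sum>u\<in>keys a. Poly_Mapping.single u (lookup a u)) * (\<Sum>v\<in>keys b. Poly_Mapping.single v (lookup b v))"
    by (rule arg_cong2[where f = "(*)"]) (rule poly_mapping_sum_single)+
  then show ?thesis by (simp only: sum_product mult_single)
qed

lemma single_of_sum: "Poly_Mapping.single u (\<Sum>i\<in>K. f i) = (\<Sum>i\<in>K. Poly_Mapping.single u (f i))"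
  by (induction K rule: infinite_finite_induct) (simp_all add: single_add)

lemma lookup_degree0_mult: "lookup (degree0 r * a) u = r * lookup a u"
proof -
  have "degree0 r * a = degree0 r * (\<Sum>v\<in>keys a. Poly_Mapping.single v (lookup a v))"
    by (rule arg_cong[where f = "(*) (degree0 r)"]) (rule poly_mapping_sum_single)
  also have "\<dots> = (\<Sum>v\<in>keys a. Poly_Mapping.single v (r * lookup a v))"
    by (simp add: degree0_def sum_distrib_left mult_single)
  finally have "lookup (degree0 r * a) u = (\<Sum>v\<in>keys a. (r * lookup a v when v = u))"
    by (simp add: lookup_sum lookup_single)
  also have "\<dots> = (\<Sum>v\<in>keys a. if v = u then r * lookup a v else 0)" by (simp add: when_def)
  also have "\<dots> = r * lookup a u" by (simp add: sum.delta in_keys_iff)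
  finally show ?thesis .
qed

context base
begin

lemma FRi_sum: "(\<And>i. i \<in> A \<Longrightarrow> f i \<in> FRi d) \<Longrightarrow> sum f A \<in> FRi d"
  by (induction A rule: infinite_finite_induct) (auto simp: FRi_0 FRi_add)

lemma FRi_FRi_mult:
  assumes "f \<in> FRi a" "g \<in> FRi b"
  shows "f * g \<in> FRi (a + b)"
proof (cases "a < 0 \<or> b < 0")
  case True
  then have "f * g = 0" using assms by (auto simp: FRi_def)
  then show ?thesis by (simp only: FRi_0)
next
  case False
  then have "f \<in> FR (nat a)" using assms(1) by (simp add: FRi_def)
  then obtain s where s: "\<forall>i. s i \<in> R" "f = form (nat a) s" unfolding FR_def by blast
  have "s i * (g * emb (PX ^ i * PY ^ (nat a - i))) \<in> FRi (b + int (nat a))" if "i \<in> {..nat a}" for i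
  proof (rule FRi_smult)
    show "s i \<in> R" using s(1) by blast
    show "g * emb (PX ^ i * PY ^ (nat a - i)) \<in> FRi (b + int (nat a))"
      by (rule FRi_mult[OF assms(2) hpolys_mult'[OF PX_power PY_power]]) (use that in simp)
  qed
  then have "(\<Sum>i\<le>nat a. s i * (g * emb (PX ^ i * PY ^ (nat a - i)))) \<in> FRi (b + int (nat a))" by (rule FRi_sum)
  moreover have "(\<Sum>i\<le>nat a. s i * (g * emb (PX ^ i * PY ^ (nat a - i)))) = f * g"
    unfolding s(2) form_def sum_distrib_right by (rule sum.cong) (simp_all add: mult_ac)
  ultimately show ?thesis using False by (simp add: add.commute)
qed

end

context divisor_family
begin

text \<open>The sections whose poles along the removed divisors are cleared by the power
  \<open>\<Lambda> ^ k\<close>: a free module over \<open>R\<close> for each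
  \<open>k\<close>.\<close>

definition Gr :: "zvec \<Rightarrow> nat \<Rightarrow> ratfun set" where
  "Gr u k = {f. f * (N u * emb (\<Lambda> ^ k)) \<in> FRi (dg u + int (k * m))}"

lemma Sec_Gr: "u \<in> weights n \<delta> \<Longrightarrow> f \<in> Sec u \<longleftrightarrow> (\<exists>k. f \<in> Gr u k)"
  by (simp add: Sec_global Gr_def emb_simps mult.assoc)

lemma Gr_mono:
  assumes "f \<in> Gr u k" "k \<le> k'"
  shows "f \<in> Gr u k'"
proof -
  have "f * (N u * emb (\<Lambda> ^ k)) * emb (\<Lambda> ^ (k' - k)) \<in> FRi (dg u + int (k * m) + int ((k' - k) * m))"
    using assms(1) unfolding Gr_def by (intro FRi_mult \<Lambda>_pow) simp
  moreover have "\<Lambda> ^ k' = \<Lambda> ^ k * \<Lambda> ^ (k' - k)" using assms(2) by (simp add: power_add[symmetric])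
  moreover have "int (k * m) + int ((k' - k) * m) = int (k' * m)"
    using assms(2) by (simp only: of_nat_add[symmetric] distrib_right[symmetric]) simp
  ultimately show ?thesis by (simp add: Gr_def emb_simps mult.assoc add.assoc)
qed

lemma Gr_0: "0 \<in> Gr u k" and Gr_add: "f \<in> Gr u k \<Longrightarrow> g \<in> Gr u k \<Longrightarrow> f + g \<in> Gr u k"
  and Gr_smult: "r \<in> R \<Longrightarrow> f \<in> Gr u k \<Longrightarrow> r * f \<in> Gr u k"
  by (simp_all add: Gr_def FRi_0 FRi_add FRi_smult distrib_right mult.assoc)

lemma e_superadditive:
  assumes "u \<in> weights n \<delta>" "v \<in> weights n \<delta>" "j \<in> J0"
  shows "e u j + e v j \<le> e (u + v) j"
proof -
  have "e u j + e v j \<le> \<lfloor>minval (\<Delta> j) u + minval (\<Delta> j) v\<rfloor>" unfolding e_def by (rule le_floor_add)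
  also have "\<dots> \<le> e (u + v) j" unfolding e_def
    by (intro floor_mono minval_superadditive hm assms weights_add)
  finally show ?thesis .
qed

text \<open>Rounded minima are superadditive in the weight, so the equations for \<open>u\<close>,
  \<open>v\<close> and \<open>u + v\<close> differ by a form rather than by a fraction; its degree
  is the excess in \<open>dg\<close>.\<close>

lemma N_add:
  assumes "u \<in> weights n \<delta>" "v \<in> weights n \<delta>"
  obtains P :: Defs.poly and d :: nat
  where "N (u + v) = N u * N v * emb P" "P \<in> H d" "dg (u + v) = dg u + dg v + int d"
proof -
  define k where "k j = nat (e (u + v) j - e u j - e v j)" for j
  have k: "e (u + v) j = e u j + e v j + int (k j)" if "j \<in> J0" for j
    using e_superadditive[OF assms that] by (simp add: k_def)
  show thesis
  proof (rule that)
    have J: "j \<in> J" if "j \<in> J0" for j using that by (simp add: J0_def)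
    have nz: "emb (l j) \<noteq> 0" if "j \<in> J0" for j using L(3)[OF J[OF that]] by (simp add: emb_eq_0_iff)
    have "N (u + v) = (\<Prod>j\<in>J0. emb (l j) powi e u j * emb (l j) powi e v j * emb (l j ^ k j))"
      unfolding N_def
    proof (rule prod.cong)
      fix j assume j: "j \<in> J0"
      show "emb (l j) powi e (u + v) j = emb (l j) powi e u j * emb (l j) powi e v j * emb (l j ^ k j)"
        unfolding k[OF j] power_int_add[OF disjI1[OF nz[OF j]]] by (simp add: emb_simps)
    qed simp
    then show "N (u + v) = N u * N v * emb (\<Prod>j\<in>J0. l j ^ k j)"
      unfolding N_def by (simp add: prod.distrib emb_simps)
    have "l j ^ k j \<in> H (k j)" if "j \<in> J0" for j using hpolys_power[OF L(1)[OF J[OF that]], of "k j"] by simp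
    then show "(\<Prod>j\<in>J0. l j ^ k j) \<in> H (\<Sum>j\<in>J0. k j)" by (rule hpolys_prod)
    show "dg (u + v) = dg u + dg v + int (\<Sum>j\<in>J0. k j)" unfolding dg_def by (simp add: k sum.distrib)
  qed
qed

lemma Sec_0: "u \<in> weights n \<delta> \<Longrightarrow> 0 \<in> Sec u"
  using Sec_Gr Gr_0 by blast

lemma Sec_add:
  assumes "u \<in> weights n \<delta>" "f \<in> Sec u" "g \<in> Sec u"
  shows "f + g \<in> Sec u"
proof -
  from assms obtain k k' where "f \<in> Gr u k" "g \<in> Gr u k'" using Sec_Gr by blast
  then have "f + g \<in> Gr u (max k k')" by (intro Gr_add) (auto elim: Gr_mono)
  then show ?thesis using Sec_Gr[OF assms(1)] by blast
qed

lemma Sec_sum: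
  assumes "u \<in> weights n \<delta>" "\<And>i. i \<in> K \<Longrightarrow> f i \<in> Sec u"
  shows "sum f K \<in> Sec u"
  using assms(2) by (induction K rule: infinite_finite_induct) (simp_all add: Sec_0 Sec_add assms(1))

lemma Sec_smult:
  assumes "u \<in> weights n \<delta>" "r \<in> R" "f \<in> Sec u"
  shows "r * f \<in> Sec u"
  using Sec_Gr[OF assms(1)] Gr_smult[OF assms(2)] assms(3) by blast

lemma Sec_mult:
  assumes u: "u \<in> weights n \<delta>" "v \<in> weights n \<delta>" and f: "f \<in> Sec u" and g: "g \<in> Sec v"
  shows "f * g \<in> Sec (u + v)"
proof -
  from f obtain k where k: "f \<in> Gr u k" using Sec_Gr[OF u(1)] by blast
  from g obtain k' where k': "g \<in> Gr v k'" using Sec_Gr[OF u(2)] by blast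
  obtain P d where P: "N (u + v) = N u * N v * emb P" "P \<in> H d" "dg (u + v) = dg u + dg v + int d"
    by (rule N_add[OF u])
  have "f * (N u * emb (\<Lambda> ^ k)) * (g * (N v * emb (\<Lambda> ^ k'))) * emb P
      \<in> FRi (dg u + int (k * m) + (dg v + int (k' * m)) + int d)"
    using k k' unfolding Gr_def mem_Collect_eq by (rule FRi_mult[OF FRi_FRi_mult P(2)])
  moreover have "f * (N u * emb (\<Lambda> ^ k)) * (g * (N v * emb (\<Lambda> ^ k'))) * emb P =
      f * g * (N (u + v) * emb (\<Lambda> ^ (k + k')))" by (simp add: P(1) emb_simps power_add mult_ac)
  moreover have "dg u + int (k * m) + (dg v + int (k' * m)) + int d = dg (u + v) + int ((k + k') * m)"
    by (simp add: P(3) distrib_right)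
  ultimately have "f * g \<in> Gr (u + v) (k + k')" by (simp add: Gr_def)
  then show ?thesis using Sec_Gr[OF weights_add[OF u]] by blast
qed

lemma weight_0: "N 0 = 1" "dg 0 = 0"
  by (simp_all add: N_def dg_def e_def minval_weight_0 J0_def)

lemma R_Sec_0: "r \<in> R \<Longrightarrow> r \<in> Sec 0"
proof -
  assume r: "r \<in> R"
  have "emb 1 \<in> FR 0" by (rule FR_emb) (rule hpolys_1)
  then have "1 \<in> FRi 0" by (simp add: FRi_def emb_simps)
  then have "r * 1 \<in> FRi 0" by (rule FRi_smult[OF r])
  then have "r \<in> Gr 0 0" by (simp add: Gr_def weight_0 emb_simps)
  then show ?thesis using Sec_Gr[OF weights_0] by blast
qed

section \<open>The algebra of the divisor and its finite stages\<close>

definition A :: "(zvec \<Rightarrow>\<^sub>0 ratfun) set" where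
  "A = {a. \<forall>u\<in>keys a. u \<in> weights n \<delta> \<and> lookup a u \<in> Sec u}"

lemma divisor_algebra_A: "divisor_algebra n Y \<delta> D = subring_of A"
  by (simp add: divisor_algebra_def A_def Sec_def)

lemma AD: "a \<in> A \<Longrightarrow> u \<in> keys a \<Longrightarrow> u \<in> weights n \<delta>" "a \<in> A \<Longrightarrow> u \<in> weights n \<delta> \<Longrightarrow> lookup a u \<in> Sec u"
  using Sec_0 by (auto simp: A_def in_keys_iff)

lemma A_single: "u \<in> weights n \<delta> \<Longrightarrow> f \<in> Sec u \<Longrightarrow> Poly_Mapping.single u f \<in> A"
  by (auto simp: A_def lookup_single)

lemma A_0: "0 \<in> A" by (simp add: A_def)

lemma A_add: "a \<in> A \<Longrightarrow> b \<in> A \<Longrightarrow> a + b \<in> A"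
proof -
  assume ab: "a \<in> A" "b \<in> A"
  show "a + b \<in> A" unfolding A_def
  proof (rule CollectI, rule ballI)
    fix u assume "u \<in> keys (a + b)"
    then have "u \<in> keys a \<union> keys b" using keys_add[of a b] by blast
    then have u: "u \<in> weights n \<delta>" using AD(1) ab by blast
    show "u \<in> weights n \<delta> \<and> lookup (a + b) u \<in> Sec u"
      using u Sec_add[OF u AD(2)[OF ab(1) u] AD(2)[OF ab(2) u]] by (simp add: lookup_add)
  qed
qed

lemma A_sum: "(\<And>i. i \<in> K \<Longrightarrow> f i \<in> A) \<Longrightarrow> sum f K \<in> A"
  by (induction K rule: infinite_finite_induct) (auto simp: A_0 A_add)

lemma A_mult: "a \<in> A \<Longrightarrow> b \<in> A \<Longrightarrow> a * b \<in> A"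
  unfolding poly_mapping_mult_sum[of a b]
  by (intro A_sum A_single weights_add Sec_mult AD) assumption+

lemma degree0_A: "r \<in> R \<Longrightarrow> degree0 r \<in> A"
  unfolding degree0_def by (intro A_single weights_0 R_Sec_0)

lemma degree0_1: "degree0 1 = 1" by (simp add: degree0_def)

lemma subring_closed_A: "subring_closed A"
proof -
  have one: "1 \<in> A" using degree0_A[OF subring_closedD(1)[OF subring_closed_R]] by (simp add: degree0_1)
  have "- 1 \<in> R" by (intro subring_closedD(5)[OF subring_closed_R] subring_closedD(1)[OF subring_closed_R])
  then have m: "degree0 (- 1) \<in> A" by (rule degree0_A)
  have neg: "- a \<in> A" if "a \<in> A" for a
  proof -
    have "degree0 (- 1) * a = - a" by (rule poly_mapping_eqI) (simp add: lookup_degree0_mult)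
    then show ?thesis using A_mult[OF m that] by simp
  qed
  show ?thesis unfolding subring_closed_def
    by (intro conjI ballI) (simp_all add: one A_0 A_add A_mult neg)
qed

text \<open>With the weights in a finite set and a uniform bound on the poles, these are the
  submodules that exhaust \<open>A\<close>.\<close>

definition W_part :: "zvec set \<Rightarrow> nat \<Rightarrow> (zvec \<Rightarrow>\<^sub>0 ratfun) set" where
  "W_part W k = {a. keys a \<subseteq> W \<and> (\<forall>u\<in>W. lookup a u \<in> Gr u k)}"

lemma finite_W_part:
  assumes "finite Q" "Q \<subseteq> A"
  obtains W k where "finite W" "W \<subseteq> weights n \<delta>" "Q \<subseteq> W_part W k"
proof -
  define W where "W = (\<Union>a\<in>Q. keys a)"
  have W: "finite W" "W \<subseteq> weights n \<delta>" using assms AD(1) by (auto simp: W_def)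
  have "\<forall>(a, u)\<in>Q \<times> W. \<exists>k. lookup a u \<in> Gr u k"
  proof (rule ballI, clarify)
    fix a u assume au: "a \<in> Q" "u \<in> W"
    then have u: "u \<in> weights n \<delta>" using W(2) by blast
    have "lookup a u \<in> Sec u" using au assms(2) AD(2)[OF _ u] by blast
    then show "\<exists>k. lookup a u \<in> Gr u k" using Sec_Gr[OF u] by blast
  qed
  then have "\<forall>p\<in>Q \<times> W. \<exists>k. lookup (fst p) (snd p) \<in> Gr (snd p) k" by auto
  from bchoice[OF this] obtain k where k: "\<forall>p\<in>Q \<times> W. lookup (fst p) (snd p) \<in> Gr (snd p) (k p)"
    by (elim exE) (rule that)
  \<comment> \<open>The sum is a convenient upper bound for the finitely many exponents
    \<open>k p\<close>.\<close>
  define K where "K = (\<Sum>p\<in>Q \<times> W. k p)"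
  have K: "k p \<le> K" if "p \<in> Q \<times> W" for p
    unfolding K_def using that assms(1) W(1) by (intro member_le_sum) auto
  have "a \<in> W_part W K" if "a \<in> Q" for a
  proof -
    have "lookup a u \<in> Gr u K" if "u \<in> W" for u
      using k[rule_format, of "(a, u)"] K[of "(a, u)"] Gr_mono \<open>a \<in> Q\<close> that by simp
    moreover have "keys a \<subseteq> W" using that by (auto simp: W_def)
    ultimately show ?thesis by (simp add: W_part_def)
  qed
  then show thesis using that[OF W, of K] by blast
qed

definition Bas :: "zvec \<Rightarrow> nat \<Rightarrow> nat \<Rightarrow> ratfun" where
  "Bas u k i = emb (PX ^ i * PY ^ (nat (dg u + int (k * m)) - i)) / (N u * emb (\<Lambda> ^ k))"

definition cf :: "zvec \<Rightarrow> nat \<Rightarrow> ratfun \<Rightarrow> nat \<Rightarrow> ratfun" where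
  "cf u k f = coef (nat (dg u + int (k * m))) (f * (N u * emb (\<Lambda> ^ k)))"

text \<open>In negative degree the stage is zero and must have an empty basis, whereas
  \<open>{..nat d}\<close> would contain the index \<open>0\<close>.\<close>

definition Ix :: "zvec \<Rightarrow> nat \<Rightarrow> nat set" where
  "Ix u k = (if dg u + int (k * m) < 0 then {} else {..nat (dg u + int (k * m))})"

lemma Ix_le: "i \<in> Ix u k \<Longrightarrow> i \<le> nat (dg u + int (k * m))"
  by (simp add: Ix_def split: if_splits)

lemma fin_Ix: "finite (Ix u k)" by (simp add: Ix_def)

lemma denom_nz: "N u * emb (\<Lambda> ^ k) \<noteq> 0" using N_nz \<Lambda>(2) by (simp add: emb_eq_0_iff)

lemma Bas_Sec:
  assumes "u \<in> weights n \<delta>" "i \<in> Ix u k"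
  shows "Bas u k i \<in> Sec u"
proof -
  have i: "dg u + int (k * m) \<ge> 0" "i \<le> nat (dg u + int (k * m))" using assms(2) by (auto simp: Ix_def split: if_splits)
  have "Bas u k i * (N u * emb (\<Lambda> ^ k)) = emb (PX ^ i * PY ^ (nat (dg u + int (k * m)) - i))"
    unfolding Bas_def using denom_nz[of u k] by simp
  moreover have "emb (PX ^ i * PY ^ (nat (dg u + int (k * m)) - i)) \<in> FR (nat (dg u + int (k * m)))"
    by (intro FR_emb hpolys_mult'[OF PX_power PY_power]) (use i(2) in simp)
  ultimately have "Bas u k i \<in> Gr u k" using i(1) by (simp add: Gr_def FRi_def)
  then show ?thesis using Sec_Gr[OF assms(1)] by blast
qed

lemma Gr_FR: "f \<in> Gr u k \<Longrightarrow> i \<in> Ix u k \<Longrightarrow> f * (N u * emb (\<Lambda> ^ k)) \<in> FR (nat (dg u + int (k * m)))"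
  by (auto simp: Gr_def FRi_def Ix_def split: if_splits)

lemma cf_R: "f \<in> Gr u k \<Longrightarrow> i \<in> Ix u k \<Longrightarrow> cf u k f i \<in> R"
  unfolding cf_def by (rule coef(1)) (rule Gr_FR)

lemma cf_add: "f \<in> Gr u k \<Longrightarrow> g \<in> Gr u k \<Longrightarrow> i \<in> Ix u k \<Longrightarrow> cf u k (f + g) i = cf u k f i + cf u k g i"
  unfolding cf_def distrib_right by (rule coef_add[OF Gr_FR Gr_FR Ix_le])

lemma cf_smult: "r \<in> R \<Longrightarrow> f \<in> Gr u k \<Longrightarrow> i \<in> Ix u k \<Longrightarrow> cf u k (r * f) i = r * cf u k f i"
  unfolding cf_def mult.assoc[of r] by (rule coef_smult[OF _ Gr_FR Ix_le])

lemma cf_expand: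
  assumes "f \<in> Gr u k"
  shows "f = (\<Sum>i\<in>Ix u k. cf u k f i * Bas u k i)"
proof (cases "dg u + int (k * m) < 0")
  case True
  then have "f * (N u * emb (\<Lambda> ^ k)) = 0" using assms by (simp add: Gr_def FRi_def)
  then have "f = 0" using denom_nz[of u k] by (simp only: mult_eq_0_iff) blast
  then show ?thesis using True by (simp add: Ix_def)
next
  case False
  define d where "d = nat (dg u + int (k * m))"
  have "f * (N u * emb (\<Lambda> ^ k)) \<in> FR d" using assms False by (simp add: Gr_def FRi_def d_def)
  from coef(2)[OF this] have "f * (N u * emb (\<Lambda> ^ k)) = (\<Sum>i\<le>d. cf u k f i * emb (PX ^ i * PY ^ (d - i)))"
    by (simp add: form_def cf_def d_def)
  then have "f = (\<Sum>i\<le>d. cf u k f i * emb (PX ^ i * PY ^ (d - i))) / (N u * emb (\<Lambda> ^ k))"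
    using denom_nz[of u k] by (simp add: eq_divide_eq)
  then show ?thesis using False by (simp add: Ix_def Bas_def d_def sum_divide_distrib)
qed

lemma W_part_expand:
  assumes W: "finite W" and a: "a \<in> W_part W k"
  shows "a = (\<Sum>c\<in>Sigma W (\<lambda>u. Ix u k). degree0 (cf (fst c) k (lookup a (fst c)) (snd c)) *
    Poly_Mapping.single (fst c) (Bas (fst c) k (snd c)))"
proof -
  have "a = (\<Sum>u\<in>keys a. Poly_Mapping.single u (lookup a u))" by (rule poly_mapping_sum_single)
  also have "\<dots> = (\<Sum>u\<in>W. Poly_Mapping.single u (lookup a u))"
    by (rule sum.mono_neutral_left[OF W]) (use a in \<open>auto simp: W_part_def in_keys_iff\<close>)
  also have "\<dots> = (\<Sum>u\<in>W. \<Sum>i\<in>Ix u k. Poly_Mapping.single u (cf u k (lookup a u) i * Bas u k i))"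
  proof (rule sum.cong)
    fix u assume "u \<in> W"
    then have "lookup a u \<in> Gr u k" using a by (simp add: W_part_def)
    from arg_cong[OF cf_expand[OF this], of "Poly_Mapping.single u"]
    show "Poly_Mapping.single u (lookup a u) = (\<Sum>i\<in>Ix u k. Poly_Mapping.single u (cf u k (lookup a u) i * Bas u k i))"
      by (simp only: single_of_sum)
  qed simp
  also have "\<dots> = (\<Sum>c\<in>Sigma W (\<lambda>u. Ix u k). Poly_Mapping.single (fst c) (cf (fst c) k (lookup a (fst c)) (snd c) * Bas (fst c) k (snd c)))"
    by (subst sum.Sigma) (simp_all add: W fin_Ix split_def)
  finally show ?thesis by (simp add: degree0_def mult_single)
qed

text \<open>The stages \<open>W_part W k\<close> are free, with a basis indexed by a weight and the
  exponent of \<open>X0\<close>; the coordinates \<open>cf\<close> are linear over \<open>R\<close>,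
  as the dual basis criterion requires.\<close>

theorem flat: "flat_morphism tb tc (subring_of R) (divisor_algebra n Y \<delta> D) degree0"
  unfolding divisor_algebra_A
proof (rule flat_morphism_subringI[OF subring_closed_R subring_closed_A])
  show "degree0 ` R \<subseteq> A" using degree0_A by blast
  show "degree0 1 = 1" by (rule degree0_1)
  show "degree0 (a + b) = degree0 a + degree0 b" "degree0 (a * b) = degree0 a * degree0 b" for a b
    by (simp_all add: degree0_def single_add mult_single)
  fix Q assume Q: "finite Q" "Q \<subseteq> A"
  obtain W k where W: "finite W" "W \<subseteq> weights n \<delta>" "Q \<subseteq> W_part W k" by (rule finite_W_part[OF Q])
  let ?C = "Sigma W (\<lambda>u. Ix u k)"
  let ?e = "\<lambda>c. Poly_Mapping.single (fst c) (Bas (fst c) k (snd c))"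
  let ?k = "\<lambda>c a. cf (fst c) k (lookup a (fst c)) (snd c)"
  have mem: "lookup a u \<in> Gr u k" if "a \<in> W_part W k" "u \<in> W" for a u using that by (simp add: W_part_def)
  have FA: "W_part W k \<subseteq> A"
  proof
    fix a assume a: "a \<in> W_part W k"
    show "a \<in> A" unfolding A_def
    proof (rule CollectI, rule ballI)
      fix u assume "u \<in> keys a"
      then have "u \<in> W" using a by (auto simp: W_part_def)
      then have u: "u \<in> weights n \<delta>" using W(2) by blast
      show "u \<in> weights n \<delta> \<and> lookup a u \<in> Sec u"
        using u Sec_Gr[OF u] mem[OF a \<open>u \<in> W\<close>] by blast
    qed
  qed
  have Fadd: "a + b \<in> W_part W k" if ab: "a \<in> W_part W k" "b \<in> W_part W k" for a b
  proof -
    have "keys (a + b) \<subseteq> W" using ab keys_add[of a b] by (auto simp: W_part_def)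
    then show ?thesis using mem[OF ab(1)] mem[OF ab(2)] by (simp add: W_part_def lookup_add Gr_add)
  qed
  have Fsmult: "degree0 r * a \<in> W_part W k" if r: "r \<in> R" and a: "a \<in> W_part W k" for r a
  proof -
    have "keys (degree0 r * a) \<subseteq> keys a" by (rule subsetI) (simp add: in_keys_iff lookup_degree0_mult)
    then have "keys (degree0 r * a) \<subseteq> W" using a by (auto simp: W_part_def)
    then show ?thesis using Gr_smult[OF r mem[OF a]] by (simp add: W_part_def lookup_degree0_mult)
  qed
  have e: "?e \<in> ?C \<rightarrow> A"
  proof
    fix c assume c: "c \<in> ?C"
    then have "fst c \<in> weights n \<delta>" "snd c \<in> Ix (fst c) k" using W(2) by auto
    then show "?e c \<in> A" by (intro A_single Bas_Sec)
  qed
  show "\<exists>F (C :: (zvec \<times> nat) set) e k. Q \<subseteq> F \<and> F \<subseteq> A \<and> (\<forall>x\<in>F. \<forall>y\<in>F. x + y \<in> F) \<and>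
        (\<forall>r\<in>R. \<forall>x\<in>F. degree0 r * x \<in> F) \<and> finite C \<and> e \<in> C \<rightarrow> A \<and>
        (\<forall>c\<in>C. k c \<in> F \<rightarrow> R \<and> (\<forall>x\<in>F. \<forall>y\<in>F. k c (x + y) = k c x + k c y) \<and>
          (\<forall>r\<in>R. \<forall>x\<in>F. k c (degree0 r * x) = r * k c x)) \<and>
        (\<forall>x\<in>F. x = (\<Sum>c\<in>C. degree0 (k c x) * e c))"
  proof (intro exI conjI)
    show "Q \<subseteq> W_part W k" by (rule W(3))
    show "W_part W k \<subseteq> A" by (rule FA)
    show "\<forall>x\<in>W_part W k. \<forall>y\<in>W_part W k. x + y \<in> W_part W k" using Fadd by (intro ballI)
    show "\<forall>r\<in>R. \<forall>x\<in>W_part W k. degree0 r * x \<in> W_part W k" using Fsmult by (intro ballI)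
    show "finite ?C" using W(1) fin_Ix by (intro finite_SigmaI)
    show "?e \<in> ?C \<rightarrow> A" by (rule e)
    show "\<forall>c\<in>?C. ?k c \<in> W_part W k \<rightarrow> R \<and> (\<forall>x\<in>W_part W k. \<forall>y\<in>W_part W k. ?k c (x + y) = ?k c x + ?k c y) \<and>
          (\<forall>r\<in>R. \<forall>x\<in>W_part W k. ?k c (degree0 r * x) = r * ?k c x)"
    proof (rule ballI)
      fix c assume "c \<in> ?C"
      then have c: "fst c \<in> W" "snd c \<in> Ix (fst c) k" by auto
      show "?k c \<in> W_part W k \<rightarrow> R \<and> (\<forall>x\<in>W_part W k. \<forall>y\<in>W_part W k. ?k c (x + y) = ?k c x + ?k c y) \<and>
          (\<forall>r\<in>R. \<forall>x\<in>W_part W k. ?k c (degree0 r * x) = r * ?k c x)"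
        using c mem[OF _ c(1)] by (simp add: Pi_def lookup_add lookup_degree0_mult cf_R cf_add cf_smult)
    qed
    show "\<forall>x\<in>W_part W k. x = (\<Sum>c\<in>?C. degree0 (?k c x) * ?e c)"
      by (rule ballI) (rule W_part_expand[OF W(1)])
  qed
qed

end

subsection \<open>Specialisation of the parameters\<close>

lemma single_eq_0_iff: "Poly_Mapping.single u c = 0 \<longleftrightarrow> c = 0"
  by (metis lookup_single_eq lookup_zero single_zero)

text \<open>Specialisation is a partial map on the field: some representation of the fraction must
  have a denominator that does not become zero when the parameters take the value
  \<open>b\<close>.\<close>

definition specializable :: "(p1 \<times> nat \<Rightarrow> complex) \<Rightarrow> ratfun set" where
  "specializable b = {emb F / emb G | F G. subT b G \<noteq> 0}"

definition spz :: "(p1 \<times> nat \<Rightarrow> complex) \<Rightarrow> ratfun \<Rightarrow> ratfun" where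
  "spz b f = (SOME g. \<exists>F G. subT b G \<noteq> 0 \<and> f = emb F / emb G \<and> g = emb (subT b F) / emb (subT b G))"

lemma specializableI: "subT b G \<noteq> 0 \<Longrightarrow> emb F / emb G \<in> specializable b"
  unfolding specializable_def by blast

lemma specializableE:
  assumes "f \<in> specializable b"
  obtains F G where "subT b G \<noteq> 0" "f = emb F / emb G"
  using assms unfolding specializable_def by blast

text \<open>Cross-multiplied equations are preserved by the homomorphism \<open>subT b\<close>, so
  the representation chosen in \<open>spz\<close> does not matter.\<close>

lemma spz_eq:
  assumes "subT b G \<noteq> 0"
  shows "spz b (emb F / emb G) = emb (subT b F) / emb (subT b G)"
proof -
  let ?P = "\<lambda>g. \<exists>F' G'. subT b G' \<noteq> 0 \<and> emb F / emb G = emb F' / emb G' \<and> g = emb (subT b F') / emb (subT b G')"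
  have "?P (emb (subT b F) / emb (subT b G))" using assms by blast
  then have "?P (spz b (emb F / emb G))" unfolding spz_def by (rule someI)
  then obtain F' G' where *: "subT b G' \<noteq> 0" "emb F / emb G = emb F' / emb G'"
    "spz b (emb F / emb G) = emb (subT b F') / emb (subT b G')" by blast
  have nz: "G \<noteq> 0" "G' \<noteq> 0" using assms *(1) by (auto simp: subT_simps(4))
  have "F * G' = F' * G" using *(2) emb_divide_eq_iff[OF nz] by simp
  then have "subT b F * subT b G' = subT b F' * subT b G" by (simp only: subT_simps(3)[symmetric])
  then have "emb (subT b F) / emb (subT b G) = emb (subT b F') / emb (subT b G')"
    by (simp only: emb_divide_eq_iff[OF assms *(1)])
  then show ?thesis using *(3) by simp
qed

lemma spz_emb: "emb F \<in> specializable b" "spz b (emb F) = emb (subT b F)"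
  using specializableI[where G = 1 and F = F and b = b] spz_eq[where G = 1 and F = F and b = b] by (simp_all add: subT_simps emb_simps)

lemma spz_const: "const c \<in> specializable b" "spz b (const c) = const c"
  by (simp_all add: const_emb spz_emb subT_const)

lemma spz_0: "0 \<in> specializable b" "spz b 0 = 0"
  using spz_emb[where F = 0 and b = b] by (simp_all add: subT_simps emb_simps)

lemma spz_1: "1 \<in> specializable b" "spz b 1 = 1"
  using spz_emb[where F = 1 and b = b] by (simp_all add: subT_simps emb_simps)

lemma spz_add: "f + g \<in> specializable b" "spz b (f + g) = spz b f + spz b g"
  and spz_mult: "f * g \<in> specializable b" "spz b (f * g) = spz b f * spz b g"
  if fg: "f \<in> specializable b" "g \<in> specializable b"
proof -
  obtain F G where f: "subT b G \<noteq> 0" "f = emb F / emb G" by (rule specializableE[OF fg(1)])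
  obtain F' G' where g: "subT b G' \<noteq> 0" "g = emb F' / emb G'" by (rule specializableE[OF fg(2)])
  have nz: "emb G \<noteq> 0" "emb G' \<noteq> 0" "emb (subT b G) \<noteq> 0" "emb (subT b G') \<noteq> 0"
    using f(1) g(1) by (auto simp: subT_simps(4) emb_eq_0_iff)
  have GG: "subT b (G * G') \<noteq> 0" using f(1) g(1) by (simp add: subT_simps)
  have s: "f + g = emb (F * G' + F' * G) / emb (G * G')" using nz by (simp add: f(2) g(2) emb_simps add_frac_eq)
  show "f + g \<in> specializable b" unfolding s by (rule specializableI[OF GG])
  have f': "spz b f = emb (subT b F) / emb (subT b G)" by (simp only: f(2) spz_eq[OF f(1)])
  have g': "spz b g = emb (subT b F') / emb (subT b G')" by (simp only: g(2) spz_eq[OF g(1)])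
  show "spz b (f + g) = spz b f + spz b g"
    unfolding f' g' unfolding s spz_eq[OF GG]
    using nz by (simp add: subT_simps emb_simps add_frac_eq)
  have p: "f * g = emb (F * F') / emb (G * G')" by (simp add: f(2) g(2) emb_simps)
  show "f * g \<in> specializable b" unfolding p by (rule specializableI[OF GG])
  show "spz b (f * g) = spz b f * spz b g"
    unfolding f' g' unfolding p spz_eq[OF GG] by (simp add: subT_simps emb_simps)
qed

lemma spz_divide: "f / g \<in> specializable b" "spz b (f / g) = spz b f / spz b g"
  if fg: "f \<in> specializable b" "g \<in> specializable b" "spz b g \<noteq> 0"
proof -
  obtain F G where f: "subT b G \<noteq> 0" "f = emb F / emb G" by (rule specializableE[OF fg(1)])
  obtain F' G' where g: "subT b G' \<noteq> 0" "g = emb F' / emb G'" by (rule specializableE[OF fg(2)])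
  have F': "subT b F' \<noteq> 0" using fg(3) spz_eq[OF g(1), of F'] by (auto simp: g(2) emb_simps)
  have GF: "subT b (G * F') \<noteq> 0" using f(1) F' by (simp add: subT_simps)
  have q: "f / g = emb (F * G') / emb (G * F')" by (simp add: f(2) g(2) emb_simps)
  show "f / g \<in> specializable b" unfolding q by (rule specializableI[OF GF])
  have f': "spz b f = emb (subT b F) / emb (subT b G)" by (simp only: f(2) spz_eq[OF f(1)])
  have g': "spz b g = emb (subT b F') / emb (subT b G')" by (simp only: g(2) spz_eq[OF g(1)])
  show "spz b (f / g) = spz b f / spz b g"
    unfolding f' g' unfolding q spz_eq[OF GF] by (simp add: subT_simps emb_simps)
qed

lemma spz_sum: "sum f K \<in> specializable b \<and> spz b (sum f K) = (\<Sum>i\<in>K. spz b (f i))"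
  if "\<And>i. i \<in> K \<Longrightarrow> f i \<in> specializable b"
  using that by (induction K rule: infinite_finite_induct) (simp_all add: spz_0 spz_add)

lemma spz_prod: "prod f K \<in> specializable b \<and> spz b (prod f K) = (\<Prod>i\<in>K. spz b (f i))"
  if "\<And>i. i \<in> K \<Longrightarrow> f i \<in> specializable b"
  using that by (induction K rule: infinite_finite_induct) (simp_all add: spz_1 spz_mult)

lemma spz_powi:
  assumes "subT b F \<noteq> 0"
  shows "emb F powi k \<in> specializable b" "spz b (emb F powi k) = emb (subT b F) powi k"
proof -
  have nat: "emb F ^ i \<in> specializable b" "spz b (emb F ^ i) = emb (subT b F) ^ i" for i
    using spz_emb[where F = "F ^ i" and b = b] by (simp_all add: emb_simps subT_simps)
  have inv: "1 / emb F ^ i \<in> specializable b" "spz b (1 / emb F ^ i) = 1 / emb (subT b F) ^ i" for i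
  proof -
    have "spz b (emb F ^ i) \<noteq> 0" using assms by (simp add: nat emb_eq_0_iff)
    from spz_divide[OF spz_1(1) nat(1) this]
    show "1 / emb F ^ i \<in> specializable b" "spz b (1 / emb F ^ i) = 1 / emb (subT b F) ^ i"
      by (simp_all only: spz_1 nat)
  qed
  show "emb F powi k \<in> specializable b" "spz b (emb F powi k) = emb (subT b F) powi k"
    using nat[of "nat k"] inv[of "nat (- k)"]
    by (simp_all add: power_int_def power_inverse inverse_eq_divide power_one_over)
qed

text \<open>On functions regular at \<open>b\<close> the specialisation is the value at
  \<open>b\<close>, as a constant function. Its kernel is the maximal ideal of the local ring, which
  later identifies \<open>point_ideal\<close> with a kernel.\<close>

lemma lr_spz:
  assumes "f \<in> lr I b"
  shows "f \<in> specializable b" "\<exists>c. spz b f = const c" "spz b f = 0 \<longleftrightarrow> f \<in> nonunits (lr I b)"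
proof -
  obtain F G where FG: "F \<in> hpolys (PV I) 0" "G \<in> hpolys (PV I) 0" "ev b G \<noteq> 0" "f = emb F / emb G"
    by (rule lrE[OF assms])
  have s: "subT b F = Poly_Mapping.single 0 (ev b F)" "subT b G = Poly_Mapping.single 0 (ev b G)"
    using FG(1,2) by (simp_all add: subT_hpolys_0)
  have nz: "subT b G \<noteq> 0" using FG(3) by (simp add: s(2) single_eq_0_iff)
  have "G \<noteq> 0" using nz by (auto simp: subT_simps(4))
  show "f \<in> specializable b" unfolding FG(4) by (rule specializableI[OF nz])
  have e: "spz b f = const (ev b F) / const (ev b G)" unfolding FG(4) spz_eq[OF nz] s by (simp add: const_emb)
  have "const (ev b F) = const (ev b F / ev b G) * const (ev b G)"
    using FG(3) by (simp add: const_emb emb_simps(3)[symmetric] mult_single)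
  moreover have cG: "const (ev b G) \<noteq> 0" using nz by (simp add: const_emb s(2)[symmetric] emb_eq_0_iff)
  ultimately have e': "spz b f = const (ev b F / ev b G)" unfolding e by (simp add: divide_eq_eq)
  then show "\<exists>c. spz b f = const c" by blast
  have "spz b f = 0 \<longleftrightarrow> const (ev b F) = 0" unfolding e using cG by simp
  also have "\<dots> \<longleftrightarrow> ev b F = 0" by (simp add: const_emb emb_eq_0_iff single_eq_0_iff)
  also have "\<dots> \<longleftrightarrow> f \<in> nonunits (lr I b)"
  proof
    assume F: "ev b F = 0"
    have "inverse f \<notin> lr I b" if f: "f \<noteq> 0"
    proof
      assume "inverse f \<in> lr I b"
      then obtain F' G' where 1: "G' \<in> hpolys (PV I) 0" "ev b G' \<noteq> 0" "inverse f = emb F' / emb G'" by (rule lrE)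
      have F0: "F \<noteq> 0" using f by (auto simp: FG(4) emb_simps)
      have G'0: "G' \<noteq> 0" using 1(2) by (auto simp: poly_eval_simps)
      have "emb G / emb F = emb F' / emb G'" using 1(3) by (simp add: FG(4))
      then have "G * G' = F' * F" by (simp only: emb_divide_eq_iff[OF F0 G'0])
      then have "ev b G * ev b G' = ev b F' * ev b F" by (simp only: poly_eval_simps[symmetric])
      then show False using F FG(3) 1(2) by simp
    qed
    then show "f \<in> nonunits (lr I b)" using assms by (auto simp: nonunits_def)
  next
    assume n: "f \<in> nonunits (lr I b)"
    show "ev b F = 0"
    proof (rule ccontr)
      assume F: "ev b F \<noteq> 0"
      have "inverse f = emb G / emb F" by (simp add: FG(4))
      then have "inverse f \<in> lr I b" using lrI[OF FG(2,1) F] by simp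
      moreover have "F \<noteq> 0" using F by (auto simp: poly_eval_simps)
      then have "f \<noteq> 0" using \<open>G \<noteq> 0\<close> by (simp add: FG(4) emb_eq_0_iff)
      ultimately show False using n by (simp add: nonunits_def)
    qed
  qed
  finally show "spz b f = 0 \<longleftrightarrow> f \<in> nonunits (lr I b)" .
qed

definition spz_map :: "(p1 \<times> nat \<Rightarrow> complex) \<Rightarrow> (zvec \<Rightarrow>\<^sub>0 ratfun) \<Rightarrow> (zvec \<Rightarrow>\<^sub>0 ratfun)" where
  "spz_map b a = Poly_Mapping.map (spz b) a"

lemma lookup_spz_map: "lookup (spz_map b a) u = spz b (lookup a u)"
  by (simp add: spz_map_def Poly_Mapping.map.rep_eq when_def spz_0)

lemma spz_map_single: "spz_map b (Poly_Mapping.single u f) = Poly_Mapping.single u (spz b f)"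
  by (rule poly_mapping_eqI) (simp add: lookup_spz_map lookup_single when_def spz_0)

lemma spz_map_add:
  assumes "\<And>u. lookup a u \<in> specializable b" "\<And>u. lookup a' u \<in> specializable b"
  shows "spz_map b (a + a') = spz_map b a + spz_map b a'"
  by (rule poly_mapping_eqI) (simp add: lookup_spz_map lookup_add spz_add assms)

lemma spz_map_sum:
  assumes "\<And>i u. i \<in> K \<Longrightarrow> lookup (f i) u \<in> specializable b"
  shows "spz_map b (sum f K) = (\<Sum>i\<in>K. spz_map b (f i))"
proof (rule poly_mapping_eqI)
  fix u
  show "lookup (spz_map b (sum f K)) u = lookup (\<Sum>i\<in>K. spz_map b (f i)) u"
    using spz_sum[of K "\<lambda>i. lookup (f i) u" b] assms by (simp add: lookup_spz_map lookup_sum)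
qed

lemma spz_map_expand: "spz_map b a = (\<Sum>u\<in>keys a. Poly_Mapping.single u (spz b (lookup a u)))"
proof (rule poly_mapping_eqI)
  fix u
  have "lookup (\<Sum>u\<in>keys a. Poly_Mapping.single u (spz b (lookup a u))) u =
      (\<Sum>v\<in>keys a. if v = u then spz b (lookup a v) else 0)" by (simp add: lookup_sum lookup_single when_def)
  also have "\<dots> = spz b (lookup a u)" by (simp add: sum.delta in_keys_iff spz_0)
  finally show "lookup (spz_map b a) u = lookup (\<Sum>u\<in>keys a. Poly_Mapping.single u (spz b (lookup a u))) u"
    by (simp add: lookup_spz_map)
qed

lemma spz_map_mult:
  assumes a: "\<And>u. lookup a u \<in> specializable b" and a': "\<And>u. lookup a' u \<in> specializable b"
  shows "spz_map b (a * a') = spz_map b a * spz_map b a'"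
proof -
  have s: "lookup (Poly_Mapping.single (u + v) (lookup a u * lookup a' v)) w \<in> specializable b" for u v w
    by (simp add: lookup_single when_def spz_0 spz_mult a a')
  have s2: "lookup (\<Sum>v\<in>keys a'. Poly_Mapping.single (u + v) (lookup a u * lookup a' v)) w \<in> specializable b" for u w
    unfolding lookup_sum by (rule conjunct1[OF spz_sum]) (rule s)
  have "spz_map b (a * a') =
      (\<Sum>u\<in>keys a. \<Sum>v\<in>keys a'. Poly_Mapping.single (u + v) (spz b (lookup a u) * spz b (lookup a' v)))"
    unfolding poly_mapping_mult_sum[of a a'] spz_map_sum[OF s2] spz_map_sum[OF s]
    by (simp only: spz_map_single spz_mult[OF a a'])
  then show ?thesis unfolding spz_map_expand[of b a] spz_map_expand[of b a'] by (simp only: sum_product mult_single)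
qed

text \<open>The fibre has the same index set and polyhedra, hence the same exponents and degrees,
  and its linear forms are the specialised ones. So \<open>N\<close>, \<open>\<Lambda>\<close> and
  the basis elements of the two sides correspond term by term.\<close>

locale fibre_family = tot: divisor_family I B J \<alpha> \<beta> \<gamma> \<epsilon> Y x n \<delta> \<Delta> +
    lam: divisor_family "{}" "{\<lambda>_. 0}" J "\<lambda>j. subT b (\<alpha> j)" "\<lambda>j. subT b (\<beta> j)" "\<lambda>j. subT b (\<gamma> j)"
      "\<lambda>j. subT b (\<epsilon> j)" Y' x' n \<delta> \<Delta>
  for I B and J :: "'j set" and \<alpha> \<beta> \<gamma> \<epsilon> and Y :: "'p variety" and x and n \<delta> and \<Delta> :: "'j \<Rightarrow> qvec set"
    and b and Y' :: "'q variety" and x' +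
  assumes b_B: "b \<in> B"
begin

lemma subT_l: "j \<in> J \<Longrightarrow> subT b (tot.l j) = lam.l j"
  by (simp add: linear_form.l_def[OF tot.lin] linear_form.l_def[OF lam.lin] subT_simps subT_X)

lemma spz_N: "tot.N u \<in> specializable b" "spz b (tot.N u) = lam.N u"
proof -
  have J: "j \<in> J" if "j \<in> tot.J0" for j using that by (simp add: tot.J0_def)
  have nz: "subT b (tot.l j) \<noteq> 0" if "j \<in> tot.J0" for j using lam.L(3)[OF J[OF that]] subT_l[OF J[OF that]] by simp
  have *: "tot.N u \<in> specializable b \<and> spz b (tot.N u) = (\<Prod>j\<in>tot.J0. spz b (emb (tot.l j) powi tot.e u j))"
    unfolding tot.N_def by (rule spz_prod) (rule spz_powi[OF nz])
  also have "(\<Prod>j\<in>tot.J0. spz b (emb (tot.l j) powi tot.e u j)) = lam.N u"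
    unfolding lam.N_def by (rule prod.cong) (simp_all add: spz_powi[OF nz] subT_l[OF J])
  finally show "tot.N u \<in> specializable b" "spz b (tot.N u) = lam.N u" by simp_all
qed

lemma subT_\<Lambda>: "subT b (tot.\<Lambda>) = lam.\<Lambda>"
  unfolding tot.\<Lambda>_def lam.\<Lambda>_def subT_simps by (rule prod.cong) (simp_all add: tot.Ji_def subT_l)

lemma spz_Bas: "tot.Bas u k i \<in> specializable b" "spz b (tot.Bas u k i) = lam.Bas u k i"
proof -
  have d: "tot.N u * emb (tot.\<Lambda> ^ k) \<in> specializable b"
    "spz b (tot.N u * emb (tot.\<Lambda> ^ k)) = lam.N u * emb (lam.\<Lambda> ^ k)"
    by (simp_all add: spz_mult spz_N spz_emb subT_simps subT_\<Lambda>)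
  have nz: "spz b (tot.N u * emb (tot.\<Lambda> ^ k)) \<noteq> 0" unfolding d(2) by (rule lam.denom_nz)
  from spz_divide[OF spz_emb(1) d(1) nz]
  show "tot.Bas u k i \<in> specializable b" "spz b (tot.Bas u k i) = lam.Bas u k i"
    unfolding tot.Bas_def lam.Bas_def d(2) by (simp_all only: spz_emb subT_simps subT_X)
qed

lemma tot_R: "r \<in> tot.R \<Longrightarrow> r \<in> lr I b"
  using b_B by (simp add: tot.R_def)

lemma const_R: "const c \<in> tot.R" "const c \<in> lam.R"
  unfolding const_emb by (rule tot.emb_R[OF hpolys_const] lam.emb_R[OF hpolys_const])+

lemma spz_R:
  assumes "r \<in> tot.R"
  shows "r \<in> specializable b" "spz b r \<in> lam.R"
  using lr_spz(1,2)[OF tot_R[OF assms]] const_R(2) by auto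

text \<open>Without parameters specialisation is the identity, and its values on a local ring of the
  base are constants.\<close>

lemma lam_R: "r \<in> lam.R \<Longrightarrow> \<exists>c. r = const c"
proof -
  assume "r \<in> lam.R"
  then have "r \<in> lr {} (\<lambda>_. 0)" by (simp add: lam.R_def)
  then obtain F G where FG: "F \<in> hpolys (PV {}) 0" "G \<in> hpolys (PV {}) 0" "ev (\<lambda>_. 0) G \<noteq> 0" "r = emb F / emb G" by (rule lrE)
  from lr_spz(2)[OF \<open>r \<in> lr {} _\<close>] obtain c where c: "spz (\<lambda>_. 0) r = const c" by blast
  have "subT (\<lambda>_. 0) G = G" "subT (\<lambda>_. 0) F = F" using FG(1,2) subT_id by blast+
  moreover have "G \<noteq> 0" using FG(3) by (auto simp: poly_eval_simps)
  ultimately have "spz (\<lambda>_. 0) r = r" unfolding FG(4) by (simp add: spz_eq)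
  then show ?thesis using c by auto
qed

text \<open>Termwise in the basis: a coefficient specialises to a constant, and a basis element to
  the corresponding basis element of the fibre.\<close>

lemma spz_Sec:
  assumes u: "u \<in> weights n \<delta>" and f: "f \<in> tot.Sec u"
  shows "f \<in> specializable b" "spz b f \<in> lam.Sec u"
proof -
  from f obtain k where k: "f \<in> tot.Gr u k" using tot.Sec_Gr[OF u] by blast
  have c: "tot.cf u k f i \<in> tot.R" if "i \<in> tot.Ix u k" for i by (rule tot.cf_R[OF k that])
  have s: "tot.cf u k f i * tot.Bas u k i \<in> specializable b" if "i \<in> tot.Ix u k" for i
    by (intro spz_mult spz_R spz_Bas c that)
  have *: "f \<in> specializable b \<and> spz b f = (\<Sum>i\<in>tot.Ix u k. spz b (tot.cf u k f i * tot.Bas u k i))"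
    by (subst (1 2) tot.cf_expand[OF k]) (rule spz_sum[OF s])
  then show "f \<in> specializable b" by blast
  have "spz b (tot.cf u k f i * tot.Bas u k i) \<in> lam.Sec u" if "i \<in> tot.Ix u k" for i
    unfolding spz_mult(2)[OF spz_R(1)[OF c[OF that]] spz_Bas(1)] spz_Bas(2)
    by (rule lam.Sec_smult[OF u spz_R(2)[OF c[OF that]] lam.Bas_Sec[OF u that]])
  then have "(\<Sum>i\<in>tot.Ix u k. spz b (tot.cf u k f i * tot.Bas u k i)) \<in> lam.Sec u"
    by (rule lam.Sec_sum[OF u])
  then show "spz b f \<in> lam.Sec u" using * by simp
qed

lemma A_spz: "a \<in> tot.A \<Longrightarrow> lookup a u \<in> specializable b"
proof (cases "u \<in> keys a")
  case True
  assume a: "a \<in> tot.A"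
  show ?thesis by (rule spz_Sec(1)[OF tot.AD(1)[OF a True] tot.AD(2)[OF a tot.AD(1)[OF a True]]])
qed (simp add: in_keys_iff spz_0)

lemma spz_map_A: "a \<in> tot.A \<Longrightarrow> spz_map b a \<in> lam.A"
  unfolding spz_map_expand
  by (intro lam.A_sum lam.A_single tot.AD(1) spz_Sec(2) tot.AD(2)) assumption+

text \<open>The coefficients over the fibre are constants, which are regular on \<open>B\<close> as
  well; the same combination of the basis elements of the family is a lift.\<close>

lemma spz_Sec_surj:
  assumes u: "u \<in> weights n \<delta>" and g: "g \<in> lam.Sec u"
  shows "\<exists>f\<in>tot.Sec u. spz b f = g"
proof -
  from g obtain k where k: "g \<in> lam.Gr u k" using lam.Sec_Gr[OF u] by blast
  have "\<forall>i\<in>lam.Ix u k. \<exists>c. lam.cf u k g i = const c" using lam.cf_R[OF k] lam_R by blast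
  from bchoice[OF this] obtain c where c: "\<forall>i\<in>lam.Ix u k. lam.cf u k g i = const (c i)" by (elim exE) (rule that)
  let ?f = "\<Sum>i\<in>lam.Ix u k. const (c i) * tot.Bas u k i"
  have s: "const (c i) * tot.Bas u k i \<in> specializable b" for i by (intro spz_mult spz_const spz_Bas)
  have "spz b ?f = (\<Sum>i\<in>lam.Ix u k. spz b (const (c i) * tot.Bas u k i))" by (rule conjunct2[OF spz_sum]) (rule s)
  also have "\<dots> = (\<Sum>i\<in>lam.Ix u k. lam.cf u k g i * lam.Bas u k i)"
    by (rule sum.cong) (simp_all add: spz_mult spz_const spz_Bas c)
  also have "\<dots> = g" by (rule lam.cf_expand[OF k, symmetric])
  finally have "spz b ?f = g" .
  moreover have "?f \<in> tot.Sec u"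
    by (rule tot.Sec_sum[OF u]) (rule tot.Sec_smult[OF u const_R(1) tot.Bas_Sec[OF u]])
  ultimately show ?thesis by blast
qed

lemma spz_map_image: "spz_map b ` tot.A = lam.A"
proof (intro equalityI subsetI)
  fix g assume g: "g \<in> lam.A"
  have "\<forall>u\<in>keys g. \<exists>f. f \<in> tot.Sec u \<and> spz b f = lookup g u"
  proof
    fix u assume "u \<in> keys g"
    then have u: "u \<in> weights n \<delta>" by (rule lam.AD(1)[OF g])
    from spz_Sec_surj[OF u lam.AD(2)[OF g u]] show "\<exists>f. f \<in> tot.Sec u \<and> spz b f = lookup g u" by blast
  qed
  from bchoice[OF this] obtain f where f: "\<forall>u\<in>keys g. f u \<in> tot.Sec u \<and> spz b (f u) = lookup g u" by (elim exE) (rule that)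
  let ?a = "\<Sum>u\<in>keys g. Poly_Mapping.single u (f u)"
  have s: "Poly_Mapping.single u (f u) \<in> tot.A" if "u \<in> keys g" for u
    using f that by (intro tot.A_single lam.AD(1)[OF g]) auto
  have "spz_map b ?a = (\<Sum>u\<in>keys g. spz_map b (Poly_Mapping.single u (f u)))"
    by (rule spz_map_sum) (rule A_spz[OF s])
  also have "\<dots> = (\<Sum>u\<in>keys g. Poly_Mapping.single u (lookup g u))"
    by (rule sum.cong) (simp_all add: spz_map_single f)
  also have "\<dots> = g" by (rule poly_mapping_sum_single[symmetric])
  finally have "spz_map b ?a = g" .
  moreover have "?a \<in> tot.A" by (rule tot.A_sum[OF s])
  ultimately show "g \<in> spz_map b ` tot.A" by (rule image_eqI[OF sym])
qed (use spz_map_A in blast)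

lemma spz_map_hom: "spz_map b \<in> ring_hom (subring_of tot.A) (subring_of lam.A)"
proof (rule ring_hom_memI)
  show "spz_map b \<one>\<^bsub>subring_of tot.A\<^esub> = \<one>\<^bsub>subring_of lam.A\<^esub>"
    using spz_map_single[of b 0 1] by (simp add: spz_1)
qed (simp_all add: spz_map_A spz_map_mult spz_map_add A_spz)

text \<open>The specialised basis elements are still linearly independent, so all coefficients of a
  section that specialises to zero do so themselves. This takes the place of compatibility with base
  change.\<close>

lemma cf_kernel:
  assumes u: "u \<in> weights n \<delta>" and k: "f \<in> tot.Gr u k" and f: "spz b f = 0" and i: "i \<in> tot.Ix u k"
  shows "spz b (tot.cf u k f i) = 0"
proof -
  define d where "d = nat (tot.dg u + int (k * tot.m))"
  have Ix: "tot.Ix u k = {..d}" using i by (simp add: tot.Ix_def d_def split: if_splits)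
  have c: "tot.cf u k f i \<in> tot.R" if "i \<in> {..d}" for i by (rule tot.cf_R[OF k]) (use that in \<open>simp add: Ix\<close>)
  have s: "tot.cf u k f i * tot.Bas u k i \<in> specializable b" if "i \<in> {..d}" for i
    by (intro spz_mult spz_R spz_Bas c that)
  have "0 = spz b (\<Sum>i\<le>d. tot.cf u k f i * tot.Bas u k i)"
    using f tot.cf_expand[OF k] unfolding Ix by simp
  also have "\<dots> = (\<Sum>i\<le>d. spz b (tot.cf u k f i * tot.Bas u k i))" by (rule conjunct2[OF spz_sum]) (rule s)
  also have "\<dots> = (\<Sum>i\<le>d. spz b (tot.cf u k f i) * lam.Bas u k i)"
    by (rule sum.cong) (simp_all add: spz_mult spz_R spz_Bas c)
  \<comment> \<open>\<open>form\<close> does not depend on the base, so the sum can be read as a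
    form over the fibre.\<close>
  also have "\<dots> = tot.form d (\<lambda>i. spz b (tot.cf u k f i)) / (lam.N u * emb (lam.\<Lambda> ^ k))"
    by (simp add: tot.form_def lam.Bas_def d_def sum_divide_distrib)
  finally have z: "tot.form d (\<lambda>i. spz b (tot.cf u k f i)) = 0"
    using lam.denom_nz[of u k] by (metis divide_eq_0_iff)
  show ?thesis
  proof (rule lam.form_eq_0[of d "\<lambda>i. spz b (tot.cf u k f i)"])
    fix i assume "i \<le> d"
    then have "spz b (tot.cf u k f i) \<in> lam.R" by (intro spz_R c) simp
    then show "\<exists>b'. spz b (tot.cf u k f i) \<in> lr {} b'" by (auto simp: lam.R_def)
  qed (use z i Ix in auto)
qed

text \<open>By the expansion in the basis, an element of the kernel is a combination of elements of
  the algebra with coefficients that vanish at \<open>b\<close>.\<close>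

lemma kernel_spz_map:
  "a_kernel (subring_of tot.A) (subring_of lam.A) (spz_map b) =
     genideal (subring_of tot.A) (degree0 ` {r \<in> tot.R. spz b r = 0})" (is "?K = genideal ?A ?S")
proof -
  interpret A: cring ?A by (rule cring_subring_of[OF tot.subring_closed_A])
  interpret S: cring "subring_of lam.A" by (rule cring_subring_of[OF lam.subring_closed_A])
  have hr: "ring_hom_ring ?A (subring_of lam.A) (spz_map b)" by unfold_locales (rule spz_map_hom)
  have K: "a \<in> ?K \<longleftrightarrow> a \<in> tot.A \<and> spz_map b a = 0" for a by (simp add: a_kernel_def')
  have SA: "?S \<subseteq> carrier ?A" using tot.degree0_A by auto
  interpret G: ideal "genideal ?A ?S" ?A by (rule A.genideal_ideal[OF SA])
  show ?thesis
  proof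
    show "genideal ?A ?S \<subseteq> ?K"
    proof (rule A.genideal_minimal[OF ring_hom_ring.kernel_is_ideal[OF hr]], rule subsetI)
      fix a assume "a \<in> ?S"
      then obtain r where "r \<in> tot.R" "spz b r = 0" "a = degree0 r" by blast
      then show "a \<in> ?K" using tot.degree0_A[of r] by (simp add: K degree0_def spz_map_single)
    qed
    show "?K \<subseteq> genideal ?A ?S"
    proof
      fix a assume "a \<in> ?K"
      then have a: "a \<in> tot.A" "spz_map b a = 0" by (simp_all add: K)
      have "finite {a}" "{a} \<subseteq> tot.A" using a(1) by simp_all
      from tot.finite_W_part[OF this] obtain W k where W: "finite W" "W \<subseteq> weights n \<delta>" "{a} \<subseteq> tot.W_part W k" by blast
      then have aW: "a \<in> tot.W_part W k" by simp
      let ?t = "\<lambda>c. degree0 (tot.cf (fst c) k (lookup a (fst c)) (snd c)) *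
        Poly_Mapping.single (fst c) (tot.Bas (fst c) k (snd c))"
      have t: "?t c \<in> genideal ?A ?S" if c: "c \<in> Sigma W (\<lambda>u. tot.Ix u k)" for c
      proof -
        have cW: "fst c \<in> W" "snd c \<in> tot.Ix (fst c) k" using c by auto
        then have u: "fst c \<in> weights n \<delta>" using W(2) by blast
        have g: "lookup a (fst c) \<in> tot.Gr (fst c) k" using aW cW(1) by (simp add: tot.W_part_def)
        have "spz b (lookup a (fst c)) = 0" using a(2) lookup_spz_map[of b a "fst c"] by simp
        from cf_kernel[OF u g this cW(2)] tot.cf_R[OF g cW(2)]
        have "degree0 (tot.cf (fst c) k (lookup a (fst c)) (snd c)) \<in> ?S" by blast
        then have 1: "degree0 (tot.cf (fst c) k (lookup a (fst c)) (snd c)) \<in> genideal ?A ?S"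
          using A.genideal_self[OF SA] by blast
        have "Poly_Mapping.single (fst c) (tot.Bas (fst c) k (snd c)) \<in> carrier ?A"
          using tot.A_single[OF u tot.Bas_Sec[OF u cW(2)]] by simp
        from G.I_r_closed[OF 1 this] show ?thesis by simp
      qed
      have "sum ?t C \<in> genideal ?A ?S" if "finite C" "C \<subseteq> Sigma W (\<lambda>u. tot.Ix u k)" for C
        using that
      proof (induction C rule: finite_induct)
        case empty
        then show ?case using G.zero_closed by simp
      next
        case (insert c C)
        then have "?t c \<in> genideal ?A ?S" "sum ?t C \<in> genideal ?A ?S" using t by blast+
        from G.a_closed[OF this] show ?case using insert.hyps by simp
      qed
      from this[OF finite_SigmaI[OF W(1) tot.fin_Ix] order_refl]
      show "a \<in> genideal ?A ?S" using tot.W_part_expand[OF W(1) aW] by simp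
    qed
  qed
qed

theorem fibre_iso:
  "isomorphic_over_C
     (fibre (divisor_algebra n Y \<delta> tot.D) (\<lambda>c. degree0 (const c)) degree0 {r \<in> tot.R. spz b r = 0})
     (X_scheme n Y' \<delta> lam.D)"
  unfolding X_scheme_def tot.divisor_algebra_A lam.divisor_algebra_A
proof (rule isomorphic_fibre)
  show "cring (subring_of tot.A)" by (rule cring_subring_of[OF tot.subring_closed_A])
  show "cring (subring_of lam.A)" by (rule cring_subring_of[OF lam.subring_closed_A])
  show "spz_map b \<in> ring_hom (subring_of tot.A) (subring_of lam.A)" by (rule spz_map_hom)
  show "spz_map b ` carrier (subring_of tot.A) = carrier (subring_of lam.A)" by (simp add: spz_map_image)
  show "a_kernel (subring_of tot.A) (subring_of lam.A) (spz_map b) =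
     genideal (subring_of tot.A) (degree0 ` {r \<in> tot.R. spz b r = 0})" by (rule kernel_spz_map)
  show "degree0 (const c) \<in> carrier (subring_of tot.A)" for c by (simp add: tot.degree0_A const_R)
  show "spz_map b (degree0 (const c)) = degree0 (const c)" for c by (simp add: degree0_def spz_map_single spz_const)
qed

end

subsection \<open>Rational functions on the projective line with a single simple zero\<close>

abbreviation "C0 \<equiv> (Poly_Mapping.single 0 :: complex \<Rightarrow> Defs.poly)"

lemma PV_empty: "PV {} = {X0, X1}" by (simp add: PV_def)

lemma p1_coords_pc: "p1_coords p = (case p of Fin z \<Rightarrow> pc z 1 (\<lambda>_. 0) | Infty \<Rightarrow> pc 1 0 (\<lambda>_. 0))"
  by (rule ext) (simp add: pc_def split: p1.split coord.split)

lemma pts_P1: "pts P1 = UNIV" by (simp add: P1_def zariski_def)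

lemma zariski_lring:
  "{Fract F G | F G d. F \<in> hpolys V d \<and> G \<in> hpolys V d \<and> poly_eval x G \<noteq> 0} = reg V 0 x"
  unfolding reg_def Fract_emb by auto

lemma p1_coords_onto:
  assumes "z \<noteq> 0 \<or> w \<noteq> 0"
  shows "\<exists>p k. k \<noteq> 0 \<and> p1_coords p = pc (k * z) (k * w) (\<lambda>_. 0)"
proof (cases "w = 0")
  case True
  then show ?thesis using assms by (intro exI[of _ Infty] exI[of _ "1 / z"]) (simp add: p1_coords_pc)
next
  case False
  then show ?thesis by (intro exI[of _ "Fin (z / w)"] exI[of _ "1 / w"]) (simp add: p1_coords_pc)
qed

lemma p1_coords_ex: "\<exists>z w. (z \<noteq> 0 \<or> w \<noteq> 0) \<and> p1_coords p = pc z w (\<lambda>_. 0)"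
proof (cases p)
  case (Fin z)
  then show ?thesis by (intro exI[of _ z] exI[of _ 1]) (simp add: p1_coords_pc)
next
  case Infty
  then show ?thesis by (intro exI[of _ 1] exI[of _ 0]) (simp add: p1_coords_pc)
qed

lemma P1_family:
  assumes "finite J" "\<And>j. j \<in> J \<Longrightarrow> linear_form {} (\<alpha> j) (\<beta> j) (\<gamma> j) (\<epsilon> j)"
  shows "variety_family {} {\<lambda>_. 0} J \<alpha> \<beta> \<gamma> \<epsilon> P1 p1_coords"
proof (intro variety_family.intro linear_forms.intro base.intro linear_forms_axioms.intro variety_family_axioms.intro)
  show "dense {} {\<lambda>_. 0}" by (rule dense_singleton)
  show "finite J" by (rule assms(1))
  show "linear_form {} (\<alpha> j) (\<beta> j) (\<gamma> j) (\<epsilon> j)" if "j \<in> J" for j by (rule assms(2)[OF that])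
  show "closed_sets P1 = {{p \<in> pts P1. \<forall>F\<in>S. poly_eval (p1_coords p) F = 0} | S. S \<subseteq> (\<Union>d. hpolys (PV {}) d)}"
    by (simp add: P1_def zariski_def PV_empty)
  show "funs P1 = {Fract F G | F G d. F \<in> hpolys (PV {}) d \<and> G \<in> hpolys (PV {}) d \<and> G \<noteq> 0}"
    by (simp add: P1_def zariski_def PV_empty)
  show "lring P1 p = reg (PV {}) 0 (p1_coords p)" for p
    unfolding zariski_lring[symmetric] by (simp add: P1_def zariski_def PV_empty)
  show "\<exists>b\<in>{\<lambda>_. 0}. \<exists>z w. (z \<noteq> 0 \<or> w \<noteq> 0) \<and> p1_coords p = pc z w b" for p
    using p1_coords_ex[of p] by simp
  show "\<exists>p\<in>pts P1. \<exists>k. k \<noteq> 0 \<and> p1_coords p = pc (k * z) (k * w) b"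
    if "b \<in> {\<lambda>_. 0}" "z \<noteq> 0 \<or> w \<noteq> 0" for b z w
    using p1_coords_onto[OF that(2)] that(1) by (simp add: P1_def zariski_def)
qed simp

text \<open>The linear form of the point \<open>Q\<close> is \<open>X0 - z X1\<close>, or
  \<open>X1\<close> at infinity, with a complement of determinant \<open>1\<close>.\<close>

fun pt\<alpha> pt\<beta> pt\<gamma> pt\<epsilon> :: "p1 \<Rightarrow> Defs.poly" where
  "pt\<alpha> (Fin z) = 1" | "pt\<alpha> Infty = 0"
| "pt\<beta> (Fin z) = - C0 z" | "pt\<beta> Infty = 1"
| "pt\<gamma> (Fin z) = 0" | "pt\<gamma> Infty = - 1"
| "pt\<epsilon> (Fin z) = 1" | "pt\<epsilon> Infty = 0"

lemma hpolys_minus_const: "- C0 z \<in> hpolys V 0"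
  unfolding single_uminus[symmetric] by (rule hpolys_const)

lemma pt_linear_form: "linear_form {} (pt\<alpha> Q) (pt\<beta> Q) (pt\<gamma> Q) (pt\<epsilon> Q)"
  using hpolys_minus_const[of 1 "PV {}"] hpolys_const[of 0 "PV {}"]
  by (cases Q) (unfold_locales; simp add: hpolys_minus_const)+

lemma pt_vanish: "poly_eval (p1_coords p) (linear_form.l (pt\<alpha> Q) (pt\<beta> Q)) = 0 \<longleftrightarrow> p = Q"
proof -
  interpret L: linear_form "{}" "pt\<alpha> Q" "pt\<beta> Q" "pt\<gamma> Q" "pt\<epsilon> Q" by (rule pt_linear_form)
  show ?thesis
    by (cases p; simp add: p1_coords_pc L.poly_eval_l; cases Q; simp add: poly_eval_simps poly_eval_const)
qed

lemma homogeneous_degree_unique: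
  assumes "F \<in> hpolys V d" "F \<in> hpolys V' d'" "F \<noteq> 0"
  shows "d = d'"
proof -
  have "keys F \<noteq> {}" using assms(3) by simp
  then obtain k where "k \<in> keys F" by blast
  then show ?thesis using assms(1,2) by (auto simp: hpolys_def)
qed

text \<open>The value at infinity shows that the dehomogenised form has full degree
  \<open>d\<close>, so for \<open>d > 0\<close> it would have a root.\<close>

lemma zero_free_form:
  assumes F: "F \<in> hpolys (PV {}) d" and nz: "\<And>p. poly_eval (p1_coords p) F \<noteq> 0"
  shows "d = 0"
proof (rule ccontr)
  assume d: "d \<noteq> 0"
  define p where "p = uni (\<lambda>_. 0) F"
  have "coeff p d \<noteq> 0" using nz[of Infty] degree_uni(2)[OF F] by (simp add: p_def p1_coords_pc)
  then have "Polynomial.degree p \<ge> d" by (rule le_degree)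
  then have "\<not> constant (poly p)" using d by (simp add: constant_degree)
  then obtain z where "poly p z = 0" using fundamental_theorem_of_algebra by blast
  then show False using nz[of "Fin z"] by (simp add: p_def poly_uni p1_coords_pc)
qed

lemma form_0_const:
  assumes "F \<in> hpolys (PV {}) 0"
  obtains c where "F = C0 c"
  using subT_hpolys_0[OF assms, of "\<lambda>_. 0"] subT_id[OF assms, of "\<lambda>_. 0"] that by simp

lemma form_1_expand:
  assumes "F \<in> hpolys (PV {}) 1"
  obtains a b where "F = C0 a * PX + C0 b * PY"
proof -
  obtain G where G: "\<And>i. G i \<in> hpolys (PV {}) 0" "F = (\<Sum>i\<le>1. G i * PX ^ i * PY ^ (1 - i))"
    by (rule hpolys_expand[OF assms]) blast
  obtain a where a: "G 1 = C0 a" by (rule form_0_const[OF G(1)])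
  obtain b where b: "G 0 = C0 b" by (rule form_0_const[OF G(1)])
  have "F = C0 a * PX + C0 b * PY" unfolding G(2) using a b by (simp add: add.commute)
  then show thesis by (rule that)
qed

text \<open>Splitting off all factors equal to the linear form of \<open>Q\<close> leaves a unit of
  the local ring at \<open>Q\<close>; the number of factors is the order.\<close>

lemma zero_divisor_P1:
  assumes F: "F \<in> hpolys (PV {}) d" "F \<noteq> 0" and G: "G \<in> hpolys (PV {}) d"
    and Q: "poly_eval (p1_coords Q) G \<noteq> 0"
  obtains k F' where "F = linear_form.l (pt\<alpha> Q) (pt\<beta> Q) ^ k * F'" "F' \<in> hpolys (PV {}) (d - k)" "k \<le> d"
    "poly_eval (p1_coords Q) F' \<noteq> 0" "zero_divisor P1 (emb F / emb G) {Q} = k"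
proof -
  interpret V: variety_family "{}" "{\<lambda>_. 0}" "{Q}" pt\<alpha> pt\<beta> pt\<gamma> pt\<epsilon> P1 p1_coords
    by (rule P1_family) (simp_all add: pt_linear_form)
  have QQ: "Q \<in> {Q}" by simp
  have Z: "V.Z Q = {Q}" by (simp add: V.Z_def pt_vanish pts_P1)
  obtain k F' d' where s: "F = V.l Q ^ k * F'" "F' \<in> hpolys (PV {}) d'" "V.rs Q F' \<noteq> 0"
    using V.strip[OF QQ F] by blast
  have lk: "V.l Q ^ k \<in> hpolys (PV {}) k" using hpolys_power[OF V.L(1)[OF QQ], of k] by simp
  have "F \<in> hpolys (PV {}) (k + d')" unfolding s(1) by (rule hpolys_mult[OF lk s(2)])
  from homogeneous_degree_unique[OF F(1) this F(2)] have d: "d = k + d'" .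
  have F': "poly_eval (p1_coords Q) F' \<noteq> 0" using V.vanish_iff[OF QQ s(2)] s(3) unfolding Z by simp
  have c: "poly_eval (p1_coords Q) (V.c Q) \<noteq> 0"
  proof -
    interpret L: linear_form "{}" "pt\<alpha> Q" "pt\<beta> Q" "pt\<gamma> Q" "pt\<epsilon> Q" by (rule pt_linear_form)
    have "poly_eval (pc z w b) L.c = (case Q of Fin _ \<Rightarrow> w | Infty \<Rightarrow> - z)" for z w b
      unfolding L.poly_eval_c by (cases Q) (simp_all add: poly_eval_simps)
    then show ?thesis unfolding p1_coords_pc by (cases Q) (simp_all split: p1.split)
  qed
  have ck: "V.c Q ^ k \<in> hpolys (PV {}) k" using hpolys_power[OF V.L(2)[OF QQ], of k] by simp
  have cF: "V.c Q ^ k * F' \<in> hpolys (PV {}) d" unfolding d by (rule hpolys_mult[OF ck s(2)])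
  let ?u = "emb (V.c Q ^ k * F') / emb G"
  have Qz: "Q \<in> V.Z Q" by (simp add: Z)
  note Wi = V.Z_irreducible[OF QQ]
  have u1: "?u \<in> lring_along P1 (V.Z Q)" by (rule V.LW_I[OF Wi cF G Qz Q])
  have u2: "?u \<notin> nonunits (lring_along P1 (V.Z Q))"
    unfolding V.LW_nonunits_iff[OF Wi cF G Qz Q] using Qz c F' by (auto simp: poly_eval_simps)
  have tu: "V.t Q ^ k * ?u = emb F / emb G"
    using V.L(4)[OF QQ] by (simp add: V.t_def s(1) emb_simps power_divide)
  from V.ord_Z[OF QQ u1 u2, of k] have "ord_along P1 {Q} (emb F / emb G) = int k" unfolding Z tu .
  then have "zero_divisor P1 (emb F / emb G) {Q} = k" by (simp add: zero_divisor_def)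
  then show thesis using s(1,2) F' by (intro that[of k F']) (simp_all add: d)
qed

text \<open>In lowest terms the numerator and the denominator have no common zero, so the zeros of
  the numerator are those of \<open>f\<close>, which is one simple zero. The numerator is then
  linear, hence so is the denominator, and \<open>f\<close> is a fractional linear
  transformation.\<close>

lemma sole_simple_zero_fraction:
  assumes f: "sole_simple_zero f P"
  obtains a b c d where "a * d - b * c = 1" "f = emb (C0 a * PX + C0 b * PY) / emb (C0 c * PX + C0 d * PY)"
    "poly_eval (p1_coords P) (C0 a * PX + C0 b * PY) = 0"
proof -
  have f1: "f \<in> funs P1" "f \<noteq> 0" "zero_divisor P1 f {P} = 1" "\<And>Q. Q \<noteq> P \<Longrightarrow> zero_divisor P1 f {Q} = 0"
    using f by (auto simp: sole_simple_zero_def)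
  \<comment> \<open>Lowest terms are reached by taking the smallest degree of a
    representation.\<close>
  define S where "S d \<longleftrightarrow> (\<exists>F G. f = emb F / emb G \<and> F \<in> hpolys (PV {}) d \<and> G \<in> hpolys (PV {}) d \<and> G \<noteq> 0)" for d
  have "\<exists>d. S d" using f1(1) unfolding S_def by (auto simp: P1_def zariski_def PV_empty Fract_emb)
  then have "S (LEAST d. S d)" by (rule LeastI_ex)
  then obtain n0 where n0: "S n0" "\<And>d. S d \<Longrightarrow> n0 \<le> d" using Least_le[of S] by blast
  from n0(1) obtain F G where FG: "f = emb F / emb G" "F \<in> hpolys (PV {}) n0" "G \<in> hpolys (PV {}) n0" "G \<noteq> 0"
    unfolding S_def by blast
  have F0: "F \<noteq> 0" using f1(2) by (auto simp: FG(1) emb_simps)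
  have coprime: "poly_eval (p1_coords Q) G \<noteq> 0" if Q: "poly_eval (p1_coords Q) F = 0" for Q
  proof
    assume Q': "poly_eval (p1_coords Q) G = 0"
    interpret V: variety_family "{}" "{\<lambda>_. 0}" "{Q}" pt\<alpha> pt\<beta> pt\<gamma> pt\<epsilon> P1 p1_coords
      by (rule P1_family) (simp_all add: pt_linear_form)
    have QQ: "Q \<in> {Q}" by simp
    have Z: "V.Z Q = {Q}" by (simp add: V.Z_def pt_vanish pts_P1)
    have r: "V.rs Q F = 0" "V.rs Q G = 0"
      using V.vanish_iff[OF QQ FG(2)] V.vanish_iff[OF QQ FG(3)] Q Q' by (simp_all add: Z)
    obtain F1 where F1: "F = V.l Q * F1" "F1 \<in> hpolys (PV {}) (n0 - 1)" "n0 = 0 \<Longrightarrow> F = 0"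
      by (rule V.Z_dvd[OF QQ FG(2) r(1)]) blast
    obtain G1 where G1: "G = V.l Q * G1" "G1 \<in> hpolys (PV {}) (n0 - 1)" "n0 = 0 \<Longrightarrow> G = 0"
      by (rule V.Z_dvd[OF QQ FG(3) r(2)]) blast
    have "f = emb F1 / emb G1" using V.L(3)[OF QQ] by (simp add: FG(1) F1(1) G1(1) emb_simps)
    moreover have "G1 \<noteq> 0" using FG(4) G1(1) by auto
    ultimately have "S (n0 - 1)" unfolding S_def using F1(2) G1(2) by blast
    then show False using n0(2)[of "n0 - 1"] F1(3) F0 by (cases n0) auto
  qed
  have "n0 \<noteq> 0"
  proof
    assume z: "n0 = 0"
    have "G \<in> hpolys (PV {}) 0" using FG(3) z by simp
    then obtain c where c: "G = C0 c" by (rule form_0_const)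
    have "poly_eval (p1_coords P) G \<noteq> 0" using FG(4) by (auto simp: c poly_eval_const single_eq_0_iff)
    then obtain k F' where "k \<le> n0" "zero_divisor P1 (emb F / emb G) {P} = k"
      by (rule zero_divisor_P1[OF FG(2) F0 FG(3)]) blast
    then show False using f1(3) z by (simp add: FG(1)[symmetric])
  qed
  then obtain Q where Q: "poly_eval (p1_coords Q) F = 0" using zero_free_form[OF FG(2)] by blast
  obtain k F' where k: "F = linear_form.l (pt\<alpha> Q) (pt\<beta> Q) ^ k * F'" "F' \<in> hpolys (PV {}) (n0 - k)" "k \<le> n0"
    "poly_eval (p1_coords Q) F' \<noteq> 0" "zero_divisor P1 (emb F / emb G) {Q} = k"
    by (rule zero_divisor_P1[OF FG(2) F0 FG(3) coprime[OF Q]])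
  have only_P: "Q' = P" if Q': "poly_eval (p1_coords Q') F = 0" for Q'
  proof -
    obtain k F' where k: "F = linear_form.l (pt\<alpha> Q') (pt\<beta> Q') ^ k * F'"
      "poly_eval (p1_coords Q') F' \<noteq> 0" "zero_divisor P1 (emb F / emb G) {Q'} = k"
      by (rule zero_divisor_P1[OF FG(2) F0 FG(3) coprime[OF Q']]) blast
    have "k \<noteq> 0" using k(1,2) Q' by (cases k) auto
    then show "Q' = P" using f1(4)[of Q'] k(3) by (cases "Q' = P") (auto simp: FG(1)[symmetric])
  qed
  have QP: "Q = P" by (rule only_P[OF Q])
  then have k1: "k = 1" using k(5) f1(3) by (simp add: FG(1)[symmetric])
  have "n0 - k = 0"
  proof (rule zero_free_form[OF k(2)])
    fix p
    show "poly_eval (p1_coords p) F' \<noteq> 0"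
    proof
      assume "poly_eval (p1_coords p) F' = 0"
      then have "poly_eval (p1_coords p) F = 0" by (simp add: k(1) poly_eval_simps)
      then have "p = Q" using only_P QP by simp
      then show False using k(4) \<open>poly_eval (p1_coords p) F' = 0\<close> by simp
    qed
  qed
  then have n1: "n0 = 1" using k1 k(3) by simp
  obtain a b where ab: "F = C0 a * PX + C0 b * PY" using form_1_expand FG(2) n1 by blast
  obtain c d where cd: "G = C0 c * PX + C0 d * PY" using form_1_expand FG(3) n1 by blast
  have evF: "poly_eval (pc z w v) F = a * z + b * w" for z w v
    by (simp add: ab poly_eval_simps poly_eval_var poly_eval_const)
  have evG: "poly_eval (pc z w v) G = c * z + d * w" for z w v
    by (simp add: cd poly_eval_simps poly_eval_var poly_eval_const)
  \<comment> \<open>At the zero \<open>[- b : a]\<close> of the numerator the denominator has the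
    value \<open>a * d - b * c\<close>, up to a scalar.\<close>
  have det: "a * d - b * c \<noteq> 0"
  proof
    assume det: "a * d - b * c = 0"
    have "a \<noteq> 0 \<or> b \<noteq> 0" using F0 by (auto simp: ab)
    then have "- b \<noteq> 0 \<or> a \<noteq> 0" by auto
    from p1_coords_onto[OF this] obtain p k where p: "p1_coords p = pc (k * - b) (k * a) (\<lambda>_. 0)" by blast
    have "poly_eval (p1_coords p) F = 0" by (simp add: p evF)
    moreover have "poly_eval (p1_coords p) G = k * (a * d - b * c)" by (simp add: p evG algebra_simps)
    ultimately show False using coprime[of p] det by simp
  qed
  \<comment> \<open>Dividing all four coefficients by a square root of the determinant makes it
    \<open>1\<close> and does not change the fraction.\<close>
  define s where "s = csqrt (a * d - b * c)"
  have s: "s * s = a * d - b * c" by (simp add: s_def power2_eq_square[symmetric])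
  have s0: "s \<noteq> 0" using s det by auto
  have sF: "C0 (a / s) * PX + C0 (b / s) * PY = C0 (1 / s) * F"
    by (simp add: ab distrib_left mult.assoc[symmetric] mult_single)
  have sG: "C0 (c / s) * PX + C0 (d / s) * PY = C0 (1 / s) * G"
    by (simp add: cd distrib_left mult.assoc[symmetric] mult_single)
  have "a / s * (d / s) - b / s * (c / s) = (a * d - b * c) / (s * s)" by (simp add: diff_divide_distrib)
  then have 1: "a / s * (d / s) - b / s * (c / s) = 1" unfolding s using det by simp
  show thesis
  proof (rule that[OF 1])
    show "f = emb (C0 (a / s) * PX + C0 (b / s) * PY) / emb (C0 (c / s) * PX + C0 (d / s) * PY)"
      unfolding sF sG using s0 by (simp add: FG(1) emb_simps single_eq_0_iff)
    show "poly_eval (p1_coords P) (C0 (a / s) * PX + C0 (b / s) * PY) = 0"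
      unfolding sF using Q QP by (simp add: poly_eval_simps)
  qed
qed

text \<open>A nonzero form that vanishes on \<open>W\<close> is split into a power of the linear
  form of a point \<open>Q\<close> of \<open>W\<close> and a form that does not vanish at
  \<open>Q\<close>; irreducibility leaves \<open>Q\<close> alone.\<close>

lemma prime_divisor_P1:
  assumes "W \<in> prime_divisors P1"
  obtains Q where "W = {Q}"
proof -
  have W: "irreducible_closed P1 W" "W \<noteq> UNIV" using assms by (auto simp: prime_divisors_def P1_def zariski_def)
  then obtain Q where Q: "Q \<in> W" by (auto simp: irreducible_closed_def)
  interpret V: variety_family "{}" "{\<lambda>_. 0}" "{Q}" pt\<alpha> pt\<beta> pt\<gamma> pt\<epsilon> P1 p1_coords
    by (rule P1_family) (simp_all add: pt_linear_form)
  have QQ: "Q \<in> {Q}" by simp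
  have Z: "V.Z Q = {Q}" by (simp add: V.Z_def pt_vanish pts_P1)
  note pts = pts_P1
  have "W \<in> closed_sets P1" using W(1) by (simp add: irreducible_closed_def)
  then obtain S where S: "W = {p \<in> pts P1. \<forall>F\<in>S. poly_eval (p1_coords p) F = 0}" "S \<subseteq> (\<Union>d. hpolys (PV {}) d)"
    unfolding V.Y_closed by blast
  obtain F where F: "F \<in> S" "F \<noteq> 0"
  proof -
    have "\<exists>p. p \<notin> W" using W(2) by blast
    then obtain p F where "F \<in> S" "poly_eval (p1_coords p) F \<noteq> 0" unfolding S(1) pts by blast
    then show thesis using that[of F] poly_eval_nz by blast
  qed
  obtain d where Fd: "F \<in> hpolys (PV {}) d" using F(1) S(2) by blast
  obtain k F' d' where s: "F = V.l Q ^ k * F'" "F' \<in> hpolys (PV {}) d'" "V.rs Q F' \<noteq> 0"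
    using V.strip[OF QQ Fd F(2)] by blast
  have F': "poly_eval (p1_coords Q) F' \<noteq> 0" using V.vanish_iff[OF QQ s(2)] s(3) unfolding Z by simp
  let ?C = "{p \<in> pts P1. poly_eval (p1_coords p) F' = 0}"
  have "W \<subseteq> {Q} \<union> ?C"
  proof
    fix p assume "p \<in> W"
    then have "poly_eval (p1_coords p) F = 0" using S(1) F(1) by blast
    then have "poly_eval (p1_coords p) (V.l Q) = 0 \<or> poly_eval (p1_coords p) F' = 0"
      unfolding s(1) by (simp add: poly_eval_simps) blast
    then show "p \<in> {Q} \<union> ?C" by (auto simp: pt_vanish pts)
  qed
  moreover have "{Q} \<in> closed_sets P1" using V.Z_irreducible[OF QQ] by (simp add: Z irreducible_closed_def)
  moreover have "?C \<in> closed_sets P1" by (rule V.closedI[OF s(2)])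
  ultimately have "W \<subseteq> {Q} \<or> W \<subseteq> ?C" using W(1) unfolding irreducible_closed_def by blast
  then have "W = {Q}" using Q F' by auto
  then show thesis by (rule that)
qed

lemma point_prime_P1: "{Q} \<in> prime_divisors P1"
proof -
  interpret V: variety_family "{}" "{\<lambda>_. 0}" "{Q}" pt\<alpha> pt\<beta> pt\<gamma> pt\<epsilon> P1 p1_coords
    by (rule P1_family) (simp_all add: pt_linear_form)
  have "V.Z Q = {Q}" by (simp add: V.Z_def pt_vanish pts_P1)
  then show ?thesis using V.Z_prime[of Q] by simp
qed

subsection \<open>The family over the parameter space\<close>

lemma subT_linear_form:
  assumes "linear_form I \<alpha> \<beta> \<gamma> \<epsilon>"
  shows "linear_form {} (subT b \<alpha>) (subT b \<beta>) (subT b \<gamma>) (subT b \<epsilon>)"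
proof
  interpret linear_form I \<alpha> \<beta> \<gamma> \<epsilon> by fact
  show "subT b \<alpha> \<in> hpolys (PV {}) 0" "subT b \<beta> \<in> hpolys (PV {}) 0"
    "subT b \<gamma> \<in> hpolys (PV {}) 0" "subT b \<epsilon> \<in> hpolys (PV {}) 0"
    by (rule subT_hpolys[OF coeffs(1)] subT_hpolys[OF coeffs(2)] subT_hpolys[OF coeffs(3)] subT_hpolys[OF coeffs(4)])+
  show "subT b \<alpha> * subT b \<epsilon> - subT b \<beta> * subT b \<gamma> = 1"
    by (simp only: subT_simps(3)[symmetric] subT_simps(6)[symmetric] det subT_simps(1))
qed

definition TV :: "(p1 \<times> nat) set \<Rightarrow> coord set" where
  "TV I = {T P i | P i. (P, i) \<in> I}"

lemma PV_TV: "PV I = {X0, X1} \<union> TV I" by (simp add: PV_def TV_def)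

text \<open>In the absence of \<open>X0\<close> and \<open>X1\<close> every monomial has degree
  \<open>0\<close>; the quotients of forms in \<open>zariski\<close> thus become quotients of
  polynomials in the parameters.\<close>

lemma hpolys_TV_degree:
  assumes "F \<in> hpolys (TV I) d" "F \<noteq> 0"
  shows "d = 0"
proof -
  have "keys F \<noteq> {}" using assms(2) by simp
  then obtain m where m: "m \<in> keys F" by blast
  then have k: "keys m \<subseteq> TV I" "lookup m X0 + lookup m X1 = d" using assms(1) by (auto simp: hpolys_def)
  have "X0 \<notin> keys m" "X1 \<notin> keys m" using k(1) by (auto simp: TV_def)
  then show ?thesis using k(2) by (simp add: in_keys_iff)
qed

lemma hpolys_TV_0: "hpolys (TV I) 0 = hpolys (PV I) 0"
proof (intro equalityI subsetI)
  fix F assume F: "F \<in> hpolys (PV I) 0"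
  have "v \<in> TV I" if "m \<in> keys F" "v \<in> keys m" for m v
    using hpolys_0_no_X[OF F that] by (auto simp: PV_def TV_def)
  then show "F \<in> hpolys (TV I) 0" using F by (auto simp: hpolys_def)
qed (auto simp: PV_TV intro: hpolys_mono)

lemma reg_TV: "reg (TV I) 0 (aff_coords b) = lr I b"
proof (intro equalityI subsetI)
  fix f assume "f \<in> reg (TV I) 0 (aff_coords b)"
  then obtain F G d e where f: "F \<in> hpolys (TV I) d" "G \<in> hpolys (TV I) e" "int d = int e + 0" "ev b G \<noteq> 0" "f = emb F / emb G"
    by (rule regE)
  have "e = 0" by (rule hpolys_TV_degree[OF f(2) poly_eval_nz[OF f(4)]])
  then have "F \<in> hpolys (PV I) 0" "G \<in> hpolys (PV I) 0" using f(1,2,3) by (simp_all add: hpolys_TV_0)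
  then show "f \<in> lr I b" unfolding f(5) using f(4) by (rule lrI)
next
  fix f assume "f \<in> lr I b"
  then obtain F G where f: "F \<in> hpolys (PV I) 0" "G \<in> hpolys (PV I) 0" "ev b G \<noteq> 0" "f = emb F / emb G" by (rule lrE)
  then show "f \<in> reg (TV I) 0 (aff_coords b)" unfolding f(4) hpolys_TV_0[symmetric] by (intro regI[where a = 0 and b = 0]) simp_all
qed

lemma base_variety_simps:
  "pts (base_variety Ps r B) = B"
  "funs (base_variety Ps r B) = {Fract F G | F G d. F \<in> hpolys (TV (param_index Ps r)) d \<and> G \<in> hpolys (TV (param_index Ps r)) d \<and> G \<noteq> 0}"
  "lring (base_variety Ps r B) b = lr (param_index Ps r) b"
  unfolding reg_TV[symmetric] zariski_lring[symmetric]
  by (simp_all add: base_variety_def open_subvariety_def Aff_def zariski_def TV_def)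

text \<open>A point of \<open>B\<close> makes membership in the function field automatic; over the
  empty set the intersection would be everything.\<close>

lemma regular_functions_base:
  assumes "B \<noteq> {}"
  shows "regular_functions (base_variety Ps r B) = (\<Inter>b\<in>B. lr (param_index Ps r) b)"
proof -
  have "f \<in> funs (base_variety Ps r B)" if f: "f \<in> lr (param_index Ps r) b" for f b
  proof -
    obtain F G where f: "F \<in> hpolys (PV (param_index Ps r)) 0" "G \<in> hpolys (PV (param_index Ps r)) 0"
      "ev b G \<noteq> 0" "f = emb F / emb G" by (rule lrE[OF f])
    have "G \<noteq> 0" by (rule poly_eval_nz[OF f(3)])
    then show ?thesis unfolding base_variety_simps(2) Fract_emb f(4) using f(1,2) hpolys_TV_0 by blast
  qed
  then show ?thesis unfolding regular_functions_def base_variety_simps using assms by blast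
qed

lemma tot_coords:
  assumes "p1_coords q = pc z w (\<lambda>_. 0)"
  shows "(\<lambda>v. p1_coords q v + aff_coords a v) = pc z w a"
  unfolding assms by (rule ext) (simp add: pc_def aff_coords_def split: coord.split)

lemma restricted_family_of_sets:
  assumes "\<And>S. f S \<inter> U = g S"
  shows "{C \<inter> U | C. C \<in> {f S | S. P S}} = {g S | S. P S}"
  unfolding assms[symmetric] by blast

lemma Ytot_family:
  assumes J: "finite J" "\<And>j. j \<in> J \<Longrightarrow> linear_form (param_index Ps r) (\<alpha> j) (\<beta> j) (\<gamma> j) (\<epsilon> j)"
    and B: "is_open (Aff (param_index Ps r)) B" "(\<lambda>_. 0) \<in> B"
  shows "variety_family (param_index Ps r) B J \<alpha> \<beta> \<gamma> \<epsilon> (Ytot Ps r B) (\<lambda>(q, a) v. p1_coords q v + aff_coords a v)"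
    and "B \<subseteq> aff_points (param_index Ps r)"
proof -
  let ?I = "param_index Ps r"
  let ?x = "\<lambda>(q, a) v. p1_coords q v + aff_coords a v"
  have TV: "Aff ?I = zariski (TV ?I) (aff_points ?I) aff_coords" by (simp add: Aff_def TV_def)
  from B(1) obtain S where S: "S \<subseteq> (\<Union>d. hpolys (TV ?I) d)"
      "B = aff_points ?I - {p \<in> aff_points ?I. \<forall>F\<in>S. ev p F = 0}"
    unfolding is_open_def TV by (auto simp: zariski_def)
  show Baff: "B \<subseteq> aff_points ?I" using S(2) by blast
  \<comment> \<open>The origin lies in \<open>B\<close>, so some defining polynomial is nonzero
    there. The points where it does not vanish form a nonempty open subset of \<open>B\<close>,
    which gives density.\<close>
  from B(2) S(2) obtain F where F: "F \<in> S" "ev (\<lambda>_. 0) F \<noteq> 0" by blast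
  from F(1) S(1) obtain d where Fd: "F \<in> hpolys (TV ?I) d" by blast
  have "d = 0" by (rule hpolys_TV_degree[OF Fd poly_eval_nz[OF F(2)]])
  then have F0: "F \<in> hpolys (PV ?I) 0" using Fd by (simp add: hpolys_TV_0)
  have dense: "dense ?I B"
  proof (rule dense_open[OF F0 B(2) F(2)])
    fix b assume "b \<in> aff_points ?I" "ev b F \<noteq> 0"
    then show "b \<in> B" unfolding S(2) using F(1) by blast
  qed
  have x: "\<exists>z w. (z \<noteq> 0 \<or> w \<noteq> 0) \<and> ?x p = pc z w (snd p)" for p
  proof -
    obtain z w where zw: "z \<noteq> 0 \<or> w \<noteq> 0" "p1_coords (fst p) = pc z w (\<lambda>_. 0)" using p1_coords_ex[of "fst p"] by blast
    have "?x p = pc z w (snd p)" using tot_coords[OF zw(2), of "snd p"] by (simp add: split_beta)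
    then show ?thesis using zw(1) by blast
  qed
  show "variety_family ?I B J \<alpha> \<beta> \<gamma> \<epsilon> (Ytot Ps r B) ?x"
  proof (intro variety_family.intro linear_forms.intro base.intro linear_forms_axioms.intro variety_family_axioms.intro)
    show "dense ?I B" by (rule dense)
    show "B \<noteq> {}" using B(2) by blast
    show "finite J" by (rule J(1))
    show "linear_form ?I (\<alpha> j) (\<beta> j) (\<gamma> j) (\<epsilon> j)" if "j \<in> J" for j by (rule J(2)[OF that])
    have pts: "pts (Ytot Ps r B) = UNIV \<times> B" by (simp add: Ytot_def open_subvariety_def)
    show "closed_sets (Ytot Ps r B) = {{p \<in> pts (Ytot Ps r B). \<forall>F\<in>S. poly_eval (?x p) F = 0} | S. S \<subseteq> (\<Union>d. hpolys (PV ?I) d)}"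
      unfolding pts unfolding Ytot_def open_subvariety_def P1_Aff_def zariski_def PV_def[symmetric]
      by (simp only: variety.simps, rule restricted_family_of_sets) (use Baff in auto)
    show "funs (Ytot Ps r B) = {Fract F G | F G d. F \<in> hpolys (PV ?I) d \<and> G \<in> hpolys (PV ?I) d \<and> G \<noteq> 0}"
      by (simp add: Ytot_def open_subvariety_def P1_Aff_def zariski_def PV_def)
    show "lring (Ytot Ps r B) p = reg (PV ?I) 0 (?x p)" for p
      unfolding zariski_lring[symmetric] by (simp add: Ytot_def open_subvariety_def P1_Aff_def zariski_def PV_def)
    show "\<exists>b\<in>B. \<exists>z w. (z \<noteq> 0 \<or> w \<noteq> 0) \<and> ?x p = pc z w b" if "p \<in> pts (Ytot Ps r B)" for p
      using x[of p] that unfolding pts by (intro bexI[of _ "snd p"]) auto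
    show "\<exists>p\<in>pts (Ytot Ps r B). \<exists>k. k \<noteq> 0 \<and> ?x p = pc (k * z) (k * w) b"
      if b: "b \<in> B" "z \<noteq> 0 \<or> w \<noteq> 0" for b z w
    proof -
      from p1_coords_onto[OF b(2)] obtain p k where pk: "k \<noteq> 0" "p1_coords p = pc (k * z) (k * w) (\<lambda>_. 0)" by blast
      have "?x (p, b) = pc (k * z) (k * w) b" using tot_coords[OF pk(2)] by simp
      then show ?thesis unfolding pts using pk(1) b(1) by (intro bexI[of _ "(p, b)"] exI[of _ k]) auto
    qed
  qed
qed

lemma divisor_sum_cong: "(\<And>j. j \<in> J \<Longrightarrow> f j = g j) \<Longrightarrow> divisor_sum Y \<delta> J \<Delta> f = divisor_sum Y \<delta> J \<Delta> g"
  by (rule ext) (simp add: divisor_sum_def)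

lemma local_equation_cong:
  assumes "\<And>Z. Z \<in> prime_divisors Y \<Longrightarrow> E Z = E' Z"
  shows "local_equation Y E p h = local_equation Y E' p h"
proof -
  have S: "{Z \<in> prime_divisors Y. p \<in> Z \<and> E Z \<noteq> 0} = {Z \<in> prime_divisors Y. p \<in> Z \<and> E' Z \<noteq> 0}"
    by (rule Collect_cong) (use assms in auto)
  have "(\<Prod>Z\<in>{Z \<in> prime_divisors Y. p \<in> Z \<and> E Z \<noteq> 0}. g Z powi E Z) =
      (\<Prod>Z\<in>{Z \<in> prime_divisors Y. p \<in> Z \<and> E' Z \<noteq> 0}. g Z powi E' Z)" for g :: "'a set \<Rightarrow> ratfun"
    by (rule prod.cong[OF S]) (use assms in simp)
  then show ?thesis unfolding local_equation_def using assms by simp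
qed

text \<open>The divisor at the origin of the base is compared with \<open>D\<close> at prime
  divisors; their coefficients determine the locus, the local equations and so the algebra.\<close>

lemma divisor_algebra_cong:
  assumes "\<And>Z. Z \<in> prime_divisors Y \<Longrightarrow> D Z = D' Z"
  shows "divisor_algebra n Y \<delta> D = divisor_algebra n Y \<delta> D'"
proof -
  have "{Z \<in> prime_divisors Y. D Z = {}} = {Z \<in> prime_divisors Y. D' Z = {}}"
    by (rule Collect_cong) (use assms in auto)
  then have loc: "locus Y D = locus Y D'" by (simp only: locus_def)
  have "local_equation Y (\<lambda>Z. \<lfloor>evaluate D u Z\<rfloor>) p h = local_equation Y (\<lambda>Z. \<lfloor>evaluate D' u Z\<rfloor>) p h" for u p h
    by (rule local_equation_cong) (simp add: evaluate_def assms)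
  then show ?thesis by (simp only: divisor_algebra_def sections_def loc)
qed

text \<open>The numbers \<open>a P\<close>, \<open>b P\<close>, \<open>c P\<close>,
  \<open>d P\<close> are the coefficients of \<open>y P\<close> as a fractional linear
  transformation of determinant \<open>1\<close>.\<close>

locale decomposition =
  fixes n :: nat and \<delta> :: "qvec set" and D :: "p1 set \<Rightarrow> qvec set"
    and Ps :: "p1 set" and r :: "p1 \<Rightarrow> nat" and \<Delta> :: "p1 \<Rightarrow> nat \<Rightarrow> qvec set"
    and y :: "p1 \<Rightarrow> ratfun" and B :: "(p1 \<times> nat \<Rightarrow> complex) set"
    and a b c d :: "p1 \<Rightarrow> complex"
  assumes D: "polyhedral_divisor n P1 \<delta> D"
    and Ps: "finite Ps" "\<And>P. nontrivial n (D {P}) \<Longrightarrow> P \<in> Ps"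
    and dec: "\<And>P. P \<in> Ps \<Longrightarrow> minkowski_decomposition n \<delta> (D {P}) (r P) (\<Delta> P)"
    and base: "admissible_base Ps r y B"
    and adm: "\<And>P. P \<in> Ps \<Longrightarrow> admissible n \<delta> (r P) (\<Delta> P)"
    and y: "\<And>P. P \<in> Ps \<Longrightarrow> a P * d P - b P * c P = 1"
      "\<And>P. P \<in> Ps \<Longrightarrow> y P = emb (C0 (a P) * PX + C0 (b P) * PY) / emb (C0 (c P) * PX + C0 (d P) * PY)"
      "\<And>P. P \<in> Ps \<Longrightarrow> poly_eval (p1_coords P) (C0 (a P) * PX + C0 (b P) * PY) = 0"
begin

definition \<tau> :: "p1 \<times> nat \<Rightarrow> Defs.poly" where
  "\<tau> j = (if snd j = 0 then 0 else poly_var (T (fst j) (snd j)))"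

text \<open>With \<open>\<beta> j\<close>, the coefficients of the numerator of
  \<open>y P - t\<close>. The denominator is unchanged, and subtracting a multiple of the second row
  from the first keeps the determinant equal to \<open>1\<close>.\<close>

definition "\<alpha> j = C0 (a (fst j)) - \<tau> j * C0 (c (fst j))"
definition "\<beta> j = C0 (b (fst j)) - \<tau> j * C0 (d (fst j))"
definition "\<gamma> j = C0 (c (fst j))"
definition "\<epsilon> j = C0 (d (fst j))"

abbreviation "J \<equiv> summand_index Ps r"
abbreviation "I \<equiv> param_index Ps r"
abbreviation "X \<equiv> (\<lambda>(q, a) v. p1_coords q v + aff_coords a v) :: p1 \<times> (p1 \<times> nat \<Rightarrow> complex) \<Rightarrow> coord \<Rightarrow> complex"
abbreviation "\<Delta>' \<equiv> (\<lambda>(P, i). \<Delta> P i)"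

lemma J: "j \<in> J \<Longrightarrow> fst j \<in> Ps" "j \<in> J \<Longrightarrow> snd j \<le> r (fst j)" by (auto simp: summand_index_def)

lemma finite_J: "finite J"
proof -
  have "J = Sigma Ps (\<lambda>P. {..r P})" by (auto simp: summand_index_def)
  then show ?thesis using Ps(1) by simp
qed

lemma \<tau>_H: "j \<in> J \<Longrightarrow> \<tau> j \<in> hpolys (PV I) 0"
proof (cases "snd j = 0")
  case True
  then show ?thesis using hpolys_const[of 0 "PV I"] by (simp add: \<tau>_def)
next
  case False
  assume "j \<in> J"
  then have "T (fst j) (snd j) \<in> PV I" using False by (auto simp: PV_def param_index_def summand_index_def)
  from hpolys_poly_var[OF this] show ?thesis using False by (simp add: \<tau>_def)
qed

lemma lin: "j \<in> J \<Longrightarrow> linear_form I (\<alpha> j) (\<beta> j) (\<gamma> j) (\<epsilon> j)"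
proof
  assume j: "j \<in> J"
  have \<tau>C: "\<tau> j * C0 s \<in> hpolys (PV I) 0" for s using hpolys_mult[OF \<tau>_H[OF j] hpolys_const] by simp
  show "\<alpha> j \<in> hpolys (PV I) 0" "\<beta> j \<in> hpolys (PV I) 0" unfolding \<alpha>_def \<beta>_def by (intro hpolys_diff hpolys_const \<tau>C)+
  show "\<gamma> j \<in> hpolys (PV I) 0" "\<epsilon> j \<in> hpolys (PV I) 0" unfolding \<gamma>_def \<epsilon>_def by (rule hpolys_const)+
  have "\<alpha> j * \<epsilon> j - \<beta> j * \<gamma> j = C0 (a (fst j)) * C0 (d (fst j)) - C0 (b (fst j)) * C0 (c (fst j))"
    by (simp add: \<alpha>_def \<beta>_def \<gamma>_def \<epsilon>_def algebra_simps)
  also have "\<dots> = C0 (a (fst j) * d (fst j) - b (fst j) * c (fst j))" by (simp add: mult_single single_diff)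
  also have "\<dots> = 1" by (simp add: y(1)[OF J(1)[OF j]])
  finally show "\<alpha> j * \<epsilon> j - \<beta> j * \<gamma> j = 1" .
qed

lemma B_open: "is_open (Aff I) B" "(\<lambda>_. 0) \<in> B"
  using base by (simp_all add: admissible_base_def)

lemmas Vt_family = Ytot_family(1)[OF finite_J lin B_open]
lemma B_aff: "B \<subseteq> aff_points I"
  by (rule Ytot_family(2)[OF finite_J _ B_open]) (rule lin)

lemmas Vl_family = P1_family[OF finite_J subT_linear_form[OF lin]]

sublocale Vt: variety_family I B J \<alpha> \<beta> \<gamma> \<epsilon> "Ytot Ps r B" X by (rule Vt_family)

lemma denominator_nz: "P \<in> Ps \<Longrightarrow> C0 (c P) * PX + C0 (d P) * PY \<noteq> 0"
  using Vt.L(4)[of "(P, 0)"] linear_form.c_def[OF lin, of "(P, 0)"]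
  by (simp add: summand_index_def \<gamma>_def \<epsilon>_def)

lemma fraction_diff:
  assumes "P \<in> Ps"
  shows "emb ((C0 (a P) - s * C0 (c P)) * PX + (C0 (b P) - s * C0 (d P)) * PY) / emb (C0 (c P) * PX + C0 (d P) * PY) = y P - emb s"
proof -
  have "(C0 (a P) - s * C0 (c P)) * PX + (C0 (b P) - s * C0 (d P)) * PY =
      (C0 (a P) * PX + C0 (b P) * PY) - s * (C0 (c P) * PX + C0 (d P) * PY)" by (simp add: algebra_simps)
  moreover have "emb (F - s * G) / emb G = emb F / emb G - emb s" if "G \<noteq> 0" for F G
    using that by (simp add: emb_simps diff_divide_distrib)
  ultimately show ?thesis using denominator_nz[OF assms] by (simp only: y(2)[OF assms])
qed

lemma Vt_t: "j \<in> J \<Longrightarrow> Vt.t j = y (fst j) - param (fst j) (snd j)"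
proof -
  assume j: "j \<in> J"
  have "emb (\<tau> j) = param (fst j) (snd j)" by (simp add: \<tau>_def param_def Fract_emb emb_simps)
  then show ?thesis
    using fraction_diff[OF J(1)[OF j], of "\<tau> j"] linear_form.l_def[OF lin[OF j]] linear_form.c_def[OF lin[OF j]]
    by (simp only: Vt.t_def \<alpha>_def[of j] \<beta>_def[of j] \<gamma>_def[of j] \<epsilon>_def[of j])
qed

text \<open>The condition on \<open>B\<close> speaks of the supports of the zero divisors of
  \<open>y P - t\<close>, which contain the sets \<open>Z j\<close>. Summands with a common point
  thus belong to one decomposition, where admissibility applies.\<close>

lemma disjoint:
  assumes "j \<in> J" "k \<in> J" "fst j \<noteq> fst k"
  shows "Vt.Z j \<inter> Vt.Z k = {}"
proof -
  have "Vt.Z i \<subseteq> zero_support (Ytot Ps r B) (y (fst i) - param (fst i) (snd i))" if i: "i \<in> J" for i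
    unfolding zero_support_def using Vt.Z_prime[OF i] Vt.zero_divisor_t[OF i Vt.Z_prime[OF i]] Vt_t[OF i] by auto
  moreover have "zero_support (Ytot Ps r B) (y (fst j) - param (fst j) (snd j)) \<inter>
      zero_support (Ytot Ps r B) (y (fst k) - param (fst k) (snd k)) = {}"
    using base J[OF assms(1)] J[OF assms(2)] assms(3) unfolding admissible_base_def by blast
  ultimately show ?thesis using assms(1,2) by blast
qed

lemma admJ:
  assumes "u \<in> weights n \<delta>" "i \<in> J" "j \<in> J" "fst i = fst j" "\<Delta>' i \<noteq> {}" "\<Delta>' j \<noteq> {}"
    "minval (\<Delta>' i) u \<notin> \<int>" "minval (\<Delta>' j) u \<notin> \<int>"
  shows "i = j"
proof -
  have "snd i = snd j"
    using adm[OF J(1)[OF assms(2)]] assms J(2)[OF assms(2)] J(2)[OF assms(3)]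
    unfolding admissible_def by (simp add: split_beta)
  then show ?thesis using assms(4) by (simp add: prod_eq_iff)
qed

lemma cone: "pointed_cone n \<delta>" using D by (simp add: polyhedral_divisor_def)

lemma polyJ: "j \<in> J \<Longrightarrow> polyhedron n (\<Delta>' j)" "j \<in> J \<Longrightarrow> \<Delta>' j \<noteq> {} \<Longrightarrow> tail n (\<Delta>' j) = \<delta>"
  using dec[OF J(1), of j] J(2)[of j] by (auto simp: minkowski_decomposition_def split_beta)

lemma Dt: "divisor_family I B J \<alpha> \<beta> \<gamma> \<epsilon> (Ytot Ps r B) X n \<delta> \<Delta>'"
proof (intro divisor_family.intro divisor_family_axioms.intro Vt_family)
  fix u i j assume *: "u \<in> weights n \<delta>" "i \<in> J" "j \<in> J" "Vt.Z i = Vt.Z j" "\<Delta>' i \<noteq> {}" "\<Delta>' j \<noteq> {}"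
    "minval (\<Delta>' i) u \<notin> \<int>" "minval (\<Delta>' j) u \<notin> \<int>"
  have "fst i = fst j" using disjoint[OF *(2,3)] Vt.Z_ne[OF *(2)] *(4) by auto
  from admJ[OF *(1-3) this *(5-8)] show "i = j" .
qed (use cone polyJ in blast)+

text \<open>If two summands meet at \<open>p\<close> in the fibre, their zero sets in the total
  space meet at \<open>(p, b0)\<close>; so again they belong to one decomposition.\<close>

lemma fibre_family:
  assumes b0: "b0 \<in> B"
  shows "fibre_family I B J \<alpha> \<beta> \<gamma> \<epsilon> (Ytot Ps r B) X n \<delta> \<Delta>' b0 P1 p1_coords"
proof -
  interpret Vl: variety_family "{}" "{\<lambda>_. 0}" J "\<lambda>j. subT b0 (\<alpha> j)" "\<lambda>j. subT b0 (\<beta> j)" "\<lambda>j. subT b0 (\<gamma> j)"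
      "\<lambda>j. subT b0 (\<epsilon> j)" P1 p1_coords by (rule Vl_family)
  have l: "subT b0 (Vt.l j) = Vl.l j" if "j \<in> J" for j
    using that by (simp add: linear_form.l_def[OF Vt.lin] linear_form.l_def[OF Vl.lin] subT_simps subT_X)
  have Z: "(p, b0) \<in> Vt.Z j" if p: "p \<in> Vl.Z j" and j: "j \<in> J" for p j
  proof -
    obtain z w where zw: "p1_coords p = pc z w (\<lambda>_. 0)" using p1_coords_ex[of p] by blast
    have "poly_eval (pc z w (\<lambda>_. 0)) (subT b0 (Vt.l j)) = 0" using p by (simp add: Vl.Z_def zw l[OF j])
    then have "poly_eval (pc z w b0) (Vt.l j) = 0" by (simp only: poly_eval_subT)
    moreover have "X (p, b0) = pc z w b0" using tot_coords[OF zw] by simp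
    moreover have "(p, b0) \<in> pts (Ytot Ps r B)" using b0 by (simp add: Ytot_def open_subvariety_def)
    ultimately show ?thesis by (simp add: Vt.Z_def)
  qed
  have "divisor_family {} {\<lambda>_. 0} J (\<lambda>j. subT b0 (\<alpha> j)) (\<lambda>j. subT b0 (\<beta> j)) (\<lambda>j. subT b0 (\<gamma> j))
      (\<lambda>j. subT b0 (\<epsilon> j)) P1 p1_coords n \<delta> \<Delta>'"
  proof (intro divisor_family.intro divisor_family_axioms.intro Vl_family)
    fix u i j assume *: "u \<in> weights n \<delta>" "i \<in> J" "j \<in> J" "Vl.Z i = Vl.Z j" "\<Delta>' i \<noteq> {}" "\<Delta>' j \<noteq> {}"
      "minval (\<Delta>' i) u \<notin> \<int>" "minval (\<Delta>' j) u \<notin> \<int>"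
    obtain p where "p \<in> Vl.Z i" using Vl.Z_ne[OF *(2)] by blast
    then have "(p, b0) \<in> Vt.Z i \<inter> Vt.Z j" using Z *(2,3,4) by blast
    then have "fst i = fst j" using disjoint[OF *(2,3)] by blast
    from admJ[OF *(1-3) this *(5-8)] show "i = j" .
  qed (use cone polyJ in blast)+
  then show ?thesis using b0 Dt by (intro fibre_family.intro fibre_family_axioms.intro)
qed

sublocale tot: divisor_family I B J \<alpha> \<beta> \<gamma> \<epsilon> "Ytot Ps r B" X n \<delta> \<Delta>' by (rule Dt)

lemma Dtot_eq: "Dtot Ps r \<Delta> y B \<delta> = tot.D"
  unfolding Dtot_def tot.D_def by (rule divisor_sum_cong) (simp add: Vt_t split_beta)

lemma base_R: "regular_functions (base_variety Ps r B) = Vt.R"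
  unfolding Vt.R_def by (rule regular_functions_base) (use B_open(2) in blast)

lemma flat: "flat_morphism tb tc (base_ring Ps r B) (divisor_algebra n (Ytot Ps r B) \<delta> (Dtot Ps r \<Delta> y B \<delta>)) degree0"
  unfolding base_ring_def base_R Dtot_eq by (rule tot.flat)

lemma subT_\<tau>:
  assumes "b0 \<in> B" "j \<in> J"
  shows "subT b0 (\<tau> j) = C0 (b0 j)"
proof (cases "snd j = 0")
  case True
  \<comment> \<open>The coordinate with index \<open>0\<close> is not a parameter, and points of
    \<open>B\<close> vanish there by convention.\<close>
  then have "j \<notin> I" by (auto simp: param_index_def)
  moreover have "b0 \<in> aff_points I" using assms(1) B_aff by blast
  ultimately have "b0 j = 0" unfolding aff_points_def mem_Collect_eq by blast
  then show ?thesis using True by (simp add: \<tau>_def subT_simps(4))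
next
  case False
  then show ?thesis by (simp add: \<tau>_def subT_T)
qed

lemma lam_t:
  assumes b0: "b0 \<in> B" and j: "j \<in> J"
  shows "variety_family.t (\<lambda>j. subT b0 (\<alpha> j)) (\<lambda>j. subT b0 (\<beta> j)) (\<lambda>j. subT b0 (\<gamma> j)) (\<lambda>j. subT b0 (\<epsilon> j)) j =
    y (fst j) - const (b0 j)"
proof -
  interpret Vl: variety_family "{}" "{\<lambda>_. 0}" J "\<lambda>j. subT b0 (\<alpha> j)" "\<lambda>j. subT b0 (\<beta> j)" "\<lambda>j. subT b0 (\<gamma> j)"
      "\<lambda>j. subT b0 (\<epsilon> j)" P1 p1_coords by (rule Vl_family)
  have l: "Vl.l j = (C0 (a (fst j)) - C0 (b0 j) * C0 (c (fst j))) * PX + (C0 (b (fst j)) - C0 (b0 j) * C0 (d (fst j))) * PY"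
    unfolding linear_form.l_def[OF Vl.lin[OF j]]
    by (simp add: \<alpha>_def \<beta>_def subT_simps subT_const subT_\<tau>[OF b0 j])
  have c: "Vl.c j = C0 (c (fst j)) * PX + C0 (d (fst j)) * PY"
    unfolding linear_form.c_def[OF Vl.lin[OF j]] by (simp add: \<gamma>_def \<epsilon>_def subT_const)
  show ?thesis unfolding Vl.t_def l c fraction_diff[OF J(1)[OF j]] const_emb ..
qed

lemma fibres:
  assumes b0: "b0 \<in> B"
  shows "isomorphic_over_C (fibre (divisor_algebra n (Ytot Ps r B) \<delta> (Dtot Ps r \<Delta> y B \<delta>)) (\<lambda>c. degree0 (const c)) degree0
      (point_ideal (base_variety Ps r B) b0)) (X_scheme n P1 \<delta> (Dlam Ps r \<Delta> y b0 \<delta>))"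
proof -
  interpret F: fibre_family I B J \<alpha> \<beta> \<gamma> \<epsilon> "Ytot Ps r B" X n \<delta> \<Delta>' b0 P1 p1_coords
    by (rule fibre_family[OF b0])
  have t: "F.lam.t j = y (fst j) - const (b0 j)" if j: "j \<in> J" for j
    by (rule lam_t[OF b0 j])
  have Dl: "Dlam Ps r \<Delta> y b0 \<delta> = F.lam.D"
    unfolding Dlam_def F.lam.D_def by (rule divisor_sum_cong) (simp add: t split_beta)
  have "point_ideal (base_variety Ps r B) b0 = {f \<in> Vt.R. spz b0 f = 0}"
    unfolding point_ideal_def base_R base_variety_simps
    by (rule Collect_cong) (use lr_spz(3)[OF F.tot_R] in blast)
  then show ?thesis using F.fibre_iso by (simp only: Dtot_eq Dl)
qed

text \<open>At the origin all summands of \<open>P\<close> sit at the zero \<open>P\<close> of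
  \<open>y P\<close>, where the decomposition adds up to \<open>D {P}\<close> again; at any other
  point the coefficient is the trivial one, \<open>\<delta>\<close>.\<close>

lemma central_divisor:
  assumes W: "W \<in> prime_divisors P1"
  shows "Dlam Ps r \<Delta> y (\<lambda>_. 0) \<delta> W = D W"
proof -
  interpret F: fibre_family I B J \<alpha> \<beta> \<gamma> \<epsilon> "Ytot Ps r B" X n \<delta> \<Delta>' "\<lambda>_. 0" P1 p1_coords
    by (rule fibre_family[OF B_open(2)])
  have t: "F.lam.t j = y (fst j) - const 0" if j: "j \<in> J" for j
    using lam_t[OF B_open(2) j] by simp
  have Dl: "Dlam Ps r \<Delta> y (\<lambda>_. 0) \<delta> = F.lam.D"
    unfolding Dlam_def F.lam.D_def by (rule divisor_sum_cong) (simp add: t split_beta)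
  have Z: "F.lam.Z j = {fst j}" if j: "j \<in> J" for j
  proof -
    have "F.lam.l j = C0 (a (fst j)) * PX + C0 (b (fst j)) * PY"
      unfolding linear_form.l_def[OF F.lam.lin[OF j]]
      by (simp add: \<alpha>_def \<beta>_def subT_simps subT_const subT_\<tau>[OF B_open(2) j])
    then have "fst j \<in> F.lam.Z j" using y(3)[OF J(1)[OF j]] by (simp add: F.lam.Z_def pts_P1)
    moreover obtain Q where "F.lam.Z j = {Q}" by (rule prime_divisor_P1[OF F.lam.Z_prime[OF j]])
    ultimately show ?thesis by simp
  qed
  obtain Q where Q: "W = {Q}" by (rule prime_divisor_P1[OF W])
  have DQ: "D {Q} = {} \<or> tail n (D {Q}) = \<delta>" using D point_prime_P1[of Q] by (auto simp: polyhedral_divisor_def)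
  have S: "{j \<in> J. F.lam.Z j = W} = (if Q \<in> Ps then Pair Q ` {..r Q} else {})"
  proof -
    have "{j \<in> J. F.lam.Z j = W} = {j \<in> J. fst j = Q}" by (rule Collect_cong) (use Z Q in auto)
    then show ?thesis by (auto simp: summand_index_def)
  qed
  have "F.lam.D W = \<delta> + (\<Sum>j\<in>{j \<in> J. F.lam.Z j = W}. \<Delta>' j)" by (rule F.lam.D_eq[OF W])
  also have "\<dots> = D W"
  proof (cases "Q \<in> Ps")
    case True
    have "(\<Sum>j\<in>Pair Q ` {..r Q}. \<Delta>' j) = (\<Sum>i\<le>r Q. \<Delta> Q i)" by (subst sum.reindex) (simp_all add: inj_on_def)
    also have "\<dots> = D {Q}" using dec[OF True] by (simp add: minkowski_decomposition_def)
    finally have s: "(\<Sum>j\<in>{j \<in> J. F.lam.Z j = W}. \<Delta>' j) = D {Q}" using True by (simp only: S if_True)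
    have "\<delta> + D {Q} = D {Q}" by (rule cone_plus_tail[OF pointed_cone_0[OF cone]]) (use DQ in blast)
    then show ?thesis unfolding s unfolding Q .
  next
    case False
    then have "\<not> nontrivial n (D {Q})" using Ps(2) by blast
    then have "D {Q} = \<delta>" using DQ by (auto simp: nontrivial_def)
    then show ?thesis unfolding S unfolding Q using False by simp
  qed
  finally show ?thesis unfolding Dl .
qed

lemma X_scheme_central: "X_scheme n P1 \<delta> (Dlam Ps r \<Delta> y (\<lambda>_. 0) \<delta>) = X_scheme n P1 \<delta> D"
proof -
  have "divisor_algebra n P1 \<delta> (Dlam Ps r \<Delta> y (\<lambda>_. 0) \<delta>) = divisor_algebra n P1 \<delta> D"
    by (rule divisor_algebra_cong) (rule central_divisor)
  then show ?thesis by (simp only: X_scheme_def)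
qed

end

theorem theorem2p8:
  fixes n :: nat and \<delta> :: "qvec set" and D :: "p1 set \<Rightarrow> qvec set"
    and Ps :: "p1 set" and r :: "p1 \<Rightarrow> nat" and \<Delta> :: "p1 \<Rightarrow> nat \<Rightarrow> qvec set"
    and y :: "p1 \<Rightarrow> ratfun" and B :: "(p1 \<times> nat \<Rightarrow> complex) set"
  assumes "polyhedral_divisor n P1 \<delta> D"
    and "proper n P1 \<delta> D"
    and "finite Ps"
    and "\<And>P. nontrivial n (D {P}) \<Longrightarrow> P \<in> Ps"
    and "\<And>P. P \<in> Ps \<Longrightarrow> minkowski_decomposition n \<delta> (D {P}) (r P) (\<Delta> P)"
    and "\<And>P. P \<in> Ps \<Longrightarrow> sole_simple_zero (y P) P"
    and "admissible_base Ps r y B"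
    and "\<And>P. P \<in> Ps \<Longrightarrow> admissible n \<delta> (r P) (\<Delta> P)"
  shows "let A = divisor_algebra n (Ytot Ps r B) \<delta> (Dtot Ps r \<Delta> y B \<delta>);
             fib = (\<lambda>l. fibre A (\<lambda>c. degree0 (const c)) degree0
                           (point_ideal (base_variety Ps r B) l))
         in flat_morphism TYPE('b) TYPE('c) (base_ring Ps r B) A degree0 \<and>
            (\<forall>l\<in>B. isomorphic_over_C (fib l) (X_scheme n P1 \<delta> (Dlam Ps r \<Delta> y l \<delta>))) \<and>
            isomorphic_over_C (fib (\<lambda>_. 0)) (X_scheme n P1 \<delta> D)"
proof -
  have "\<forall>P\<in>Ps. \<exists>q :: complex \<times> complex \<times> complex \<times> complex. case q of (a, b, c, d) \<Rightarrow> a * d - b * c = 1 \<and>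
      y P = emb (C0 a * PX + C0 b * PY) / emb (C0 c * PX + C0 d * PY) \<and>
      poly_eval (p1_coords P) (C0 a * PX + C0 b * PY) = 0"
  proof
    fix P assume "P \<in> Ps"
    then obtain a b c d where "a * d - b * c = 1"
      "y P = emb (C0 a * PX + C0 b * PY) / emb (C0 c * PX + C0 d * PY)"
      "poly_eval (p1_coords P) (C0 a * PX + C0 b * PY) = 0"
      by (rule sole_simple_zero_fraction[OF assms(6)])
    then show "\<exists>q. case q of (a, b, c, d) \<Rightarrow> a * d - b * c = 1 \<and>
      y P = emb (C0 a * PX + C0 b * PY) / emb (C0 c * PX + C0 d * PY) \<and>
      poly_eval (p1_coords P) (C0 a * PX + C0 b * PY) = 0" by (intro exI[of _ "(a, b, c, d)"]) simp
  qed
  from bchoice[OF this] obtain q :: "p1 \<Rightarrow> complex \<times> complex \<times> complex \<times> complex"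
    where q: "\<forall>P\<in>Ps. case q P of (a, b, c, d) \<Rightarrow> a * d - b * c = 1 \<and>
      y P = emb (C0 a * PX + C0 b * PY) / emb (C0 c * PX + C0 d * PY) \<and>
      poly_eval (p1_coords P) (C0 a * PX + C0 b * PY) = 0" by (elim exE) (rule that)
  interpret decomposition n \<delta> D Ps r \<Delta> y B "\<lambda>P. fst (q P)" "\<lambda>P. fst (snd (q P))"
      "\<lambda>P. fst (snd (snd (q P)))" "\<lambda>P. snd (snd (snd (q P)))"
  proof
    fix P assume "P \<in> Ps"
    then have "case q P of (a, b, c, d) \<Rightarrow> a * d - b * c = 1 \<and>
      y P = emb (C0 a * PX + C0 b * PY) / emb (C0 c * PX + C0 d * PY) \<and>
      poly_eval (p1_coords P) (C0 a * PX + C0 b * PY) = 0" by (rule bspec[OF q])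
    then show "fst (q P) * snd (snd (snd (q P))) - fst (snd (q P)) * fst (snd (snd (q P))) = 1"
      "y P = emb (C0 (fst (q P)) * PX + C0 (fst (snd (q P))) * PY) / emb (C0 (fst (snd (snd (q P)))) * PX + C0 (snd (snd (snd (q P)))) * PY)"
      "poly_eval (p1_coords P) (C0 (fst (q P)) * PX + C0 (fst (snd (q P))) * PY) = 0"
      unfolding split_beta by blast+
  qed (fact assms)+
  \<comment> \<open>The claim about the central fibre is the case of the origin, with
    \<open>D\<close> replaced by the divisor at the parameter value zero.\<close>
  show ?thesis
    unfolding Let_def X_scheme_central[symmetric] using flat fibres B_open(2) by blast
qed

end
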